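(* Let $X$ be a locally compact Polish space. For a sequence $(M^{(n)})_{n=0}^\infty$ with $M^{(0)}=1$ and $M^{(n)}$ a symmetric nonnegative Radon measure on $X^n$ for $n\in\mathbb N$, consider the bounds (C1) for each $\Lambda\in\mathcal B_c(X)$ there is a constant $C_\Lambda>0$ with $M^{(n)}(\Lambda^n)\le C_\Lambda^n\,n!$ for all $n\in\mathbb N$; (C2) for each $\Lambda\in\mathcal B_c(X)$ there is a constant $C'_\Lambda>0$ with $M^{(n)}(\Lambda^{(n)}_{\widehat 0})\le (C'_\Lambda)^n\,n!$ for all $n\in\mathbb N$, and $C'_{\Lambda_k}\to0$ for any sequence $(\Lambda_k)$ in $\mathcal B_c(X)$ with $\Lambda_k\downarrow\varnothing$; and the identity (S) for all $n\in\mathbb N$, all $i_1,\dots,i_n\in\mathbb N$ and all $\Delta\in\mathcal B(X^{(n)}_{\widehat 0})$: $M_{i_1,\dots,i_n}(\Delta)=M_{1,\dots,1}(\Delta)$. (i) Let $\mu$ be a random measure on $X$ (a probability measure on $\mathbb M(X)$) with finite moments, whose moment sequence $(M^{(n)})_{n=0}^\infty$ satisfies (C1) and (C2). Then $\mu$ is a simple point process, i.e. $\mu(\Gamma(X))=1$, if and only if (S) holds. In the latter case, the correlation measure $\rho$ of $\mu$ is given by $$\rho^{(n)}(\Delta)=\frac1{n!}M^{(n)}(\Delta),\qquad \Delta\in\mathcal B(X^{(n)}_{\widehat 0}),\ n\in\mathbb N,$$ where $\rho^{(n)}$ is the restriction of $\rho$ to $\Gamma^{(n)}(X)$, identified with a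 measure on $X^{(n)}_{\widehat 0}$. (ii) Let $(M^{(n)})_{n=0}^\infty$ be a sequence with $M^{(0)}=1$ and $M^{(n)}$ a symmetric nonnegative Radon measure on $X^n$ for each $n\in\mathbb N$, satisfying (C1) and (C2). Then $(M^{(n)})_{n=0}^\infty$ is the moment sequence of a simple point process in $X$ if and only if $(M^{(n)})_{n=0}^\infty$ is positive definite and (S) holds.
   Context: $\mathbb N=\{1,2,\dots\}$. $\mathcal B_c(X)$: Borel sets with compact closure. $\mathbb M(X)$: nonnegative Radon measures on $X$ with the vague topology and its Borel $\sigma$-algebra. $\Gamma(X)$: locally finite subsets of $X$, identified with Radon measures $\sum_i\delta_{x_i}$ ($x_i$ distinct), so $\Gamma(X)\subset\mathbb M(X)$; a simple point process in $X$ is a probability measure on $\mathbb M(X)$ concentrated on $\Gamma(X)$. A probability measure $\mu$ on $\mathbb M(X)$ has finite moments if $\int\eta(A)^n\,d\mu(\eta)<\infty$ for all $n\in\mathbb N$, $A\in\mathcal B_c(X)$; its moment sequence is $M^{(0)}=1$ and $M^{(n)}$ the symmetric Radon measure on $X^n$ with $M^{(n)}(A_1\times\dots\times A_n)=\int\eta(A_1)\cdots\eta(A_n)\,d\mu(\eta)$. $X^{(n)}_{\widehat 0}$: points of $X^n$ with pairwise distinct coordinates; $\Lambda^{(n)}_{\widehat 0}:=\Lambda^n\cap X^{(n)}_{\widehat 0}$. For $i_1,\dots,i_k\in\mathbb N$, $n=i_1+\dots+i_k$, $M_{i_1,\dots,i_k}$ is the measure on $X^{(k)}_{\widehat 0}$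 with $M_{i_1,\dots,i_k}(\Delta)=M^{(n)}(\{(x_1,\dots,x_1,\dots,x_k,\dots,x_k):(x_1,\dots,x_k)\in\Delta\})$, where $x_l$ is repeated $i_l$ times consecutively. $\Lambda_k\downarrow\varnothing$: decreasing with empty intersection. $\Gamma^{(n)}(X)$ is the set of $n$-point subsets of $X$, $\Gamma_0(X)=\bigcup_{n\ge0}\Gamma^{(n)}(X)$. The correlation measure of a point process $\mu$ in $X$ is the measure $\rho$ on $\Gamma_0(X)$ with $\int_{\Gamma(X)}\sum_{\lambda\subset\gamma,\,|\lambda|<\infty}G(\lambda)\,d\mu(\gamma)=\int_{\Gamma_0(X)}G\,d\rho$ for all measurable $G\ge0$; its restriction $\rho^{(n)}$ to $\Gamma^{(n)}(X)$ is identified with the symmetric measure on $X^{(n)}_{\widehat 0}$ with $\int\sum_{\{x_1,\dots,x_n\}\subset\gamma}f(x_1,\dots,x_n)\,d\mu(\gamma)=\int f\,d\rho^{(n)}$ for symmetric measurable $f\ge0$ (sum over unordered subsets). $\Psi(X):=\bigcup_{n\ge0}\Psi^{(n)}(X)$ (disjoint union), $\Psi^{(0)}(X)$ a one-point set, $\Psi^{(n)}(X)=X^n$; $M$ is the measure on $\Psi(X)$ whose restriction to $\Psi^{(n)}(X)$ is $M^{(n)}$ (mass $1$ on $\Psi^{(0)}(X)$). For functions $F_1,F_2$ on $\Psi(X)$ with components $F_i^{(n)}$, $(F_1\otimes F_2)^{(k)}=\sum_{m+n=k}F_1^{(m)}\otimes F_2^{(n)}$. $(M^{(n)})$ is positive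 definite if $\int_{\Psi(X)}F\otimes F\,dM\ge0$ for every bounded measurable $F:\Psi(X)\to\mathbb R$ vanishing outside $\Psi^{(0)}(X)\cup\bigcup_{n=1}^N\Lambda^n$ for some $N\in\mathbb N$, $\Lambda\in\mathcal B_c(X)$. *)

theory Defs
  imports "HOL-Probability.Probability"
begin

section \<open>Radon measures, powers, the vague topology\<close>

definition borel_of :: "'b topology \<Rightarrow> 'b measure" where
  "borel_of T = sigma (topspace T) {U. openin T U}"

definition radon_measure :: "'b topology \<Rightarrow> 'b measure \<Rightarrow> bool" where
  "radon_measure T N \<longleftrightarrow>
     sets N = sets (borel_of T) \<and>
     (\<forall>K. compactin T K \<longrightarrow> emeasure N K < \<infinity>) \<and>
     (\<forall>A\<in>sets N. emeasure N A = (SUP K\<in>{K. compactin T K \<and> K \<subseteq> A}. emeasure N K))"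

definition relcompact_borel :: "'a::topological_space set set" where
  "relcompact_borel = {A \<in> sets borel. compact (closure A)}"

text \<open>The points of \<open>X\<^sup>n\<close> are the functions on \<open>{..<n}\<close>, extended by \<open>undefined\<close>; \<open>X\<^sup>0\<close> is
  a one-point space.\<close>

definition pow_top :: "nat \<Rightarrow> (nat \<Rightarrow> 'a::topological_space) topology" where
  "pow_top n = product_topology (\<lambda>_. euclidean) {..<n}"

definition cube :: "nat \<Rightarrow> 'a set \<Rightarrow> (nat \<Rightarrow> 'a) set" where
  "cube n \<Lambda> = PiE {..<n} (\<lambda>_. \<Lambda>)"

definition offdiag :: "nat \<Rightarrow> (nat \<Rightarrow> 'a) set" where
  "offdiag n = {x \<in> cube n UNIV. inj_on x {..<n}}"

definition offdiag_borel :: "nat \<Rightarrow> (nat \<Rightarrow> 'a::topological_space) measure" where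
  "offdiag_borel n = borel_of (subtopology (pow_top n) (offdiag n))"

definition symmetric_measure :: "nat \<Rightarrow> (nat \<Rightarrow> 'a) measure \<Rightarrow> bool" where
  "symmetric_measure n N \<longleftrightarrow> (\<forall>\<sigma>. \<sigma> permutes {..<n} \<longrightarrow> distr N N (\<lambda>x. x \<circ> \<sigma>) = N)"

definition radon_measures :: "'a::topological_space measure set" where
  "radon_measures = {\<eta>. radon_measure euclidean \<eta>}"

text \<open>The coarsest topology on the set of Radon measures for which \<open>\<eta> \<mapsto> \<integral> f d\<eta>\<close> is continuous for
  every continuous \<open>f\<close> with compact support.\<close>

definition vague_topology :: "'a::topological_space measure topology" where
  "vague_topology = topology_generated_by
     {{\<eta> \<in> radon_measures. (\<integral>x. f x \<partial>\<eta>) \<in> U} | (f :: 'a \<Rightarrow> real) U.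
        continuous_on UNIV f \<and> compact (closure {x. f x \<noteq> 0}) \<and> open U}"

section \<open>Random measures and point processes\<close>

definition random_measure :: "'a::topological_space measure measure \<Rightarrow> bool" where
  "random_measure \<mu> \<longleftrightarrow> prob_space \<mu> \<and> sets \<mu> = sets (borel_of vague_topology)"

definition configurations :: "'a::topological_space set set" where
  "configurations = {\<gamma>. \<forall>K. compact K \<longrightarrow> finite (\<gamma> \<inter> K)}"

text \<open>The push-forward of the counting measure on \<open>\<gamma>\<close>, that is, the sum of the Dirac measures at
  the points of \<open>\<gamma>\<close>.\<close>

definition config_measure :: "'a::topological_space set \<Rightarrow> 'a measure" where
  "config_measure \<gamma> = distr (count_space \<gamma>) borel (\<lambda>x. x)"

definition simple_measures :: "'a::topological_space measure set" where
  "simple_measures = config_measure ` configurations"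

definition simple_point_process :: "'a::topological_space measure measure \<Rightarrow> bool" where
  "simple_point_process \<mu> \<longleftrightarrow> random_measure \<mu> \<and> emeasure \<mu> simple_measures = 1"

definition finite_moments :: "'a::topological_space measure measure \<Rightarrow> bool" where
  "finite_moments \<mu> \<longleftrightarrow>
     (\<forall>n\<ge>1. \<forall>A\<in>relcompact_borel. (\<integral>\<^sup>+\<eta>. emeasure \<eta> A ^ n \<partial>\<mu>) < \<infinity>)"

definition symmetric_radon_sequence :: "(nat \<Rightarrow> (nat \<Rightarrow> 'a::topological_space) measure) \<Rightarrow> bool" where
  "symmetric_radon_sequence M \<longleftrightarrow>
     (\<forall>n. radon_measure (pow_top n) (M n) \<and> symmetric_measure n (M n)) \<and>
     emeasure (M 0) (topspace (pow_top 0)) = 1"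

definition moment_sequence ::
    "'a::topological_space measure measure \<Rightarrow> (nat \<Rightarrow> (nat \<Rightarrow> 'a) measure) \<Rightarrow> bool" where
  "moment_sequence \<mu> M \<longleftrightarrow>
     symmetric_radon_sequence M \<and>
     (\<forall>n\<ge>1. \<forall>A. (\<forall>l<n. A l \<in> relcompact_borel) \<longrightarrow>
        emeasure (M n) (PiE {..<n} A) = (\<integral>\<^sup>+\<eta>. (\<Prod>l<n. emeasure \<eta> (A l)) \<partial>\<mu>))"

section \<open>Bounds and identities for a sequence of measures\<close>

definition growth_bound :: "(nat \<Rightarrow> (nat \<Rightarrow> 'a::topological_space) measure) \<Rightarrow> bool" where
  "growth_bound M \<longleftrightarrow>
     (\<forall>\<Lambda>\<in>relcompact_borel. \<exists>C::real. C > 0 \<and>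
        (\<forall>n\<ge>1. emeasure (M n) (cube n \<Lambda>) \<le> ennreal (C ^ n * fact n)))"

text \<open>The constants are allowed to vanish: the sequence with all \<open>\<Lambda> k\<close> empty decreases to the
  empty set and forces the constant of the empty set to be \<open>0\<close>, so no strictly positive family of
  constants, one for each \<open>\<Lambda>\<close>, satisfies the last clause. The condition below holds if and only if
  each \<open>\<Lambda>\<close> has a strictly positive constant, and for each sequence \<open>\<Lambda> k\<close> as in the last clause
  strictly positive constants tending to \<open>0\<close> can be chosen.\<close>

definition offdiag_growth_bound :: "(nat \<Rightarrow> (nat \<Rightarrow> 'a::topological_space) measure) \<Rightarrow> bool" where
  "offdiag_growth_bound M \<longleftrightarrow>
     (\<exists>C :: 'a set \<Rightarrow> real.
        (\<forall>\<Lambda>\<in>relcompact_borel. C \<Lambda> \<ge> 0 \<and>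
           (\<forall>n\<ge>1. emeasure (M n) (cube n \<Lambda> \<inter> offdiag n) \<le> ennreal (C \<Lambda> ^ n * fact n))) \<and>
        (\<forall>\<Lambda> :: nat \<Rightarrow> 'a set. range \<Lambda> \<subseteq> relcompact_borel \<and> decseq \<Lambda> \<and> (\<Inter>k. \<Lambda> k) = {} \<longrightarrow>
           (\<lambda>k. C (\<Lambda> k)) \<longlonglongrightarrow> 0))"

text \<open>\<open>diag_point k i x\<close> is the tuple \<open>(x\<^sub>0, \<dots>, x\<^sub>0, x\<^sub>1, \<dots>, x\<^sub>1, \<dots>)\<close> in which each \<open>x\<^sub>l\<close>, \<open>l < k\<close>, is
  repeated \<open>i l\<close> times: the list below contains the successive indices.\<close>

definition diag_point :: "nat \<Rightarrow> (nat \<Rightarrow> nat) \<Rightarrow> (nat \<Rightarrow> 'a) \<Rightarrow> (nat \<Rightarrow> 'a)" where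
  "diag_point k i x =
     (\<lambda>j\<in>{..<(\<Sum>l<k. i l)}. x (concat (map (\<lambda>l. replicate (i l) l) [0..<k]) ! j))"

definition diag_mass ::
    "(nat \<Rightarrow> (nat \<Rightarrow> 'a) measure) \<Rightarrow> nat \<Rightarrow> (nat \<Rightarrow> nat) \<Rightarrow> (nat \<Rightarrow> 'a) set \<Rightarrow> ennreal" where
  "diag_mass M k i \<Delta> = emeasure (M (\<Sum>l<k. i l)) (diag_point k i ` \<Delta>)"

definition simplicity_identity :: "(nat \<Rightarrow> (nat \<Rightarrow> 'a::topological_space) measure) \<Rightarrow> bool" where
  "simplicity_identity M \<longleftrightarrow>
     (\<forall>n\<ge>1. \<forall>i. (\<forall>l<n. i l \<ge> 1) \<longrightarrow>
        (\<forall>\<Delta>\<in>sets (offdiag_borel n). diag_mass M n i \<Delta> = diag_mass M n (\<lambda>_. 1) \<Delta>))"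

section \<open>Correlation measures\<close>

definition finite_configs :: "'a set set" where
  "finite_configs = {\<xi>. finite \<xi>}"

text \<open>The \<open>n\<close>-point subsets carry the quotient structure induced by \<open>(x\<^sub>1, \<dots>, x\<^sub>n) \<mapsto> {x\<^sub>1, \<dots>, x\<^sub>n}\<close>, and
  the finite configurations are their disjoint union over \<open>n\<close>.\<close>

definition finite_config_space :: "'a::topological_space set measure" where
  "finite_config_space = sigma finite_configs
     {A. A \<subseteq> finite_configs \<and> (\<forall>n. {x \<in> offdiag n. x ` {..<n} \<in> A} \<in> sets (offdiag_borel n))}"

text \<open>For \<open>\<eta> = config_measure \<gamma>\<close> the set of atoms of \<open>\<eta>\<close> is \<open>\<gamma>\<close>.\<close>

definition atoms :: "'a measure \<Rightarrow> 'a set" where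
  "atoms \<eta> = {x. emeasure \<eta> {x} \<noteq> 0}"

definition correlation_measure ::
    "'a::topological_space measure measure \<Rightarrow> 'a set measure \<Rightarrow> bool" where
  "correlation_measure \<mu> \<rho> \<longleftrightarrow>
     sets \<rho> = sets finite_config_space \<and>
     (\<forall>G \<in> borel_measurable finite_config_space.
        (\<integral>\<^sup>+\<eta>\<in>simple_measures.
            (\<integral>\<^sup>+\<xi>. G \<xi> \<partial>count_space {\<xi>. \<xi> \<subseteq> atoms \<eta> \<and> finite \<xi>}) \<partial>\<mu>)
        = (\<integral>\<^sup>+\<xi>. G \<xi> \<partial>\<rho>))"

text \<open>The identification of the restriction of \<open>\<rho>\<close> to the \<open>n\<close>-point configurations with a symmetric
  measure on \<open>offdiag n\<close>: the restriction is the push-forward of that measure, with no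
  factor \<open>n!\<close>.\<close>

definition lifted_restriction ::
    "nat \<Rightarrow> 'a::topological_space set measure \<Rightarrow> (nat \<Rightarrow> 'a) measure \<Rightarrow> bool" where
  "lifted_restriction n \<rho> \<rho>n \<longleftrightarrow>
     sets \<rho>n = sets (offdiag_borel n) \<and> symmetric_measure n \<rho>n \<and>
     (\<forall>A\<in>sets finite_config_space. (\<forall>\<xi>\<in>A. card \<xi> = n) \<longrightarrow>
        emeasure \<rho> A = emeasure \<rho>n {x \<in> offdiag n. x ` {..<n} \<in> A})"

section \<open>Positive definiteness\<close>

definition Psi_top :: "(nat \<times> (nat \<Rightarrow> 'a::topological_space)) topology" where
  "Psi_top = sum_topology pow_top UNIV"

definition Psi_measure ::
    "(nat \<Rightarrow> (nat \<Rightarrow> 'a::topological_space) measure) \<Rightarrow> (nat \<times> (nat \<Rightarrow> 'a)) measure" where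
  "Psi_measure M = measure_of (topspace Psi_top) (sets (borel_of Psi_top))
     (\<lambda>A. \<Sum>n. emeasure (M n) {x. (n, x) \<in> A})"

definition Psi_tensor ::
    "(nat \<times> (nat \<Rightarrow> 'a) \<Rightarrow> real) \<Rightarrow> (nat \<times> (nat \<Rightarrow> 'a) \<Rightarrow> real) \<Rightarrow> nat \<times> (nat \<Rightarrow> 'a) \<Rightarrow> real" where
  "Psi_tensor F1 F2 = (\<lambda>(k, x). \<Sum>m\<le>k.
     F1 (m, restrict x {..<m}) * F2 (k - m, \<lambda>j\<in>{..<k - m}. x (m + j)))"

text \<open>Since \<open>cube 0 \<Lambda>\<close> is all of \<open>X\<^sup>0\<close>, the support condition puts no restriction on the component of
  degree \<open>0\<close>.\<close>

definition positive_definite :: "(nat \<Rightarrow> (nat \<Rightarrow> 'a::topological_space) measure) \<Rightarrow> bool" where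
  "positive_definite M \<longleftrightarrow>
     (\<forall>F \<in> borel_measurable (borel_of Psi_top).
        (\<exists>B. \<forall>p\<in>topspace Psi_top. \<bar>F p\<bar> \<le> B) \<and>
        (\<exists>N. \<exists>\<Lambda>\<in>relcompact_borel. \<forall>p\<in>topspace Psi_top - (SIGMA n:{..N}. cube n \<Lambda>). F p = 0) \<longrightarrow>
        (\<integral>p. Psi_tensor F F p \<partial>Psi_measure M) \<ge> 0)"

end

theory Submission
  imports Defs "HOL-Computational_Algebra.Polynomial" "HOL-Combinatorics.Permutations"
    "HOL-Library.Poly_Mapping"
begin

text \<open>
  \<^emph>\<open>Simplicity.\<close> Let \<open>T\<^sub>k\<close> be the mass that \<open>\<eta>\<^sup>k\<close> gives to the diagonal of \<open>U\<^sup>k\<close>. Then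
  \<open>\<integral>\<^sub>U (\<eta>{x} - 1)\<^sup>2 d\<eta>(x) = T\<^sub>3 - 2 T\<^sub>2 + \<eta>(U)\<close>, and this vanishes for all \<open>U\<close> of an exhaustion if and only
  if \<open>\<eta>\<close> is the counting measure of a configuration. By (S) for one point, the expectation is
  \<open>M\<^sup>1(U) - 2 M\<^sup>1(U) + M\<^sup>1(U) = 0\<close>.

  \<^emph>\<open>Existence.\<close> By (S) the formal factorial moments of the number \<open>N A\<close> of points in \<open>A\<close> are the numbers
  \<open>M\<^sup>n(A\<^sup>n \<inter> offdiag)\<close>. When these grow slowly, inverting them gives weights \<open>s\<close> on the natural numbers,
  of unknown sign but exponentially decaying, such that the positive functional \<open>L\<close> defined by the
  moments acts on polynomials in the single variable \<open>N A\<close> as integration against \<open>s\<close>. Approximating the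
  indicator of \<open>{N A = n}\<close> by polynomials, one cuts \<open>L\<close> into joint pieces \<open>{N A\<^sub>1 = n\<^sub>1, \<dots>, N A\<^sub>k = n\<^sub>k}\<close>;
  their masses are the finite-dimensional distributions of a process of counts with the prescribed
  moments. The growth is slow enough for singletons and, by (C2), for small punctured neighbourhoods,
  and countably many disjoint sets of these two kinds cover the space. On a countable semiring of
  subsets of these pieces which contains compact inner approximations the counts are almost surely
  additive and continuous at the empty set, and Caratheodory's theorem extends them to a random measure.
\<close>

(* This sum notation of Poly_Mapping is ambiguous with that of suminf. *)
no_syntax
  "_Sum_any" :: "pttrn \<Rightarrow> 'a \<Rightarrow> 'a::comm_monoid_add"    (\<open>(\<open>indent=2 notation=\<open>binder \<Sum>\<close>\<close>\<Sum>_. _)\<close> [0, 10] 10)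

section \<open>Moment functionals in countably many integer variables\<close>

text \<open>In several variables, nonnegativity on squares does not make a functional an integral
  against a measure, so the joint law has to be built from one-variable data. The link is
  Cauchy-Schwarz: for a polynomial u in one count and an arbitrary g, the number L(u g)^2 is at most
  L(u u) L(g g), and L(u u) is an explicit series in the values of u. Only the absolute values of
  the weights enter the estimates, so their signs do no harm; nonnegativity of the masses is
  recovered from squares, since an indicator equals its own square in the limit. Slow growth is
  available only locally. Neighbourhoods of a point shrink to the point and not to the empty set,
  which is why (C2) helps only after the point has been removed; the point itself is harmless
  because a tuple of two or more equal entries is not off-diagonal. Since counts are natural
  numbers, a small mean along an approximation makes the count vanish almost surely at some stage,
  which turns estimates of means into exact statements about single realizations.\<close>

definition binom_poly :: "nat \<Rightarrow> real poly" where
  "binom_poly k = smult (1 / fact k) (\<Prod>j<k. [:- of_nat j, 1:])"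

lemma poly_binom_poly: "poly (binom_poly k) (of_nat j) = of_nat (j choose k)"
  by (simp add: binom_poly_def poly_prod binomial_gbinomial gbinomial_prod_rev atLeast0LessThan)

text \<open>The values on \<open>{0..m}\<close> are those of the indicator of \<open>n\<close>, and the values on all natural numbers \<open>j\<close>
  are bounded by \<open>3\<^sup>j\<close> uniformly in \<open>m\<close>.\<close>

definition delta_poly :: "nat \<Rightarrow> nat \<Rightarrow> real poly" where
  "delta_poly n m = (\<Sum>k\<le>m. smult ((-1) ^ (k + n) * of_nat (k choose n)) (binom_poly k))"

lemma poly_delta_poly:
  "poly (delta_poly n m) (of_nat j) = (\<Sum>k\<le>m. (-1) ^ (k + n) * of_nat (k choose n) * of_nat (j choose k))"
  by (simp add: delta_poly_def poly_sum poly_binom_poly mult.assoc)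

text \<open>The product (j choose k)(k choose n) equals (j choose n)((j - n) choose (k - n)), and
  the remaining alternating row sum of Pascal's triangle vanishes unless j = n. The truncation at
  \<open>m\<close> is invisible for j \<le> m, since (j choose k) vanishes beyond k = j.\<close>

lemma poly_delta_poly_eq:
  assumes "j \<le> m"
  shows "poly (delta_poly n m) (of_nat j) = (if j = n then 1 else 0)"
proof -
  have *: "(j choose k) * (k choose n) = (j choose n) * ((j - n) choose (k - n))" if "n \<le> k" "k \<le> j" for k
    using choose_mult[OF that] by simp
  have "(\<Sum>k\<le>m. (-1) ^ (k + n) * of_nat (k choose n) * of_nat (j choose k) :: real)
      = (\<Sum>k\<in>{n..j}. (-1) ^ (k + n) * of_nat (j choose n) * of_nat ((j - n) choose (k - n)))"
    (is "?l = ?r")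
  proof -
    have "?l = (\<Sum>k\<in>{n..j}. (-1) ^ (k + n) * of_nat (k choose n) * of_nat (j choose k))"
      using assms by (intro sum.mono_neutral_right) (auto simp: not_le)
    also have "\<dots> = ?r"
    proof (rule sum.cong[OF refl])
      fix k assume "k \<in> {n..j}"
      then have "real (j choose k) * real (k choose n) = real (j choose n) * real ((j - n) choose (k - n))"
        using *[of k] by (metis atLeastAtMost_iff of_nat_mult)
      then show "(-1) ^ (k + n) * real (k choose n) * real (j choose k) =
          (-1) ^ (k + n) * real (j choose n) * real ((j - n) choose (k - n))"
        by (simp add: mult_ac)
    qed
    finally show ?thesis .
  qed
  also have "\<dots> = (if j = n then 1 else 0)"
  proof (cases "n \<le> j")
    case True
    have "(\<Sum>k\<in>{n..j}. (-1) ^ (k + n) * of_nat (j choose n) * of_nat ((j - n) choose (k - n)) :: real)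
      = (\<Sum>i\<le>j - n. (-1) ^ i * of_nat (j choose n) * of_nat ((j - n) choose i))"
      by (rule sum.reindex_bij_witness[of _ "\<lambda>i. i + n" "\<lambda>k. k - n"])
        (use True in \<open>auto simp: power_add minus_one_power_iff\<close>)
    also have "\<dots> = of_nat (j choose n) * (\<Sum>i\<le>j - n. (-1) ^ i * of_nat ((j - n) choose i))"
      by (simp add: sum_distrib_left mult_ac)
    also have "\<dots> = (if j = n then 1 else 0)"
      using choose_alternating_sum[of "j - n", where 'a=real] True by auto
    finally show ?thesis .
  qed auto
  finally show ?thesis by (simp add: poly_delta_poly)
qed

text \<open>Summation over n replaces (k choose n) by at most 2^k, and the binomial theorem for (2 +
  1)^j does the rest. A bound for the whole sum over n, uniform in \<open>R\<close> and
  \<open>m\<close>, is what \<open>localize_sums\<close> needs; bounds for the single polynomials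
  would not control sums of growing length.\<close>

lemma sum_abs_delta_poly_le:
  "(\<Sum>n\<le>R. \<bar>poly (delta_poly n m) (of_nat j)\<bar>) \<le> 3 ^ j"
proof -
  have "(\<Sum>n\<le>R. \<bar>poly (delta_poly n m) (of_nat j)\<bar>)
      \<le> (\<Sum>n\<le>R. \<Sum>k\<le>m. of_nat (k choose n) * of_nat (j choose k))"
    unfolding poly_delta_poly
    by (intro sum_mono order_trans[OF sum_abs]) (auto simp: abs_mult intro!: sum_mono)
  also have "\<dots> = (\<Sum>k\<le>m. of_nat (\<Sum>n\<le>R. k choose n) * of_nat (j choose k))"
    by (subst sum.swap) (simp add: sum_distrib_right)
  also have "\<dots> \<le> (\<Sum>k\<le>m. 2 ^ k * of_nat (j choose k))"
  proof (intro sum_mono mult_right_mono)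
    fix k
    have "(\<Sum>n\<le>R. k choose n) \<le> (\<Sum>n\<le>k. k choose n)"
    proof -
      have "(\<Sum>n\<le>R. k choose n) = (\<Sum>n\<in>{..R} \<inter> {..k}. k choose n)"
        by (rule sum.mono_neutral_right) auto
      also have "\<dots> \<le> (\<Sum>n\<le>k. k choose n)" by (rule sum_mono2) auto
      finally show ?thesis .
    qed
    also have "\<dots> = 2 ^ k" by (rule choose_row_sum)
    finally show "real (\<Sum>n\<le>R. k choose n) \<le> 2 ^ k"
      by (metis of_nat_le_iff of_nat_numeral of_nat_power)
  qed simp
  also have "\<dots> = (\<Sum>k\<in>{..m} \<inter> {..j}. 2 ^ k * of_nat (j choose k))"
    by (rule sum.mono_neutral_right) auto
  also have "\<dots> \<le> (\<Sum>k\<le>j. 2 ^ k * of_nat (j choose k))"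
    by (rule sum_mono2) auto
  also have "\<dots> = (2 + 1) ^ j"
    by (subst binomial_ring) (simp add: mult_ac)
  finally show ?thesis by simp
qed

lemma abs_delta_poly_le: "\<bar>poly (delta_poly n m) (of_nat j)\<bar> \<le> 3 ^ j"
proof -
  have "\<bar>poly (delta_poly n m) (of_nat j)\<bar> \<le> (\<Sum>i\<le>n. \<bar>poly (delta_poly i m) (of_nat j)\<bar>)"
    by (rule member_le_sum) auto
  then show ?thesis using sum_abs_delta_poly_le order_trans by blast
qed

text \<open>\<open>\<phi> i\<close> substitutes the \<open>i\<close>-th variable into a polynomial, and \<open>\<phi> 0 [:c:]\<close> is the scalar \<open>c\<close>. The
  marginal weights \<open>s i j\<close> may have any sign. The rate \<open>256 = 16\<^sup>2\<close> makes the squares of polynomials with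
  values \<open>O(16\<^sup>j)\<close> summable against them, which leaves room for products of two \<open>delta_poly\<close>.\<close>

locale moment_functional =
  fixes L :: "'r::comm_ring_1 \<Rightarrow> real" and \<phi> :: "nat \<Rightarrow> real poly \<Rightarrow> 'r" and s :: "nat \<Rightarrow> nat \<Rightarrow> real"
  assumes L_add: "L (a + b) = L a + L b"
    and L_scale: "L (\<phi> 0 [:c:] * a) = c * L a"
    and L_square: "0 \<le> L (a * a)"
    and L_one: "L 1 = 1"
    and phi_add: "\<phi> i (u + v) = \<phi> i u + \<phi> i v"
    and phi_mult: "\<phi> i (u * v) = \<phi> i u * \<phi> i v"
    and phi_one: "\<phi> i 1 = 1"
    and phi_const: "\<phi> i [:c:] = \<phi> 0 [:c:]"
    and summable_marginal: "summable (\<lambda>j. 256 ^ j * \<bar>s i j\<bar>)"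
    and L_marginal: "L (\<phi> i u) = (\<Sum>j. poly u (of_nat j) * s i j)"
begin

text \<open>The class of functionals in which the successive restrictions of \<open>L\<close> live.
  Domination by \<open>L\<close> on squares is part of it because the marginal weights are known for
  \<open>L\<close> only: every estimate for \<open>K\<close> is made with \<open>L\<close>.\<close>

definition dominated :: "('r \<Rightarrow> real) \<Rightarrow> bool" where
  "dominated K \<longleftrightarrow> (\<forall>a b. K (a + b) = K a + K b) \<and> (\<forall>c a. K (\<phi> 0 [:c:] * a) = c * K a) \<and>
     (\<forall>a. 0 \<le> K (a * a) \<and> K (a * a) \<le> L (a * a))"

lemma dominatedD:
  assumes "dominated K"
  shows "K (a + b) = K a + K b" "K (\<phi> i [:c:] * a) = c * K a" "0 \<le> K (a * a)" "K (a * a) \<le> L (a * a)"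
  using assms by (auto simp: dominated_def phi_const[of i])

lemma dominated_L: "dominated L"
  by (simp add: dominated_def L_add L_scale L_square)

lemma phi_diff: "\<phi> i (u - v) = \<phi> i u - \<phi> i v"
  by (metis add_diff_cancel_right' diff_add_cancel phi_add)

lemma phi_zero: "\<phi> i 0 = 0"
  using phi_diff[of i 0 0] by simp

lemma phi_sum: "\<phi> i (sum u A) = (\<Sum>k\<in>A. \<phi> i (u k))"
  by (induct A rule: infinite_finite_induct) (auto simp: phi_zero phi_add)

lemma dominated_diff:
  assumes "dominated K" shows "K (a - b) = K a - K b"
  by (metis add_diff_cancel_right' assms diff_add_cancel dominatedD(1))

lemma dominated_sum:
  assumes "dominated K" shows "K (sum u A) = (\<Sum>k\<in>A. K (u k))"
  using dominatedD(1)[OF assms] dominated_diff[OF assms, of 0 0]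
  by (induct A rule: infinite_finite_induct) auto

text \<open>Nonnegativity of the quadratic polynomial t \<mapsto> K((a + t b)^2), with the scalar t
  embedded into the ring by \<open>\<phi> 0\<close>.\<close>

lemma Cauchy_Schwarz:
  assumes K: "dominated K"
  shows "(K (a * b))\<^sup>2 \<le> K (a * a) * K (b * b)"
proof -
  let ?c = "\<lambda>t. \<phi> 0 [:t:]"
  have q: "0 \<le> K (a * a) + 2 * t * K (a * b) + t\<^sup>2 * K (b * b)" for t
  proof -
    have eq: "(a + ?c t * b) * (a + ?c t * b) = a * a + ?c t * (a * b) + ?c t * (a * b) + ?c t * (?c t * (b * b))"
      by (simp add: algebra_simps)
    have "K ((a + ?c t * b) * (a + ?c t * b)) = K (a * a) + 2 * t * K (a * b) + t\<^sup>2 * K (b * b)"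
      unfolding eq by (simp only: dominatedD(1,2)[OF K]) (simp add: power2_eq_square)
    then show ?thesis using dominatedD(3)[OF K, of "a + ?c t * b"] by simp
  qed
  show ?thesis
  proof (cases "K (b * b) = 0")
    case True
    have "K (a * b) = 0"
    proof (rule ccontr)
      assume "K (a * b) \<noteq> 0"
      \<comment> \<open>The polynomial is affine here, and at this argument it takes the value
        -1.\<close>
      with q[of "- (K (a * a) + 1) / (2 * K (a * b))"] True show False by (simp add: field_simps)
    qed
    then show ?thesis using True by simp
  next
    case False
    then have "K (b * b) > 0" using dominatedD(3)[OF K, of b] by simp
    \<comment> \<open>The quadratic polynomial attains its minimum here.\<close>
    with q[of "- K (a * b) / K (b * b)"] show ?thesis
      by (simp add: field_simps power2_eq_square)
  qed
qed

lemma Cauchy_Schwarz_L: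
  assumes K: "dominated K"
  shows "(K (a * b))\<^sup>2 \<le> L (a * a) * L (b * b)"
  by (rule order_trans[OF Cauchy_Schwarz[OF K] mult_mono])
    (use dominatedD[OF K] dominatedD[OF dominated_L] in auto)

section \<open>Tail estimates and restriction to the event that a count has a given value\<close>

definition tail :: "nat \<Rightarrow> nat \<Rightarrow> real" where
  "tail i m = (\<Sum>j. 256 ^ (j + Suc m) * \<bar>s i (j + Suc m)\<bar>)"

lemma tail_tendsto: "tail i \<longlonglongrightarrow> 0"
proof -
  let ?g = "\<lambda>j. 256 ^ j * \<bar>s i j\<bar>"
  have "tail i = (\<lambda>m. suminf ?g - sum ?g {..<Suc m})"
    unfolding tail_def by (rule ext) (rule suminf_minus_initial_segment[OF summable_marginal])
  moreover have "(\<lambda>m. suminf ?g - sum ?g {..<Suc m}) \<longlonglongrightarrow> suminf ?g - suminf ?g"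
    by (intro tendsto_diff tendsto_const LIMSEQ_Suc[OF summable_LIMSEQ[OF summable_marginal]])
  ultimately show ?thesis by simp
qed

text \<open>The square of the bound 16^j is 256^j, which the weights absorb; the terms up to
  \<open>m\<close> drop out because u vanishes there.\<close>

lemma L_square_le_tail:
  assumes u0: "\<And>j. j \<le> m \<Longrightarrow> poly u (of_nat j) = 0"
    and ub: "\<And>j. \<bar>poly u (of_nat j)\<bar> \<le> B * 16 ^ j"
  shows "L (\<phi> i u * \<phi> i u) \<le> B\<^sup>2 * tail i m"
proof -
  have *: "\<bar>poly (u * u) (of_nat j) * s i j\<bar> \<le> B\<^sup>2 * (256 ^ j * \<bar>s i j\<bar>)" for j
  proof -
    have "\<bar>poly u (of_nat j)\<bar> * \<bar>poly u (of_nat j)\<bar> \<le> (B * 16 ^ j) * (B * 16 ^ j)"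
      by (intro mult_mono ub) (use ub[of j] in auto)
    also have "\<dots> = B\<^sup>2 * 256 ^ j"
      by (simp add: power2_eq_square mult_ac flip: power_mult_distrib)
    finally have "\<bar>poly u (of_nat j)\<bar> * \<bar>poly u (of_nat j)\<bar> * \<bar>s i j\<bar> \<le> B\<^sup>2 * 256 ^ j * \<bar>s i j\<bar>"
      by (rule mult_right_mono) simp
    then show ?thesis by (simp only: poly_mult abs_mult mult.assoc)
  qed
  have sm: "summable (\<lambda>j. B\<^sup>2 * (256 ^ j * \<bar>s i j\<bar>))"
    by (intro summable_mult summable_marginal)
  have sm': "summable (\<lambda>j. poly (u * u) (of_nat j) * s i j)"
    by (rule summable_rabs_cancel, rule summable_comparison_test'[OF sm, of 0]) (use * in auto)
  have "L (\<phi> i u * \<phi> i u) = (\<Sum>j. poly (u * u) (of_nat j) * s i j)"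
    by (simp only: phi_mult[symmetric] L_marginal)
  also have "\<dots> = (\<Sum>j. poly (u * u) (of_nat (j + Suc m)) * s i (j + Suc m))"
    by (subst suminf_split_initial_segment[OF sm', of "Suc m"]) (simp add: u0)
  also have "\<dots> \<le> (\<Sum>j. B\<^sup>2 * (256 ^ (j + Suc m) * \<bar>s i (j + Suc m)\<bar>))"
    by (intro suminf_le summable_ignore_initial_segment sm sm')
      (use * abs_le_D1 in blast)
  also have "\<dots> = B\<^sup>2 * tail i m"
    unfolding tail_def
    by (intro suminf_mult summable_ignore_initial_segment summable_marginal)
  finally show ?thesis .
qed

text \<open>Cauchy-Schwarz separates u from g. As g enters only through the constant L(g g), the
  bound tends to 0 with \<open>m\<close> for every g in the ring.\<close>

lemma dominated_le_tail:
  assumes K: "dominated K"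
    and "\<And>j. j \<le> m \<Longrightarrow> poly u (of_nat j) = 0"
    and "\<And>j. \<bar>poly u (of_nat j)\<bar> \<le> B * 16 ^ j"
  shows "\<bar>K (\<phi> i u * g)\<bar> \<le> sqrt (B\<^sup>2 * L (g * g)) * sqrt (tail i m)"
proof -
  have "(K (\<phi> i u * g))\<^sup>2 \<le> L (\<phi> i u * \<phi> i u) * L (g * g)"
    by (rule Cauchy_Schwarz_L[OF K])
  also have "\<dots> \<le> (B\<^sup>2 * tail i m) * L (g * g)"
    by (intro mult_right_mono L_square_le_tail assms L_square)
  also have "\<dots> = (B\<^sup>2 * L (g * g)) * tail i m" by simp
  finally show ?thesis
    by (metis real_sqrt_abs real_sqrt_le_iff real_sqrt_mult)
qed

lemma dominated_tendsto_0:
  assumes K: "dominated K"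
    and "\<And>m j. j \<le> m \<Longrightarrow> poly (u m) (of_nat j) = 0"
    and "\<And>m j. \<bar>poly (u m) (of_nat j)\<bar> \<le> B * 16 ^ j"
  shows "(\<lambda>m. K (\<phi> i (u m) * g)) \<longlonglongrightarrow> 0"
proof (rule tendsto_rabs_zero_cancel, rule tendsto_sandwich[OF _ _ tendsto_const])
  have "(\<lambda>m. sqrt (B\<^sup>2 * L (g * g)) * sqrt (tail i m)) \<longlonglongrightarrow> sqrt (B\<^sup>2 * L (g * g)) * sqrt 0"
    by (intro tendsto_intros tail_tendsto)
  then show "(\<lambda>m. sqrt (B\<^sup>2 * L (g * g)) * sqrt (tail i m)) \<longlonglongrightarrow> 0" by simp
  show "\<forall>\<^sub>F m in sequentially. \<bar>K (\<phi> i (u m) * g)\<bar> \<le> sqrt (B\<^sup>2 * L (g * g)) * sqrt (tail i m)"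
    by (intro always_eventually allI dominated_le_tail assms)
qed auto

lemma pow3_le_16: "(3::real) ^ j \<le> 16 ^ j" "(1::real) \<le> 16 ^ j" "(9::real) ^ j \<le> 16 ^ j"
  by (auto intro!: power_mono)

text \<open>The restriction of \<open>K\<close> to the event that the \<open>i\<close>-th variable equals \<open>n\<close>.\<close>

definition localize :: "nat \<Rightarrow> nat \<Rightarrow> ('r \<Rightarrow> real) \<Rightarrow> 'r \<Rightarrow> real" where
  "localize i n K g = lim (\<lambda>m. K (\<phi> i (delta_poly n m) * g))"

text \<open>Approximants of levels l \<le> m both equal the indicator of n on {0..l}, so their
  difference vanishes there, and it is bounded by 2 * 16^j everywhere: the tail at l makes the
  sequence Cauchy.\<close>

lemma localize_tendsto:
  assumes K: "dominated K"
  shows "(\<lambda>m. K (\<phi> i (delta_poly n m) * g)) \<longlonglongrightarrow> localize i n K g"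
proof -
  let ?X = "\<lambda>m. K (\<phi> i (delta_poly n m) * g)"
  have b: "\<bar>?X m - ?X l\<bar> \<le> sqrt (2\<^sup>2 * L (g * g)) * sqrt (tail i l)" if "l \<le> m" for l m
  proof -
    have "?X m - ?X l = K (\<phi> i (delta_poly n m - delta_poly n l) * g)"
      by (simp add: phi_diff left_diff_distrib dominated_diff[OF K])
    moreover have "\<bar>poly (delta_poly n m - delta_poly n l) (of_nat j)\<bar> \<le> 2 * 16 ^ j" for j
      using abs_delta_poly_le[of n m j] abs_delta_poly_le[of n l j] pow3_le_16[of j]
      by (simp add: abs_le_iff)
    then have "\<bar>K (\<phi> i (delta_poly n m - delta_poly n l) * g)\<bar> \<le> sqrt (2\<^sup>2 * L (g * g)) * sqrt (tail i l)"
      using that by (intro dominated_le_tail[OF K]) (auto simp: poly_delta_poly_eq)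
    ultimately show ?thesis by simp
  qed
  have lim0: "(\<lambda>l. sqrt (2\<^sup>2 * L (g * g)) * sqrt (tail i l)) \<longlonglongrightarrow> sqrt (2\<^sup>2 * L (g * g)) * sqrt 0"
    by (intro tendsto_intros tail_tendsto)
  have "Cauchy ?X"
  proof (rule metric_CauchyI)
    fix e :: real assume "0 < e"
    with lim0 have "\<forall>\<^sub>F l in sequentially. sqrt (2\<^sup>2 * L (g * g)) * sqrt (tail i l) < e / 2"
      by (intro order_tendstoD(2)[OF lim0]) simp
    then obtain N where N: "sqrt (2\<^sup>2 * L (g * g)) * sqrt (tail i N) < e / 2"
      by (auto simp: eventually_sequentially)
    have "dist (?X m) (?X k) < e" if "m \<ge> N" "k \<ge> N" for m k
      using b[OF that(1)] b[OF that(2)] N by (auto simp: dist_real_def)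
    then show "\<exists>M. \<forall>m\<ge>M. \<forall>n\<ge>M. dist (?X m) (?X n) < e" by blast
  qed
  then show ?thesis
    unfolding localize_def by (simp add: Cauchy_convergent_iff convergent_LIMSEQ_iff)
qed

text \<open>An indicator is its own square: f f - f vanishes on {0..m}, so f may be replaced by f f
  in the limit. This exhibits the restriction, evaluated at g g, as a limit of values of
  \<open>K\<close> on squares.\<close>

lemma localize_square_tendsto:
  assumes K: "dominated K"
  shows "(\<lambda>m. K ((\<phi> i (delta_poly n m) * g) * (\<phi> i (delta_poly n m) * g))) \<longlonglongrightarrow> localize i n K (g * g)"
proof -
  let ?f = "\<lambda>m. delta_poly n m"
  have "(\<lambda>m. K (\<phi> i (?f m * ?f m - ?f m) * (g * g))) \<longlonglongrightarrow> 0"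
  proof (rule dominated_tendsto_0[OF K])
    show "\<bar>poly (?f m * ?f m - ?f m) (of_nat j)\<bar> \<le> 2 * 16 ^ j" for m j
    proof -
      have "\<bar>poly (?f m) (of_nat j)\<bar> * \<bar>poly (?f m) (of_nat j)\<bar> \<le> 3 ^ j * 3 ^ j"
        by (intro mult_mono abs_delta_poly_le) auto
      also have "(3::real) ^ j * 3 ^ j = 9 ^ j" by (simp flip: power_mult_distrib)
      finally have "\<bar>poly (?f m) (of_nat j) * poly (?f m) (of_nat j)\<bar> \<le> 16 ^ j"
        unfolding abs_mult using pow3_le_16(3)[of j] by linarith
      then show ?thesis
        using abs_delta_poly_le[of n m j] pow3_le_16(1)[of j] unfolding poly_diff poly_mult by linarith
    qed
  qed (simp add: poly_delta_poly_eq)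
  from tendsto_add[OF this localize_tendsto[OF K, of i n "g * g"]]
  have "(\<lambda>m. K (\<phi> i (?f m * ?f m - ?f m) * (g * g)) + K (\<phi> i (?f m) * (g * g))) \<longlonglongrightarrow> localize i n K (g * g)"
    by simp
  moreover have "K (\<phi> i (?f m * ?f m - ?f m) * (g * g)) + K (\<phi> i (?f m) * (g * g))
      = K ((\<phi> i (?f m) * g) * (\<phi> i (?f m) * g))" for m
    by (simp add: dominatedD(1)[OF K, symmetric] phi_diff phi_mult algebra_simps)
  ultimately show ?thesis by simp
qed

text \<open>The same idempotence for the complementary event. As a limit of nonnegative numbers, the
  right-hand side is nonnegative, so a restriction never exceeds \<open>K\<close> on
  squares.\<close>

lemma localize_compl_square_tendsto:
  assumes K: "dominated K"
  shows "(\<lambda>m. K (((1 - \<phi> i (delta_poly n m)) * g) * ((1 - \<phi> i (delta_poly n m)) * g)))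
     \<longlonglongrightarrow> K (g * g) - localize i n K (g * g)"
proof -
  have "K (((1 - \<phi> i (delta_poly n m)) * g) * ((1 - \<phi> i (delta_poly n m)) * g))
     = K (g * g) - 2 * K (\<phi> i (delta_poly n m) * (g * g))
       + K ((\<phi> i (delta_poly n m) * g) * (\<phi> i (delta_poly n m) * g))" for m
  proof -
    have eq: "((1 - \<phi> i (delta_poly n m)) * g) * ((1 - \<phi> i (delta_poly n m)) * g)
      = g * g - \<phi> i (delta_poly n m) * (g * g) - \<phi> i (delta_poly n m) * (g * g)
       + (\<phi> i (delta_poly n m) * g) * (\<phi> i (delta_poly n m) * g)"
      by (simp add: algebra_simps)
    show ?thesis unfolding eq by (simp only: dominatedD(1)[OF K] dominated_diff[OF K])
  qed
  moreover have "(\<lambda>m. K (g * g) - 2 * K (\<phi> i (delta_poly n m) * (g * g))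
       + K ((\<phi> i (delta_poly n m) * g) * (\<phi> i (delta_poly n m) * g)))
     \<longlonglongrightarrow> K (g * g) - 2 * localize i n K (g * g) + localize i n K (g * g)"
    by (intro tendsto_intros localize_tendsto localize_square_tendsto K)
  ultimately show ?thesis by simp
qed

lemma localize_le:
  assumes K: "dominated K"
  shows "localize i n K (g * g) \<le> K (g * g)"
proof -
  have "0 \<le> K (g * g) - localize i n K (g * g)"
    by (rule LIMSEQ_le_const[OF localize_compl_square_tendsto[OF K]])
      (use dominatedD(3)[OF K] in auto)
  then show ?thesis by simp
qed

lemma dominated_localize:
  assumes K: "dominated K"
  shows "dominated (localize i n K)"
  unfolding dominated_def
proof (intro conjI allI)
  fix a b
  have "(\<lambda>m. K (\<phi> i (delta_poly n m) * a) + K (\<phi> i (delta_poly n m) * b)) \<longlonglongrightarrow> localize i n K a + localize i n K b"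
    by (intro tendsto_intros localize_tendsto K)
  then show "localize i n K (a + b) = localize i n K a + localize i n K b"
    using localize_tendsto[OF K, of i n "a + b"]
    by (simp add: distrib_left dominatedD(1)[OF K] LIMSEQ_unique)
next
  fix c a
  have "(\<lambda>m. c * K (\<phi> i (delta_poly n m) * a)) \<longlonglongrightarrow> c * localize i n K a"
    by (intro tendsto_intros localize_tendsto K)
  moreover have "K (\<phi> i (delta_poly n m) * (\<phi> 0 [:c:] * a)) = c * K (\<phi> i (delta_poly n m) * a)" for m
    using dominatedD(2)[OF K, of 0 c "\<phi> i (delta_poly n m) * a"] by (simp add: mult_ac)
  ultimately show "localize i n K (\<phi> 0 [:c:] * a) = c * localize i n K a"
    using localize_tendsto[OF K, of i n "\<phi> 0 [:c:] * a"] by (simp add: LIMSEQ_unique)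
next
  fix a
  show "0 \<le> localize i n K (a * a)"
    by (rule LIMSEQ_le_const[OF localize_square_tendsto[OF K]])
      (use dominatedD(3)[OF K] in auto)
  show "localize i n K (a * a) \<le> L (a * a)"
    using localize_le[OF K] dominatedD(4)[OF K] order_trans by blast
qed

text \<open>On the event that the i-th count is n, multiplication by this count is multiplication by
  n: the polynomial X - n times an approximate indicator of n vanishes at 0, ..., m. The linear
  factor costs a constant times 2^j, and 3 * 2 = 6 is still below 16.\<close>

lemma localize_eigen:
  assumes K: "dominated K"
  shows "localize i n K (\<phi> i [:0, 1:] * g) = of_nat n * localize i n K g"
proof -
  define C where "C = 1 + real n"
  let ?u = "\<lambda>m. delta_poly n (m + n) * [:- of_nat n, 1:]"
  have "(\<lambda>m. K (\<phi> i (?u m) * g)) \<longlonglongrightarrow> 0"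
  proof (rule dominated_tendsto_0[OF K])
    show "\<bar>poly (?u m) (of_nat j)\<bar> \<le> C * 16 ^ j" for m j
    proof -
      have "real j \<le> 2 ^ j" by (metis less_exp less_imp_le of_nat_le_iff of_nat_numeral of_nat_power)
      then have "\<bar>real j - real n\<bar> \<le> 2 ^ j + real n" by linarith
      also have "\<dots> \<le> C * 2 ^ j" unfolding C_def distrib_right by (simp add: mult_le_cancel_left1)
      finally have "\<bar>poly (delta_poly n (m + n)) (of_nat j)\<bar> * \<bar>real j - real n\<bar> \<le> 3 ^ j * (C * 2 ^ j)"
        by (intro mult_mono abs_delta_poly_le) auto
      also have "\<dots> = C * 6 ^ j" by (simp flip: power_mult_distrib)
      also have "\<dots> \<le> C * 16 ^ j" by (intro mult_left_mono power_mono) (auto simp: C_def)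
      finally show ?thesis unfolding poly_mult abs_mult by simp
    qed
  qed (simp add: poly_delta_poly_eq)
  moreover have "K (\<phi> i (?u m) * g) = K (\<phi> i (delta_poly n (m + n)) * (\<phi> i [:0, 1:] * g))
        - of_nat n * K (\<phi> i (delta_poly n (m + n)) * g)" for m
  proof -
    have "[:- of_nat n, 1:] = [:0, 1:] - [:of_nat n :: real:]" by simp
    then have "\<phi> i (?u m) * g = \<phi> i (delta_poly n (m + n)) * (\<phi> i [:0, 1:] * g)
        - \<phi> i [:of_nat n:] * (\<phi> i (delta_poly n (m + n)) * g)"
      by (simp only: phi_mult phi_diff) (simp add: algebra_simps)
    then show ?thesis by (simp add: dominated_diff[OF K] dominatedD(2)[OF K])
  qed
  moreover have "(\<lambda>m. K (\<phi> i (delta_poly n (m + n)) * (\<phi> i [:0, 1:] * g))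
        - of_nat n * K (\<phi> i (delta_poly n (m + n)) * g)) \<longlonglongrightarrow>
      localize i n K (\<phi> i [:0, 1:] * g) - of_nat n * localize i n K g"
    by (intro tendsto_intros LIMSEQ_ignore_initial_segment localize_tendsto K)
  ultimately have "localize i n K (\<phi> i [:0, 1:] * g) - of_nat n * localize i n K g = 0"
    by (simp only: LIMSEQ_unique)
  then show ?thesis by simp
qed

text \<open>A limit of identities, as the ring is commutative. Hence further restrictions keep the
  values that are already fixed.\<close>

lemma localize_eigen_preserve:
  assumes K: "dominated K" and e: "\<And>g. K (\<phi> k [:0, 1:] * g) = c * K g"
  shows "localize i n K (\<phi> k [:0, 1:] * g) = c * localize i n K g"
proof -
  have "K (\<phi> i (delta_poly n m) * (\<phi> k [:0, 1:] * g)) = c * K (\<phi> i (delta_poly n m) * g)" for m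
    using e[of "\<phi> i (delta_poly n m) * g"] by (simp add: mult_ac)
  moreover have "(\<lambda>m. c * K (\<phi> i (delta_poly n m) * g)) \<longlonglongrightarrow> c * localize i n K g"
    by (intro tendsto_intros localize_tendsto K)
  ultimately show ?thesis
    using localize_tendsto[OF K, of i n "\<phi> k [:0, 1:] * g"] by (simp add: LIMSEQ_unique)
qed

text \<open>One minus the sum of the approximants for n \<le> R vanishes on {0..R}, and its values
  are at most 1 + 3^j however many approximants are summed, so the remainder is again controlled by
  the tail.\<close>

lemma localize_sums:
  assumes K: "dominated K"
  shows "(\<lambda>n. localize i n K g) sums K g"
proof -
  \<comment> \<open>The level \<open>R + m\<close> is at least \<open>R\<close>, so all the summands
    are exact indicators on {0..R}, whatever \<open>m\<close> is.\<close>
  let ?f = "\<lambda>R m. 1 - (\<Sum>n\<le>R. delta_poly n (R + m))"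
  have b: "\<bar>K g - (\<Sum>n\<le>R. localize i n K g)\<bar> \<le> sqrt (2\<^sup>2 * L (g * g)) * sqrt (tail i R)" for R
  proof -
    have "(\<lambda>m. K g - (\<Sum>n\<le>R. K (\<phi> i (delta_poly n (R + m)) * g))) \<longlonglongrightarrow> K g - (\<Sum>n\<le>R. localize i n K g)"
      unfolding add.commute[of R]
      by (intro tendsto_intros LIMSEQ_ignore_initial_segment localize_tendsto K)
    moreover have "K g - (\<Sum>n\<le>R. K (\<phi> i (delta_poly n (R + m)) * g)) = K (\<phi> i (?f R m) * g)" for m
      by (simp only: phi_diff phi_one phi_sum left_diff_distrib sum_distrib_right dominated_diff[OF K]
          dominated_sum[OF K] mult_1)
    moreover have "\<bar>K (\<phi> i (?f R m) * g)\<bar> \<le> sqrt (2\<^sup>2 * L (g * g)) * sqrt (tail i R)" for m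
    proof (rule dominated_le_tail[OF K])
      fix j
      have "\<bar>\<Sum>n\<le>R. poly (delta_poly n (R + m)) (of_nat j)\<bar> \<le> 3 ^ j"
        by (rule order_trans[OF sum_abs sum_abs_delta_poly_le])
      then show "\<bar>poly (?f R m) (of_nat j)\<bar> \<le> 2 * 16 ^ j"
        using pow3_le_16[of j] unfolding poly_diff poly_sum poly_1 by linarith
    qed (simp add: poly_sum poly_delta_poly_eq)
    ultimately show ?thesis
      by (intro LIMSEQ_le_const2[OF tendsto_rabs]) auto
  qed
  have "(\<lambda>R. K g - (\<Sum>n\<le>R. localize i n K g)) \<longlonglongrightarrow> 0"
  proof (rule tendsto_rabs_zero_cancel, rule tendsto_sandwich[OF _ _ tendsto_const])
    have "(\<lambda>R. sqrt (2\<^sup>2 * L (g * g)) * sqrt (tail i R)) \<longlonglongrightarrow> sqrt (2\<^sup>2 * L (g * g)) * sqrt 0"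
      by (intro tendsto_intros tail_tendsto)
    then show "(\<lambda>R. sqrt (2\<^sup>2 * L (g * g)) * sqrt (tail i R)) \<longlonglongrightarrow> 0" by simp
  qed (use b in auto)
  from tendsto_diff[OF tendsto_const[of "K g"] this]
  show ?thesis by (simp add: sums_def_le)
qed

end

section \<open>Laws of sequences of natural numbers with prescribed prefix probabilities\<close>

lemma map_upt_eq_iff: "map \<omega> [0..<k] = ns \<longleftrightarrow> length ns = k \<and> (\<forall>i<k. \<omega> i = ns ! i)"
  by (subst list_eq_iff_nth_eq) auto

lemma measurable_prefix:
  assumes "{..<k} \<subseteq> I"
  shows "(\<lambda>\<omega>. map \<omega> [0..<k]) \<in> measurable (PiM I (\<lambda>_. count_space (UNIV :: nat set))) (count_space UNIV)"
proof (subst measurable_count_space_eq_countable, simp, safe)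
  fix ns :: "nat list"
  let ?M = "PiM I (\<lambda>_. count_space (UNIV :: nat set))"
  have "(\<lambda>\<omega>. map \<omega> [0..<k]) -` {ns} \<inter> space ?M =
      (if length ns = k then {\<omega>\<in>space ?M. \<forall>i\<in>{..<k}. \<omega> i = ns ! i} else {})"
    by (auto simp: map_upt_eq_iff)
  also have "\<dots> \<in> sets ?M"
  proof -
    have "{\<omega>\<in>space ?M. \<omega> i = ns ! i} \<in> sets ?M" if "i < k" for i
    proof -
      have "(\<lambda>\<omega>. \<omega> i) \<in> measurable ?M (count_space UNIV)"
        using that assms by (intro measurable_component_singleton) auto
      from measurable_sets[OF this, of "{ns ! i}"] show ?thesis by (simp add: vimage_def Int_def conj_commute)
    qed
    then show ?thesis by (auto intro!: sets.sets_Collect_finite_All)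
  qed
  finally show "(\<lambda>\<omega>. map \<omega> [0..<k]) -` {ns} \<inter> space ?M \<in> sets ?M" .
qed auto

text \<open>Read \<open>q ns\<close> as the probability that the sequence begins with
  \<open>ns\<close>. The conditional law of the next entry has the weights
  \<open>q (ns @ [n]) / q ns\<close>, and the theorem of Ionescu-Tulcea composes these
  kernels.\<close>

lemma nat_list_extension:
  fixes q :: "nat list \<Rightarrow> real"
  assumes nonneg: "\<And>ns. 0 \<le> q ns" and nil: "q [] = 1"
    and cons: "\<And>ns. (\<lambda>n. q (ns @ [n])) sums q ns"
  obtains P where "prob_space P" "sets P = sets (PiM UNIV (\<lambda>_. count_space (UNIV :: nat set)))"
    "\<And>ns. emeasure P {\<omega>. map \<omega> [0..<length ns] = ns} = ennreal (q ns)"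
proof -
  let ?N = "\<lambda>_::nat. count_space (UNIV :: nat set)"
  \<comment> \<open>A prefix of probability 0 needs a conditional law as well; the point mass at 0
    serves.\<close>
  define kern where "kern ns = (if q ns = 0 then return (count_space UNIV) 0
    else density (count_space UNIV) (\<lambda>n. ennreal (q (ns @ [n]) / q ns)))" for ns
  have kern_prob: "prob_space (kern ns)" for ns
  proof (cases "q ns = 0")
    case True then show ?thesis by (auto simp: kern_def intro!: prob_space_return)
  next
    case False
    then have "(\<lambda>n. q (ns @ [n]) / q ns) sums (q ns / q ns)" by (intro sums_divide cons)
    then have "(\<Sum>n. ennreal (q (ns @ [n]) / q ns)) = 1"
      using False nonneg by (subst suminf_ennreal2) (auto simp: sums_iff)
    then show ?thesis
      using False by (intro prob_spaceI) (simp add: kern_def emeasure_density nn_integral_count_space_nat)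
  qed
  have kern_sets: "sets (kern ns) = UNIV" for ns by (simp add: kern_def)
  have kern_single: "ennreal (q ns) * emeasure (kern ns) {n} = ennreal (q (ns @ [n]))" for ns n
  proof (cases "q ns = 0")
    case True
    have "q (ns @ [n]) \<le> q ns"
      using cons[of ns] nonneg sum_le_suminf[of "\<lambda>n. q (ns @ [n])" "{n}"] by (auto simp: sums_iff)
    then show ?thesis using True nonneg[of "ns @ [n]"] by simp
  next
    case False
    then show ?thesis
      using nonneg by (simp add: kern_def emeasure_density nn_integral_count_space_indicator[symmetric] ennreal_mult[symmetric])
  qed
  have kern_meas: "kern \<in> measurable (count_space UNIV) (subprob_algebra (count_space UNIV))"
    using kern_prob kern_sets
    by (auto simp: space_subprob_algebra intro!: prob_space_imp_subprob_space)
  define P where "P i \<omega> = kern (map \<omega> [0..<i])" for i \<omega>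
  interpret IT: Ionescu_Tulcea P ?N
  proof (rule Ionescu_Tulcea.intro)
    show "P i \<in> measurable (PiM {0..<i} ?N) (subprob_algebra (count_space UNIV))" for i
      unfolding P_def by (rule measurable_compose[OF measurable_prefix kern_meas]) auto
  qed (simp add: P_def kern_prob)
  let ?u = "\<lambda>_. undefined"
  have C: "emeasure (IT.C 0 (length ns) ?u) (PiE {0..<length ns} (\<lambda>i. {ns ! i})) = ennreal (q ns)" for ns
  proof (induct ns rule: rev_induct)
    case Nil
    have "{\<lambda>x. undefined} \<in> sets (PiM {} ?N)" by (simp add: sets_PiM_empty)
    then show ?case by (simp add: nil emeasure_return)
  next
    case (snoc n ns)
    let ?k = "length ns"
    let ?A = "PiE {0..<Suc ?k} (\<lambda>i. {(ns @ [n]) ! i})"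
    let ?B = "PiE {0..<?k} (\<lambda>i. {ns ! i})"
    have u: "?u \<in> space (PiM {0..<0} ?N)" by (simp add: space_PiM)
    have A: "?A \<in> sets (PiM {0..<Suc ?k} ?N)" by (rule sets_PiM_I_finite) auto
    have B: "?B \<in> sets (PiM {0..<?k} ?N)" by (rule sets_PiM_I_finite) auto
    have "emeasure (IT.C 0 (Suc ?k) ?u) ?A = (\<integral>\<^sup>+x. emeasure (IT.eP ?k x) ?A \<partial>IT.C 0 ?k ?u)"
      unfolding IT.C.simps add_0
    proof (rule emeasure_bind[OF _ _ A])
      show "space (IT.C 0 ?k ?u) \<noteq> {}"
        using prob_space.not_empty[OF IT.prob_space_C[OF u]] .
      show "IT.eP ?k \<in> measurable (IT.C 0 ?k ?u) (subprob_algebra (PiM {0..<Suc ?k} ?N))"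
        using IT.measurable_eP[of ?k] IT.sets_C[OF u, of ?k] by (simp cong: measurable_cong_sets)
    qed
    also have "\<dots> = (\<integral>\<^sup>+x. emeasure (kern ns) {n} * indicator ?B x \<partial>IT.C 0 ?k ?u)"
    proof (rule nn_integral_cong)
      fix x assume "x \<in> space (IT.C 0 ?k ?u)"
      then have x: "x \<in> space (PiM {0..<?k} ?N)" using IT.space_C[OF u, of ?k] by simp
      then have xe: "x \<in> extensional {0..<?k}" by (simp add: space_PiM PiE_iff)
      have upd: "x(?k := m) \<in> ?A \<longleftrightarrow> x \<in> ?B \<and> m = n" for m
        using xe by (auto simp: PiE_iff nth_append extensional_def less_Suc_eq)
      have "emeasure (IT.eP ?k x) ?A = emeasure (kern (map x [0..<?k])) {m. x(?k := m) \<in> ?A}"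
        by (simp add: IT.emeasure_eP[OF x A] P_def vimage_def)
      also have "{m. x(?k := m) \<in> ?A} = (if x \<in> ?B then {n} else {})"
        unfolding upd by auto
      also have "emeasure (kern (map x [0..<?k])) (if x \<in> ?B then {n} else {}) =
          emeasure (kern ns) {n} * indicator ?B x"
      proof (cases "x \<in> ?B")
        case True
        then have "map x [0..<?k] = ns" by (auto simp: map_upt_eq_iff PiE_iff)
        then show ?thesis using True by simp
      qed simp
      finally show "emeasure (IT.eP ?k x) ?A = emeasure (kern ns) {n} * indicator ?B x" .
    qed
    also have "\<dots> = emeasure (kern ns) {n} * emeasure (IT.C 0 ?k ?u) ?B"
      using B IT.sets_C[OF u, of ?k] by (intro nn_integral_cmult_indicator) simp
    also have "\<dots> = ennreal (q (ns @ [n]))"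
      using kern_single[of ns n] snoc by (simp add: mult.commute)
    finally show ?case by simp
  qed
  have lim: "emeasure IT.PF.lim {\<omega>. map \<omega> [0..<length ns] = ns} = ennreal (q ns)" for ns
  proof -
    let ?k = "length ns"
    let ?B = "PiE {0..<?k} (\<lambda>i. {ns ! i})"
    have B: "?B \<in> sets (PiM {0..<?k} ?N)" by (rule sets_PiM_I_finite) auto
    have "{\<omega>. map \<omega> [0..<length ns] = ns} = prod_emb UNIV ?N {0..<?k} ?B"
      by (auto simp: prod_emb_def map_upt_eq_iff PiE_iff)
    then have "emeasure IT.PF.lim {\<omega>. map \<omega> [0..<length ns] = ns} = emeasure (IT.CI {0..<?k}) ?B"
      by (simp add: IT.lim[OF _ B])
    also have "\<dots> = emeasure (IT.C 0 ?k ?u) (prod_emb {0..<?k} ?N {0..<?k} ?B)"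
      by (rule IT.emeasure_CI[OF _ B]) auto
    also have "prod_emb {0..<?k} ?N {0..<?k} ?B = ?B"
      by (rule prod_emb_id) (auto simp: PiE_def)
    finally show ?thesis using C by simp
  qed
  have "prob_space IT.PF.lim"
  proof (rule prob_spaceI)
    show "emeasure IT.PF.lim (space IT.PF.lim) = 1"
      using lim[of "[]"] by (simp add: nil space_PiM)
  qed
  then show ?thesis
    by (rule that[of IT.PF.lim]) (simp_all only: IT.PF.sets_lim lim)
qed

section \<open>The joint law of the counts\<close>

context moment_functional
begin

text \<open>The head of the list is the value of the last variable.\<close>

primrec chain :: "nat list \<Rightarrow> 'r \<Rightarrow> real" where
  "chain [] = L"
| "chain (n # ns) = localize (length ns) n (chain ns)"

lemma dominated_chain: "dominated (chain ns)"
  by (induct ns) (auto simp: dominated_L dominated_localize)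

text \<open>An eigenvalue arises when its variable is restricted, and it survives the later
  restrictions. Lists grow at the head, so the value of the k-th variable is entry k of the reversed
  list.\<close>

lemma chain_eigen:
  "k < length ns \<Longrightarrow> chain ns (\<phi> k [:0, 1:] * g) = of_nat (rev ns ! k) * chain ns g"
proof (induct ns arbitrary: g)
  case (Cons n ns)
  show ?case
  proof (cases "k = length ns")
    case True
    then show ?thesis by (simp add: localize_eigen[OF dominated_chain] nth_append)
  next
    case False
    then have "k < length ns" using Cons by simp
    then show ?thesis
      using localize_eigen_preserve[OF dominated_chain Cons(1)] by (simp add: nth_append)
  qed
qed simp

lemma chain_prod:
  assumes "\<And>i. i \<in> set is \<Longrightarrow> i < length ns"
  shows "chain ns (prod_list (map (\<lambda>i. \<phi> i [:0, 1:]) is) * g) =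
     prod_list (map (\<lambda>i. of_nat (rev ns ! i)) is) * chain ns g"
  using assms by (induct "is") (auto simp: chain_eigen mult.assoc)

text \<open>Iterated \<open>localize_sums\<close>. The argument is a square so that all terms are
  nonnegative and the sum over lists can be an integral in \<open>ennreal\<close>.\<close>

lemma nn_integral_chain:
  "(\<integral>\<^sup>+ns. ennreal (chain ns (h * h)) \<partial>count_space {ns. length ns = k}) = ennreal (L (h * h))"
proof (induct k)
  case (Suc k)
  let ?A = "{ns::nat list. length ns = k}"
  have bij: "bij_betw (\<lambda>(ns, n). n # ns) (?A \<times> UNIV) {ns. length ns = Suc k}"
    by (auto simp: bij_betw_def inj_on_def image_iff length_Suc_conv)
  have "(\<integral>\<^sup>+ns. ennreal (chain ns (h * h)) \<partial>count_space {ns. length ns = Suc k})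
      = (\<integral>\<^sup>+p. ennreal (chain (case p of (ns, n) \<Rightarrow> n # ns) (h * h)) \<partial>count_space (?A \<times> UNIV))"
    by (rule nn_integral_bij_count_space[OF bij, symmetric])
  also have "\<dots> = (\<integral>\<^sup>+p. ennreal (chain (case p of (ns, n) \<Rightarrow> n # ns) (h * h)) * indicator (?A \<times> UNIV) p \<partial>count_space UNIV)"
    by (simp add: nn_integral_count_space_indicator)
  also have "\<dots> = (\<integral>\<^sup>+ns. \<integral>\<^sup>+n. ennreal (chain (n # ns) (h * h)) * indicator ?A ns \<partial>count_space UNIV \<partial>count_space UNIV)"
    by (subst nn_integral_fst_count_space[symmetric]) (auto intro!: nn_integral_cong simp: indicator_def)
  also have "\<dots> = (\<integral>\<^sup>+ns. (\<integral>\<^sup>+n. ennreal (chain (n # ns) (h * h)) \<partial>count_space UNIV) * indicator ?A ns \<partial>count_space UNIV)"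
    by (simp add: nn_integral_multc)
  also have "\<dots> = (\<integral>\<^sup>+ns. ennreal (chain ns (h * h)) * indicator ?A ns \<partial>count_space UNIV)"
  proof (intro nn_integral_cong arg_cong2[where f="(*)"] refl)
    fix ns
    have "(\<lambda>n. chain (n # ns) (h * h)) sums chain ns (h * h)"
      by (simp add: localize_sums[OF dominated_chain])
    then show "(\<integral>\<^sup>+n. ennreal (chain (n # ns) (h * h)) \<partial>count_space UNIV) = ennreal (chain ns (h * h))"
      using dominatedD(3)[OF dominated_chain]
      by (simp only: nn_integral_count_space_nat suminf_ennreal2 sums_iff)
  qed
  also have "\<dots> = ennreal (L (h * h))"
    by (subst Suc[symmetric]) (simp add: nn_integral_count_space_indicator)
  finally show ?case .
qed (simp add: nn_integral_count_space_finite)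

text \<open>The prefix probabilities are the masses \<open>chain (rev ns) 1\<close>. The functionals
  \<open>chain\<close> are known to be nonnegative on squares only, so the expectations compared
  directly are those of (1 + c W)^2 for a monomial W; the monomial itself follows by
  polarization.\<close>

theorem representing_measure:
  obtains P where "prob_space P" "sets P = sets (PiM UNIV (\<lambda>_. count_space (UNIV :: nat set)))"
    "\<And>is. integrable P (\<lambda>\<omega>. prod_list (map (\<lambda>i. real (\<omega> i)) is))"
    "\<And>is. (\<integral>\<omega>. prod_list (map (\<lambda>i. real (\<omega> i)) is) \<partial>P) = L (prod_list (map (\<lambda>i. \<phi> i [:0, 1:]) is))"
proof -
  obtain P where P: "prob_space P" and sP: "sets P = sets (PiM UNIV (\<lambda>_. count_space (UNIV :: nat set)))"
    and Pq: "\<And>ns. emeasure P {\<omega>. map \<omega> [0..<length ns] = ns} = ennreal (chain (rev ns) 1)"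
  proof (rule nat_list_extension[of "\<lambda>ns. chain (rev ns) 1"])
    show "0 \<le> chain (rev ns) 1" for ns
      using dominatedD(3)[OF dominated_chain, of "rev ns" 1] by simp
    show "(\<lambda>n. chain (rev (ns @ [n])) 1) sums chain (rev ns) 1" for ns
      using localize_sums[OF dominated_chain] by simp
  qed (auto simp: L_one)
  have spP: "space P = UNIV" using sets_eq_imp_space_eq[OF sP] by (simp add: space_PiM)
  have pm: "(\<lambda>\<omega>. map \<omega> [0..<k]) \<in> measurable P (count_space UNIV)" for k
    unfolding measurable_cong_sets[OF sP refl] by (rule measurable_prefix) simp
  \<comment> \<open>The law of the first k coordinates is discrete with mass
    \<open>chain (rev ns) 1\<close> at each \<open>ns\<close> of length k; the reversal is absorbed
    by a bijection of the lists of this length.\<close>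
  have E: "(\<integral>\<^sup>+\<omega>. f (map \<omega> [0..<k]) \<partial>P) = (\<integral>\<^sup>+ns. f (rev ns) * ennreal (chain ns 1) \<partial>count_space {ns. length ns = k})"
    for f k
  proof -
    let ?D = "distr P (count_space UNIV) (\<lambda>\<omega>. map \<omega> [0..<k])"
    have single: "emeasure ?D {ns} = ennreal (chain (rev ns) 1) * indicator {ns. length ns = k} ns" for ns
    proof (cases "length ns = k")
      case True
      have "(\<lambda>\<omega>. map \<omega> [0..<k]) -` {ns} \<inter> space P = {\<omega>. map \<omega> [0..<length ns] = ns}"
        using True spP by auto
      then show ?thesis using True Pq[of ns] by (simp add: emeasure_distr[OF pm])
    next
      case False
      then have "(\<lambda>\<omega>. map \<omega> [0..<k]) -` {ns} \<inter> space P = {}" by auto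
      then show ?thesis using False by (simp add: emeasure_distr[OF pm])
    qed
    have D: "?D = density (count_space UNIV) (\<lambda>ns. emeasure ?D {ns})"
      by (rule measure_eqI_countable[of _ UNIV])
        (auto simp: emeasure_density nn_integral_count_space_indicator[symmetric])
    have "(\<integral>\<^sup>+\<omega>. f (map \<omega> [0..<k]) \<partial>P) = (\<integral>\<^sup>+ns. f ns \<partial>?D)"
      by (simp add: nn_integral_distr[OF pm])
    also have "\<dots> = (\<integral>\<^sup>+ns. emeasure ?D {ns} * f ns \<partial>count_space UNIV)"
      by (subst D) (simp add: nn_integral_density)
    also have "\<dots> = (\<integral>\<^sup>+ns. f ns * ennreal (chain (rev ns) 1) \<partial>count_space {ns. length ns = k})"
      unfolding single by (subst nn_integral_count_space_indicator) (auto intro!: nn_integral_cong simp: mult_ac)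
    also have "\<dots> = (\<integral>\<^sup>+ns. f (rev ns) * ennreal (chain ns 1) \<partial>count_space {ns. length ns = k})"
      by (subst nn_integral_bij_count_space[of rev "{ns. length ns = k}" "{ns. length ns = k}", symmetric])
        (auto simp: bij_betw_def inj_on_def image_iff intro!: exI[of _ "rev _"])
    finally show ?thesis .
  qed
  have main: "integrable P (\<lambda>\<omega>. prod_list (map (\<lambda>i. real (\<omega> i)) is)) \<and>
     (\<integral>\<omega>. prod_list (map (\<lambda>i. real (\<omega> i)) is) \<partial>P) = L (prod_list (map (\<lambda>i. \<phi> i [:0, 1:]) is))" for "is"
  proof -
    let ?W = "\<lambda>\<omega>. prod_list (map (\<lambda>i. real (\<omega> i)) is)"
    let ?g = "prod_list (map (\<lambda>i. \<phi> i [:0, 1:]) is)"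
    \<comment> \<open>Prefixes of this length contain every variable of the monomial; the inserted 0
      covers the empty monomial.\<close>
    define k where "k = Suc (Max (insert 0 (set is)))"
    have k: "i < k" if "i \<in> set is" for i
      using that by (auto simp: k_def less_Suc_eq_le intro!: Max_ge)
    define F where "F ns = prod_list (map (\<lambda>i. real (ns ! i)) is)" for ns
    have Wk: "?W \<omega> = F (map \<omega> [0..<k])" for \<omega>
      unfolding F_def using k by (intro arg_cong[where f=prod_list]) auto
    have Wm: "?W \<in> borel_measurable P"
      unfolding Wk by (rule measurable_compose[OF pm]) simp
    have sq: "integrable P (\<lambda>\<omega>. (1 + c * ?W \<omega>)\<^sup>2) \<and>
        (\<integral>\<omega>. (1 + c * ?W \<omega>)\<^sup>2 \<partial>P) = L ((1 + \<phi> 0 [:c:] * ?g) * (1 + \<phi> 0 [:c:] * ?g))" for c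
    proof -
      let ?h = "1 + \<phi> 0 [:c:] * ?g"
      have "(\<integral>\<^sup>+\<omega>. ennreal ((1 + c * ?W \<omega>)\<^sup>2) \<partial>P) =
         (\<integral>\<^sup>+ns. ennreal ((1 + c * F (rev ns))\<^sup>2) * ennreal (chain ns 1) \<partial>count_space {ns. length ns = k})"
        unfolding Wk by (rule E)
      also have "\<dots> = (\<integral>\<^sup>+ns. ennreal (chain ns (?h * ?h)) \<partial>count_space {ns. length ns = k})"
      proof (rule nn_integral_cong)
        fix ns :: "nat list" assume "ns \<in> space (count_space {ns. length ns = k})"
        then have ns: "\<And>i. i \<in> set is \<Longrightarrow> i < length ns" using k by auto
        let ?w = "F (rev ns)"
        note D = dominatedD[OF dominated_chain[of ns]]
        have eq: "?h * ?h = 1 * 1 + \<phi> 0 [:c:] * (?g * 1) + \<phi> 0 [:c:] * (?g * 1) + \<phi> 0 [:c:] * (\<phi> 0 [:c:] * (?g * (?g * 1)))"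
          by (simp add: algebra_simps)
        have "chain ns (?h * ?h) = (1 + c * ?w)\<^sup>2 * chain ns 1"
          unfolding eq by (simp only: D(1,2) chain_prod[OF ns] flip: F_def) (simp add: power2_eq_square algebra_simps)
        then show "ennreal ((1 + c * ?w)\<^sup>2) * ennreal (chain ns 1) = ennreal (chain ns (?h * ?h))"
          using D(3)[of 1] by (simp add: ennreal_mult)
      qed
      also have "\<dots> = ennreal (L (?h * ?h))" by (rule nn_integral_chain)
      finally have I: "(\<integral>\<^sup>+\<omega>. ennreal ((1 + c * ?W \<omega>)\<^sup>2) \<partial>P) = ennreal (L (?h * ?h))" .
      have m: "(\<lambda>\<omega>. (1 + c * ?W \<omega>)\<^sup>2) \<in> borel_measurable P" using Wm by measurable
      from m show ?thesis
        using I L_square[of ?h]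
        by (intro conjI integrableI_nonneg integral_eq_nn_integral[THEN trans]) auto
    qed
    \<comment> \<open>Polarization gives the integrability of W and its expectation at once.\<close>
    have W: "?W \<omega> = ((1 + 1 * ?W \<omega>)\<^sup>2 - (1 + (-1) * ?W \<omega>)\<^sup>2) / 4" for \<omega>
      by (simp add: power2_eq_square algebra_simps)
    have i: "integrable P ?W"
      by (subst W, intro integrable_divide Bochner_Integration.integrable_diff) (use sq[of 1] sq[of "-1"] in blast)+
    have eq: "(1 + \<phi> 0 [:c:] * ?g) * (1 + \<phi> 0 [:c:] * ?g) =
        1 + \<phi> 0 [:c:] * ?g + \<phi> 0 [:c:] * ?g + \<phi> 0 [:c:] * (\<phi> 0 [:c:] * (?g * ?g))" for c
      by (simp add: algebra_simps)
    have "(\<integral>\<omega>. ?W \<omega> \<partial>P) = (L ((1 + \<phi> 0 [:1:] * ?g) * (1 + \<phi> 0 [:1:] * ?g))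
       - L ((1 + \<phi> 0 [:-1:] * ?g) * (1 + \<phi> 0 [:-1:] * ?g))) / 4"
      by (subst W) (use sq[of 1] sq[of "-1"] in \<open>simp del: mult_1_left mult_minus1\<close>)
    also have "\<dots> = L ?g"
      unfolding eq by (simp only: L_add L_scale) simp
    finally show ?thesis using i by simp
  qed
  show ?thesis by (rule that[OF P sP]) (use main in auto)
qed

end

section \<open>Factorial moments\<close>

definition falling_poly :: "nat \<Rightarrow> real poly" where
  "falling_poly n = (\<Prod>j<n. [:- of_nat j, 1:])"

text \<open>The recursion behind factorial moments: an additional point is either new or one of the
  n points already chosen. \<open>dist_cube_recursion\<close> is its counterpart for
  measures.\<close>

lemma falling_poly_Suc: "[:0, 1:] * falling_poly n = falling_poly (Suc n) + smult (of_nat n) (falling_poly n)"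
proof -
  have "[:0, 1:] = [:- of_nat n, 1:] + [:of_nat n :: real:]" by simp
  then show ?thesis
    unfolding falling_poly_def by (simp only: distrib_right prod.lessThan_Suc) simp
qed

lemma poly_falling_poly: "poly (falling_poly n) (of_nat j) = fact n * of_nat (j choose n)"
  using poly_binom_poly[of n j] by (simp add: binom_poly_def falling_poly_def field_simps)

text \<open>The signed Pascal matrix is inverse to the Pascal matrix; up to a sign, the sum is the
  value of \<open>delta_poly n j\<close> at j.\<close>

lemma sum_choose_choose_alternating:
  "(\<Sum>k\<le>j. (-1) ^ (j + k) * of_nat (j choose k) * of_nat (k choose n) :: real) = (if j = n then 1 else 0)"
proof -
  have "(\<Sum>k\<le>j. (-1) ^ (j + k) * of_nat (j choose k) * of_nat (k choose n) :: real)
      = (-1) ^ (j + n) * poly (delta_poly n j) (of_nat j)"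
    unfolding poly_delta_poly sum_distrib_left
    by (intro sum.cong) (auto simp: minus_one_power_iff)
  then show ?thesis by (simp add: poly_delta_poly_eq)
qed

lemma suminf_eq_infsum:
  fixes f :: "nat \<Rightarrow> real"
  assumes "summable (\<lambda>n. \<bar>f n\<bar>)"
  shows "suminf f = infsum f UNIV"
proof -
  have "f summable_on UNIV" using assms by (intro norm_summable_imp_summable_on) simp
  then have "(f has_sum infsum f UNIV) UNIV" by (rule has_sum_infsum)
  then show ?thesis using has_sum_imp_sums sums_unique by metis
qed

text \<open>If l n is the mean of (N choose n) for a count N, inclusion-exclusion gives s k as the
  weight of the event N = k. The row sums 257^j make the double series converge absolutely at rate
  256, which justifies the interchange of summations that inverts the transformation.\<close>

lemma signed_inversion:
  fixes l :: "nat \<Rightarrow> real"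
  assumes l: "summable (\<lambda>n. 257 ^ n * \<bar>l n\<bar>)"
  defines "s \<equiv> \<lambda>k. \<Sum>j. (-1) ^ (j + k) * of_nat (j choose k) * l j"
  shows "summable (\<lambda>k. 256 ^ k * \<bar>s k\<bar>)" "(\<Sum>k. of_nat (k choose n) * s k) = l n"
proof -
  let ?g = "\<lambda>j k. 256 ^ k * of_nat (j choose k) * \<bar>l j\<bar>"
  have row: "(\<lambda>k. ?g j k) sums (257 ^ j * \<bar>l j\<bar>)" for j
  proof -
    have "(\<lambda>k. ?g j k) sums (\<Sum>k\<le>j. ?g j k)"
      by (rule sums_finite) (auto simp: binomial_eq_0)
    also have "(\<Sum>k\<le>j. ?g j k) = (256 + 1) ^ j * \<bar>l j\<bar>"
      by (subst binomial_ring) (simp add: sum_distrib_left sum_distrib_right mult_ac)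
    finally show ?thesis by simp
  qed
  have row': "((\<lambda>k. ?g j k) has_sum (257 ^ j * \<bar>l j\<bar>)) UNIV" for j
    by (intro sums_nonneg_imp_has_sum row) auto
  have G: "(\<lambda>(j, k). ?g j k) summable_on UNIV \<times> UNIV"
  proof (rule Infinite_Sum.abs_summable_summable, subst Infinite_Sum.abs_summable_on_Sigma_iff, intro conjI ballI)
    show "(\<lambda>k. norm (case (j, k) of (j, k) \<Rightarrow> ?g j k)) summable_on UNIV" for j
      using row'[of j] by (auto simp: summable_on_def)
    have "infsum (\<lambda>k. norm (case (j, k) of (j, k) \<Rightarrow> ?g j k)) UNIV = 257 ^ j * \<bar>l j\<bar>" for j
      using infsumI[OF row'[of j]] by simp
    then show "(\<lambda>j. norm (infsum (\<lambda>k. norm (case (j, k) of (j, k) \<Rightarrow> ?g j k)) UNIV)) summable_on UNIV"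
      using l by (simp add: summable_on_UNIV_nonneg_real_iff)
  qed
  have G': "(\<lambda>(k, j). ?g j k) summable_on UNIV \<times> UNIV"
    using G by (subst (asm) summable_on_reindex_bij_betw[of prod.swap "UNIV \<times> UNIV", symmetric])
      (auto simp: bij_betw_def case_prod_unfold)
  have col: "(\<lambda>j. ?g j k) summable_on UNIV" for k
    using summable_on_SigmaD1[of "\<lambda>k j. ?g j k" UNIV "\<lambda>_. UNIV" k] G' by simp
  have colsum: "(\<lambda>k. infsum (\<lambda>j. ?g j k) UNIV) summable_on UNIV"
    using summable_on_Sigma_banach[of "\<lambda>k j. ?g j k" UNIV "\<lambda>_. UNIV"] G' by (simp add: case_prod_unfold)
  have col2: "summable (\<lambda>j. of_nat (j choose k) * \<bar>l j\<bar>)" for k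
  proof -
    have "summable (\<lambda>j. ?g j k)" using col by (rule summable_on_imp_summable)
    then have "summable (\<lambda>j. (1 / 256 ^ k) * ?g j k)" by (rule summable_mult)
    then show ?thesis by simp
  qed
  have sabs: "summable (\<lambda>j. \<bar>(-1) ^ (j + k) * of_nat (j choose k) * l j\<bar>)" for k
    using col2[of k] by (simp add: abs_mult)
  have sb: "256 ^ k * \<bar>s k\<bar> \<le> infsum (\<lambda>j. ?g j k) UNIV" for k
  proof -
    have "\<bar>s k\<bar> \<le> (\<Sum>j. \<bar>(-1) ^ (j + k) * of_nat (j choose k) * l j\<bar>)"
      unfolding s_def by (rule summable_rabs[OF sabs])
    also have "\<dots> = (\<Sum>j. of_nat (j choose k) * \<bar>l j\<bar>)" by (simp add: abs_mult)
    finally have "256 ^ k * \<bar>s k\<bar> \<le> 256 ^ k * (\<Sum>j. of_nat (j choose k) * \<bar>l j\<bar>)" by simp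
    also have "\<dots> = (\<Sum>j. ?g j k)" using suminf_mult[OF col2, of "256 ^ k"] by (simp add: mult.assoc)
    also have "\<dots> = infsum (\<lambda>j. ?g j k) UNIV"
      by (rule suminf_eq_infsum) (use summable_on_imp_summable[OF col] in \<open>simp add: abs_mult\<close>)
    finally show ?thesis .
  qed
  show S: "summable (\<lambda>k. 256 ^ k * \<bar>s k\<bar>)"
    by (rule summable_comparison_test'[OF summable_on_imp_summable[OF colsum], of 0]) (use sb in auto)
  let ?f = "\<lambda>k j. of_nat (k choose n) * ((-1) ^ (j + k) * of_nat (j choose k) * l j)"
  \<comment> \<open>Binomial coefficients grow at most like 2^k, so the majorant with the factor
    256^k dominates the second double series as well.\<close>
  have le: "real (k choose n) \<le> 256 ^ k" for k
  proof -
    have "k choose n \<le> 2 ^ k" by (rule binomial_le_pow2)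
    also have "(2::nat) ^ k \<le> 256 ^ k" by (rule power_mono) auto
    finally show ?thesis by (metis of_nat_le_iff of_nat_numeral of_nat_power)
  qed
  have F: "(\<lambda>(k, j). ?f k j) summable_on UNIV \<times> UNIV"
  proof (rule Infinite_Sum.abs_summable_summable, rule Infinite_Sum.abs_summable_on_comparison_test[of "\<lambda>(k, j). ?g j k"])
    show "(\<lambda>p. norm (case p of (k, j) \<Rightarrow> ?g j k)) summable_on UNIV \<times> UNIV"
      using G' by (simp add: case_prod_unfold)
    show "norm (case p of (k, j) \<Rightarrow> ?f k j) \<le> norm (case p of (k, j) \<Rightarrow> ?g j k)" for p
      using mult_right_mono[OF le, of "of_nat (snd p choose fst p) * \<bar>l (snd p)\<bar>" "fst p"]
      by (cases p) (simp add: abs_mult mult.assoc)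
  qed
  have "(\<Sum>k. of_nat (k choose n) * s k) = infsum (\<lambda>k. of_nat (k choose n) * s k) UNIV"
  proof (rule suminf_eq_infsum, rule summable_comparison_test'[OF S, of 0])
    show "norm \<bar>real (k choose n) * s k\<bar> \<le> 256 ^ k * \<bar>s k\<bar>" for k
      using mult_right_mono[OF le, of "\<bar>s k\<bar>" k] by (simp add: abs_mult)
  qed
  also have "\<dots> = infsum (\<lambda>k. infsum (\<lambda>j. ?f k j) UNIV) UNIV"
    unfolding s_def suminf_eq_infsum[OF sabs]
    by (intro infsum_cong infsum_cmult_right[symmetric] norm_summable_imp_summable_on) (use sabs in auto)
  also have "\<dots> = infsum (\<lambda>j. infsum (\<lambda>k. ?f k j) UNIV) UNIV"
    by (rule infsum_swap_banach[OF F])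
  also have "\<dots> = infsum (\<lambda>j. if j = n then l j else 0) UNIV"
  proof (rule infsum_cong)
    fix j
    have "infsum (\<lambda>k. ?f k j) UNIV = (\<Sum>k\<le>j. ?f k j)"
      by (subst infsum_finite[symmetric], simp, rule infsum_cong_neutral) (auto simp: binomial_eq_0)
    also have "\<dots> = (\<Sum>k\<le>j. (-1) ^ (j + k) * of_nat (j choose k) * of_nat (k choose n)) * l j"
      by (simp add: sum_distrib_left sum_distrib_right mult_ac)
    finally show "infsum (\<lambda>k. ?f k j) UNIV = (if j = n then l j else 0)"
      unfolding sum_choose_choose_alternating by simp
  qed
  also have "\<dots> = infsum (\<lambda>j. if j = n then l j else 0) {n}"
    by (rule infsum_cong_neutral) auto
  also have "\<dots> = l n" by simp
  finally show "(\<Sum>k. of_nat (k choose n) * s k) = l n" .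
qed

text \<open>The induction on u treats all products \<open>falling_poly n * u\<close> together,
  because multiplication by the variable raises n by \<open>falling_poly_Suc\<close>. For n = 0 the
  product is u itself, so no expansion in the basis of falling factorials is needed.\<close>

lemma marginal_of_factorial_moments:
  fixes T :: "real poly \<Rightarrow> real"
  assumes T_add: "\<And>u v. T (u + v) = T u + T v" and T_smult: "\<And>c u. T (smult c u) = c * T u"
    and T_falling: "\<And>n. T (falling_poly n) = fact n * l n"
    and l: "summable (\<lambda>n. 257 ^ n * \<bar>l n\<bar>)"
  obtains s where "summable (\<lambda>k. 256 ^ k * \<bar>s k\<bar>)" "\<And>u. T u = (\<Sum>k. poly u (of_nat k) * s k)"
proof -
  define s where "s = (\<lambda>k. \<Sum>j. (-1) ^ (j + k) * of_nat (j choose k) * l j)"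
  have s: "summable (\<lambda>k. 256 ^ k * \<bar>s k\<bar>)" "(\<Sum>k. of_nat (k choose n) * s k) = l n" for n
    using signed_inversion[OF l] unfolding s_def by blast+
  have sm: "summable (\<lambda>k. of_nat (k choose n) * s k)" for n
  proof (rule summable_comparison_test'[OF s(1), of 0])
    fix k
    have "k choose n \<le> 2 ^ k" by (rule binomial_le_pow2)
    also have "(2::nat) ^ k \<le> 256 ^ k" by (rule power_mono) auto
    finally have "real (k choose n) \<le> 256 ^ k" by (metis of_nat_le_iff of_nat_numeral of_nat_power)
    from mult_right_mono[OF this, of "\<bar>s k\<bar>"]
    show "norm (real (k choose n) * s k) \<le> 256 ^ k * \<bar>s k\<bar>" by (simp add: abs_mult)
  qed
  let ?P = "\<lambda>u. (\<lambda>k. poly u (of_nat k) * s k) sums T u"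
  have base: "?P (falling_poly n)" for n
    using sums_mult[OF summable_sums[OF sm[of n]], of "fact n"]
    by (simp add: poly_falling_poly T_falling s(2) mult.assoc)
  have add: "?P (u + v)" if "?P u" "?P v" for u v
    using sums_add[OF that] by (simp add: T_add distrib_right)
  have smult: "?P (smult c u)" if "?P u" for u c
    using sums_mult[OF that, of c] by (simp add: T_smult mult.assoc)
  have zero: "?P 0" using T_smult[of 0 0] by simp
  have "?P (falling_poly n * u)" for n u
  proof (induct u arbitrary: n)
    case 0 then show ?case using zero by simp
  next
    case (pCons a u)
    have "falling_poly n * pCons a u = smult a (falling_poly n) + ([:0, 1:] * falling_poly n) * u"
    proof -
      have "pCons a u = [:a:] + [:0, 1:] * u" by simp
      then show ?thesis by (simp only: distrib_left) (simp add: mult_ac)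
    qed
    also have "\<dots> = smult a (falling_poly n) + (falling_poly (Suc n) * u + smult (of_nat n) (falling_poly n * u))"
      unfolding falling_poly_Suc by (simp add: distrib_right)
    finally have eq: "falling_poly n * pCons a u =
      smult a (falling_poly n) + (falling_poly (Suc n) * u + smult (of_nat n) (falling_poly n * u))" .
    show ?case unfolding eq by (intro add smult base pCons)
  qed
  from this[of 0] have "?P u" for u by (simp add: falling_poly_def)
  then show ?thesis using that[OF s(1)] sums_unique by blast
qed

section \<open>Radon measures on locally compact Polish spaces\<close>

lemma sets_borel_of_euclidean: "sets (borel_of euclidean) = sets borel"
  by (simp add: borel_of_def borel_def)

lemma space_borel_of [simp]: "space (borel_of T) = topspace T"
  by (simp add: borel_of_def space_measure_of_conv)

lemma openin_sets_borel_of: "openin T U \<Longrightarrow> U \<in> sets (borel_of T)"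
  unfolding borel_of_def by (subst sets_measure_of) (auto dest: openin_subset)

lemma sets_borel_of: "sets (borel_of T) = sigma_sets (topspace T) {U. openin T U}"
  unfolding borel_of_def by (subst sets_measure_of) (auto dest: openin_subset)

lemma measurable_borel_of:
  assumes "\<And>x. x \<in> space M \<Longrightarrow> f x \<in> topspace T"
    and "\<And>U. openin T U \<Longrightarrow> f -` U \<inter> space M \<in> sets M"
  shows "f \<in> measurable M (borel_of T)"
  unfolding borel_of_def by (rule measurable_measure_of) (use assms in \<open>auto dest: openin_subset\<close>)

lemma continuous_map_measurable_borel_of:
  assumes "continuous_map T S f"
  shows "f \<in> measurable (borel_of T) (borel_of S)"
proof (rule measurable_borel_of)
  show "f -` U \<inter> space (borel_of T) \<in> sets (borel_of T)" if "openin S U" for U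
  proof -
    have "openin T {x \<in> topspace T. f x \<in> U}"
      using assms that by (auto simp: continuous_map_def)
    moreover have "f -` U \<inter> space (borel_of T) = {x \<in> topspace T. f x \<in> U}" by auto
    ultimately show ?thesis by (simp add: openin_sets_borel_of)
  qed
qed (use assms in \<open>auto simp: continuous_map_def Pi_iff\<close>)

lemma topspace_pow_top: "topspace (pow_top n) = PiE {..<n} (\<lambda>_. UNIV)"
  by (simp add: pow_top_def)

abbreviation pow_borel :: "nat \<Rightarrow> (nat \<Rightarrow> 'a::topological_space) measure" where
  "pow_borel n \<equiv> PiM {..<n} (\<lambda>_. borel)"

lemma space_pow_borel: "space (pow_borel n) = PiE {..<n} (\<lambda>_. UNIV)"
  by (simp add: space_PiM)

text \<open>By second countability every open set of the power is a countable union of boxes with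
  sides in a countable basis, so the Borel sigma-algebra of the product topology is the product
  sigma-algebra.\<close>

lemma sets_borel_of_pow_top:
  "sets (borel_of (pow_top n)) = sets (pow_borel n :: (nat \<Rightarrow> 'a::second_countable_topology) measure)"
proof
  let ?B = "borel_of (pow_top n) :: (nat \<Rightarrow> 'a) measure"
  have "(\<lambda>x. x) \<in> measurable ?B (pow_borel n)"
  proof (rule measurable_PiM_single')
    show "(\<lambda>x. x i) \<in> borel_measurable ?B" if "i \<in> {..<n}" for i
    proof -
      have "continuous_map (pow_top n) euclidean (\<lambda>x. x i :: 'a)"
        unfolding pow_top_def by (rule continuous_map_product_projection[OF that])
      from continuous_map_measurable_borel_of[OF this] show ?thesis
        by (simp add: measurable_cong_sets[OF refl sets_borel_of_euclidean])
    qed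
  qed (auto simp: topspace_pow_top PiE_def)
  note m = this
  show "sets (pow_borel n) \<subseteq> sets ?B"
  proof
    fix A :: "(nat \<Rightarrow> 'a) set" assume A: "A \<in> sets (pow_borel n)"
    have "A \<subseteq> space ?B" using sets.sets_into_space[OF A] by (simp add: topspace_pow_top space_PiM)
    then show "A \<in> sets ?B" using measurable_sets[OF m A] by (simp add: Int_absorb2)
  qed
next
  obtain B :: "'a set set" where B: "countable B" "topological_basis B"
    using ex_countable_basis by blast
  let ?C = "PiE {..<n} ` (PiE {..<n} (\<lambda>_. B))"
  have cC: "countable ?C" by (intro countable_image countable_PiE) (auto simp: B)
  have "U \<in> sets (pow_borel n)" if U: "openin (pow_top n) U" for U :: "(nat \<Rightarrow> 'a) set"
  proof -
    have "U = \<Union>{V \<in> ?C. V \<subseteq> U}"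
    proof (intro equalityI subsetI)
      fix x assume x: "x \<in> U"
      then have "\<exists>W. finite {i \<in> {..<n}. W i \<noteq> topspace (euclidean :: 'a topology)} \<and>
          (\<forall>i\<in>{..<n}. openin euclidean (W i)) \<and> x \<in> PiE {..<n} W \<and> PiE {..<n} W \<subseteq> U"
        using U unfolding pow_top_def openin_product_topology_alt by blast
      then obtain W where W: "\<And>i. i \<in> {..<n} \<Longrightarrow> open (W i)" "x \<in> PiE {..<n} W" "PiE {..<n} W \<subseteq> U"
        by (metis open_openin)
      have "\<exists>V\<in>B. x i \<in> V \<and> V \<subseteq> W i" if "i \<in> {..<n}" for i
      proof -
        have "x i \<in> W i" using W(2) that by (simp add: PiE_iff)
        show ?thesis
          by (rule topological_basisE[OF B(2) W(1)[OF that] \<open>x i \<in> W i\<close>]) blast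
      qed
      then obtain V where V: "\<And>i. i \<in> {..<n} \<Longrightarrow> V i \<in> B \<and> x i \<in> V i \<and> V i \<subseteq> W i" by metis
      let ?V = "PiE {..<n} (restrict V {..<n})"
      have "?V \<in> ?C" using V by (intro imageI) auto
      moreover have "?V \<subseteq> PiE {..<n} W" by (rule PiE_mono) (use V in simp)
      moreover have "x \<in> ?V" using V W(2) by (simp add: PiE_iff)
      ultimately show "x \<in> \<Union>{V \<in> ?C. V \<subseteq> U}"
        using W(3) by (intro UnionI[of ?V] CollectI conjI) (assumption | rule subset_trans)+
    qed auto
    also have "\<dots> \<in> sets (pow_borel n)"
    proof (rule sets.countable_Union)
      show "countable {V \<in> ?C. V \<subseteq> U}" by (rule countable_subset[OF _ cC]) auto
      show "{V \<in> ?C. V \<subseteq> U} \<subseteq> sets (pow_borel n)"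
      proof safe
        fix V :: "nat \<Rightarrow> 'a set" assume V: "V \<in> PiE {..<n} (\<lambda>_. B)"
        show "PiE {..<n} V \<in> sets (pow_borel n)"
          by (rule sets_PiM_I_finite) (use V topological_basis_open[OF B(2)] in \<open>auto simp: PiE_iff\<close>)
      qed
    qed
    finally show ?thesis .
  qed
  then have "sigma_sets (topspace (pow_top n)) {U. openin (pow_top n) U} \<subseteq> sets (pow_borel n :: (nat \<Rightarrow> 'a) measure)"
    using sets.sigma_sets_subset[of "{U. openin (pow_top n) U}" "pow_borel n :: (nat \<Rightarrow> 'a) measure"]
    by (auto simp: topspace_pow_top space_PiM)
  then show "sets (borel_of (pow_top n)) \<subseteq> sets (pow_borel n :: (nat \<Rightarrow> 'a) measure)"
    by (simp add: sets_borel_of)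
qed

lemma cube_sets: "A \<in> sets borel \<Longrightarrow> cube n A \<in> sets (pow_borel n)"
  unfolding cube_def by (rule sets_PiM_I_finite) auto

lemma offdiag_sets: "offdiag n \<in> sets (pow_borel n :: (nat \<Rightarrow> 'a::{second_countable_topology, t2_space}) measure)"
proof -
  have eq: "{x\<in>space (pow_borel n). x i = x j} \<in> sets (pow_borel n :: (nat \<Rightarrow> 'a) measure)"
    if "i \<in> {..<n}" "j \<in> {..<n}" for i j
    by (rule measurable_equality_set) (use that in \<open>auto intro!: measurable_component_singleton\<close>)
  have "offdiag n = {x\<in>space (pow_borel n). \<forall>i\<in>{..<n}. \<forall>j\<in>{..<n}. i \<noteq> j \<longrightarrow> \<not> x i = (x j :: 'a)}"
    by (auto simp: offdiag_def cube_def space_PiM inj_on_def)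
  also have "\<dots> \<in> sets (pow_borel n)"
    by (intro sets.sets_Collect eq finite_lessThan sets.sets_Collect_finite_All) auto
  finally show ?thesis .
qed

text \<open>The trace of a sigma-algebra on one of its members consists of the members contained in
  it, and \<open>offdiag n\<close> is a member because diagonals are Borel.\<close>

lemma sets_offdiag_borel:
  "sets (offdiag_borel n :: (nat \<Rightarrow> 'a::{second_countable_topology, t2_space}) measure) =
     {A \<in> sets (pow_borel n). A \<subseteq> offdiag n}"
proof -
  let ?O = "offdiag n :: (nat \<Rightarrow> 'a) set"
  have O: "?O \<in> sigma_sets (topspace (pow_top n)) {U. openin (pow_top n) U}"
    using offdiag_sets[of n] by (simp add: sets_borel_of_pow_top[symmetric] sets_borel_of)
  have top: "topspace (subtopology (pow_top n) ?O) = ?O"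
    by (auto simp: topspace_pow_top offdiag_def cube_def)
  have "sets (offdiag_borel n) = sigma_sets ?O ((\<inter>) ?O ` {U. openin (pow_top n) U})"
    unfolding offdiag_borel_def sets_borel_of top
    by (rule arg_cong[where f="sigma_sets ?O"]) (auto simp: openin_subtopology)
  also have "\<dots> = (\<inter>) ?O ` sigma_sets (topspace (pow_top n)) {U. openin (pow_top n) U}"
    by (rule sigma_sets_Int[OF O, symmetric]) (auto simp: topspace_pow_top offdiag_def cube_def)
  also have "\<dots> = (\<inter>) ?O ` sets (pow_borel n)"
    by (simp only: sets_borel_of_pow_top[symmetric] sets_borel_of)
  also have "\<dots> = {A \<in> sets (pow_borel n). A \<subseteq> ?O}"
  proof safe
    fix A :: "(nat \<Rightarrow> 'a) set" assume "A \<in> sets (pow_borel n)"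
    then show "?O \<inter> A \<in> sets (pow_borel n)" using offdiag_sets by (rule sets.Int[rotated])
  next
    fix A :: "(nat \<Rightarrow> 'a) set" assume "A \<in> sets (pow_borel n)" "A \<subseteq> ?O"
    then show "A \<in> (\<inter>) ?O ` sets (pow_borel n)" by (intro image_eqI[of _ _ A]) auto
  qed
  finally show ?thesis .
qed

lemma space_offdiag_borel: "space (offdiag_borel n) = offdiag n"
  by (auto simp: offdiag_borel_def topspace_pow_top offdiag_def cube_def)

lemma relcompact_borel_iff:
  "(A :: 'a::t2_space set) \<in> relcompact_borel \<longleftrightarrow> A \<in> sets borel \<and> (\<exists>K. compact K \<and> A \<subseteq> K)"
  unfolding relcompact_borel_def
proof safe
  show "\<exists>K. compact K \<and> A \<subseteq> K" if "compact (closure A)" using that closure_subset by blast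
  show "compact (closure A)" if "compact K" "A \<subseteq> K" for K
  proof -
    have "closure A \<subseteq> K" using that by (simp add: closure_minimal compact_imp_closed)
    then have "closure A = K \<inter> closure A" by auto
    then show ?thesis using compact_Int_closed[OF that(1) closed_closure, of A] by simp
  qed
qed

lemma relcompact_borel_sets: "A \<in> relcompact_borel \<Longrightarrow> A \<in> sets borel"
  by (simp add: relcompact_borel_def)

lemma relcompact_borel_subset:
  "(B :: 'a::t2_space set) \<in> relcompact_borel \<Longrightarrow> A \<in> sets borel \<Longrightarrow> A \<subseteq> B \<Longrightarrow> A \<in> relcompact_borel"
  unfolding relcompact_borel_iff by blast

lemma relcompact_borel_finite_UN:
  "finite I \<Longrightarrow> (\<And>i. i \<in> I \<Longrightarrow> (A i :: 'a::t2_space set) \<in> relcompact_borel) \<Longrightarrow> (\<Union>i\<in>I. A i) \<in> relcompact_borel"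
  by (induct I rule: finite_induct) (auto simp: relcompact_borel_def)

text \<open>Lindelof's theorem with a centre attached to each set of the subcover. The centres are
  kept because the neighbourhoods of interest are punctured at them.\<close>

lemma countable_open_cover:
  fixes N :: "'a::second_countable_topology \<Rightarrow> 'a set \<Rightarrow> bool"
  assumes "\<And>x. \<exists>U. open U \<and> x \<in> U \<and> N x U"
  obtains c :: "nat \<Rightarrow> 'a" and U where "\<And>i. open (U i)" "\<And>i. N (c i) (U i)" "(\<Union>i. U i) = UNIV"
    "\<And>i. c i \<in> U i"
proof -
  obtain V where V: "\<And>x. open (V x)" "\<And>x. x \<in> V x" "\<And>x. N x (V x)" using assms by metis
  obtain \<F> where F: "\<F> \<subseteq> range V" "countable \<F>" "\<Union>\<F> = \<Union>(range V)"
    using Lindelof[of "range V"] V(1) by auto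
  have ne: "\<F> \<noteq> {}" using F(3) V(2) by auto
  have "\<forall>W\<in>\<F>. \<exists>x. W = V x" using F(1) by auto
  then obtain g where g: "\<And>W. W \<in> \<F> \<Longrightarrow> W = V (g W)" by metis
  let ?U = "from_nat_into \<F>"
  have U: "?U i \<in> \<F>" for i by (rule from_nat_into[OF ne])
  have r: "range ?U = \<F>" by (rule range_from_nat_into[OF ne F(2)])
  show ?thesis
  proof (rule that[of ?U "\<lambda>i. g (?U i)"])
    show "(\<Union>i. ?U i) = UNIV" using r F(3) V(2) by auto
  qed (use U g V in metis)+
qed

locale loc_compact =
  fixes dummy :: "'a::polish_space itself"
  assumes loc_compact: "locally_compact_space (euclidean :: 'a topology)"
begin

lemma relcompact_nbhd: "\<exists>U. open U \<and> x \<in> U \<and> (U :: 'a set) \<in> relcompact_borel"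
proof -
  have "\<exists>U K. openin euclidean U \<and> compactin euclidean K \<and> x \<in> U \<and> U \<subseteq> K"
    using loc_compact unfolding locally_compact_space_def topspace_euclidean by blast
  then obtain U K where "open U" "compact K" "x \<in> U" "U \<subseteq> K"
    by (metis compactin_euclidean_iff open_openin)
  then show ?thesis unfolding relcompact_borel_iff using borel_open by blast
qed

lemma exhaustion:
  obtains U :: "nat \<Rightarrow> 'a set" where "\<And>i. open (U i)" "\<And>i. U i \<in> relcompact_borel" "incseq U"
    "(\<Union>i. U i) = UNIV" "\<And>K. compact K \<Longrightarrow> \<exists>i. K \<subseteq> U i" "\<And>A. A \<in> relcompact_borel \<Longrightarrow> \<exists>i. A \<subseteq> U i"
proof -
  obtain V :: "nat \<Rightarrow> 'a set" where V: "\<And>i. open (V i)" "\<And>i. V i \<in> relcompact_borel" "(\<Union>i. V i) = UNIV"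
    using countable_open_cover[of "\<lambda>_ U. U \<in> relcompact_borel"] relcompact_nbhd by metis
  define U where "U n = (\<Union>i\<le>n. V i)" for n
  have inc: "incseq U" unfolding U_def by (intro incseq_SucI UN_mono) auto
  have un: "(\<Union>i. U i) = UNIV"
  proof -
    have "V i \<subseteq> U i" for i unfolding U_def by auto
    then show ?thesis using V(3) by (metis UN_mono order_refl top.extremum_unique)
  qed
  have o: "open (U i)" for i unfolding U_def using V(1) by auto
  have c: "\<exists>i. K \<subseteq> U i" if cK: "compact K" for K
  proof -
    obtain D where D: "D \<subseteq> UNIV" "finite D" "K \<subseteq> (\<Union>i\<in>D. U i)"
      by (rule compactE_image[OF cK, of UNIV U]) (use o un in auto)
    have "K \<subseteq> U (Max (insert 0 D))"
    proof
      fix x assume "x \<in> K"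
      then obtain i where "i \<in> D" "x \<in> U i" using D(3) by auto
      moreover then have "i \<le> Max (insert 0 D)" using D(2) by auto
      ultimately show "x \<in> U (Max (insert 0 D))" using incseqD[OF inc] by auto
    qed
    then show ?thesis by blast
  qed
  show ?thesis
  proof (rule that[of U])
    show "U i \<in> relcompact_borel" for i unfolding U_def by (intro relcompact_borel_finite_UN V) auto
    show "\<exists>i. A \<subseteq> U i" if "A \<in> relcompact_borel" for A
      using that c unfolding relcompact_borel_iff by (meson subset_trans)
  qed (use inc un o c in auto)
qed

text \<open>Chosen once and for all, so that countable suprema along one fixed sequence can be used
  throughout.\<close>

definition exh :: "nat \<Rightarrow> 'a set" where
  "exh = (SOME U. (\<forall>i. open (U i) \<and> U i \<in> relcompact_borel) \<and> incseq U \<and> (\<Union>i. U i) = UNIV \<and>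
     (\<forall>K. compact K \<longrightarrow> (\<exists>i. K \<subseteq> U i)) \<and> (\<forall>A\<in>relcompact_borel. \<exists>i. A \<subseteq> U i))"

lemma exh: "(\<forall>i. open (exh i) \<and> exh i \<in> relcompact_borel) \<and> incseq exh \<and> (\<Union>i. exh i) = UNIV \<and>
     (\<forall>K. compact K \<longrightarrow> (\<exists>i. K \<subseteq> exh i)) \<and> (\<forall>A\<in>relcompact_borel. \<exists>i. A \<subseteq> exh i)"
proof -
  have "\<exists>U :: nat \<Rightarrow> 'a set. (\<forall>i. open (U i) \<and> U i \<in> relcompact_borel) \<and> incseq U \<and> (\<Union>i. U i) = UNIV \<and>
     (\<forall>K. compact K \<longrightarrow> (\<exists>i. K \<subseteq> U i)) \<and> (\<forall>A\<in>relcompact_borel. \<exists>i. A \<subseteq> U i)"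
    by (rule exhaustion) metis
  from someI_ex[OF this] show ?thesis unfolding exh_def .
qed

lemma
  shows exh_open: "open (exh i)" and exh_relcompact: "exh i \<in> relcompact_borel"
    and incseq_exh: "incseq exh" and UN_exh: "(\<Union>i. exh i) = UNIV"
    and compact_subset_exh: "compact K \<Longrightarrow> \<exists>i. K \<subseteq> exh i"
    and relcompact_subset_exh: "A \<in> relcompact_borel \<Longrightarrow> \<exists>i. A \<subseteq> exh i"
    and exh_borel: "exh i \<in> sets borel"
  using exh by (simp_all add: relcompact_borel_sets)

lemma radon_euclideanD:
  assumes "radon_measure (euclidean :: 'a topology) \<eta>"
  shows "sets \<eta> = sets borel" "space \<eta> = UNIV" "compact K \<Longrightarrow> emeasure \<eta> K < \<infinity>"
    "A \<in> relcompact_borel \<Longrightarrow> emeasure \<eta> A < \<infinity>"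
proof -
  show s: "sets \<eta> = sets borel" and k: "compact K \<Longrightarrow> emeasure \<eta> K < \<infinity>" for K
    using assms by (auto simp: radon_measure_def sets_borel_of_euclidean compactin_euclidean_iff)
  show "space \<eta> = UNIV" using sets_eq_imp_space_eq[OF s] by simp
  assume "A \<in> relcompact_borel"
  then obtain K where "compact K" "A \<subseteq> K" unfolding relcompact_borel_iff by blast
  then show "emeasure \<eta> A < \<infinity>"
    using k[of K] emeasure_mono[of A K \<eta>] s by (auto simp: compact_imp_closed order_le_less_trans)
qed

text \<open>Finite Borel measures on a Polish space are inner regular. This applies to the
  restriction of \<eta> to each member of the exhaustion, and the masses of the restrictions
  increase to that of the whole.\<close>

lemma radon_euclideanI:
  assumes s: "sets \<eta> = sets (borel :: 'a measure)" and fin: "\<And>K. compact K \<Longrightarrow> emeasure \<eta> K < \<infinity>"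
  shows "radon_measure euclidean \<eta>"
  unfolding radon_measure_def
proof (intro conjI allI impI ballI)
  show "sets \<eta> = sets (borel_of euclidean)" by (simp add: s sets_borel_of_euclidean)
  show "compactin euclidean K \<Longrightarrow> emeasure \<eta> K < \<infinity>" for K using fin by (simp add: compactin_euclidean_iff)
  fix A assume A: "A \<in> sets \<eta>"
    note U = exh_open exh_relcompact incseq_exh UN_exh
  let ?S = "SUP K\<in>{K. compact K \<and> K \<subseteq> A}. emeasure \<eta> K"
  have Us: "exh i \<in> sets \<eta>" for i using U(1) s by auto
  have "emeasure \<eta> (A \<inter> exh i) \<le> ?S" for i
  proof -
    let ?N = "density \<eta> (indicator (exh i))"
    have N: "emeasure ?N B = emeasure \<eta> (B \<inter> exh i)" if "B \<in> sets borel" for B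
      using that Us[of i] s by (simp add: emeasure_density flip: indicator_inter_arith)
        (simp add: Int_commute)
    obtain K where K: "compact K" "exh i \<subseteq> K" using U(2) unfolding relcompact_borel_iff by blast
    have "emeasure \<eta> (exh i) \<le> emeasure \<eta> K" using K s by (intro emeasure_mono) (auto simp: compact_imp_closed)
    then have "emeasure ?N (space ?N) \<noteq> \<infinity>"
      using fin[OF K(1)] N[of UNIV] sets_eq_imp_space_eq[OF s] by auto
    then have "emeasure ?N A = (SUP K\<in>{K. K \<subseteq> A \<and> compact K}. emeasure ?N K)"
      using A s by (intro inner_regular) auto
    also have "\<dots> \<le> ?S"
    proof (rule SUP_mono)
      fix K assume K: "K \<in> {K. K \<subseteq> A \<and> compact K}"
      then have "emeasure ?N K \<le> emeasure \<eta> K"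
        using s N[of K] by (auto simp: compact_imp_closed intro!: emeasure_mono)
      then show "\<exists>L\<in>{K. compact K \<and> K \<subseteq> A}. emeasure ?N K \<le> emeasure \<eta> L" using K by blast
    qed
    finally show ?thesis using N A s by simp
  qed
  then have "(SUP i. emeasure \<eta> (A \<inter> exh i)) \<le> ?S" by (rule SUP_least)
  also have "(SUP i. emeasure \<eta> (A \<inter> exh i)) = emeasure \<eta> (\<Union>i. A \<inter> exh i)"
    using A Us U(3) by (intro SUP_emeasure_incseq) (auto simp: incseq_def)
  also have "(\<Union>i. A \<inter> exh i) = A" using U(4) by auto
  finally have "emeasure \<eta> A \<le> ?S" .
  moreover have "?S \<le> emeasure \<eta> A" using A by (intro SUP_least emeasure_mono) auto
  ultimately show "emeasure \<eta> A = (SUP K\<in>{K. compactin euclidean K \<and> K \<subseteq> A}. emeasure \<eta> K)"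
    by (simp add: compactin_euclidean_iff)
qed

lemma radon_sigma_finite:
  assumes "radon_measure (euclidean :: 'a topology) \<eta>"
  shows "sigma_finite_measure \<eta>"
proof -
    note U = exh_open exh_relcompact incseq_exh UN_exh
  show ?thesis
    by standard (use U radon_euclideanD[OF assms] in \<open>force intro!: exI[of _ "range exh"] simp: less_top[symmetric]\<close>)
qed

end

section \<open>Measurability for the vague topology\<close>

text \<open>Countably many terms whose values are uniformly dense on compact sets, by Stone-Weierstrass; they
  reduce the vague topology to countably many open conditions.\<close>

datatype fun_term = Const_term rat | Dist_term nat | Add_term fun_term fun_term | Mult_term fun_term fun_term

instance fun_term :: countable
  by countable_datatype

definition dense_seq :: "nat \<Rightarrow> 'a::second_countable_topology" where
  "dense_seq = (SOME q. \<forall>U. open U \<longrightarrow> U \<noteq> {} \<longrightarrow> (\<exists>n. q n \<in> U))"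

lemma dense_seq:
  assumes "open U" "(U :: 'a::second_countable_topology set) \<noteq> {}"
  shows "\<exists>n. dense_seq n \<in> U"
proof -
  obtain D :: "'a set" where D: "countable D" "\<And>X. open X \<Longrightarrow> X \<noteq> {} \<Longrightarrow> \<exists>d\<in>D. d \<in> X"
    using countable_dense_setE by metis
  have "D \<noteq> {}" using D(2)[of UNIV] by auto
  then have "\<forall>U. open U \<longrightarrow> U \<noteq> {} \<longrightarrow> (\<exists>n. from_nat_into D n \<in> U)"
    using D by (metis from_nat_into_surj)
  from someI[of "\<lambda>q. \<forall>U. open U \<longrightarrow> U \<noteq> {} \<longrightarrow> (\<exists>n. q n \<in> U)", OF this]
  show ?thesis using assms unfolding dense_seq_def by blast
qed

primrec fun_val :: "fun_term \<Rightarrow> 'a::{metric_space, second_countable_topology} \<Rightarrow> real" where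
  "fun_val (Const_term c) x = of_rat c"
| "fun_val (Dist_term n) x = dist x (dense_seq n)"
| "fun_val (Add_term s t) x = fun_val s x + fun_val t x"
| "fun_val (Mult_term s t) x = fun_val s x * fun_val t x"

lemma continuous_fun_val: "continuous_on UNIV (fun_val t)"
  by (induct t) (auto intro!: continuous_intros)

text \<open>Stone-Weierstrass for the class \<open>R\<close> of continuous functions that terms
  approximate uniformly on K. This class is a ring with all real constants, which the terms
  themselves lack, and distances to dense points separate points.\<close>

lemma fun_val_dense:
  fixes K :: "'a::{metric_space, second_countable_topology} set"
  assumes K: "compact K" and f: "continuous_on K f" and e: "0 < (e::real)"
  shows "\<exists>t. \<forall>x\<in>K. \<bar>f x - fun_val t x\<bar> < e"
proof -
  define R where "R = {g :: 'a \<Rightarrow> real. continuous_on K g \<and> (\<forall>e>0. \<exists>t. \<forall>x\<in>K. \<bar>g x - fun_val t x\<bar> < e)}"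
  interpret function_ring_on R K
  proof
    show "compact K" by fact
    show "f \<in> R \<Longrightarrow> continuous_on K f" for f by (simp add: R_def)
    show "(\<lambda>x. f x + g x) \<in> R" if f: "f \<in> R" and g: "g \<in> R" for f g
    proof -
      have "\<exists>t. \<forall>x\<in>K. \<bar>(f x + g x) - fun_val t x\<bar> < e" if "0 < e" for e
      proof -
        have e2: "0 < e / 2" using that by simp
        obtain s where s: "\<forall>x\<in>K. \<bar>f x - fun_val s x\<bar> < e / 2" using f e2 unfolding R_def by blast
        obtain t where t: "\<forall>x\<in>K. \<bar>g x - fun_val t x\<bar> < e / 2" using g e2 unfolding R_def by blast
        have "\<bar>(f x + g x) - fun_val (Add_term s t) x\<bar> < e" if "x \<in> K" for x
          using bspec[OF s that] bspec[OF t that] unfolding fun_val.simps by linarith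
        then have "\<forall>x\<in>K. \<bar>(f x + g x) - fun_val (Add_term s t) x\<bar> < e" by blast
        then show ?thesis by blast
      qed
      then show ?thesis using f g by (auto simp: R_def intro: continuous_on_add)
    qed
    show "(\<lambda>_. c) \<in> R" for c
    proof -
      have "\<exists>t. \<forall>x\<in>K. \<bar>c - fun_val t x\<bar> < e" if "0 < e" for e
      proof -
        have "c < c + e" using that by simp
        then obtain r where "c < of_rat r" "of_rat r < c + e" using of_rat_dense by blast
        then have "\<forall>x\<in>K. \<bar>c - fun_val (Const_term r) x\<bar> < e" by auto
        then show ?thesis by blast
      qed
      then show ?thesis by (simp add: R_def)
    qed
    show "(\<lambda>x. f x * g x) \<in> R" if f: "f \<in> R" and g: "g \<in> R" for f g
    proof -
      have cf: "continuous_on K f" and cg: "continuous_on K g" using f g by (auto simp: R_def)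
      have "bounded (f ` K)" "bounded (g ` K)"
        using cf cg K by (auto intro!: compact_imp_bounded compact_continuous_image)
      then obtain B1 B2 where B1: "\<And>x. x \<in> K \<Longrightarrow> \<bar>f x\<bar> \<le> B1" and B2: "\<And>x. x \<in> K \<Longrightarrow> \<bar>g x\<bar> \<le> B2"
        unfolding bounded_iff by auto
      define B where "B = max 1 (max B1 B2)"
      have B: "\<bar>f x\<bar> \<le> B" "\<bar>g x\<bar> \<le> B" if "x \<in> K" for x using B1[OF that] B2[OF that] by (auto simp: B_def)
      have Bpos: "1 \<le> B" by (simp add: B_def)
      have "\<exists>t. \<forall>x\<in>K. \<bar>f x * g x - fun_val t x\<bar> < e" if "0 < e" for e
      proof -
        \<comment> \<open>As d \<le> 1 \<le> B, the approximant of g is bounded by 2 B, and the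
          product is off by at most B d + 2 B d < 4 B d \<le> e.\<close>
        define d where "d = min 1 (e / (4 * B))"
        have d: "0 < d" "d \<le> 1" "4 * B * d \<le> e" using that Bpos by (auto simp: d_def min_def field_simps)
        obtain s where s: "\<forall>x\<in>K. \<bar>f x - fun_val s x\<bar> < d" using f d(1) unfolding R_def by blast
        obtain t where t: "\<forall>x\<in>K. \<bar>g x - fun_val t x\<bar> < d" using g d(1) unfolding R_def by blast
        have "\<bar>f x * g x - fun_val (Mult_term s t) x\<bar> < e" if x: "x \<in> K" for x
        proof -
          have t1: "\<bar>fun_val t x\<bar> \<le> 2 * B" using B(2)[OF x] t x d(2) Bpos by (smt (verit))
          have "f x * g x - fun_val s x * fun_val t x = f x * (g x - fun_val t x) + fun_val t x * (f x - fun_val s x)"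
            by (simp add: algebra_simps)
          also have "\<bar>\<dots>\<bar> \<le> \<bar>f x\<bar> * \<bar>g x - fun_val t x\<bar> + \<bar>fun_val t x\<bar> * \<bar>f x - fun_val s x\<bar>"
            by (metis abs_mult abs_triangle_ineq)
          also have "\<dots> \<le> B * d + (2 * B) * d"
            using B[OF x] t1 s t x by (intro add_mono mult_mono) (auto simp: less_imp_le)
          also have "\<dots> < 4 * B * d" using d(1) Bpos by simp
          finally show ?thesis using d(3) by simp
        qed
        then show ?thesis by blast
      qed
      then show ?thesis using cf cg by (auto simp: R_def intro: continuous_on_mult)
    qed
    show "\<exists>f\<in>R. f x \<noteq> f y" if "x \<in> K" "y \<in> K" "x \<noteq> y" for x y
    proof -
      \<comment> \<open>A dense point closer to x than half the distance to y has different
        distances from x and from y.\<close>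
      have "ball x (dist x y / 2) \<noteq> {}" using that by auto
      then obtain n where n: "dense_seq n \<in> ball x (dist x y / 2)" using dense_seq[OF open_ball] by blast
      have "fun_val (Dist_term n) x \<noteq> fun_val (Dist_term n) y"
        using n dist_triangle2[of x y "dense_seq n"] by auto
      moreover have "fun_val (Dist_term n) \<in> R"
        unfolding R_def using continuous_on_subset[OF continuous_fun_val]
        by (auto intro!: exI[of _ "Dist_term n"] continuous_intros)
      ultimately show ?thesis by blast
    qed
  qed
  obtain g where g: "g \<in> R" "\<forall>x\<in>K. \<bar>f x - g x\<bar> < e / 2"
    using Stone_Weierstrass_basic[OF f, of "e / 2"] e by auto
  have e2: "0 < e / 2" using e by simp
  obtain t where t: "\<forall>x\<in>K. \<bar>g x - fun_val t x\<bar> < e / 2" using g(1) e2 unfolding R_def by blast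
  have "\<forall>x\<in>K. \<bar>f x - fun_val t x\<bar> < e" using g(2) t by (smt (verit) field_sum_of_halves)
  then show ?thesis by blast
qed

definition compact_support :: "('a::topological_space \<Rightarrow> real) \<Rightarrow> bool" where
  "compact_support f \<longleftrightarrow> continuous_on UNIV f \<and> compact (closure {x. f x \<noteq> 0})"

lemma compact_support_outside:
  fixes f :: "'a::t2_space \<Rightarrow> real"
  assumes "continuous_on UNIV f" "compact K" "\<And>x. x \<notin> K \<Longrightarrow> f x = 0"
  shows "compact_support f"
proof -
  have "closure {x. f x \<noteq> 0} \<subseteq> K"
    by (rule closure_minimal) (use assms in \<open>auto simp: compact_imp_closed\<close>)
  then have "closure {x. f x \<noteq> 0} = K \<inter> closure {x. f x \<noteq> 0}" by auto
  then have "compact (closure {x. f x \<noteq> 0})"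
    using compact_Int_closed[OF assms(2) closed_closure, of "{x. f x \<noteq> 0}"] by simp
  then show ?thesis using assms(1) by (simp add: compact_support_def)
qed

lemma openin_vague_basis:
  assumes "compact_support f" "open U"
  shows "openin vague_topology {\<eta> \<in> radon_measures. (\<integral>x. f x \<partial>\<eta>) \<in> U}"
  unfolding vague_topology_def
  by (rule topology_generated_by_Basis) (use assms in \<open>auto simp: compact_support_def\<close>)

lemma topspace_vague: "topspace vague_topology = (radon_measures :: 'a::topological_space measure set)"
proof
  show "topspace vague_topology \<subseteq> (radon_measures :: 'a measure set)"
    unfolding vague_topology_def topology_generated_by_topspace by auto
  have "compact_support (\<lambda>_::'a. 0)" by (simp add: compact_support_def)
  from openin_vague_basis[OF this open_UNIV] show "(radon_measures :: 'a measure set) \<subseteq> topspace vague_topology"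
    using openin_subset by fastforce
qed

lemma measurable_vague_integral:
  assumes "compact_support f"
  shows "(\<lambda>\<eta>. \<integral>x. f x \<partial>\<eta>) \<in> borel_measurable (borel_of vague_topology)"
proof (rule borel_measurableI)
  fix S :: "real set" assume "open S"
  have "(\<lambda>\<eta>. \<integral>x. f x \<partial>\<eta>) -` S \<inter> space (borel_of vague_topology) = {\<eta> \<in> radon_measures. (\<integral>x. f x \<partial>\<eta>) \<in> S}"
    by (auto simp: topspace_vague)
  then show "(\<lambda>\<eta>. \<integral>x. f x \<partial>\<eta>) -` S \<inter> space (borel_of vague_topology) \<in> sets (borel_of vague_topology)"
    using openin_sets_borel_of[OF openin_vague_basis[OF assms \<open>open S\<close>]] by simp
qed

lemma measurable_eqI:
  assumes "\<And>w. w \<in> space M \<Longrightarrow> f w = g w" "g \<in> measurable M N"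
  shows "f \<in> measurable M N"
  using assms measurable_cong by blast

text \<open>The sets with this property form a Dynkin system containing the generator. Intersecting
  with a set U of finite mass makes the subtraction for complements legitimate.\<close>

lemma measurable_emeasure_Dynkin:
  fixes \<kappa> :: "'b \<Rightarrow> 'c measure"
  assumes G: "Int_stable G" "G \<subseteq> Pow \<Omega>"
    and sets: "\<And>\<omega>. \<omega> \<in> space M \<Longrightarrow> sets (\<kappa> \<omega>) = sigma_sets \<Omega> G"
    and U: "U \<in> sigma_sets \<Omega> G" and fin: "\<And>\<omega>. \<omega> \<in> space M \<Longrightarrow> emeasure (\<kappa> \<omega>) U < \<infinity>"
    and basic: "\<And>A. A \<in> G \<Longrightarrow> (\<lambda>\<omega>. emeasure (\<kappa> \<omega>) (A \<inter> U)) \<in> borel_measurable M"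
    and mU: "(\<lambda>\<omega>. emeasure (\<kappa> \<omega>) U) \<in> borel_measurable M"
    and A: "A \<in> sigma_sets \<Omega> G"
  shows "(\<lambda>\<omega>. emeasure (\<kappa> \<omega>) (A \<inter> U)) \<in> borel_measurable M"
  using G A
proof (induct rule: sigma_sets_induct_disjoint)
  case (compl A)
  have UO: "U \<subseteq> \<Omega>" using U G(2) sigma_sets_into_sp by blast
  have "emeasure (\<kappa> \<omega>) ((\<Omega> - A) \<inter> U) = emeasure (\<kappa> \<omega>) U - emeasure (\<kappa> \<omega>) (A \<inter> U)" if w: "\<omega> \<in> space M" for \<omega>
  proof -
    interpret sigma_algebra \<Omega> "sigma_sets \<Omega> G" by (rule sigma_algebra_sigma_sets[OF G(2)])
    have "(\<Omega> - A) \<inter> U = U - A \<inter> U" using UO by auto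
    moreover have "A \<inter> U \<in> sigma_sets \<Omega> G" using compl U by auto
    moreover have "emeasure (\<kappa> \<omega>) (A \<inter> U) \<noteq> \<infinity>"
      using fin[OF w] emeasure_mono[of "A \<inter> U" U "\<kappa> \<omega>"] sets[OF w] U
      by (metis inf_le2 infinity_ennreal_def leD top.not_eq_extremum)
    ultimately show ?thesis using U sets[OF w] by (simp add: emeasure_Diff)
  qed
  then show ?case
    by (rule measurable_eqI) (auto intro!: borel_measurable_minus_ennreal mU compl)
next
  case (union A)
  have "emeasure (\<kappa> \<omega>) ((\<Union>i. A i) \<inter> U) = (\<Sum>i. emeasure (\<kappa> \<omega>) (A i \<inter> U))" if w: "\<omega> \<in> space M" for \<omega>
  proof -
    interpret sigma_algebra \<Omega> "sigma_sets \<Omega> G" by (rule sigma_algebra_sigma_sets[OF G(2)])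
    have "(\<Sum>i. emeasure (\<kappa> \<omega>) (A i \<inter> U)) = emeasure (\<kappa> \<omega>) (\<Union>i. A i \<inter> U)"
      by (rule suminf_emeasure) (use union U sets[OF w] in \<open>auto simp: disjoint_family_on_def\<close>)
    then show ?thesis by (simp add: Int_UN_distrib2)
  qed
  then show ?case
    by (rule measurable_eqI) (auto intro!: borel_measurable_suminf_order union)
qed (use basic in auto)

lemma measurable_kernel_nn_integral:
  assumes sets: "\<And>\<omega>. \<omega> \<in> space M \<Longrightarrow> sets (\<kappa> \<omega>) = sets N"
    and meas: "\<And>A. A \<in> sets N \<Longrightarrow> (\<lambda>\<omega>. emeasure (\<kappa> \<omega>) A) \<in> borel_measurable M"
    and f: "f \<in> borel_measurable N"
  shows "(\<lambda>\<omega>. \<integral>\<^sup>+x. f x \<partial>\<kappa> \<omega>) \<in> borel_measurable M"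
proof -
  have spc: "space (\<kappa> \<omega>) = space N" if "\<omega> \<in> space M" for \<omega>
    using sets_eq_imp_space_eq[OF sets[OF that]] .
  have mc: "borel_measurable (\<kappa> \<omega>) = (borel_measurable N :: ('b \<Rightarrow> ennreal) set)" if "\<omega> \<in> space M" for \<omega>
    by (rule measurable_cong_sets) (simp_all add: sets[OF that])
  show ?thesis
    using f
  proof (induct rule: borel_measurable_induct)
    case (cong f g)
    have "(\<integral>\<^sup>+x. f x \<partial>\<kappa> \<omega>) = (\<integral>\<^sup>+x. g x \<partial>\<kappa> \<omega>)" if "\<omega> \<in> space M" for \<omega>
      by (intro nn_integral_cong) (use cong spc[OF that] in auto)
    then show ?case by (rule measurable_eqI) (auto intro: cong)
  next
    case (set A)
    show ?case by (rule measurable_eqI[OF _ meas[OF set]]) (simp add: sets set)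
  next
    case (mult u c)
    have [measurable]: "(\<lambda>\<omega>. \<integral>\<^sup>+x. u x \<partial>\<kappa> \<omega>) \<in> borel_measurable M" by fact
    show ?case
    proof (rule measurable_eqI)
      show "(\<integral>\<^sup>+x. c * u x \<partial>\<kappa> \<omega>) = c * (\<integral>\<^sup>+x. u x \<partial>\<kappa> \<omega>)" if "\<omega> \<in> space M" for \<omega>
        by (rule nn_integral_cmult) (simp add: mc[OF that] mult)
    qed measurable
  next
    case (add u v)
    have [measurable]: "(\<lambda>\<omega>. \<integral>\<^sup>+x. u x \<partial>\<kappa> \<omega>) \<in> borel_measurable M" "(\<lambda>\<omega>. \<integral>\<^sup>+x. v x \<partial>\<kappa> \<omega>) \<in> borel_measurable M"
      by fact+
    show ?case
    proof (rule measurable_eqI)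
      show "(\<integral>\<^sup>+x. v x + u x \<partial>\<kappa> \<omega>) = (\<integral>\<^sup>+x. v x \<partial>\<kappa> \<omega>) + (\<integral>\<^sup>+x. u x \<partial>\<kappa> \<omega>)" if "\<omega> \<in> space M" for \<omega>
        by (rule nn_integral_add) (simp_all add: mc[OF that] add)
    qed measurable
  next
    case (seq U)
    have "(\<integral>\<^sup>+x. (SUP i. U i) x \<partial>\<kappa> \<omega>) = (SUP i. \<integral>\<^sup>+x. U i x \<partial>\<kappa> \<omega>)" if "\<omega> \<in> space M" for \<omega>
    proof -
      have "(\<integral>\<^sup>+x. (SUP i. U i x) \<partial>\<kappa> \<omega>) = (SUP i. \<integral>\<^sup>+x. U i x \<partial>\<kappa> \<omega>)"
        by (rule nn_integral_monotone_convergence_SUP) (use seq mc[OF that] in auto)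
      then show ?thesis by (simp add: SUP_apply image_comp)
    qed
    then show ?case
      by (rule measurable_eqI) (auto intro!: borel_measurable_SUP seq)
  qed
qed

context loc_compact
begin

text \<open>Multiples of the distance to the complement of U, cut off at 1, increase to the
  indicator of U; their support is compact because U lies in a compact set.\<close>

lemma bump_sequence:
  assumes U: "open U" "(U :: 'a set) \<in> relcompact_borel"
  obtains f :: "nat \<Rightarrow> 'a \<Rightarrow> real" where "\<And>k. compact_support (f k)" "\<And>k x. 0 \<le> f k x" "\<And>k x. f k x \<le> 1"
    "\<And>k x. x \<notin> U \<Longrightarrow> f k x = 0" "\<And>x. incseq (\<lambda>k. f k x)" "\<And>x. (\<lambda>k. f k x) \<longlonglongrightarrow> indicator U x"
proof -
  \<comment> \<open>Distances to the empty set are 0 by convention, so the case in which U is the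
    whole space is separate.\<close>
  define h where "h x = (if - U = {} then 1 else infdist x (- U))" for x
  define f where "f k x = min 1 (real k * h x)" for k x
  have hc: "continuous_on UNIV h" unfolding h_def by (cases "- U = {}") (auto intro!: continuous_intros)
  have h0: "0 \<le> h x" for x by (simp add: h_def infdist_nonneg)
  have hU: "h x = 0 \<longleftrightarrow> x \<notin> U" for x
    using in_closed_iff_infdist_zero[of "- U" x] U(1) by (auto simp: h_def)
  obtain K where K: "compact K" "U \<subseteq> K" using U(2) unfolding relcompact_borel_iff by blast
  have hK: "h x = 0" if "x \<notin> K" for x using that K(2) hU[of x] by blast
  show ?thesis
  proof (rule that[of f])
    show "compact_support (f k)" for k
      by (rule compact_support_outside[OF _ K(1)])
        (use hc hK in \<open>auto simp: f_def[abs_def] intro!: continuous_intros\<close>)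
    show "0 \<le> f k x" "f k x \<le> 1" for k x using h0 by (auto simp: f_def)
    show "f k x = 0" if "x \<notin> U" for k x using that hU[of x] by (simp add: f_def)
    show "incseq (\<lambda>k. f k x)" for x
      unfolding f_def incseq_def using h0 by (intro allI impI min.mono order_refl mult_right_mono) auto
    show "(\<lambda>k. f k x) \<longlonglongrightarrow> indicator U x" for x
    proof (cases "x \<in> U")
      case True
      then have pos: "0 < h x" using h0[of x] hU[of x] by simp
      obtain N :: nat where N: "1 / h x \<le> N" using real_arch_simple by blast
      have "f k x = 1" if "N \<le> k" for k
      proof -
        have "1 \<le> real N * h x" using N pos by (simp add: field_simps)
        also have "\<dots> \<le> real k * h x" using that pos by simp
        finally show ?thesis by (simp add: f_def)
      qed
      then have "\<forall>\<^sub>F k in sequentially. f k x = indicator U x"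
        using True by (auto simp: eventually_sequentially)
      then show ?thesis by (rule tendsto_eventually)
    next
      case False
      then show ?thesis using hU[of x] by (simp add: f_def)
    qed
  qed
qed

lemma compact_support_integrable:
  assumes \<eta>: "radon_measure (euclidean :: 'a topology) \<eta>" and f: "compact_support f"
  shows "integrable \<eta> f"
proof -
  let ?K = "closure {x. f x \<noteq> 0}"
  have K: "compact ?K" and c: "continuous_on UNIV f" using f by (auto simp: compact_support_def)
  have "bounded (f ` ?K)"
    using K c by (auto intro!: compact_imp_bounded compact_continuous_image intro: continuous_on_subset)
  then obtain B where B: "\<And>x. x \<in> ?K \<Longrightarrow> \<bar>f x\<bar> \<le> B" unfolding bounded_iff by auto
  show ?thesis
  proof (rule integrableI_bounded_set[of ?K])
    show "?K \<in> sets \<eta>" using radon_euclideanD[OF \<eta>] by simp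
    show "f \<in> borel_measurable \<eta>"
      using borel_measurable_continuous_onI[OF c] radon_euclideanD(1)[OF \<eta>] by (simp cong: measurable_cong_sets)
    show "emeasure \<eta> ?K < \<infinity>" using radon_euclideanD(3)[OF \<eta> K] .
    show "AE x in \<eta>. x \<in> ?K \<longrightarrow> norm (f x) \<le> B" using B by auto
    show "AE x in \<eta>. x \<notin> ?K \<longrightarrow> f x = 0"
      using closure_subset[of "{x. f x \<noteq> 0}"] by auto
  qed
qed

text \<open>Dynkin's argument for the open sets inside each member of the exhaustion, where masses
  are finite, and a supremum over the exhaustion.\<close>

lemma measurable_radon_emeasure:
  assumes \<kappa>: "\<And>\<omega>. \<omega> \<in> space M \<Longrightarrow> radon_measure (euclidean :: 'a topology) (\<kappa> \<omega>)"
    and op: "\<And>U. open U \<Longrightarrow> U \<in> relcompact_borel \<Longrightarrow> (\<lambda>\<omega>. emeasure (\<kappa> \<omega>) U) \<in> borel_measurable M"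
    and A: "A \<in> sets borel"
  shows "(\<lambda>\<omega>. emeasure (\<kappa> \<omega>) A) \<in> borel_measurable M"
proof -
  have 1: "(\<lambda>\<omega>. emeasure (\<kappa> \<omega>) (A \<inter> exh r)) \<in> borel_measurable M" for r
  proof (rule measurable_emeasure_Dynkin[where G="{U. open U}" and \<Omega>=UNIV])
    show "Int_stable {U::'a set. open U}" by (auto simp: Int_stable_def)
    show "sets (\<kappa> \<omega>) = sigma_sets UNIV {U. open U}" if "\<omega> \<in> space M" for \<omega>
      using radon_euclideanD(1)[OF \<kappa>[OF that]] by (simp add: borel_def)
    show "exh r \<in> sigma_sets UNIV {U. open U}" using exh_open by auto
    show "emeasure (\<kappa> \<omega>) (exh r) < \<infinity>" if "\<omega> \<in> space M" for \<omega>
      using radon_euclideanD(4)[OF \<kappa>[OF that] exh_relcompact] .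
    show "(\<lambda>\<omega>. emeasure (\<kappa> \<omega>) (U \<inter> exh r)) \<in> borel_measurable M" if "U \<in> {U. open U}" for U
      using that exh_open[of r] by (intro op relcompact_borel_subset[OF exh_relcompact[of r]]) auto
    show "A \<in> sigma_sets UNIV {U. open U}" using A by (simp add: borel_def)
  qed (auto intro!: op exh_open exh_relcompact)
  have "emeasure (\<kappa> \<omega>) A = (SUP r. emeasure (\<kappa> \<omega>) (A \<inter> exh r))" if "\<omega> \<in> space M" for \<omega>
  proof -
    have "(SUP r. emeasure (\<kappa> \<omega>) (A \<inter> exh r)) = emeasure (\<kappa> \<omega>) (\<Union>r. A \<inter> exh r)"
      using radon_euclideanD(1)[OF \<kappa>[OF that]] A exh_borel incseq_exh
      by (intro SUP_emeasure_incseq) (auto simp: incseq_def subset_iff)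
    then show ?thesis using UN_exh by (simp flip: Int_UN_distrib)
  qed
  then show ?thesis by (rule measurable_eqI) (auto intro!: borel_measurable_SUP 1)
qed

lemma measurable_vague_emeasure:
  assumes A: "(A :: 'a set) \<in> sets borel"
  shows "(\<lambda>\<eta>. emeasure \<eta> A) \<in> borel_measurable (borel_of vague_topology)"
proof (rule measurable_radon_emeasure[OF _ _ A])
  show "radon_measure euclidean \<eta>" if "\<eta> \<in> space (borel_of vague_topology)" for \<eta> :: "'a measure"
    using that by (simp add: topspace_vague radon_measures_def)
  note R = this
  fix U :: "'a set" assume U: "open U" "U \<in> relcompact_borel"
  obtain f :: "nat \<Rightarrow> 'a \<Rightarrow> real" where f: "\<And>k. compact_support (f k)" "\<And>k x. 0 \<le> f k x" "\<And>k x. f k x \<le> 1"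
    "\<And>k x. x \<notin> U \<Longrightarrow> f k x = 0" "\<And>x. incseq (\<lambda>k. f k x)" "\<And>x. (\<lambda>k. f k x) \<longlonglongrightarrow> indicator U x"
    using bump_sequence[OF U] by metis
  have "emeasure \<eta> U = (SUP k. ennreal (\<integral>x. f k x \<partial>\<eta>))" if e: "\<eta> \<in> space (borel_of vague_topology)" for \<eta>
  proof -
    note D = radon_euclideanD[OF R[OF e]]
    have m: "f k \<in> borel_measurable \<eta>" for k
      using compact_support_integrable[OF R[OF e] f(1)] by auto
    have "(SUP k. ennreal (f k x)) = indicator U x" for x
    proof -
      have "(\<lambda>k. ennreal (f k x)) \<longlonglongrightarrow> ennreal (indicator U x)" by (intro tendsto_ennrealI f)
      moreover have "(\<lambda>k. ennreal (f k x)) \<longlonglongrightarrow> (SUP k. ennreal (f k x))"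
        using f(5)[of x] by (intro LIMSEQ_SUP) (auto simp: incseq_def ennreal_leI)
      ultimately show ?thesis by (metis LIMSEQ_unique ennreal_indicator)
    qed
    then have "emeasure \<eta> U = (\<integral>\<^sup>+x. (SUP k. ennreal (f k x)) \<partial>\<eta>)"
      using U(1) D(1) by simp
    also have "\<dots> = (SUP k. \<integral>\<^sup>+x. ennreal (f k x) \<partial>\<eta>)"
      using f(5) m by (intro nn_integral_monotone_convergence_SUP) (auto simp: incseq_def le_fun_def ennreal_leI)
    also have "\<dots> = (SUP k. ennreal (\<integral>x. f k x \<partial>\<eta>))"
      using f(2) compact_support_integrable[OF R[OF e] f(1)] by (intro SUP_cong refl nn_integral_eq_integral) auto
    finally show ?thesis .
  qed
  then show "(\<lambda>\<eta>. emeasure \<eta> U) \<in> borel_measurable (borel_of vague_topology)"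
    by (rule measurable_eqI)
      (auto intro!: borel_measurable_SUP measurable_compose[OF measurable_vague_integral[OF f(1)] measurable_ennreal])
qed

lemma measurable_radon_integral:
  assumes \<kappa>: "\<And>\<omega>. \<omega> \<in> space M \<Longrightarrow> radon_measure (euclidean :: 'a topology) (\<kappa> \<omega>)"
    and meas: "\<And>A. A \<in> sets borel \<Longrightarrow> (\<lambda>\<omega>. emeasure (\<kappa> \<omega>) A) \<in> borel_measurable M"
    and f: "compact_support f"
  shows "(\<lambda>\<omega>. \<integral>x. f x \<partial>\<kappa> \<omega>) \<in> borel_measurable M"
proof -
  have fm: "f \<in> borel_measurable borel"
    using f by (auto simp: compact_support_def intro: borel_measurable_continuous_onI)
  have 1: "(\<lambda>\<omega>. \<integral>\<^sup>+x. ennreal (g x) \<partial>\<kappa> \<omega>) \<in> borel_measurable M" if "g \<in> borel_measurable borel" for g :: "'a \<Rightarrow> real"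
    by (rule measurable_kernel_nn_integral[of _ _ borel])
      (use that radon_euclideanD(1)[OF \<kappa>] meas in auto)
  have "(\<integral>x. f x \<partial>\<kappa> \<omega>) = enn2real (\<integral>\<^sup>+x. ennreal (f x) \<partial>\<kappa> \<omega>) - enn2real (\<integral>\<^sup>+x. ennreal (- f x) \<partial>\<kappa> \<omega>)"
    if "\<omega> \<in> space M" for \<omega>
    by (rule real_lebesgue_integral_def[OF compact_support_integrable[OF \<kappa>[OF that] f]])
  then show ?thesis
    by (rule measurable_eqI) (auto intro!: borel_measurable_diff measurable_compose[OF 1 borel_measurable_enn2real] fm)
qed

text \<open>The distance to the complement of a larger member of the exhaustion has a positive
  minimum m on a compact set containing \<open>exh r\<close>; divided by m and cut off at 1 it has
  the required properties.\<close>

lemma cutoff: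
  obtains h :: "'a \<Rightarrow> real" where "compact_support h" "\<And>x. 0 \<le> h x" "\<And>x. x \<in> exh r \<Longrightarrow> h x = 1" "\<And>x. h x \<le> 1"
proof -
  obtain K where K: "compact K" "exh r \<subseteq> K" using exh_relcompact[of r] unfolding relcompact_borel_iff by blast
  obtain r' where r': "K \<subseteq> exh r'" using compact_subset_exh[OF K(1)] by blast
  obtain K' where K': "compact K'" "exh r' \<subseteq> K'" using exh_relcompact[of r'] unfolding relcompact_borel_iff by blast
  define g where "g x = (if - exh r' = {} then 1 else infdist x (- exh r'))" for x
  have gc: "continuous_on UNIV g" unfolding g_def by (cases "- exh r' = {}") (auto intro!: continuous_intros)
  have g0: "0 \<le> g x" for x by (simp add: g_def infdist_nonneg)
  have gU: "g x = 0 \<longleftrightarrow> x \<notin> exh r'" for x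
    using in_closed_iff_infdist_zero[of "- exh r'" x] exh_open[of r'] by (auto simp: g_def)
  have gK: "g x = 0" if "x \<notin> K'" for x using that K'(2) gU[of x] by blast
  obtain m where m: "0 < m" "\<And>x. x \<in> K \<Longrightarrow> m \<le> g x"
  proof (cases "K = {}")
    case True then show ?thesis using that[of 1] by auto
  next
    case False
    obtain y where y: "y \<in> K" "\<forall>x\<in>K. g y \<le> g x"
      using continuous_attains_inf[OF K(1) False continuous_on_subset[OF gc]] by auto
    have "0 < g y" using y(1) r' gU[of y] g0[of y] by auto
    then show ?thesis using that[of "g y"] y by auto
  qed
  show ?thesis
  proof (rule that[of "\<lambda>x. min 1 (g x / m)"])
    show "compact_support (\<lambda>x. min 1 (g x / m))"
      by (rule compact_support_outside[OF _ K'(1)])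
        (use gc gK m(1) in \<open>auto intro!: continuous_intros\<close>)
    show "min 1 (g x / m) = 1" if "x \<in> exh r" for x
      using m(2)[of x] m(1) K(2) that by (auto simp: min_def field_simps)
  qed (use g0 m(1) in auto)
qed

text \<open>The vague topology is generated by uncountably many sets, so its open sets need a
  countable description. Integrals of the functions \<open>fun_val t\<close> times a cutoff,
  confined to rational intervals, define a countable family \<open>\<C>\<close> such that every open
  set is the union of the members of \<open>\<C>\<close> inside it.\<close>

lemma measurable_vague:
  assumes \<kappa>: "\<And>\<omega>. \<omega> \<in> space M \<Longrightarrow> radon_measure (euclidean :: 'a topology) (\<kappa> \<omega>)"
    and meas: "\<And>A. A \<in> sets borel \<Longrightarrow> (\<lambda>\<omega>. emeasure (\<kappa> \<omega>) A) \<in> borel_measurable M"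
  shows "\<kappa> \<in> measurable M (borel_of vague_topology)"
proof -
  have "\<forall>r. \<exists>h :: 'a \<Rightarrow> real. compact_support h \<and> (\<forall>x. 0 \<le> h x \<and> h x \<le> 1) \<and> (\<forall>x\<in>exh r. h x = 1)"
    using cutoff by metis
  then obtain h :: "nat \<Rightarrow> 'a \<Rightarrow> real" where h: "\<And>r. compact_support (h r)" "\<And>r x. 0 \<le> h r x" "\<And>r x. h r x \<le> 1"
    "\<And>r x. x \<in> exh r \<Longrightarrow> h r x = 1" by metis
  define D where "D = range (\<lambda>(t, r). \<lambda>x. fun_val t x * h r x)"
  have hs: "compact_support (\<lambda>x. g x * h r x)" if "continuous_on UNIV g" for g r
    by (rule compact_support_outside[of _ "closure {x. h r x \<noteq> 0}"])
      (use that h(1)[of r] closure_subset[of "{x. h r x \<noteq> 0}"] in \<open>auto simp: compact_support_def intro!: continuous_intros\<close>)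
  have Dc: "compact_support g" if "g \<in> D" for g
    using that hs[OF continuous_fun_val] by (auto simp: D_def)
  have cD: "countable D" unfolding D_def by (rule countable_image) (rule countableI_type)
  have hD: "h r \<in> D" for r unfolding D_def by (rule image_eqI[of _ _ "(Const_term 1, r)"]) auto
  define V where "V l = {\<eta> \<in> radon_measures. \<forall>(g, a, b)\<in>set l. (\<integral>x. g x \<partial>\<eta>) \<in> {of_rat a<..<of_rat b}}"
    for l :: "(('a \<Rightarrow> real) \<times> rat \<times> rat) list"
  define \<C> where "\<C> = V ` lists (D \<times> UNIV \<times> UNIV)"
  have cC: "countable \<C>" unfolding \<C>_def by (intro countable_image countable_lists countable_SIGMA cD) auto
  have Cint: "A \<inter> B \<in> \<C>" if "A \<in> \<C>" "B \<in> \<C>" for A B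
  proof -
    obtain k l where "A = V k" "B = V l" "k \<in> lists (D \<times> UNIV \<times> UNIV)" "l \<in> lists (D \<times> UNIV \<times> UNIV)"
      using \<open>A \<in> \<C>\<close> \<open>B \<in> \<C>\<close> unfolding \<C>_def by blast
    moreover have "V k \<inter> V l = V (k @ l)" unfolding V_def set_append by blast
    ultimately show ?thesis unfolding \<C>_def by (metis append_in_lists_conv imageI)
  qed
  have Cmeas: "\<kappa> -` A \<inter> space M \<in> sets M" if "A \<in> \<C>" for A
  proof -
    obtain l where l: "A = V l" "l \<in> lists (D \<times> UNIV \<times> UNIV)" using \<open>A \<in> \<C>\<close> unfolding \<C>_def by blast
    have "{\<omega>\<in>space M. (\<integral>x. g x \<partial>\<kappa> \<omega>) \<in> {of_rat a<..<of_rat b}} \<in> sets M" if "(g, a, b) \<in> set l" for g a b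
    proof -
      have "compact_support g" using that l(2) Dc by auto
      from measurable_radon_integral[OF \<kappa> meas this]
      have "(\<lambda>\<omega>. \<integral>x. g x \<partial>\<kappa> \<omega>) \<in> borel_measurable M" by blast
      from measurable_sets[OF this, of "{of_rat a<..<of_rat b}"] show ?thesis by (simp add: vimage_def Int_def conj_commute)
    qed
    then have "{\<omega>\<in>space M. \<forall>p\<in>set l. (\<lambda>(g, a, b). (\<integral>x. g x \<partial>\<kappa> \<omega>) \<in> {of_rat a<..<of_rat b}) p} \<in> sets M"
      by (intro sets.sets_Collect_finite_All) (auto simp: case_prod_beta)
    also have "{\<omega>\<in>space M. \<forall>p\<in>set l. (\<lambda>(g, a, b). (\<integral>x. g x \<partial>\<kappa> \<omega>) \<in> {of_rat a<..<of_rat b}) p} = \<kappa> -` A \<inter> space M"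
      using \<kappa> by (auto simp: l(1) V_def radon_measures_def)
    finally show ?thesis .
  qed
  have basic: "\<exists>A\<in>\<C>. \<eta> \<in> A \<and> A \<subseteq> {\<eta> \<in> radon_measures. (\<integral>x. f x \<partial>\<eta>) \<in> U}"
    if f: "compact_support f" and U: "open U" and \<eta>: "\<eta> \<in> radon_measures" "(\<integral>x. f x \<partial>\<eta>) \<in> U"
    for f :: "'a \<Rightarrow> real" and U \<eta>
  proof -
    obtain e where e: "0 < e" "ball (\<integral>x. f x \<partial>\<eta>) e \<subseteq> U" using U \<eta>(2) open_contains_ball by blast
    let ?K = "closure {x. f x \<noteq> 0}"
    obtain r where r: "?K \<subseteq> exh r" using compact_subset_exh f unfolding compact_support_def by blast
    obtain K where K: "compact K" "\<And>x. h r x \<noteq> 0 \<Longrightarrow> x \<in> K"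
      using h(1)[of r] closure_subset[of "{x. h r x \<noteq> 0}"] unfolding compact_support_def by blast
    define I where "I = (\<integral>x. h r x \<partial>\<eta>)"
    have I0: "0 \<le> I" unfolding I_def using h(2) by (intro integral_nonneg_AE) auto
    \<comment> \<open>As long as the integral of the cutoff is at most I + 1, exchanging f for its
      approximation changes the integral by at most d (I + 1) = e / 4.\<close>
    define d where "d = e / (4 * (I + 1))"
    have d: "0 < d" "d * (I + 1) = e / 4" using e(1) I0 by (auto simp: d_def field_simps)
    obtain t where t: "\<forall>x\<in>K. \<bar>f x - fun_val t x\<bar> < d"
      using fun_val_dense[OF K(1) continuous_on_subset[of UNIV f K] d(1)] f by (auto simp: compact_support_def)
    let ?g = "\<lambda>x. fun_val t x * h r x"
    have gD: "?g \<in> D" unfolding D_def by (rule image_eqI[of _ _ "(t, r)"]) auto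
    have fg: "\<bar>f x - ?g x\<bar> \<le> d * h r x" for x
    proof -
      have "f x = f x * h r x"
        using r h(4)[of x r] closure_subset[of "{x. f x \<noteq> 0}"] by (cases "f x = 0") auto
      then have "\<bar>f x - ?g x\<bar> = \<bar>f x - fun_val t x\<bar> * h r x"
        using h(2)[of r x] by (metis abs_mult abs_of_nonneg left_diff_distrib)
      also have "\<dots> \<le> d * h r x"
        using t K(2)[of x] h(2)[of r x] by (cases "h r x = 0") (auto intro!: mult_right_mono less_imp_le)
      finally show ?thesis .
    qed
    have int: "\<bar>(\<integral>x. f x \<partial>\<nu>) - (\<integral>x. ?g x \<partial>\<nu>)\<bar> \<le> d * (\<integral>x. h r x \<partial>\<nu>)" if "\<nu> \<in> radon_measures" for \<nu>
    proof -
      have R: "radon_measure euclidean \<nu>" using that by (simp add: radon_measures_def)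
      note CI = compact_support_integrable[OF R]
      have "\<bar>(\<integral>x. f x \<partial>\<nu>) - (\<integral>x. ?g x \<partial>\<nu>)\<bar> = \<bar>\<integral>x. f x - ?g x \<partial>\<nu>\<bar>"
        using CI[OF f] CI[OF Dc[OF gD]] by simp
      also have "\<dots> \<le> (\<integral>x. \<bar>f x - ?g x\<bar> \<partial>\<nu>)" by (rule integral_abs_bound)
      also have "\<dots> \<le> (\<integral>x. d * h r x \<partial>\<nu>)"
        using CI[OF f] CI[OF Dc[OF gD]] CI[OF h(1)] fg by (intro integral_mono) auto
      finally show ?thesis by simp
    qed
    let ?c = "\<integral>x. ?g x \<partial>\<eta>"
    have "?c - e / 4 < ?c" "?c < ?c + e / 4" "I - 1 < I" "I < I + 1" using e(1) by simp_all
    note dense = of_rat_dense[OF this(1)] of_rat_dense[OF this(2)] of_rat_dense[OF this(3)] of_rat_dense[OF this(4)]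
    obtain a where a: "?c - e / 4 < of_rat a" "of_rat a < ?c" using dense(1) by blast
    obtain b where b: "?c < of_rat b" "of_rat b < ?c + e / 4" using dense(2) by blast
    obtain a' where a': "of_rat a' < I" using dense(3) by blast
    obtain b' where b': "I < of_rat b'" "of_rat b' < I + 1" using dense(4) by blast
    \<comment> \<open>The second entry serves to keep the integral of the cutoff below I + 1; its
      lower end \<open>a'\<close> may be any rational number below I.\<close>
    let ?l = "[(?g, a, b), (h r, a', b')]"
    have "V ?l \<in> \<C>" unfolding \<C>_def using gD hD by (intro imageI) auto
    moreover have "\<eta> \<in> V ?l" using \<eta>(1) a b a' b' by (auto simp: V_def I_def)
    moreover have "(\<integral>x. f x \<partial>\<nu>) \<in> U" if nu: "\<nu> \<in> V ?l" for \<nu>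
    proof -
      have n: "\<nu> \<in> radon_measures" "of_rat a < (\<integral>x. ?g x \<partial>\<nu>)" "(\<integral>x. ?g x \<partial>\<nu>) < of_rat b" "(\<integral>x. h r x \<partial>\<nu>) < I + 1"
        using nu b' by (auto simp: V_def)
      have "d * (\<integral>x. h r x \<partial>\<nu>) \<le> d * (I + 1)" "d * I \<le> d * (I + 1)" using n(4) d(1) by auto
      then have "\<bar>(\<integral>x. f x \<partial>\<nu>) - (\<integral>x. ?g x \<partial>\<nu>)\<bar> \<le> e / 4" "\<bar>(\<integral>x. f x \<partial>\<eta>) - ?c\<bar> \<le> e / 4"
        using int[OF n(1)] int[OF \<eta>(1)] d(2) unfolding I_def[symmetric] by linarith+
      then have "\<bar>(\<integral>x. f x \<partial>\<nu>) - (\<integral>x. f x \<partial>\<eta>)\<bar> < e" using a b n(2,3) e(1) by linarith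
      then show ?thesis using e(2) by (auto simp: dist_real_def subset_iff abs_minus_commute)
    qed
    moreover have "V ?l \<subseteq> radon_measures" by (auto simp: V_def)
    ultimately show ?thesis by blast
  qed
  have gen: "\<forall>\<eta>\<in>W. \<exists>A\<in>\<C>. \<eta> \<in> A \<and> A \<subseteq> W"
    if "generate_topology_on {{\<eta> \<in> radon_measures. (\<integral>x. f x \<partial>\<eta>) \<in> U} | (f :: 'a \<Rightarrow> real) U.
        continuous_on UNIV f \<and> compact (closure {x. f x \<noteq> 0}) \<and> open U} W" for W
    using that
  proof induct
    case (Int a b)
    show ?case
    proof
      fix \<eta> assume "\<eta> \<in> a \<inter> b"
      then obtain A B where "A \<in> \<C>" "\<eta> \<in> A" "A \<subseteq> a" "B \<in> \<C>" "\<eta> \<in> B" "B \<subseteq> b" using Int by blast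
      then show "\<exists>A\<in>\<C>. \<eta> \<in> A \<and> A \<subseteq> a \<inter> b" by (intro bexI[OF _ Cint[of A B]]) auto
    qed
  next
    case (UN K)
    show ?case
    proof
      fix \<eta> assume "\<eta> \<in> \<Union>K"
      then obtain k where k: "k \<in> K" "\<eta> \<in> k" by blast
      then obtain A where "A \<in> \<C>" "\<eta> \<in> A" "A \<subseteq> k" using UN by blast
      then show "\<exists>A\<in>\<C>. \<eta> \<in> A \<and> A \<subseteq> \<Union>K" using k(1) by blast
    qed
  next
    case (Basis s)
    then obtain f :: "'a \<Rightarrow> real" and U where "s = {\<eta> \<in> radon_measures. (\<integral>x. f x \<partial>\<eta>) \<in> U}" "compact_support f" "open U"
      unfolding compact_support_def by blast
    then show ?case using basic by auto
  qed simp
  show ?thesis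
  proof (rule measurable_borel_of)
    show "\<kappa> \<omega> \<in> topspace vague_topology" if "\<omega> \<in> space M" for \<omega>
      using \<kappa>[OF that] by (simp add: topspace_vague radon_measures_def)
    fix W :: "'a measure set" assume W: "openin vague_topology W"
    then have g: "\<forall>\<eta>\<in>W. \<exists>A\<in>\<C>. \<eta> \<in> A \<and> A \<subseteq> W"
      unfolding vague_topology_def openin_topology_generated_by_iff by (rule gen)
    have "W = \<Union>{A\<in>\<C>. A \<subseteq> W}"
    proof (intro equalityI subsetI)
      fix \<eta> assume "\<eta> \<in> W"
      with g obtain A where "A \<in> \<C>" "\<eta> \<in> A" "A \<subseteq> W" by metis
      then show "\<eta> \<in> \<Union>{A\<in>\<C>. A \<subseteq> W}" by (intro UnionI[of A]) simp_all
    qed blast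
    from arg_cong[OF this, of "\<lambda>W. \<kappa> -` W \<inter> space M"]
    have "\<kappa> -` W \<inter> space M = (\<Union>A\<in>{A\<in>\<C>. A \<subseteq> W}. \<kappa> -` A \<inter> space M)"
      by (simp only: vimage_Union UN_extend_simps)
    also have "\<dots> \<in> sets M"
      using cC Cmeas by (intro sets.countable_UN') (auto intro: countable_subset)
    finally show "\<kappa> -` W \<inter> space M \<in> sets M" .
  qed
qed

end

section \<open>Powers of a random measure and their means\<close>

lemma nn_integral_kernel:
  assumes sets: "\<And>\<omega>. \<omega> \<in> space M \<Longrightarrow> sets (\<kappa> \<omega>) = sets N"
    and meas: "\<And>A. A \<in> sets N \<Longrightarrow> (\<lambda>\<omega>. emeasure (\<kappa> \<omega>) A) \<in> borel_measurable M"
    and eq: "\<And>A. A \<in> sets N \<Longrightarrow> emeasure N A = (\<integral>\<^sup>+\<omega>. emeasure (\<kappa> \<omega>) A \<partial>M)"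
    and f: "f \<in> borel_measurable N"
  shows "(\<integral>\<^sup>+x. f x \<partial>N) = (\<integral>\<^sup>+\<omega>. (\<integral>\<^sup>+x. f x \<partial>\<kappa> \<omega>) \<partial>M)"
proof -
  have spc: "space (\<kappa> \<omega>) = space N" if "\<omega> \<in> space M" for \<omega>
    using sets_eq_imp_space_eq[OF sets[OF that]] .
  have mc: "borel_measurable (\<kappa> \<omega>) = (borel_measurable N :: ('b \<Rightarrow> ennreal) set)" if "\<omega> \<in> space M" for \<omega>
    by (rule measurable_cong_sets) (simp_all add: sets[OF that])
  have km: "(\<lambda>\<omega>. \<integral>\<^sup>+x. f x \<partial>\<kappa> \<omega>) \<in> borel_measurable M" if "f \<in> borel_measurable N" for f :: "'b \<Rightarrow> ennreal"
    by (rule measurable_kernel_nn_integral[OF sets meas that])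
  show ?thesis
    using f
  proof (induct rule: borel_measurable_induct)
    case (cong f g)
    have "(\<integral>\<^sup>+x. f x \<partial>\<kappa> \<omega>) = (\<integral>\<^sup>+x. g x \<partial>\<kappa> \<omega>)" if "\<omega> \<in> space M" for \<omega>
      by (intro nn_integral_cong) (use cong spc[OF that] in auto)
    then have "(\<integral>\<^sup>+\<omega>. (\<integral>\<^sup>+x. f x \<partial>\<kappa> \<omega>) \<partial>M) = (\<integral>\<^sup>+\<omega>. (\<integral>\<^sup>+x. g x \<partial>\<kappa> \<omega>) \<partial>M)"
      by (rule nn_integral_cong)
    moreover have "(\<integral>\<^sup>+x. f x \<partial>N) = (\<integral>\<^sup>+x. g x \<partial>N)"
      by (rule nn_integral_cong) (rule cong)
    ultimately show ?case using cong by simp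
  next
    case (set A)
    have "(\<integral>\<^sup>+\<omega>. (\<integral>\<^sup>+x. indicator A x \<partial>\<kappa> \<omega>) \<partial>M) = (\<integral>\<^sup>+\<omega>. emeasure (\<kappa> \<omega>) A \<partial>M)"
      by (rule nn_integral_cong) (simp add: sets set)
    then show ?case using set eq by simp
  next
    case (mult u c)
    have "(\<integral>\<^sup>+\<omega>. (\<integral>\<^sup>+x. c * u x \<partial>\<kappa> \<omega>) \<partial>M) = (\<integral>\<^sup>+\<omega>. c * (\<integral>\<^sup>+x. u x \<partial>\<kappa> \<omega>) \<partial>M)"
      by (intro nn_integral_cong nn_integral_cmult) (simp add: mc mult)
    also have "\<dots> = c * (\<integral>\<^sup>+\<omega>. (\<integral>\<^sup>+x. u x \<partial>\<kappa> \<omega>) \<partial>M)"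
      by (rule nn_integral_cmult) (rule km, fact)
    finally show ?case using mult by (simp add: nn_integral_cmult)
  next
    case (add u v)
    have "(\<integral>\<^sup>+\<omega>. (\<integral>\<^sup>+x. v x + u x \<partial>\<kappa> \<omega>) \<partial>M) = (\<integral>\<^sup>+\<omega>. (\<integral>\<^sup>+x. v x \<partial>\<kappa> \<omega>) + (\<integral>\<^sup>+x. u x \<partial>\<kappa> \<omega>) \<partial>M)"
      by (intro nn_integral_cong nn_integral_add) (simp_all add: mc add)
    also have "\<dots> = (\<integral>\<^sup>+\<omega>. (\<integral>\<^sup>+x. v x \<partial>\<kappa> \<omega>) \<partial>M) + (\<integral>\<^sup>+\<omega>. (\<integral>\<^sup>+x. u x \<partial>\<kappa> \<omega>) \<partial>M)"
      by (rule nn_integral_add) (rule km, fact)+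
    finally show ?case using add by (simp add: nn_integral_add)
  next
    case (seq U)
    have i: "incseq (\<lambda>i \<omega>. \<integral>\<^sup>+x. U i x \<partial>\<kappa> \<omega>)"
      using seq unfolding incseq_def le_fun_def by (intro allI impI nn_integral_mono) auto
    have "(\<integral>\<^sup>+x. (SUP i. U i) x \<partial>\<kappa> \<omega>) = (SUP i. \<integral>\<^sup>+x. U i x \<partial>\<kappa> \<omega>)" if "\<omega> \<in> space M" for \<omega>
    proof -
      have "(\<integral>\<^sup>+x. (SUP i. U i x) \<partial>\<kappa> \<omega>) = (SUP i. \<integral>\<^sup>+x. U i x \<partial>\<kappa> \<omega>)"
        by (rule nn_integral_monotone_convergence_SUP) (use seq mc[OF that] in auto)
      then show ?thesis by (simp add: SUP_apply image_comp)
    qed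
    then have "(\<integral>\<^sup>+\<omega>. (\<integral>\<^sup>+x. (SUP i. U i) x \<partial>\<kappa> \<omega>) \<partial>M) = (\<integral>\<^sup>+\<omega>. (SUP i. \<integral>\<^sup>+x. U i x \<partial>\<kappa> \<omega>) \<partial>M)"
      by (rule nn_integral_cong)
    also have "\<dots> = (SUP i. \<integral>\<^sup>+\<omega>. (\<integral>\<^sup>+x. U i x \<partial>\<kappa> \<omega>) \<partial>M)"
      by (rule nn_integral_monotone_convergence_SUP[OF i]) (rule km, rule seq)
    also have "\<dots> = (SUP i. \<integral>\<^sup>+x. U i x \<partial>N)" using seq by simp
    also have "\<dots> = (\<integral>\<^sup>+x. (SUP i. U i x) \<partial>N)"
      by (rule nn_integral_monotone_convergence_SUP[symmetric]) (use seq in auto)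
    finally show ?case by (simp add: SUP_apply image_comp)
  qed
qed

text \<open>The countable cover of the space by members of the generator is what allows unrestricted
  sides: a cylinder is a countable union of boxes all of whose sides belong to the
  generator.\<close>

lemma sigma_sets_boxes:
  fixes \<E> :: "'a::topological_space set set"
  assumes "sigma_sets UNIV \<E> = sets borel" "range C \<subseteq> \<E>" "(\<Union>i::nat. C i) = UNIV"
  shows "sigma_sets (PiE {..<n} (\<lambda>_. UNIV)) {PiE {..<n} A |A. A \<in> {..<n} \<rightarrow> \<E>} = sets (pow_borel n)"
proof -
  have s: "sets (sigma UNIV \<E>) = sets borel" using assms(1) by simp
  let ?P = "{{f\<in>PiE {..<n} (\<lambda>_. UNIV). \<forall>i\<in>j. f i \<in> A i} | A j. j \<in> {{..<n}} \<and> A \<in> Pi j (\<lambda>_. \<E>)}"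
  have "sets (pow_borel n :: (nat \<Rightarrow> 'a) measure) = sets (PiM {..<n} (\<lambda>_. sigma UNIV \<E>))"
    by (rule sets_PiM_cong) (simp_all only: s)
  also have "\<dots> = sets (sigma (PiE {..<n} (\<lambda>_. UNIV)) ?P)"
  proof (rule sets_PiM_sigma)
    show "\<exists>S\<subseteq>\<E>. countable S \<and> UNIV = \<Union>S"
      by (rule exI[of _ "range C"]) (use assms(2,3) in auto)
  qed auto
  also have "?P = {PiE {..<n} A |A. A \<in> {..<n} \<rightarrow> \<E>}"
  proof -
    have "{f\<in>PiE {..<n} (\<lambda>_. UNIV). \<forall>i\<in>{..<n}. f i \<in> A i} = PiE {..<n} A" for A :: "nat \<Rightarrow> 'a set"
      unfolding PiE_def Pi_def by blast
    note eq = this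
    have "?P = {{f\<in>PiE {..<n} (\<lambda>_. UNIV). \<forall>i\<in>{..<n}. f i \<in> A i} | A. A \<in> {..<n} \<rightarrow> \<E>}"
      by blast
    then show ?thesis by (simp only: eq)
  qed
  finally have "sets (pow_borel n :: (nat \<Rightarrow> 'a) measure) =
      sets (sigma (PiE {..<n} (\<lambda>_. UNIV)) {PiE {..<n} A |A. A \<in> {..<n} \<rightarrow> \<E>})" .
  moreover have "{PiE {..<n} A |A. A \<in> {..<n} \<rightarrow> \<E>} \<subseteq> Pow (PiE {..<n} (\<lambda>_. UNIV))"
    by (auto simp: PiE_iff)
  ultimately show ?thesis by (simp only: sets_measure_of)
qed

context loc_compact
begin

definition tpow :: "nat \<Rightarrow> 'a measure \<Rightarrow> (nat \<Rightarrow> 'a) measure" where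
  "tpow n \<eta> = PiM {..<n} (\<lambda>_. \<eta>)"

abbreviation radon :: "'a measure \<Rightarrow> bool" where
  "radon \<equiv> radon_measure euclidean"

lemma radon_product_sigma_finite: "radon \<eta> \<Longrightarrow> product_sigma_finite (\<lambda>_. \<eta>)"
  using radon_sigma_finite by (simp add: product_sigma_finite_def)

lemma sets_tpow: "radon \<eta> \<Longrightarrow> sets (tpow n \<eta>) = sets (pow_borel n)"
  unfolding tpow_def by (rule sets_PiM_cong) (simp_all add: radon_euclideanD)

lemma space_tpow: "radon \<eta> \<Longrightarrow> space (tpow n \<eta>) = PiE {..<n} (\<lambda>_. UNIV)"
  by (simp add: tpow_def space_PiM radon_euclideanD)

lemma tpow_box:
  assumes "radon \<eta>" "\<And>l. l < n \<Longrightarrow> A l \<in> sets borel"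
  shows "emeasure (tpow n \<eta>) (PiE {..<n} A) = (\<Prod>l<n. emeasure \<eta> (A l))"
  unfolding tpow_def
  by (rule product_sigma_finite.emeasure_PiM[OF radon_product_sigma_finite]) (use assms radon_euclideanD(1) in auto)

lemma tpow_sigma_finite: "radon \<eta> \<Longrightarrow> sigma_finite_measure (tpow n \<eta>)"
  unfolding tpow_def by (rule product_sigma_finite.sigma_finite[OF radon_product_sigma_finite]) auto

lemma incseq_cube_exh: "incseq (\<lambda>r. cube n (exh r))"
  using incseq_exh unfolding cube_def incseq_def by (intro allI impI PiE_mono) auto

lemma UN_cube_exh: "(\<Union>r. cube n (exh r)) = PiE {..<n} (\<lambda>_. UNIV)"
proof (intro equalityI subsetI)
  fix x :: "nat \<Rightarrow> 'a" assume x: "x \<in> PiE {..<n} (\<lambda>_. UNIV)"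
  have "compact (x ` {..<n})" by (simp add: finite_imp_compact)
  then obtain r where "x ` {..<n} \<subseteq> exh r" using compact_subset_exh by blast
  then have "x \<in> cube n (exh r)" using x by (auto simp: cube_def PiE_iff)
  then show "x \<in> (\<Union>r. cube n (exh r))" by blast
qed (auto simp: cube_def PiE_iff)

lemma emeasure_SUP_cube_exh:
  assumes "sets N = sets (pow_borel n)" "B \<in> sets (pow_borel n)"
  shows "emeasure N B = (SUP r. emeasure N (B \<inter> cube n (exh r)))"
proof -
  have "(SUP r. emeasure N (B \<inter> cube n (exh r))) = emeasure N (\<Union>r. B \<inter> cube n (exh r))"
  proof (rule SUP_emeasure_incseq)
    show "range (\<lambda>r. B \<inter> cube n (exh r)) \<subseteq> sets N" using assms cube_sets[OF exh_borel] by auto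
    show "incseq (\<lambda>r. B \<inter> cube n (exh r))" using incseq_cube_exh[of n] unfolding incseq_def by blast
  qed
  also have "(\<Union>r. B \<inter> cube n (exh r)) = B"
    using UN_cube_exh[of n] sets.sets_into_space[OF assms(2)] by (simp add: space_PiM Int_absorb2 flip: Int_UN_distrib)
  finally show ?thesis by simp
qed

lemma sigma_sets_borel_boxes:
  "sigma_sets (PiE {..<n} (\<lambda>_. UNIV)) {PiE {..<n} A |A. A \<in> {..<n} \<rightarrow> sets (borel :: 'a measure)} = sets (pow_borel n)"
proof (rule sigma_sets_boxes[of _ "\<lambda>_. UNIV"])
  show "sigma_sets UNIV (sets (borel :: 'a measure)) = sets borel"
    using sets.sigma_sets_eq[of "borel :: 'a measure"] by simp
qed auto

lemma Int_stable_boxes: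
  assumes "Int_stable \<E>" shows "Int_stable {PiE {..<n} A |A. A \<in> {..<n::nat} \<rightarrow> \<E>}"
proof (rule Int_stableI)
  fix a b assume "a \<in> {PiE {..<n} A |A. A \<in> {..<n} \<rightarrow> \<E>}" "b \<in> {PiE {..<n} A |A. A \<in> {..<n} \<rightarrow> \<E>}"
  then obtain A B where AB: "a = PiE {..<n} A" "A \<in> {..<n} \<rightarrow> \<E>" "b = PiE {..<n} B" "B \<in> {..<n} \<rightarrow> \<E>" by blast
  show "a \<inter> b \<in> {PiE {..<n} A |A. A \<in> {..<n} \<rightarrow> \<E>}"
  proof (intro CollectI exI conjI)
    show "a \<inter> b = PiE {..<n} (\<lambda>i. A i \<inter> B i)" unfolding AB(1,3) by (rule PiE_Int)
    show "(\<lambda>i. A i \<inter> B i) \<in> {..<n} \<rightarrow> \<E>"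
      by (rule Pi_I, rule Int_stableD[OF assms]) (use AB(2,4) in \<open>simp_all add: Pi_iff\<close>)
  qed
qed

text \<open>Dynkin's argument for boxes inside the cubes over the exhaustion, where the powers of a
  Radon measure are finite.\<close>

lemma measurable_tpow:
  assumes \<kappa>: "\<And>\<omega>. \<omega> \<in> space M \<Longrightarrow> radon (\<kappa> \<omega>)"
    and meas: "\<And>A. A \<in> sets borel \<Longrightarrow> (\<lambda>\<omega>. emeasure (\<kappa> \<omega>) A) \<in> borel_measurable M"
    and B: "B \<in> sets (pow_borel n)"
  shows "(\<lambda>\<omega>. emeasure (tpow n (\<kappa> \<omega>)) B) \<in> borel_measurable M"
proof -
  let ?G = "{PiE {..<n} A |A. A \<in> {..<n} \<rightarrow> sets (borel :: 'a measure)}"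
  have box: "(\<lambda>\<omega>. emeasure (tpow n (\<kappa> \<omega>)) (PiE {..<n} A)) \<in> borel_measurable M"
    if "\<And>l. l < n \<Longrightarrow> A l \<in> sets borel" for A
  proof (rule measurable_eqI)
    show "emeasure (tpow n (\<kappa> \<omega>)) (PiE {..<n} A) = (\<Prod>l<n. emeasure (\<kappa> \<omega>) (A l))" if "\<omega> \<in> space M" for \<omega>
      by (rule tpow_box[OF \<kappa>[OF that]]) fact
    show "(\<lambda>\<omega>. \<Prod>l<n. emeasure (\<kappa> \<omega>) (A l)) \<in> borel_measurable M"
      by (rule borel_measurable_prod_ennreal) (use meas that in auto)
  qed
  have 1: "(\<lambda>\<omega>. emeasure (tpow n (\<kappa> \<omega>)) (B \<inter> cube n (exh r))) \<in> borel_measurable M" for r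
  proof (rule measurable_emeasure_Dynkin[where G="?G" and \<Omega>="PiE {..<n} (\<lambda>_. UNIV)"])
    show "Int_stable ?G" by (rule Int_stable_boxes) (auto simp: Int_stable_def)
    show "?G \<subseteq> Pow (PiE {..<n} (\<lambda>_. UNIV))" by (auto simp: PiE_iff)
    show "sets (tpow n (\<kappa> \<omega>)) = sigma_sets (PiE {..<n} (\<lambda>_. UNIV)) ?G" if "\<omega> \<in> space M" for \<omega>
      unfolding sigma_sets_borel_boxes by (rule sets_tpow[OF \<kappa>[OF that]])
    show "cube n (exh r) \<in> sigma_sets (PiE {..<n} (\<lambda>_. UNIV)) ?G"
      unfolding sigma_sets_borel_boxes by (rule cube_sets[OF exh_borel])
    show "emeasure (tpow n (\<kappa> \<omega>)) (cube n (exh r)) < \<infinity>" if "\<omega> \<in> space M" for \<omega>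
      using radon_euclideanD(4)[OF \<kappa>[OF that] exh_relcompact] exh_borel
      by (simp add: cube_def tpow_box[OF \<kappa>[OF that]] power_less_top_ennreal)
    show "B \<in> sigma_sets (PiE {..<n} (\<lambda>_. UNIV)) ?G"
      unfolding sigma_sets_borel_boxes by (rule B)
    show "(\<lambda>\<omega>. emeasure (tpow n (\<kappa> \<omega>)) (cube n (exh r))) \<in> borel_measurable M"
      unfolding cube_def by (rule box) (rule exh_borel)
    fix A assume "A \<in> ?G"
    then obtain A' where A': "A = PiE {..<n} A'" "A' \<in> {..<n} \<rightarrow> sets borel" by blast
    show "(\<lambda>\<omega>. emeasure (tpow n (\<kappa> \<omega>)) (A \<inter> cube n (exh r))) \<in> borel_measurable M"
      unfolding cube_def A'(1) PiE_Int by (rule box) (use A'(2) exh_borel in auto)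
  qed
  show ?thesis
  proof (rule measurable_eqI)
    show "emeasure (tpow n (\<kappa> \<omega>)) B = (SUP r. emeasure (tpow n (\<kappa> \<omega>)) (B \<inter> cube n (exh r)))" if "\<omega> \<in> space M" for \<omega>
      by (rule emeasure_SUP_cube_exh[OF sets_tpow[OF \<kappa>[OF that]] B])
  qed (rule borel_measurable_SUP, simp, rule 1)
qed

text \<open>Both sides are measures in B that agree and are finite on boxes with sides in the
  intersection-stable generator. Kernel and generator are left general for two uses: a random
  measure with relatively compact Borel sides, and \<open>realize\<close> with sides in the
  countable semiring.\<close>

lemma emeasure_eq_tpow_mean:
  assumes \<kappa>: "\<And>\<omega>. \<omega> \<in> space M \<Longrightarrow> radon (\<kappa> \<omega>)"
    and meas: "\<And>A. A \<in> sets borel \<Longrightarrow> (\<lambda>\<omega>. emeasure (\<kappa> \<omega>) A) \<in> borel_measurable M"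
    and E: "Int_stable \<E>" "sigma_sets UNIV \<E> = sets borel"
    and C: "range C \<subseteq> \<E>" "(\<Union>i::nat. C i) = UNIV"
    and N: "sets N = sets (pow_borel n)"
    and fin: "\<And>A. (\<And>l. l < n \<Longrightarrow> A l \<in> \<E>) \<Longrightarrow> emeasure N (PiE {..<n} A) \<noteq> \<infinity>"
    and eq: "\<And>A. (\<And>l. l < n \<Longrightarrow> A l \<in> \<E>) \<Longrightarrow>
       emeasure N (PiE {..<n} A) = (\<integral>\<^sup>+\<omega>. (\<Prod>l<n. emeasure (\<kappa> \<omega>) (A l)) \<partial>M)"
    and B: "B \<in> sets (pow_borel n)"
  shows "emeasure N B = (\<integral>\<^sup>+\<omega>. emeasure (tpow n (\<kappa> \<omega>)) B \<partial>M)"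
proof -
  let ?X = "PiE {..<n} (\<lambda>_. UNIV) :: (nat \<Rightarrow> 'a) set"
  let ?G = "{PiE {..<n} A |A. A \<in> {..<n} \<rightarrow> \<E>}"
  \<comment> \<open>The mean power as a measure in its own right, so that uniqueness on a generator
    can be applied to it.\<close>
  define Q where "Q = measure_of ?X (sets (pow_borel n)) (\<lambda>B. \<integral>\<^sup>+\<omega>. emeasure (tpow n (\<kappa> \<omega>)) B \<partial>M)"
  have ss: "sigma_sets ?X (sets (pow_borel n)) = sets (pow_borel n :: (nat \<Rightarrow> 'a) measure)"
    using sets.sigma_sets_eq[of "pow_borel n :: (nat \<Rightarrow> 'a) measure"] by (simp add: space_PiM)
  have sub: "sets (pow_borel n) \<subseteq> Pow ?X"
    using sets.space_closed[of "pow_borel n :: (nat \<Rightarrow> 'a) measure"] by (simp add: space_PiM)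
  have sQ: "sets Q = sets (pow_borel n)" unfolding Q_def using ss sub by simp
  have tm: "(\<lambda>\<omega>. emeasure (tpow n (\<kappa> \<omega>)) B) \<in> borel_measurable M" if "B \<in> sets (pow_borel n)" for B
    by (rule measurable_tpow[OF \<kappa> meas that])
  have eQ: "emeasure Q B = (\<integral>\<^sup>+\<omega>. emeasure (tpow n (\<kappa> \<omega>)) B \<partial>M)" if B: "B \<in> sets (pow_borel n)" for B
  proof (rule emeasure_measure_of[OF Q_def])
    show "sets (pow_borel n) \<subseteq> Pow ?X" by (rule sub)
    show "B \<in> sets Q" using B sQ by simp
    show "positive (sets Q) (\<lambda>B. \<integral>\<^sup>+\<omega>. emeasure (tpow n (\<kappa> \<omega>)) B \<partial>M)" by (simp add: positive_def)
    show "countably_additive (sets Q) (\<lambda>B. \<integral>\<^sup>+\<omega>. emeasure (tpow n (\<kappa> \<omega>)) B \<partial>M)"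
    proof (rule countably_additiveI)
      fix A :: "nat \<Rightarrow> (nat \<Rightarrow> 'a) set" assume A: "range A \<subseteq> sets Q" "disjoint_family A"
      have "(\<Sum>i. \<integral>\<^sup>+\<omega>. emeasure (tpow n (\<kappa> \<omega>)) (A i) \<partial>M) = (\<integral>\<^sup>+\<omega>. (\<Sum>i. emeasure (tpow n (\<kappa> \<omega>)) (A i)) \<partial>M)"
        by (rule nn_integral_suminf[symmetric], rule tm) (use A sQ in auto)
      also have "\<dots> = (\<integral>\<^sup>+\<omega>. emeasure (tpow n (\<kappa> \<omega>)) (\<Union>i. A i) \<partial>M)"
        by (intro nn_integral_cong suminf_emeasure) (use A sQ sets_tpow[OF \<kappa>] in auto)
      finally show "(\<Sum>i. \<integral>\<^sup>+\<omega>. emeasure (tpow n (\<kappa> \<omega>)) (A i) \<partial>M) = (\<integral>\<^sup>+\<omega>. emeasure (tpow n (\<kappa> \<omega>)) (\<Union>i. A i) \<partial>M)" .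
    qed
  qed
  have Eb: "\<E> \<subseteq> sets borel" using E(2) by auto
  have sG: "sigma_sets ?X ?G = sets (pow_borel n)" by (rule sigma_sets_boxes[OF E(2) C])
  have "N = Q"
  proof (rule measure_eqI_generator_eq_countable)
    show "Int_stable ?G" by (rule Int_stable_boxes[OF E(1)])
    show "?G \<subseteq> Pow ?X" by (auto simp: PiE_iff)
    show "sets N = sigma_sets ?X ?G" "sets Q = sigma_sets ?X ?G" using sG N sQ by simp_all
    fix a assume "a \<in> ?G"
    then obtain A where A: "a = PiE {..<n} A" "\<And>l. l < n \<Longrightarrow> A l \<in> \<E>" by blast
    have "emeasure Q a = (\<integral>\<^sup>+\<omega>. emeasure (tpow n (\<kappa> \<omega>)) (PiE {..<n} A) \<partial>M)"
      unfolding A(1) by (rule eQ, rule sets_PiM_I_finite) (use A(2) Eb in auto)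
    also have "\<dots> = (\<integral>\<^sup>+\<omega>. (\<Prod>l<n. emeasure (\<kappa> \<omega>) (A l)) \<partial>M)"
      by (intro nn_integral_cong tpow_box \<kappa>) (use A(2) Eb in auto)
    also have "\<dots> = emeasure N a" unfolding A(1) by (rule eq[symmetric]) (rule A(2))
    finally show "emeasure N a = emeasure Q a" by simp
  next
    let ?A = "(\<lambda>f. PiE {..<n} (\<lambda>i. C (f i))) ` (PiE {..<n} (\<lambda>_. UNIV))"
    show "?A \<subseteq> ?G" using C(1) by blast
    show "countable ?A" by (intro countable_image countable_PiE) auto
    show "\<Union>?A = ?X"
    proof (intro equalityI subsetI)
      fix x :: "nat \<Rightarrow> 'a" assume x: "x \<in> ?X"
      have "\<forall>l. \<exists>i. x l \<in> C i" using C(2) by blast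
      then obtain f where f: "\<And>l. x l \<in> C (f l)" by metis
      have "x \<in> PiE {..<n} (\<lambda>i. C (restrict f {..<n} i))" using x f by (auto simp: PiE_iff)
      then show "x \<in> \<Union>?A" by (intro UnionI[of "PiE {..<n} (\<lambda>i. C (restrict f {..<n} i))"] imageI) auto
    qed (auto simp: PiE_iff)
    fix a assume "a \<in> ?A"
    then obtain f where a: "a = PiE {..<n} (\<lambda>i. C (f i))" by blast
    show "emeasure N a \<noteq> \<infinity>" unfolding a by (rule fin) (use C(1) in auto)
  qed
  then show ?thesis using eQ[OF B] by simp
qed

lemma sigma_sets_relcompact: "sigma_sets UNIV relcompact_borel = sets (borel :: 'a measure)"
proof (intro equalityI)
  show "sigma_sets UNIV relcompact_borel \<subseteq> sets (borel :: 'a measure)"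
    using sets.sigma_sets_subset[of relcompact_borel "borel :: 'a measure"] by (auto simp: relcompact_borel_def)
  show "sets (borel :: 'a measure) \<subseteq> sigma_sets UNIV relcompact_borel"
  proof
    fix A :: "'a set" assume A: "A \<in> sets borel"
    have "A = (\<Union>r. A \<inter> exh r)" using UN_exh by auto
    moreover have "A \<inter> exh r \<in> relcompact_borel" for r
      by (rule relcompact_borel_subset[OF exh_relcompact[of r]]) (use A exh_borel in auto)
    then have "(\<Union>r. A \<inter> exh r) \<in> sigma_sets UNIV relcompact_borel"
      by (intro sigma_sets.Union sigma_sets.Basic)
    ultimately show "A \<in> sigma_sets UNIV relcompact_borel" by metis
  qed
qed

lemma Int_stable_relcompact: "Int_stable (relcompact_borel :: 'a set set)"
  by (rule Int_stableI) (rule relcompact_borel_subset, auto simp: relcompact_borel_def)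

lemma radon_pow_finite:
  assumes N: "radon_measure (pow_top n) N" and A: "\<And>l. l < n \<Longrightarrow> A l \<in> (relcompact_borel :: 'a set set)"
  shows "emeasure N (PiE {..<n} A) < \<infinity>"
proof -
  have "\<forall>l. \<exists>K. l < n \<longrightarrow> compact K \<and> A l \<subseteq> K" using A unfolding relcompact_borel_iff by blast
  then obtain K where K: "\<And>l. l < n \<Longrightarrow> compact (K l)" "\<And>l. l < n \<Longrightarrow> A l \<subseteq> K l" by metis
  have c: "compactin (pow_top n) (PiE {..<n} K)"
    unfolding pow_top_def compactin_PiE using K(1) by (auto simp: compactin_euclidean_iff)
  have s: "sets N = sets (pow_borel n)" using N by (simp add: radon_measure_def sets_borel_of_pow_top)
  have "emeasure N (PiE {..<n} A) \<le> emeasure N (PiE {..<n} K)"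
  proof (rule emeasure_mono)
    show "PiE {..<n} A \<subseteq> PiE {..<n} K" by (rule PiE_mono) (use K(2) in simp)
    show "PiE {..<n} K \<in> sets N" unfolding s by (rule sets_PiM_I_finite) (use K(1) in \<open>auto simp: compact_imp_closed\<close>)
  qed
  also have "\<dots> < \<infinity>" using N c by (simp add: radon_measure_def)
  finally show ?thesis .
qed

lemma symmetric_radon_sequenceD:
  assumes "symmetric_radon_sequence (M :: nat \<Rightarrow> (nat \<Rightarrow> 'a) measure)"
  shows "radon_measure (pow_top n) (M n)" "sets (M n) = sets (pow_borel n)" "space (M n) = PiE {..<n} (\<lambda>_. UNIV)"
    "\<sigma> permutes {..<n} \<Longrightarrow> distr (M n) (M n) (\<lambda>x. x \<circ> \<sigma>) = M n"
    "emeasure (M 0) {\<lambda>_. undefined} = 1"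
proof -
  show r: "radon_measure (pow_top n) (M n)" using assms by (simp add: symmetric_radon_sequence_def)
  show s: "sets (M n) = sets (pow_borel n)" using r by (simp add: radon_measure_def sets_borel_of_pow_top)
  show "space (M n) = PiE {..<n} (\<lambda>_. UNIV)" using sets_eq_imp_space_eq[OF s] by (simp add: space_PiM)

  show "\<sigma> permutes {..<n} \<Longrightarrow> distr (M n) (M n) (\<lambda>x. x \<circ> \<sigma>) = M n"
    using assms by (simp add: symmetric_radon_sequence_def symmetric_measure_def)
  show "emeasure (M 0) {\<lambda>_. undefined} = 1"
    using assms by (simp add: symmetric_radon_sequence_def topspace_pow_top)
qed

lemma random_measureD:
  assumes "random_measure (\<mu> :: 'a measure measure)"
  shows "prob_space \<mu>" "space \<mu> = radon_measures" "\<eta> \<in> space \<mu> \<Longrightarrow> radon \<eta>"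
    "A \<in> sets borel \<Longrightarrow> (\<lambda>\<eta>. emeasure \<eta> A) \<in> borel_measurable \<mu>"
    "B \<in> sets (pow_borel n) \<Longrightarrow> (\<lambda>\<eta>. emeasure (tpow n \<eta>) B) \<in> borel_measurable \<mu>"
proof -
  have s: "sets \<mu> = sets (borel_of vague_topology)" using assms by (simp add: random_measure_def)
  have sp: "space \<mu> = radon_measures" using sets_eq_imp_space_eq[OF s] by (simp add: topspace_vague)
  have R: "radon \<eta>" if "\<eta> \<in> space \<mu>" for \<eta> using that by (simp add: sp radon_measures_def)
  have m: "(\<lambda>\<eta>. emeasure \<eta> A) \<in> borel_measurable \<mu>" if "A \<in> sets borel" for A :: "'a set"
    using measurable_vague_emeasure[OF that] by (simp add: measurable_cong_sets[OF s refl])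
  show "prob_space \<mu>" using assms by (simp add: random_measure_def)
  show "space \<mu> = radon_measures" by (rule sp)
  show "\<eta> \<in> space \<mu> \<Longrightarrow> radon \<eta>" by (rule R)
  show "A \<in> sets borel \<Longrightarrow> (\<lambda>\<eta>. emeasure \<eta> A) \<in> borel_measurable \<mu>" by (rule m)
  show "B \<in> sets (pow_borel n) \<Longrightarrow> (\<lambda>\<eta>. emeasure (tpow n \<eta>) B) \<in> borel_measurable \<mu>"
    by (rule measurable_tpow[OF R m])
qed

lemma moment_eq_tpow_mean:
  assumes \<mu>: "random_measure \<mu>" and M: "moment_sequence \<mu> M" and B: "B \<in> sets (pow_borel n)"
  shows "emeasure (M n) B = (\<integral>\<^sup>+\<eta>. emeasure (tpow n \<eta>) B \<partial>\<mu>)"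
proof (rule emeasure_eq_tpow_mean[where \<E>=relcompact_borel and C=exh])
  have S: "symmetric_radon_sequence M" using M by (simp add: moment_sequence_def)
  note D = symmetric_radon_sequenceD[OF S]
  show "sets (M n) = sets (pow_borel n)" by (rule D)
  show "emeasure (M n) (PiE {..<n} A) \<noteq> \<infinity>" if "\<And>l. l < n \<Longrightarrow> A l \<in> relcompact_borel" for A
    using radon_pow_finite[OF D(1), of n A] that by simp
  show "emeasure (M n) (PiE {..<n} A) = (\<integral>\<^sup>+\<eta>. (\<Prod>l<n. emeasure \<eta> (A l)) \<partial>\<mu>)"
    if "\<And>l. l < n \<Longrightarrow> A l \<in> relcompact_borel" for A
  proof (cases "n = 0")
    case True
    then show ?thesis using D(5) prob_space.emeasure_space_1[OF random_measureD(1)[OF \<mu>]] by simp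
  next
    case False
    then show ?thesis using M that by (simp add: moment_sequence_def)
  qed
qed (use random_measureD[OF \<mu>] Int_stable_relcompact sigma_sets_relcompact exh_relcompact UN_exh B in auto)

lemma nn_integral_moment:
  assumes \<mu>: "random_measure \<mu>" and M: "moment_sequence \<mu> M" and f: "f \<in> borel_measurable (pow_borel n)"
  shows "(\<integral>\<^sup>+x. f x \<partial>M n) = (\<integral>\<^sup>+\<eta>. (\<integral>\<^sup>+x. f x \<partial>tpow n \<eta>) \<partial>\<mu>)"
proof (rule nn_integral_kernel)
  have S: "symmetric_radon_sequence M" using M by (simp add: moment_sequence_def)
  note D = symmetric_radon_sequenceD[OF S]
  show "sets (tpow n \<eta>) = sets (M n)" if "\<eta> \<in> space \<mu>" for \<eta>
    using sets_tpow[OF random_measureD(3)[OF \<mu> that]] D(2) by simp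
  show "(\<lambda>\<eta>. emeasure (tpow n \<eta>) A) \<in> borel_measurable \<mu>" if "A \<in> sets (M n)" for A
    using that D(2) by (intro random_measureD(5)[OF \<mu>]) simp
  show "emeasure (M n) A = (\<integral>\<^sup>+\<eta>. emeasure (tpow n \<eta>) A \<partial>\<mu>)" if "A \<in> sets (M n)" for A
    using that D(2) by (intro moment_eq_tpow_mean[OF \<mu> M]) simp
  show "f \<in> borel_measurable (M n)" using f by (simp add: measurable_cong_sets[OF D(2) refl])
qed

lemma measurable_nn_integral_tpow:
  assumes \<mu>: "random_measure \<mu>" and f: "f \<in> borel_measurable (pow_borel n)"
  shows "(\<lambda>\<eta>. \<integral>\<^sup>+x. f x \<partial>tpow n \<eta>) \<in> borel_measurable \<mu>"
  by (rule measurable_kernel_nn_integral[OF _ _ f])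
    (use sets_tpow random_measureD[OF \<mu>] in auto)

end

section \<open>Simple point processes\<close>

definition const_tuples :: "nat \<Rightarrow> 'a set \<Rightarrow> (nat \<Rightarrow> 'a) set" where
  "const_tuples k B = {x \<in> PiE {..<k} (\<lambda>_. UNIV). x 0 \<in> B \<and> (\<forall>j<k. x j = x 0)}"

lemma measurable_pow_component: "i < n \<Longrightarrow> (\<lambda>x. x i) \<in> borel_measurable (pow_borel n)"
  by (rule measurable_component_singleton) simp

lemma const_tuples_sets:
  fixes B :: "'a::{second_countable_topology, t2_space} set"
  assumes B: "B \<in> sets borel"
  shows "const_tuples (Suc k) B \<in> sets (pow_borel (Suc k))"
proof -
  let ?P = "pow_borel (Suc k) :: (nat \<Rightarrow> 'a) measure"
  have 1: "{x \<in> space ?P. x 0 \<in> B} \<in> sets ?P"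
    using measurable_sets[OF measurable_pow_component[of 0 "Suc k"] B] by (simp add: vimage_def Int_def conj_commute)
  have 2: "{x \<in> space ?P. x j = x 0} \<in> sets ?P" if "j \<in> {..<Suc k}" for j
    by (rule measurable_equality_set) (use that measurable_pow_component in auto)
  have "const_tuples (Suc k) B = {x \<in> space ?P. x 0 \<in> B \<and> (\<forall>j\<in>{..<Suc k}. x j = x 0)}"
    unfolding const_tuples_def space_pow_borel by auto
  also have "\<dots> \<in> sets ?P" by (intro sets.sets_Collect 1 2 sets.sets_Collect_finite_All) auto
  finally show ?thesis .
qed

text \<open>Permutations, projections to blocks of coordinates and diagonal embeddings all have this
  form, so measurability and images are treated once for all of them.\<close>

definition pull :: "nat \<Rightarrow> (nat \<Rightarrow> nat) \<Rightarrow> (nat \<Rightarrow> 'a) \<Rightarrow> (nat \<Rightarrow> 'a)" where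
  "pull N s x = (\<lambda>j\<in>{..<N}. x (s j))"

lemma measurable_pull:
  assumes "\<And>j. j < N \<Longrightarrow> s j < n"
  shows "pull N s \<in> measurable (pow_borel n) (pow_borel N :: (nat \<Rightarrow> 'a::topological_space) measure)"
  unfolding pull_def[abs_def] by (rule measurable_restrict) (use assms measurable_pow_component in auto)

lemma pull_in_PiE: "pull N s x \<in> PiE {..<N} (\<lambda>_. UNIV)"
  by (simp add: pull_def)

lemma pull_inj:
  assumes s: "s ` {..<N} = {..<n}"
  shows "inj_on (pull N s) (PiE {..<n} (\<lambda>_. UNIV))"
proof (rule inj_onI)
  fix x y assume x: "x \<in> PiE {..<n} (\<lambda>_. UNIV)" and y: "y \<in> PiE {..<n} (\<lambda>_. UNIV)" and e: "pull N s x = pull N s y"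
  show "x = y"
  proof (rule PiE_ext[OF x y])
    fix i assume "i \<in> {..<n}"
    then obtain j where "j < N" "s j = i" using s by (metis imageE lessThan_iff)
    then show "x i = y i" using fun_cong[OF e, of j] by (simp add: pull_def)
  qed
qed

text \<open>A right inverse p of the index map s recovers the preimage: y lies in the image exactly
  if its entries depend on the index j only through s j and \<open>pull n p y\<close> lies in
  \<Delta>. These are measurable conditions on y.\<close>

lemma pull_image_sets:
  fixes \<Delta> :: "(nat \<Rightarrow> 'a::{second_countable_topology, t2_space}) set"
  assumes s: "s ` {..<N} = {..<n}" and D: "\<Delta> \<in> sets (pow_borel n)"
  shows "pull N s ` \<Delta> \<in> sets (pow_borel N)"
proof -
  let ?P = "pow_borel N :: (nat \<Rightarrow> 'a) measure"
  have "\<forall>l. \<exists>j. l < n \<longrightarrow> j < N \<and> s j = l" using s by (metis imageE lessThan_iff)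
  then obtain p where p: "\<And>l. l < n \<Longrightarrow> p l < N" "\<And>l. l < n \<Longrightarrow> s (p l) = l" by metis
  have sn: "s j < n" if "j < N" for j using s that by blast
  have "pull N s ` \<Delta> = {y \<in> space ?P. (\<forall>j\<in>{..<N}. y j = y (p (s j))) \<and> pull n p y \<in> \<Delta>}"
  proof (intro equalityI subsetI)
    fix y assume "y \<in> pull N s ` \<Delta>"
    then obtain x where x: "x \<in> \<Delta>" "y = pull N s x" by blast
    have xe: "x \<in> PiE {..<n} (\<lambda>_. UNIV)" using sets.sets_into_space[OF D] x(1) by (auto simp: space_PiM)
    have "pull n p y = x"
      by (rule PiE_ext[OF pull_in_PiE xe]) (use p in \<open>simp add: x(2) pull_def\<close>)
    then show "y \<in> {y \<in> space ?P. (\<forall>j\<in>{..<N}. y j = y (p (s j))) \<and> pull n p y \<in> \<Delta>}"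
      using x p sn pull_in_PiE by (simp add: space_PiM pull_def)
  next
    fix y assume "y \<in> {y \<in> space ?P. (\<forall>j\<in>{..<N}. y j = y (p (s j))) \<and> pull n p y \<in> \<Delta>}"
    then have y: "y \<in> PiE {..<N} (\<lambda>_. UNIV)" "\<And>j. j < N \<Longrightarrow> y j = y (p (s j))" "pull n p y \<in> \<Delta>"
      by (simp_all add: space_PiM)
    have "y = pull N s (pull n p y)"
    proof (rule PiE_ext[OF y(1) pull_in_PiE])
      fix j assume "j \<in> {..<N}"
      then have "pull N s (pull n p y) j = y (p (s j))" using sn[of j] by (simp add: pull_def)
      then show "y j = pull N s (pull n p y) j" using y(2) \<open>j \<in> {..<N}\<close> by simp
    qed
    then show "y \<in> pull N s ` \<Delta>" using y(3) by blast
  qed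
  also have "\<dots> \<in> sets ?P"
  proof -
    have 1: "{y \<in> space ?P. y j = y (p (s j))} \<in> sets ?P" if "j \<in> {..<N}" for j
      by (rule measurable_equality_set) (use that measurable_pow_component p(1) sn in auto)
    have 2: "{y \<in> space ?P. pull n p y \<in> \<Delta>} \<in> sets ?P"
      using measurable_sets[OF measurable_pull[of n p N] D] p(1) by (simp add: vimage_def Int_def conj_commute)
    show ?thesis by (intro sets.sets_Collect 1 2 sets.sets_Collect_finite_All) auto
  qed
  finally show ?thesis .
qed

definition block_index :: "nat \<Rightarrow> (nat \<Rightarrow> nat) \<Rightarrow> nat list" where
  "block_index k i = concat (map (\<lambda>l. replicate (i l) l) [0..<k])"

lemma length_block_index: "length (block_index k i) = (\<Sum>l<k. i l)"
  by (simp add: block_index_def length_concat comp_def interv_sum_list_conv_sum_set_nat atLeast0LessThan)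

lemma set_block_index: "(\<And>l. l < k \<Longrightarrow> 1 \<le> i l) \<Longrightarrow> set (block_index k i) = {..<k}"
  by (force simp: block_index_def)

lemma block_index_surj:
  assumes "\<And>l. l < k \<Longrightarrow> 1 \<le> i l"
  shows "(\<lambda>j. block_index k i ! j) ` {..<(\<Sum>l<k. i l)} = {..<k}"
proof -
  have "(\<lambda>j. block_index k i ! j) ` {..<length (block_index k i)} = set (block_index k i)"
    unfolding set_conv_nth by blast
  then show ?thesis using set_block_index[OF assms] by (simp only: length_block_index)
qed

lemma diag_point_eq_pull: "diag_point k i = pull (\<Sum>l<k. i l) (\<lambda>j. block_index k i ! j)"
  by (intro ext) (simp add: diag_point_def pull_def block_index_def)

text \<open>For a single point, the diagonal masses in (S) are masses of constant tuples, which
  \<open>tpow_const_tuples\<close> computes for the powers of a measure.\<close>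

lemma diag_mass_single:
  fixes B :: "'a set"
  assumes k: "1 \<le> k"
  shows "diag_mass M 1 (\<lambda>_. k) {x \<in> offdiag 1. x 0 \<in> B} = emeasure (M k) (const_tuples k B)"
proof -
  have bi: "block_index 1 (\<lambda>_. k) = replicate k 0" by (simp add: block_index_def)
  have dp: "diag_point 1 (\<lambda>_. k) x = (\<lambda>j\<in>{..<k}. x 0)" for x :: "nat \<Rightarrow> 'a"
  proof -
    have "diag_point 1 (\<lambda>_. k) x = pull (\<Sum>l<1::nat. k) (\<lambda>j. replicate k 0 ! j) x"
      unfolding bi[symmetric] by (rule fun_cong[OF diag_point_eq_pull])
    then show ?thesis by (intro ext) (simp add: pull_def)
  qed
  have "diag_point 1 (\<lambda>_. k) ` {x \<in> offdiag 1. x 0 \<in> B} = const_tuples k B"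
  proof (intro equalityI subsetI)
    fix y assume "y \<in> diag_point 1 (\<lambda>_. k) ` {x \<in> offdiag 1. x 0 \<in> B}"
    then obtain x where x: "x 0 \<in> B" "y = diag_point 1 (\<lambda>_. k) x" by blast
    have "y = (\<lambda>j\<in>{..<k}. x 0)"
      by (simp only: x(2) dp)
    then show "y \<in> const_tuples k B" using k x(1) by (simp add: const_tuples_def)
  next
    fix y assume "y \<in> const_tuples k B"
    then have y: "y \<in> PiE {..<k} (\<lambda>_. UNIV)" "y 0 \<in> B" "\<And>j. j < k \<Longrightarrow> y j = y 0"
      unfolding const_tuples_def by blast+
    let ?x = "\<lambda>j\<in>{..<1::nat}. y 0"
    have "y = diag_point 1 (\<lambda>_. k) ?x"
      unfolding dp
    proof (rule PiE_ext[OF y(1)])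
      show "(\<lambda>j\<in>{..<k}. (\<lambda>j\<in>{..<1::nat}. y 0) 0) \<in> PiE {..<k} (\<lambda>_. UNIV)" by simp
      show "y j = (\<lambda>j\<in>{..<k}. (\<lambda>j\<in>{..<1::nat}. y 0) 0) j" if "j \<in> {..<k}" for j
        using y(3)[of j] that by simp
    qed
    moreover have "?x \<in> {x \<in> offdiag 1. x 0 \<in> B}"
      using y(2) by (simp add: offdiag_def cube_def inj_on_def)
    ultimately show "y \<in> diag_point 1 (\<lambda>_. k) ` {x \<in> offdiag 1. x 0 \<in> B}" by blast
  qed
  then show ?thesis by (simp add: diag_mass_def)
qed

text \<open>The mass of {x} is the mass of the section at x of the diagonal, a measurable subset of
  the square.\<close>

lemma measurable_singleton_mass:
  fixes \<eta> :: "'a::{second_countable_topology, t2_space} measure"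
  assumes "sigma_finite_measure \<eta>" "sets \<eta> = sets borel"
  shows "(\<lambda>x. emeasure \<eta> {x}) \<in> borel_measurable borel"
proof -
  interpret sigma_finite_measure \<eta> by fact
  let ?Q = "{p \<in> space (borel \<Otimes>\<^sub>M \<eta>). fst p = (snd p :: 'a)}"
  have id: "(\<lambda>x. x) \<in> measurable \<eta> borel" using assms(2) by (simp add: measurable_ident_sets)
  have "?Q \<in> sets (borel \<Otimes>\<^sub>M \<eta>)"
    by (rule measurable_equality_set) (use measurable_compose[OF measurable_snd id] in auto)
  from measurable_emeasure_Pair[OF this]
  have "(\<lambda>x. emeasure \<eta> (Pair x -` ?Q)) \<in> borel_measurable borel" .
  moreover have "Pair x -` ?Q = {x}" for x
    using sets_eq_imp_space_eq[OF assms(2)] by (auto simp: space_pair_measure)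
  ultimately show ?thesis by simp
qed

context loc_compact
begin

text \<open>Coordinate 0 is integrated last: once it equals y, each of the other k coordinates has
  to be y, which contributes the k-th power of the mass of {y}.\<close>

lemma tpow_const_tuples:
  assumes \<eta>: "radon \<eta>" and B: "B \<in> sets borel"
  shows "emeasure (tpow (Suc k) \<eta>) (const_tuples (Suc k) B) = (\<integral>\<^sup>+x. indicator B x * emeasure \<eta> {x} ^ k \<partial>\<eta>)"
proof -
  interpret product_sigma_finite "\<lambda>_::nat. \<eta>" by (rule radon_product_sigma_finite[OF \<eta>])
  note D = radon_euclideanD[OF \<eta>]
  have I: "{..<Suc k} = insert 0 {1..k}" by auto
  let ?C = "const_tuples (Suc k) B"
  have Cs: "?C \<in> sets (PiM (insert 0 {1..k}) (\<lambda>_. \<eta>))"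
    using const_tuples_sets[OF B, of k] sets_tpow[OF \<eta>, of "Suc k"] by (simp add: tpow_def I)
  have "emeasure (tpow (Suc k) \<eta>) ?C = (\<integral>\<^sup>+x. indicator ?C x \<partial>PiM (insert 0 {1..k}) (\<lambda>_. \<eta>))"
    using Cs by (simp add: tpow_def I)
  also have "\<dots> = (\<integral>\<^sup>+y. (\<integral>\<^sup>+x. indicator ?C (x(0 := y)) \<partial>PiM {1..k} (\<lambda>_. \<eta>)) \<partial>\<eta>)"
    by (rule product_nn_integral_insert_rev) (use Cs in auto)
  also have "\<dots> = (\<integral>\<^sup>+y. indicator B y * emeasure \<eta> {y} ^ k \<partial>\<eta>)"
  proof (rule nn_integral_cong)
    fix y
    have bx: "PiE {1..k} (\<lambda>_. {y}) \<in> sets (PiM {1..k} (\<lambda>_. \<eta>))"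
      by (rule sets_PiM_I_finite) (simp_all add: D(1))
    have "(\<integral>\<^sup>+x. indicator ?C (x(0 := y)) \<partial>PiM {1..k} (\<lambda>_. \<eta>))
        = (\<integral>\<^sup>+x. indicator B y * indicator (PiE {1..k} (\<lambda>_. {y})) x \<partial>PiM {1..k} (\<lambda>_. \<eta>))"
    proof (rule nn_integral_cong)
      fix x assume "x \<in> space (PiM {1..k} (\<lambda>_. \<eta>))"
      then have x: "x \<in> extensional {1..k}" by (simp add: space_PiM PiE_iff)
      have "x(0 := y) \<in> ?C \<longleftrightarrow> y \<in> B \<and> x \<in> PiE {1..k} (\<lambda>_. {y})"
      proof -
        have "x(0 := y) \<in> PiE {..<Suc k} (\<lambda>_. UNIV)"
          using x by (simp add: PiE_iff extensional_def)
        moreover have "(\<forall>j<Suc k. (x(0 := y)) j = (x(0 := y)) 0) \<longleftrightarrow> (\<forall>j\<in>{1..k}. x j = y)"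
          by (auto simp: less_Suc_eq_le)
        moreover have "x \<in> PiE {1..k} (\<lambda>_. {y}) \<longleftrightarrow> (\<forall>j\<in>{1..k}. x j = y)"
          by (subst PiE_iff) (use x in simp)
        ultimately show ?thesis by (simp only: const_tuples_def mem_Collect_eq fun_upd_same simp_thms)
      qed
      then show "indicator ?C (x(0 := y)) = (indicator B y * indicator (PiE {1..k} (\<lambda>_. {y})) x :: ennreal)"
        by (simp add: indicator_def)
    qed
    also have "\<dots> = indicator B y * emeasure (PiM {1..k} (\<lambda>_. \<eta>)) (PiE {1..k} (\<lambda>_. {y}))"
      by (rule nn_integral_cmult_indicator[OF bx])
    also have "emeasure (PiM {1..k} (\<lambda>_. \<eta>)) (PiE {1..k} (\<lambda>_. {y})) = emeasure \<eta> {y} ^ k"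
      by (subst emeasure_PiM) (simp_all add: D(1))
    finally show "(\<integral>\<^sup>+x. indicator ?C (x(0 := y)) \<partial>PiM {1..k} (\<lambda>_. \<eta>)) = indicator B y * emeasure \<eta> {y} ^ k" .
  qed
  finally show ?thesis .
qed

lemma configuration_countable:
  assumes "\<gamma> \<in> (configurations :: 'a set set)"
  shows "countable \<gamma>" "finite (\<gamma> \<inter> exh r)"
proof -
  show f: "finite (\<gamma> \<inter> exh r)" for r
  proof -
    obtain K where "compact K" "exh r \<subseteq> K" using exh_relcompact[of r] unfolding relcompact_borel_iff by blast
    then show ?thesis using assms finite_subset[of "\<gamma> \<inter> exh r" "\<gamma> \<inter> K"] unfolding configurations_def by blast
  qed
  have "\<gamma> = (\<Union>r. \<gamma> \<inter> exh r)" using UN_exh by blast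
  then show "countable \<gamma>" using countable_UN[of UNIV "\<lambda>r. \<gamma> \<inter> exh r"] f by (metis countable_finite countableI_type)
qed

lemma emeasure_config_measure:
  assumes "A \<in> sets (borel :: 'a measure)"
  shows "emeasure (config_measure \<gamma>) A = emeasure (count_space UNIV) (\<gamma> \<inter> A)"
proof -
  have "emeasure (config_measure \<gamma>) A = emeasure (count_space \<gamma>) (A \<inter> \<gamma>)"
    unfolding config_measure_def by (subst emeasure_distr) (use assms in auto)
  also have "\<dots> = emeasure (count_space UNIV) (\<gamma> \<inter> A)"
    by (cases "finite (A \<inter> \<gamma>)") (auto simp: Int_commute emeasure_count_space)
  finally show ?thesis .
qed

lemma emeasure_config_singleton: "emeasure (config_measure \<gamma>) {x :: 'a} = indicator \<gamma> x"
  by (subst emeasure_config_measure) (auto simp: indicator_def)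

lemma atoms_config: "atoms (config_measure \<gamma>) = (\<gamma> :: 'a set)"
  by (simp add: atoms_def emeasure_config_singleton indicator_eq_0_iff)

lemma radon_config:
  assumes "\<gamma> \<in> (configurations :: 'a set set)" shows "radon (config_measure \<gamma>)"
proof (rule radon_euclideanI)
  show "sets (config_measure \<gamma>) = sets (borel :: 'a measure)" by (simp add: config_measure_def)
  show "emeasure (config_measure \<gamma>) K < \<infinity>" if "compact K" for K
    using assms that by (subst emeasure_config_measure)
      (auto simp: configurations_def compact_imp_closed of_nat_less_top)
qed

lemma simple_measures_subset: "simple_measures \<subseteq> (radon_measures :: 'a measure set)"
  using radon_config by (auto simp: simple_measures_def radon_measures_def)

lemma nn_integral_config:
  assumes "f \<in> borel_measurable (borel :: 'a measure)"
  shows "(\<integral>\<^sup>+x. f x \<partial>config_measure \<gamma>) = (\<integral>\<^sup>+x. f x \<partial>count_space \<gamma>)"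
  unfolding config_measure_def by (subst nn_integral_distr) (use assms in auto)

text \<open>That is, \<open>\<integral> (\<eta>{x} - 1)\<^sup>2 d\<eta>(x) = 0\<close> over each set of the exhaustion.\<close>

definition excess_free :: "'a measure \<Rightarrow> bool" where
  "excess_free \<eta> \<longleftrightarrow> (\<forall>r. emeasure (tpow 3 \<eta>) (const_tuples 3 (exh r)) + emeasure \<eta> (exh r)
      = 2 * emeasure (tpow 2 \<eta>) (const_tuples 2 (exh r)))"

lemma tpow_const_tuples_numeral:
  assumes \<eta>: "radon \<eta>" and B: "B \<in> sets borel"
  shows "emeasure (tpow 2 \<eta>) (const_tuples 2 B) = (\<integral>\<^sup>+x. indicator B x * emeasure \<eta> {x} \<partial>\<eta>)"
    "emeasure (tpow 3 \<eta>) (const_tuples 3 B) = (\<integral>\<^sup>+x. indicator B x * (emeasure \<eta> {x})\<^sup>2 \<partial>\<eta>)"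
    "emeasure (tpow 1 \<eta>) (const_tuples 1 B) = emeasure \<eta> B"
  using tpow_const_tuples[OF \<eta> B, of 1] tpow_const_tuples[OF \<eta> B, of 2] tpow_const_tuples[OF \<eta> B, of 0] B
    radon_euclideanD(1)[OF \<eta>] by (simp_all add: numeral_eq_Suc)

lemma square_excess:
  assumes "a < (\<top>::ennreal)"
  shows "2 * a \<le> a\<^sup>2 + 1" "a\<^sup>2 + 1 = 2 * a \<longleftrightarrow> a = 1"
proof -
  obtain b where b: "a = ennreal b" "0 \<le> b" using assms by (cases a) auto
  have l: "2 * a = ennreal (2 * b)" using b by (simp add: ennreal_mult)
  have r: "a\<^sup>2 + 1 = ennreal (b\<^sup>2 + 1)"
    using b by (simp add: power2_eq_square ennreal_mult ennreal_plus flip: ennreal_1)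
  have "(b - 1)\<^sup>2 = b\<^sup>2 + 1 - 2 * b" by (simp add: power2_eq_square algebra_simps)
  then have le: "2 * b \<le> b\<^sup>2 + 1" and eq: "b\<^sup>2 + 1 = 2 * b \<longleftrightarrow> b = 1"
    using zero_le_power2[of "b - 1"] zero_eq_power2[of "b - 1"] by linarith+
  show "2 * a \<le> a\<^sup>2 + 1" unfolding l r using le by (rule ennreal_leI)
  have "a\<^sup>2 + 1 = 2 * a \<longleftrightarrow> b\<^sup>2 + 1 = 2 * b" unfolding l r using b(2) by (subst ennreal_inj) auto
  then show "a\<^sup>2 + 1 = 2 * a \<longleftrightarrow> a = 1" using eq b by (metis ennreal_1 ennreal_inj zero_le_one)
qed

text \<open>The square of \<eta>{x} - 1 is replaced by a comparison of \<eta>{x}^2 + 1 with 2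
  \<eta>{x}, because subtraction in \<open>ennreal\<close> is truncated. The last claim supplies the
  finiteness under which the two sides may be subtracted.\<close>

lemma excess_nonneg:
  assumes \<eta>: "radon \<eta>"
  shows "2 * emeasure (tpow 2 \<eta>) (const_tuples 2 (exh r)) \<le>
    emeasure (tpow 3 \<eta>) (const_tuples 3 (exh r)) + emeasure \<eta> (exh r)"
    and "emeasure (tpow 3 \<eta>) (const_tuples 3 (exh r)) + emeasure \<eta> (exh r) =
      (\<integral>\<^sup>+x. indicator (exh r) x * ((emeasure \<eta> {x})\<^sup>2 + 1) \<partial>\<eta>)"
    and "2 * emeasure (tpow 2 \<eta>) (const_tuples 2 (exh r)) = (\<integral>\<^sup>+x. indicator (exh r) x * (2 * emeasure \<eta> {x}) \<partial>\<eta>)"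
    and "emeasure (tpow 2 \<eta>) (const_tuples 2 (exh r)) < \<infinity>"
proof -
  note D = radon_euclideanD[OF \<eta>] and T = tpow_const_tuples_numeral[OF \<eta> exh_borel[of r]]
  have [measurable]: "(\<lambda>x. emeasure \<eta> {x}) \<in> borel_measurable \<eta>"
    using measurable_singleton_mass[OF radon_sigma_finite[OF \<eta>] D(1)] by (simp add: measurable_cong_sets[OF D(1) refl])
  have [measurable]: "exh r \<in> sets \<eta>" using D(1) exh_borel by simp
  have "(\<integral>\<^sup>+x. indicator (exh r) x * ((emeasure \<eta> {x})\<^sup>2 + 1) \<partial>\<eta>)
     = (\<integral>\<^sup>+x. indicator (exh r) x * (emeasure \<eta> {x})\<^sup>2 + indicator (exh r) x \<partial>\<eta>)"
    by (simp add: distrib_left)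
  then show 1: "emeasure (tpow 3 \<eta>) (const_tuples 3 (exh r)) + emeasure \<eta> (exh r) =
      (\<integral>\<^sup>+x. indicator (exh r) x * ((emeasure \<eta> {x})\<^sup>2 + 1) \<partial>\<eta>)"
    unfolding T by (simp add: nn_integral_add)
  show 2: "2 * emeasure (tpow 2 \<eta>) (const_tuples 2 (exh r)) = (\<integral>\<^sup>+x. indicator (exh r) x * (2 * emeasure \<eta> {x}) \<partial>\<eta>)"
    unfolding T by (subst nn_integral_cmult[symmetric]) (simp_all add: mult_ac)
  show "2 * emeasure (tpow 2 \<eta>) (const_tuples 2 (exh r)) \<le>
    emeasure (tpow 3 \<eta>) (const_tuples 3 (exh r)) + emeasure \<eta> (exh r)"
    unfolding 1 2
    by (intro nn_integral_mono mult_left_mono square_excess) (use D(3)[of "{_}"] in \<open>simp_all add: less_top\<close>)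
  have "emeasure (tpow 2 \<eta>) (const_tuples 2 (exh r)) \<le> (\<integral>\<^sup>+x. indicator (exh r) x * emeasure \<eta> (exh r) \<partial>\<eta>)"
    unfolding T by (intro nn_integral_mono) (auto split: split_indicator intro!: emeasure_mono)
  also have "\<dots> = emeasure \<eta> (exh r) * emeasure \<eta> (exh r)" by (simp add: nn_integral_multc)
  also have "\<dots> < \<infinity>" using D(4)[OF exh_relcompact[of r]] by (simp add: ennreal_mult_less_top)
  finally show "emeasure (tpow 2 \<eta>) (const_tuples 2 (exh r)) < \<infinity>" .
qed

text \<open>A nonnegative excess with integral 0 vanishes almost everywhere, so almost every point
  has mass 1. Hence \<eta> lives on the set \<gamma> of points of mass 1; compact sets have finite
  mass, so they contain only finitely many of these points, and \<eta> counts the points of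
  \<gamma>.\<close>

lemma simple_iff_excess_free:
  assumes \<eta>: "radon \<eta>"
  shows "\<eta> \<in> simple_measures \<longleftrightarrow> excess_free \<eta>"
proof
  assume "\<eta> \<in> simple_measures"
  then obtain \<gamma> where g: "\<gamma> \<in> configurations" "\<eta> = config_measure \<gamma>" by (auto simp: simple_measures_def)
  note D = radon_euclideanD[OF \<eta>]
  have m: "(\<lambda>x. emeasure \<eta> {x}) \<in> borel_measurable borel"
    by (rule measurable_singleton_mass[OF radon_sigma_finite[OF \<eta>] D(1)])
  show "excess_free \<eta>"
    unfolding excess_free_def excess_nonneg(2,3)[OF \<eta>]
  proof
    fix r
    have m1: "(\<lambda>x. indicator (exh r) x * ((emeasure \<eta> {x})\<^sup>2 + 1)) \<in> borel_measurable borel"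
      "(\<lambda>x. indicator (exh r) x * (2 * emeasure \<eta> {x})) \<in> borel_measurable borel"
      using m exh_borel[of r] by measurable
    show "(\<integral>\<^sup>+x. indicator (exh r) x * ((emeasure \<eta> {x})\<^sup>2 + 1) \<partial>\<eta>) = (\<integral>\<^sup>+x. indicator (exh r) x * (2 * emeasure \<eta> {x}) \<partial>\<eta>)"
      using m1 unfolding g(2)
      by (subst (1 2) nn_integral_config) (auto intro!: nn_integral_cong simp: emeasure_config_singleton)
  qed
next
  assume e: "excess_free \<eta>"
  note D = radon_euclideanD[OF \<eta>]
  have m: "(\<lambda>x. emeasure \<eta> {x}) \<in> borel_measurable borel"
    by (rule measurable_singleton_mass[OF radon_sigma_finite[OF \<eta>] D(1)])
  have [measurable]: "(\<lambda>x. emeasure \<eta> {x}) \<in> borel_measurable \<eta>"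
    using m by (simp add: measurable_cong_sets[OF D(1) refl])
  have one: "AE x in \<eta>. x \<in> exh r \<longrightarrow> emeasure \<eta> {x} = 1" for r
  proof -
    have [measurable]: "exh r \<in> sets \<eta>" using D(1) exh_borel by simp
    let ?f = "\<lambda>x. indicator (exh r) x * ((emeasure \<eta> {x})\<^sup>2 + 1)" and ?g = "\<lambda>x. indicator (exh r) x * (2 * emeasure \<eta> {x})"
    have le: "?g x \<le> ?f x" for x
      using D(3)[of "{x}"] by (intro mult_left_mono square_excess) (simp_all add: less_top)
    have "2 * emeasure (tpow 2 \<eta>) (const_tuples 2 (exh r)) < \<top>"
      using excess_nonneg(4)[OF \<eta>, of r] by (simp add: ennreal_mult_less_top)
    then have gf: "(\<integral>\<^sup>+x. ?g x \<partial>\<eta>) \<noteq> \<infinity>" unfolding excess_nonneg(3)[OF \<eta>] by simp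
    have "(\<integral>\<^sup>+x. ?f x - ?g x \<partial>\<eta>) = (\<integral>\<^sup>+x. ?f x \<partial>\<eta>) - (\<integral>\<^sup>+x. ?g x \<partial>\<eta>)"
      by (rule nn_integral_diff) (use gf le in auto)
    also have "\<dots> = 0"
      using e gf unfolding excess_free_def excess_nonneg(2,3)[OF \<eta>] by simp
    finally have "AE x in \<eta>. ?f x - ?g x = 0" by (subst (asm) nn_integral_0_iff_AE) auto
    then show ?thesis
    proof (rule AE_mp, intro AE_I2 impI)
      fix x assume "?f x - ?g x = 0" "x \<in> exh r"
      moreover have fin: "emeasure \<eta> {x} < \<top>" using D(3)[of "{x}"] by simp
      then have "2 * emeasure \<eta> {x} < \<top>" by (simp add: ennreal_mult_less_top)
      ultimately have "(emeasure \<eta> {x})\<^sup>2 + 1 \<le> 2 * emeasure \<eta> {x}"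
        by (simp add: ennreal_minus_eq_0)
      then show "emeasure \<eta> {x} = 1"
        using square_excess[OF fin] by (metis order_antisym)
    qed
  qed
  have "AE x in \<eta>. \<forall>r. x \<in> exh r \<longrightarrow> emeasure \<eta> {x} = 1" unfolding AE_all_countable using one by blast
  then have one: "AE x in \<eta>. emeasure \<eta> {x} = 1"
    by (rule AE_mp) (use UN_exh in \<open>intro AE_I2, blast\<close>)
  define \<gamma> where "\<gamma> = {x. emeasure \<eta> {x} = 1}"
  have gb: "\<gamma> \<in> sets borel"
    using measurable_sets[OF m, of "{1}"] by (simp add: \<gamma>_def vimage_def)
  have fin: "finite (\<gamma> \<inter> K)" if "compact K" for K
  proof (rule ccontr)
    assume inf: "infinite (\<gamma> \<inter> K)"
    obtain N :: nat where N: "emeasure \<eta> K < of_nat N"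
      using D(3)[OF \<open>compact K\<close>] ennreal_Ex_less_of_nat by auto
    obtain F where F: "F \<subseteq> \<gamma> \<inter> K" "finite F" "card F = N"
      using infinite_arbitrarily_large[OF inf] by blast
    have "of_nat N = (\<Sum>x\<in>F. emeasure \<eta> {x})" using F by (simp add: \<gamma>_def subset_iff)
    also have "\<dots> = emeasure \<eta> F" using F(2) by (intro emeasure_eq_sum_singleton[symmetric]) (auto simp: D(1))
    also have "\<dots> \<le> emeasure \<eta> K" using F(1) that by (intro emeasure_mono) (auto simp: D(1) compact_imp_closed)
    finally show False using N by simp
  qed
  then have gc: "\<gamma> \<in> configurations" by (simp add: configurations_def)
  have "\<eta> = config_measure \<gamma>"
  proof (rule measure_eqI)
    show "sets \<eta> = sets (config_measure \<gamma>)" using D(1) by (simp add: config_measure_def)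
    fix A assume "A \<in> sets \<eta>"
    then have A: "A \<in> sets borel" using D(1) by simp
    have "emeasure \<eta> A = emeasure \<eta> (\<gamma> \<inter> A)"
      by (rule emeasure_eq_AE) (use one A gb D(1) in \<open>auto simp: \<gamma>_def elim!: AE_mp\<close>)
    also have "\<dots> = (\<integral>\<^sup>+x. emeasure \<eta> {x} \<partial>count_space (\<gamma> \<inter> A))"
      by (rule emeasure_countable_singleton) (use D(1) configuration_countable(1)[OF gc] in \<open>auto intro: countable_subset\<close>)
    also have "\<dots> = (\<integral>\<^sup>+x. 1 \<partial>count_space (\<gamma> \<inter> A))" by (rule nn_integral_cong) (simp add: \<gamma>_def)
    also have "\<dots> = emeasure (config_measure \<gamma>) A"
      unfolding emeasure_config_measure[OF A] by (cases "finite (\<gamma> \<inter> A)") (simp_all add: emeasure_count_space)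
    finally show "emeasure \<eta> A = emeasure (config_measure \<gamma>) A" .
  qed
  then show "\<eta> \<in> simple_measures" using gc by (auto simp: simple_measures_def)
qed

text \<open>As an image of the configurations this set is not visibly measurable;
  \<open>excess_free\<close> describes it by countably many equations between measurable
  functions.\<close>

lemma simple_measures_sets:
  assumes \<mu>: "random_measure \<mu>"
  shows "simple_measures \<in> sets (\<mu> :: 'a measure measure)"
proof -
  note R = random_measureD[OF \<mu>]
  have c: "const_tuples 2 (exh r) \<in> sets (pow_borel 2)" "const_tuples 3 (exh r) \<in> sets (pow_borel 3)" for r
    using const_tuples_sets[OF exh_borel[of r], of 1] const_tuples_sets[OF exh_borel[of r], of 2]
    by (simp_all add: numeral_eq_Suc)
  have [measurable]: "(\<lambda>\<eta>. emeasure (tpow 2 \<eta>) (const_tuples 2 (exh r))) \<in> borel_measurable \<mu>"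
    "(\<lambda>\<eta>. emeasure (tpow 3 \<eta>) (const_tuples 3 (exh r))) \<in> borel_measurable \<mu>"
    "(\<lambda>\<eta>. emeasure \<eta> (exh r)) \<in> borel_measurable \<mu>" for r
    by (rule R c exh_borel)+
  have "simple_measures = {\<eta> \<in> space \<mu>. excess_free \<eta>}"
    using simple_iff_excess_free simple_measures_subset R(2,3) by blast
  also have "\<dots> \<in> sets \<mu>" unfolding excess_free_def by measurable
  finally show ?thesis .
qed

theorem simplicity_identity_imp_simple:
  assumes \<mu>: "random_measure (\<mu> :: 'a measure measure)" and M: "moment_sequence \<mu> M" and S: "simplicity_identity M"
  shows "simple_point_process \<mu>"
proof -
  interpret prob_space \<mu> by (rule random_measureD(1)[OF \<mu>])
  note R = random_measureD[OF \<mu>]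
  have sym: "symmetric_radon_sequence M" using M by (simp add: moment_sequence_def)
  have "AE \<eta> in \<mu>. emeasure (tpow 3 \<eta>) (const_tuples 3 (exh r)) + emeasure \<eta> (exh r)
      = 2 * emeasure (tpow 2 \<eta>) (const_tuples 2 (exh r))" for r
  proof -
    have c: "const_tuples 1 (exh r) \<in> sets (pow_borel 1)" "const_tuples 2 (exh r) \<in> sets (pow_borel 2)"
      "const_tuples 3 (exh r) \<in> sets (pow_borel 3)"
      using const_tuples_sets[OF exh_borel[of r], of 0] const_tuples_sets[OF exh_borel[of r], of 1] const_tuples_sets[OF exh_borel[of r], of 2]
      by (simp_all add: numeral_eq_Suc)
    have [measurable]: "(\<lambda>\<eta>. emeasure (tpow 2 \<eta>) (const_tuples 2 (exh r))) \<in> borel_measurable \<mu>"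
      "(\<lambda>\<eta>. emeasure (tpow 3 \<eta>) (const_tuples 3 (exh r))) \<in> borel_measurable \<mu>"
      "(\<lambda>\<eta>. emeasure \<eta> (exh r)) \<in> borel_measurable \<mu>"
      by (rule R c exh_borel)+
    let ?\<Delta> = "{x \<in> offdiag 1. x 0 \<in> exh r}"
    have "{x \<in> space (pow_borel 1). x 0 \<in> exh r} \<in> sets (pow_borel 1)"
      using measurable_sets[OF measurable_pow_component[of 0 1] exh_borel[of r]] by (simp add: vimage_def Int_def conj_commute)
    then have "offdiag 1 \<inter> {x \<in> space (pow_borel 1). x 0 \<in> exh r} \<in> sets (pow_borel 1)"
      using offdiag_sets by blast
    also have "offdiag 1 \<inter> {x \<in> space (pow_borel 1). x 0 \<in> exh r} = ?\<Delta>"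
      by (auto simp: offdiag_def cube_def space_PiM)
    finally have \<Delta>: "?\<Delta> \<in> sets (offdiag_borel 1)" by (auto simp: sets_offdiag_borel)
    \<comment> \<open>This is (S) for one point, with k repetitions against one.\<close>
    have k: "emeasure (M k) (const_tuples k (exh r)) = emeasure (M 1) (const_tuples 1 (exh r))" if "1 \<le> k" for k
      using S[unfolded simplicity_identity_def, rule_format, of 1 "\<lambda>_. k" ?\<Delta>] \<Delta> that
        diag_mass_single[OF that, of M "exh r"] diag_mass_single[of 1 M "exh r"] by simp
    have M1: "emeasure (M 1) (const_tuples 1 (exh r)) = (\<integral>\<^sup>+\<eta>. emeasure \<eta> (exh r) \<partial>\<mu>)"
      unfolding moment_eq_tpow_mean[OF \<mu> M c(1)]
      by (rule nn_integral_cong) (rule tpow_const_tuples_numeral(3)[OF R(3) exh_borel])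
    have "emeasure (M 1) (const_tuples 1 (exh r)) \<le> emeasure (M 1) (PiE {..<1} (\<lambda>_. exh r))"
    proof (rule emeasure_mono)
      show "const_tuples 1 (exh r) \<subseteq> PiE {..<1} (\<lambda>_. exh r)"
        unfolding const_tuples_def PiE_def Pi_def by auto
      show "PiE {..<1} (\<lambda>_. exh r) \<in> sets (M 1)"
        unfolding symmetric_radon_sequenceD(2)[OF sym] by (rule sets_PiM_I_finite) (auto intro: exh_borel)
    qed
    also have "\<dots> < \<infinity>" by (rule radon_pow_finite[OF symmetric_radon_sequenceD(1)[OF sym]]) (rule exh_relcompact)
    finally have fin: "emeasure (M 1) (const_tuples 1 (exh r)) < \<infinity>" .
    let ?f = "\<lambda>\<eta>. emeasure (tpow 3 \<eta>) (const_tuples 3 (exh r)) + emeasure \<eta> (exh r)"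
    let ?g = "\<lambda>\<eta>. 2 * emeasure (tpow 2 \<eta>) (const_tuples 2 (exh r))"
    have If: "(\<integral>\<^sup>+\<eta>. ?f \<eta> \<partial>\<mu>) = 2 * emeasure (M 1) (const_tuples 1 (exh r))"
      using k[of 3] M1 by (simp add: nn_integral_add moment_eq_tpow_mean[OF \<mu> M c(3), symmetric] mult_2)
    have Ig: "(\<integral>\<^sup>+\<eta>. ?g \<eta> \<partial>\<mu>) = 2 * emeasure (M 1) (const_tuples 1 (exh r))"
      using k[of 2] by (simp add: nn_integral_cmult moment_eq_tpow_mean[OF \<mu> M c(2), symmetric])
    have g: "(\<integral>\<^sup>+\<eta>. ?g \<eta> \<partial>\<mu>) \<noteq> \<infinity>" unfolding Ig using fin by (simp add: ennreal_mult_eq_top_iff)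
    \<comment> \<open>An inequality that holds pointwise between functions with the same finite
      expectation is an equality almost surely.\<close>
    have le: "AE \<eta> in \<mu>. ?g \<eta> \<le> ?f \<eta>" using excess_nonneg(1)[OF R(3)] by (intro AE_I2)
    have "(\<integral>\<^sup>+\<eta>. ?f \<eta> - ?g \<eta> \<partial>\<mu>) = (\<integral>\<^sup>+\<eta>. ?f \<eta> \<partial>\<mu>) - (\<integral>\<^sup>+\<eta>. ?g \<eta> \<partial>\<mu>)"
      by (rule nn_integral_diff[OF _ _ g le]) auto
    also have "\<dots> = 0" unfolding If Ig[symmetric] using g by simp
    finally have "AE \<eta> in \<mu>. ?f \<eta> - ?g \<eta> = 0" by (subst (asm) nn_integral_0_iff_AE) auto
    moreover have "AE \<eta> in \<mu>. ?g \<eta> \<noteq> \<infinity>"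
      using excess_nonneg(4)[OF R(3)] by (intro AE_I2) (simp add: ennreal_mult_eq_top_iff less_top)
    ultimately show ?thesis
      using le by eventually_elim (metis ennreal_minus_eq_0 infinity_ennreal_def order_antisym)
  qed
  then have "AE \<eta> in \<mu>. excess_free \<eta>" unfolding excess_free_def by (simp add: AE_all_countable)
  then have "AE \<eta> in \<mu>. \<eta> \<in> simple_measures"
    by (rule AE_mp) (use simple_iff_excess_free[OF R(3)] in \<open>intro AE_I2, blast\<close>)
  then have "prob simple_measures = 1" using AE_in_set_eq_1[OF simple_measures_sets[OF \<mu>]] by simp
  then show ?thesis using \<mu> by (simp add: simple_point_process_def emeasure_eq_measure)
qed

text \<open>Checked on boxes, where the counting measure on a finite power of a countable set is the
  product of the counting measures.\<close>

lemma tpow_config: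
  assumes g: "\<gamma> \<in> (configurations :: 'a set set)"
  shows "tpow n (config_measure \<gamma>) = distr (count_space (PiE {..<n} (\<lambda>_. \<gamma>))) (pow_borel n) (\<lambda>x. x)"
proof -
  note c = configuration_countable(1)[OF g]
  note R = radon_config[OF g]
  interpret product_sigma_finite "\<lambda>_::nat. config_measure \<gamma>" by (rule radon_product_sigma_finite[OF R])
  interpret C: product_sigma_finite "\<lambda>_::nat. count_space \<gamma>"
    using sigma_finite_measure_count_space_countable[OF c] by (simp add: product_sigma_finite_def)
  have idm: "(\<lambda>x. x) \<in> measurable (count_space (PiE {..<n} (\<lambda>_. \<gamma>))) (pow_borel n)"
    by (simp add: space_PiM PiE_iff Pi_iff)
  have "distr (count_space (PiE {..<n} (\<lambda>_. \<gamma>))) (pow_borel n) (\<lambda>x. x) = PiM {..<n} (\<lambda>_. config_measure \<gamma>)"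
  proof (rule PiM_eqI)
    show "sets (distr (count_space (PiE {..<n} (\<lambda>_. \<gamma>))) (pow_borel n) (\<lambda>x. x)) = sets (PiM {..<n} (\<lambda>_. config_measure \<gamma>))"
      using sets_tpow[OF R, of n] by (simp add: tpow_def)
    fix A assume A: "\<And>i. i \<in> {..<n} \<Longrightarrow> A i \<in> sets (config_measure \<gamma>)"
    then have Ab: "\<And>i. i < n \<Longrightarrow> A i \<in> sets borel" by (simp add: config_measure_def)
    have "emeasure (distr (count_space (PiE {..<n} (\<lambda>_. \<gamma>))) (pow_borel n) (\<lambda>x. x)) (PiE {..<n} A)
       = emeasure (count_space (PiE {..<n} (\<lambda>_. \<gamma>))) (PiE {..<n} A \<inter> PiE {..<n} (\<lambda>_. \<gamma>))"
      by (subst emeasure_distr[OF idm]) (use Ab in \<open>auto intro!: sets_PiM_I_finite\<close>)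
    also have "\<dots> = emeasure (PiM {..<n} (\<lambda>_. count_space \<gamma>)) (PiE {..<n} (\<lambda>i. A i \<inter> \<gamma>))"
      using c by (simp add: count_space_PiM_finite PiE_Int)
    also have "\<dots> = (\<Prod>i<n. emeasure (count_space \<gamma>) (A i \<inter> \<gamma>))" by (subst C.emeasure_PiM) auto
    also have "\<dots> = (\<Prod>i<n. emeasure (config_measure \<gamma>) (A i))"
      by (rule prod.cong[OF refl]) (use Ab in \<open>simp add: config_measure_def emeasure_distr\<close>)
    finally show "emeasure (distr (count_space (PiE {..<n} (\<lambda>_. \<gamma>))) (pow_borel n) (\<lambda>x. x)) (PiE {..<n} A)
       = (\<Prod>i\<in>{..<n}. emeasure (config_measure \<gamma>) (A i))" .
  qed simp
  then show ?thesis by (simp add: tpow_def)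
qed

lemma emeasure_tpow_config:
  assumes g: "\<gamma> \<in> (configurations :: 'a set set)" and B: "B \<in> sets (pow_borel n)"
  shows "emeasure (tpow n (config_measure \<gamma>)) B = emeasure (count_space UNIV) (B \<inter> PiE {..<n} (\<lambda>_. \<gamma>))"
proof -
  have "(\<lambda>x. x) \<in> measurable (count_space (PiE {..<n} (\<lambda>_. \<gamma>))) (pow_borel n)"
    by (simp add: space_PiM PiE_iff Pi_iff)
  then show ?thesis
    unfolding tpow_config[OF g] using B
    by (cases "finite (B \<inter> PiE {..<n} (\<lambda>_. \<gamma>))") (auto simp: emeasure_distr emeasure_count_space)
qed

lemma nn_integral_tpow_config:
  assumes g: "\<gamma> \<in> (configurations :: 'a set set)" and f: "f \<in> borel_measurable (pow_borel n)"
  shows "(\<integral>\<^sup>+x. f x \<partial>tpow n (config_measure \<gamma>)) = (\<integral>\<^sup>+x. f x \<partial>count_space (PiE {..<n} (\<lambda>_. \<gamma>)))"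
proof -
  have "(\<lambda>x. x) \<in> measurable (count_space (PiE {..<n} (\<lambda>_. \<gamma>))) (pow_borel n)"
    by (simp add: space_PiM PiE_iff Pi_iff)
  then show ?thesis unfolding tpow_config[OF g] using f by (simp add: nn_integral_distr)
qed

lemma simple_point_process_AE:
  assumes "simple_point_process (\<mu> :: 'a measure measure)"
  shows "AE \<eta> in \<mu>. \<eta> \<in> simple_measures"
proof -
  have \<mu>: "random_measure \<mu>" and e: "emeasure \<mu> simple_measures = 1"
    using assms by (auto simp: simple_point_process_def)
  interpret prob_space \<mu> by (rule random_measureD(1)[OF \<mu>])
  show ?thesis
    using AE_in_set_eq_1[OF simple_measures_sets[OF \<mu>]] e by (simp add: emeasure_eq_measure)
qed

text \<open>For a configuration \<gamma>, the powers count tuples in \<gamma>. As s is onto, a tuple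
  has all entries in \<gamma> exactly if its pull has, and the pull is injective; so both sides
  count equally many tuples in almost every realization.\<close>

lemma emeasure_pull_image:
  assumes \<mu>: "simple_point_process (\<mu> :: 'a measure measure)" and M: "moment_sequence \<mu> M"
    and s: "s ` {..<N} = {..<n}" and D: "\<Delta> \<in> sets (pow_borel n)"
  shows "emeasure (M N) (pull N s ` \<Delta>) = emeasure (M n) \<Delta>"
proof -
  have R: "random_measure \<mu>" using \<mu> by (simp add: simple_point_process_def)
  note P = pull_image_sets[OF s D]
  have "emeasure (tpow N \<eta>) (pull N s ` \<Delta>) = emeasure (tpow n \<eta>) \<Delta>" if eta: "\<eta> \<in> simple_measures" for \<eta> :: "'a measure"
  proof -
    obtain \<gamma> where g: "\<gamma> \<in> configurations" "\<eta> = config_measure \<gamma>" using eta by (auto simp: simple_measures_def)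
    have sub: "\<Delta> \<subseteq> PiE {..<n} (\<lambda>_. UNIV)" using sets.sets_into_space[OF D] by (simp add: space_PiM)
    have i: "inj_on (pull N s) (\<Delta> \<inter> PiE {..<n} (\<lambda>_. \<gamma>))"
      by (rule inj_on_subset[OF pull_inj[OF s]]) (use sub in blast)
    have mem: "pull N s x \<in> PiE {..<N} (\<lambda>_. \<gamma>) \<longleftrightarrow> x \<in> PiE {..<n} (\<lambda>_. \<gamma>)" if "x \<in> \<Delta>" for x
    proof -
      have "x \<in> extensional {..<n}" using sub that by (auto simp: PiE_def)
      then have "x \<in> PiE {..<n} (\<lambda>_. \<gamma>) \<longleftrightarrow> (\<forall>i\<in>s ` {..<N}. x i \<in> \<gamma>)" unfolding s by (simp add: PiE_iff)
      then show ?thesis by (simp add: pull_def PiE_iff)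
    qed
    have "pull N s ` \<Delta> \<inter> PiE {..<N} (\<lambda>_. \<gamma>) = pull N s ` (\<Delta> \<inter> PiE {..<n} (\<lambda>_. \<gamma>))"
      using mem by blast
    then show ?thesis
      unfolding g(2) emeasure_tpow_config[OF g(1) P] emeasure_tpow_config[OF g(1) D]
      using i by (simp add: emeasure_count_space finite_image_iff card_image)
  qed
  then have "AE \<eta> in \<mu>. emeasure (tpow N \<eta>) (pull N s ` \<Delta>) = emeasure (tpow n \<eta>) \<Delta>"
    using simple_point_process_AE[OF \<mu>] by (auto elim!: AE_mp)
  then show ?thesis
    unfolding moment_eq_tpow_mean[OF R M P] moment_eq_tpow_mean[OF R M D] by (rule nn_integral_cong_AE)
qed

theorem simple_imp_simplicity_identity:
  assumes \<mu>: "simple_point_process (\<mu> :: 'a measure measure)" and M: "moment_sequence \<mu> M"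
  shows "simplicity_identity M"
  unfolding simplicity_identity_def
proof (intro allI impI ballI)
  fix n and i :: "nat \<Rightarrow> nat" and \<Delta> :: "(nat \<Rightarrow> 'a) set" assume i: "\<forall>l<n. 1 \<le> i l" and D: "\<Delta> \<in> sets (offdiag_borel n)"
  have D': "\<Delta> \<in> sets (pow_borel n)" using D by (simp add: sets_offdiag_borel)
  have "diag_mass M n j \<Delta> = emeasure (M n) \<Delta>" if "\<forall>l<n. 1 \<le> j l" for j :: "nat \<Rightarrow> nat"
    unfolding diag_mass_def diag_point_eq_pull
    by (rule emeasure_pull_image[OF \<mu> M block_index_surj D']) (use that in auto)
  then show "diag_mass M n i \<Delta> = diag_mass M n (\<lambda>_. 1) \<Delta>" using i by simp
qed

end

section \<open>Correlation measures\<close>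

lemma offdiag_iff: "x \<in> offdiag n \<longleftrightarrow> x \<in> extensional {..<n} \<and> inj_on x {..<n}"
  by (simp add: offdiag_def cube_def PiE_def)

lemma offdiag_permute:
  assumes "x \<in> offdiag n" "\<sigma> permutes {..<n}"
  shows "x \<circ> \<sigma> \<in> offdiag n" "(x \<circ> \<sigma>) ` {..<n} = x ` {..<n}"
proof -
  have im: "\<sigma> ` {..<n} = {..<n}" by (rule permutes_image[OF assms(2)])
  show "(x \<circ> \<sigma>) ` {..<n} = x ` {..<n}" by (metis im image_comp)
  show "x \<circ> \<sigma> \<in> offdiag n"
    unfolding offdiag_iff
  proof
    show "x \<circ> \<sigma> \<in> extensional {..<n}"
      using assms by (simp add: extensional_def offdiag_iff permutes_not_in)
    show "inj_on (x \<circ> \<sigma>) {..<n}"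
      using assms(1) im by (intro comp_inj_on permutes_inj_on[OF assms(2)]) (simp add: offdiag_iff)
  qed
qed

lemma offdiag_same_image:
  assumes x: "x \<in> offdiag n" and y: "y \<in> offdiag n" and e: "x ` {..<n} = y ` {..<n}"
  obtains \<sigma> where "\<sigma> permutes {..<n}" "y = x \<circ> \<sigma>"
proof -
  have ix: "inj_on x {..<n}" and iy: "inj_on y {..<n}" using x y by (auto simp: offdiag_iff)
  define \<sigma> where "\<sigma> i = (if i < n then inv_into {..<n} x (y i) else i)" for i
  have yi: "y i \<in> x ` {..<n}" if "i < n" for i using that e by auto
  have xs: "x (\<sigma> i) = y i" if "i < n" for i using f_inv_into_f[OF yi[OF that]] that by (simp add: \<sigma>_def)
  have sn: "\<sigma> i < n" if "i < n" for i using inv_into_into[OF yi[OF that]] that by (simp add: \<sigma>_def)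
  have "inj_on \<sigma> {..<n}"
  proof (rule inj_onI)
    fix i j assume "i \<in> {..<n}" "j \<in> {..<n}" "\<sigma> i = \<sigma> j"
    then show "i = j" using xs[of i] xs[of j] iy by (simp add: inj_on_def)
  qed
  then have "bij_betw \<sigma> {..<n} {..<n}"
    using sn by (intro bij_betw_imageI endo_inj_surj) auto
  then have "\<sigma> permutes {..<n}" by (rule bij_imp_permutes) (simp add: \<sigma>_def)
  moreover have "y = x \<circ> \<sigma>"
  proof
    fix i
    show "y i = (x \<circ> \<sigma>) i"
      using xs[of i] x y by (cases "i < n") (auto simp: offdiag_iff extensional_def \<sigma>_def)
  qed
  ultimately show ?thesis by (rule that)
qed

text \<open>The enumerations of an n-point set arise from any one of them by permutations of the
  indices, and different permutations give different enumerations.\<close>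

lemma card_offdiag_fiber:
  assumes x: "x \<in> offdiag n"
  shows "card {y \<in> offdiag n. y ` {..<n} = x ` {..<n}} = fact n"
    "finite {y \<in> offdiag n. y ` {..<n} = x ` {..<n}}"
proof -
  have eq: "{y \<in> offdiag n. y ` {..<n} = x ` {..<n}} = (\<lambda>\<sigma>. x \<circ> \<sigma>) ` {\<sigma>. \<sigma> permutes {..<n}}"
  proof (intro equalityI subsetI)
    fix y assume "y \<in> {y \<in> offdiag n. y ` {..<n} = x ` {..<n}}"
    then have "y \<in> offdiag n" "x ` {..<n} = y ` {..<n}" by auto
    then obtain \<sigma> where "\<sigma> permutes {..<n}" "y = x \<circ> \<sigma>" using offdiag_same_image[OF x] by metis
    then show "y \<in> (\<lambda>\<sigma>. x \<circ> \<sigma>) ` {\<sigma>. \<sigma> permutes {..<n}}" by blast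
  next
    fix y assume "y \<in> (\<lambda>\<sigma>. x \<circ> \<sigma>) ` {\<sigma>. \<sigma> permutes {..<n}}"
    then obtain \<sigma> where "\<sigma> permutes {..<n}" "y = x \<circ> \<sigma>" by blast
    then show "y \<in> {y \<in> offdiag n. y ` {..<n} = x ` {..<n}}"
      using offdiag_permute[OF x, of \<sigma>] by (simp only: mem_Collect_eq)
  qed
  have "inj_on (\<lambda>\<sigma>. x \<circ> \<sigma>) {\<sigma>. \<sigma> permutes {..<n}}"
  proof (rule inj_onI)
    fix \<sigma> \<tau> assume s: "\<sigma> \<in> {\<sigma>. \<sigma> permutes {..<n}}" and t: "\<tau> \<in> {\<sigma>. \<sigma> permutes {..<n}}" and e: "x \<circ> \<sigma> = x \<circ> \<tau>"
    show "\<sigma> = \<tau>"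
    proof
      fix i
      show "\<sigma> i = \<tau> i"
      proof (cases "i < n")
        case True
        then have "\<sigma> i < n" "\<tau> i < n" using s t permutes_in_image[of _ "{..<n}" i] by auto
        then show ?thesis using fun_cong[OF e, of i] x by (auto simp: offdiag_iff inj_on_def)
      next
        case False
        then show ?thesis using s t by (simp add: permutes_not_in)
      qed
    qed
  qed
  then show "card {y \<in> offdiag n. y ` {..<n} = x ` {..<n}} = fact n"
    unfolding eq by (simp add: card_image card_permutations)
  show "finite {y \<in> offdiag n. y ` {..<n} = x ` {..<n}}"
    unfolding eq by (simp add: finite_permutations)
qed

lemma card_offdiag_image: "x \<in> offdiag n \<Longrightarrow> card (x ` {..<n}) = n"
  by (simp add: offdiag_iff card_image)

text \<open>Each n-point subset of \<gamma> has n! enumerations, so the image of the counting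
  measure on off-diagonal tuples has constant density n!.\<close>

lemma nn_integral_offdiag_tuples:
  fixes g :: "'a set \<Rightarrow> ennreal"
  assumes "countable \<gamma>"
  shows "(\<integral>\<^sup>+x. g (x ` {..<n}) * indicator (offdiag n) x \<partial>count_space (PiE {..<n} (\<lambda>_. \<gamma>)))
    = fact n * (\<integral>\<^sup>+\<xi>. g \<xi> \<partial>count_space {\<xi>. \<xi> \<subseteq> \<gamma> \<and> finite \<xi> \<and> card \<xi> = n})"
proof -
  let ?P = "PiE {..<n} (\<lambda>_. \<gamma>)"
  let ?A = "?P \<inter> offdiag n" and ?B = "{\<xi>. \<xi> \<subseteq> \<gamma> \<and> finite \<xi> \<and> card \<xi> = n}"
  let ?h = "\<lambda>x::nat \<Rightarrow> 'a. x ` {..<n}"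
  have cB: "countable ?B"
    by (rule countable_subset[OF _ countable_Collect_finite_subset[OF assms]]) auto
  have h: "?h x \<in> ?B" if "x \<in> ?A" for x
    using that card_offdiag_image[of x n] by (auto simp: PiE_iff)
  have hm: "?h \<in> measurable (count_space ?A) (count_space ?B)" using h by auto
  have D: "distr (count_space ?A) (count_space ?B) ?h = density (count_space ?B) (\<lambda>_. fact n)"
  proof (rule measure_eqI_countable[OF _ _ cB])
    fix \<xi> assume xi: "\<xi> \<in> ?B"
    obtain e where e: "bij_betw e {..<n} \<xi>" using ex_bij_betw_nat_finite[of \<xi>] xi by (auto simp: atLeast0LessThan)
    let ?x = "restrict e {..<n}"
    have x: "?x \<in> offdiag n" using e by (auto simp: offdiag_iff bij_betw_def inj_on_def)
    have xx: "?x ` {..<n} = \<xi>" using e by (auto simp: bij_betw_def)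
    have "?h -` {\<xi>} \<inter> ?A = {y \<in> offdiag n. y ` {..<n} = ?x ` {..<n}}"
    proof (intro equalityI subsetI)
      fix y assume "y \<in> {y \<in> offdiag n. y ` {..<n} = ?x ` {..<n}}"
      then have y: "y \<in> offdiag n" "y ` {..<n} = \<xi>" using xx by auto
      have "y \<in> extensional {..<n}" using y(1) by (simp add: offdiag_iff)
      moreover have "y i \<in> \<gamma>" if "i \<in> {..<n}" for i using y(2) xi that by blast
      ultimately have "y \<in> ?P" unfolding PiE_iff by blast
      then show "y \<in> ?h -` {\<xi>} \<inter> ?A" using y by simp
    next
      fix y assume "y \<in> ?h -` {\<xi>} \<inter> ?A"
      then show "y \<in> {y \<in> offdiag n. y ` {..<n} = ?x ` {..<n}}" unfolding xx by blast
    qed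
    note fib = this
    have "emeasure (distr (count_space ?A) (count_space ?B) ?h) {\<xi>} = emeasure (count_space ?A) (?h -` {\<xi>} \<inter> ?A)"
      using xi by (subst emeasure_distr[OF hm]) simp_all
    also have "\<dots> = of_nat (card {y \<in> offdiag n. y ` {..<n} = ?x ` {..<n}})"
      using card_offdiag_fiber(2)[OF x] fib by (subst emeasure_count_space) (blast, simp)
    also have "\<dots> = fact n" unfolding card_offdiag_fiber(1)[OF x] by simp
    finally show "emeasure (distr (count_space ?A) (count_space ?B) ?h) {\<xi>} = emeasure (density (count_space ?B) (\<lambda>_. fact n)) {\<xi>}"
      using xi by (simp add: emeasure_density nn_integral_cmult)
  qed simp_all
  have "(\<integral>\<^sup>+x. g (?h x) * indicator (offdiag n) x \<partial>count_space ?P) = (\<integral>\<^sup>+x. g (?h x) \<partial>count_space ?A)"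
    by (subst (1 2) nn_integral_count_space_indicator)
      (auto intro!: nn_integral_cong split: split_indicator)
  also have "\<dots> = (\<integral>\<^sup>+\<xi>. g \<xi> \<partial>distr (count_space ?A) (count_space ?B) ?h)"
    by (subst nn_integral_distr[OF hm]) auto
  also have "\<dots> = fact n * (\<integral>\<^sup>+\<xi>. g \<xi> \<partial>count_space ?B)"
    unfolding D by (simp add: nn_integral_density nn_integral_cmult)
  finally show ?thesis .
qed

lemma ennreal_inverse_fact: "ennreal (1 / fact n) * (fact n * x) = x"
proof -
  have f: "(fact n :: ennreal) = ennreal (fact n)"
    using ennreal_of_nat_eq_real_of_nat[of "fact n"] by (simp only: of_nat_fact)
  have "ennreal (1 / fact n) * fact n = ennreal ((1 / fact n) * fact n)"
    unfolding f by (rule ennreal_mult[symmetric]) simp_all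
  also have "\<dots> = 1" by simp
  finally show ?thesis by (simp add: mult.assoc[symmetric])
qed

lemma nn_integral_finite_subsets:
  fixes g :: "'a set \<Rightarrow> ennreal"
  assumes "countable \<gamma>"
  shows "(\<integral>\<^sup>+\<xi>. g \<xi> \<partial>count_space {\<xi>. \<xi> \<subseteq> \<gamma> \<and> finite \<xi>}) =
     (\<Sum>n. ennreal (1 / fact n) * (\<integral>\<^sup>+x. g (x ` {..<n}) * indicator (offdiag n) x \<partial>count_space (PiE {..<n} (\<lambda>_. \<gamma>))))"
proof -
  let ?F = "\<lambda>n. {\<xi>. \<xi> \<subseteq> \<gamma> \<and> finite \<xi> \<and> card \<xi> = n}"
  have d: "disjoint_family ?F" by (auto simp: disjoint_family_on_def)
  have U: "{\<xi>. \<xi> \<subseteq> \<gamma> \<and> finite \<xi>} = (\<Union>n. ?F n)" by auto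
  have "(\<integral>\<^sup>+\<xi>. g \<xi> \<partial>count_space {\<xi>. \<xi> \<subseteq> \<gamma> \<and> finite \<xi>}) = (\<integral>\<^sup>+\<xi>. g \<xi> * indicator (\<Union>n. ?F n) \<xi> \<partial>count_space UNIV)"
    unfolding U by (rule nn_integral_count_space_indicator)  simp
  also have "\<dots> = (\<integral>\<^sup>+\<xi>. (\<Sum>n. g \<xi> * indicator (?F n) \<xi>) \<partial>count_space UNIV)"
    by (simp only: ennreal_suminf_cmult suminf_indicator[OF d])
  also have "\<dots> = (\<Sum>n. \<integral>\<^sup>+\<xi>. g \<xi> * indicator (?F n) \<xi> \<partial>count_space UNIV)"
    by (rule nn_integral_suminf) simp
  also have "\<dots> = (\<Sum>n. \<integral>\<^sup>+\<xi>. g \<xi> \<partial>count_space (?F n))"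
    by (intro suminf_cong nn_integral_count_space_indicator[symmetric]) simp
  also have "\<dots> = (\<Sum>n. ennreal (1 / fact n) * (\<integral>\<^sup>+x. g (x ` {..<n}) * indicator (offdiag n) x \<partial>count_space (PiE {..<n} (\<lambda>_. \<gamma>))))"
    by (simp only: nn_integral_offdiag_tuples[OF assms] ennreal_inverse_fact)
  finally show ?thesis .
qed

text \<open>The generating family is already closed under complements and countable unions, so
  membership can be tested on the preimages alone.\<close>

lemma sets_finite_config_space:
  "sets (finite_config_space :: 'a::topological_space set measure) =
    {A. A \<subseteq> finite_configs \<and> (\<forall>n. {x \<in> offdiag n. x ` {..<n} \<in> A} \<in> sets (offdiag_borel n))}"
    (is "_ = ?G")
proof -
  have "sigma_algebra (finite_configs :: 'a set set) ?G"
    unfolding sigma_algebra_iff2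
  proof (intro conjI ballI allI impI)
    show "?G \<subseteq> Pow finite_configs" by auto
    show "{} \<in> ?G" by simp
    show "finite_configs - A \<in> ?G" if "A \<in> ?G" for A
    proof -
      have "{x \<in> offdiag n. x ` {..<n} \<in> finite_configs - A} = space (offdiag_borel n) - {x \<in> offdiag n. x ` {..<n} \<in> A}" for n
        by (auto simp: space_offdiag_borel finite_configs_def)
      then show ?thesis using that by auto
    qed
    show "(\<Union>i. A i) \<in> ?G" if "range A \<subseteq> ?G" for A :: "nat \<Rightarrow> 'a set set"
    proof -
      have "{x \<in> offdiag n. x ` {..<n} \<in> (\<Union>i. A i)} = (\<Union>i. {x \<in> offdiag n. x ` {..<n} \<in> A i})" for n by auto
      moreover have "A i \<in> ?G" for i using that by blast
      moreover have "(\<Union>i. {x \<in> offdiag n. x ` {..<n} \<in> A i}) \<in> sets (offdiag_borel n)" for n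
        by (rule sets.countable_UN) (use \<open>\<And>i. A i \<in> ?G\<close> in blast)
      ultimately show ?thesis by (intro CollectI conjI allI) (blast, simp only:)
    qed
  qed
  then show ?thesis unfolding finite_config_space_def by (rule sigma_algebra.sets_measure_of_eq)
qed

lemma space_finite_config_space: "space finite_config_space = finite_configs"
  by (simp add: finite_config_space_def space_measure_of_conv)

lemma offdiag_preimage_sets:
  "A \<in> sets finite_config_space \<Longrightarrow> {x \<in> offdiag n. x ` {..<n} \<in> A} \<in> sets (offdiag_borel n)"
  by (simp add: sets_finite_config_space)

lemma measurable_offdiag_image: "(\<lambda>x. x ` {..<n}) \<in> measurable (offdiag_borel n) finite_config_space"
proof (rule measurableI)
  show "x ` {..<n} \<in> space finite_config_space" for x :: "nat \<Rightarrow> 'a"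
    by (simp add: space_finite_config_space finite_configs_def)
  show "(\<lambda>x. x ` {..<n}) -` A \<inter> space (offdiag_borel n) \<in> sets (offdiag_borel n)"
    if "A \<in> sets finite_config_space" for A :: "'a set set"
    using offdiag_preimage_sets[OF that, of n] by (simp add: space_offdiag_borel vimage_def Int_def conj_commute)
qed

lemma sets_offdiag_borel_restrict:
  assumes "sets N = sets (pow_borel n)"
  shows "sets (restrict_space N (offdiag n)) = sets (offdiag_borel n :: (nat \<Rightarrow> 'a::{second_countable_topology, t2_space}) measure)"
proof -
  have "sets (restrict_space N (offdiag n)) = {A \<in> sets N. A \<subseteq> offdiag n}"
  proof (intro equalityI subsetI)
    fix A assume "A \<in> sets (restrict_space N (offdiag n))"
    then obtain B where "B \<in> sets N" "A = offdiag n \<inter> B" by (auto simp: sets_restrict_space)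
    then show "A \<in> {A \<in> sets N. A \<subseteq> offdiag n}" using offdiag_sets[of n, where 'a='a] assms by blast
  next
    fix A assume "A \<in> {A \<in> sets N. A \<subseteq> offdiag n}"
    then show "A \<in> sets (restrict_space N (offdiag n))"
      unfolding sets_restrict_space by (intro image_eqI[of _ _ A]) (simp_all add: Int_absorb1)
  qed
  then show ?thesis by (simp add: assms sets_offdiag_borel)
qed

lemma measurable_offdiag_lift:
  fixes G :: "'a::{second_countable_topology, t2_space} set \<Rightarrow> ennreal"
  assumes G: "G \<in> borel_measurable finite_config_space"
  shows "(\<lambda>x. G (x ` {..<n}) * indicator (offdiag n) x) \<in> borel_measurable (pow_borel n)"
proof -
  have "(\<lambda>x. G (x ` {..<n})) \<in> borel_measurable (restrict_space (pow_borel n) (offdiag n))"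
    using measurable_compose[OF measurable_offdiag_image G]
    by (simp add: measurable_cong_sets[OF sets_offdiag_borel_restrict[OF refl] refl])
  then show ?thesis
    by (subst (asm) borel_measurable_restrict_space_iff_ennreal) (use offdiag_sets[of n, where 'a='a] in auto)
qed

context loc_compact
begin

definition offdiag_part :: "(nat \<Rightarrow> (nat \<Rightarrow> 'a) measure) \<Rightarrow> nat \<Rightarrow> (nat \<Rightarrow> 'a) measure" where
  "offdiag_part M n = density (restrict_space (M n) (offdiag n)) (\<lambda>_. ennreal (1 / fact n))"

lemma sets_offdiag_part:
  "symmetric_radon_sequence M \<Longrightarrow> sets (offdiag_part M n) = sets (offdiag_borel n)"
  using sets_offdiag_borel_restrict[OF symmetric_radon_sequenceD(2)] by (simp add: offdiag_part_def)

lemma space_offdiag_part: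
  "symmetric_radon_sequence M \<Longrightarrow> space (offdiag_part M n) = offdiag n"
  using sets_eq_imp_space_eq[OF sets_offdiag_part] by (simp add: space_offdiag_borel)

lemma nn_integral_offdiag_part:
  assumes M: "symmetric_radon_sequence M" and f: "f \<in> borel_measurable (offdiag_borel n)"
  shows "(\<integral>\<^sup>+x. f x \<partial>offdiag_part M n) = ennreal (1 / fact n) * (\<integral>\<^sup>+x. f x * indicator (offdiag n) x \<partial>M n)"
proof -
  note D = symmetric_radon_sequenceD(2)[OF M, of n]
  have f': "f \<in> borel_measurable (restrict_space (M n) (offdiag n))"
    using f by (simp add: measurable_cong_sets[OF sets_offdiag_borel_restrict[OF D] refl])
  have o: "offdiag n \<inter> space (M n) \<in> sets (M n)" using offdiag_sets[of n, where 'a='a] D by auto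
  show ?thesis
    unfolding offdiag_part_def
    by (subst nn_integral_density) (use f' o in \<open>auto simp: nn_integral_cmult nn_integral_restrict_space\<close>)
qed

lemma emeasure_offdiag_part:
  assumes M: "symmetric_radon_sequence M" and A: "A \<in> sets (offdiag_borel n)"
  shows "emeasure (offdiag_part M n) A = ennreal (1 / fact n) * emeasure (M n) A"
proof -
  have A': "A \<in> sets (M n)" "A \<subseteq> offdiag n"
    using A symmetric_radon_sequenceD(2)[OF M] by (auto simp: sets_offdiag_borel)
  have "emeasure (offdiag_part M n) A = (\<integral>\<^sup>+x. indicator A x \<partial>offdiag_part M n)"
    using A sets_offdiag_part[OF M] by simp
  also have "\<dots> = ennreal (1 / fact n) * (\<integral>\<^sup>+x. indicator A x * indicator (offdiag n) x \<partial>M n)"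
    by (rule nn_integral_offdiag_part[OF M]) (use A in simp)
  also have "(\<integral>\<^sup>+x. indicator A x * indicator (offdiag n) x \<partial>M n) = (\<integral>\<^sup>+x. indicator A x \<partial>M n)"
    by (rule nn_integral_cong) (use A'(2) in \<open>auto split: split_indicator\<close>)
  finally show ?thesis using A' by simp
qed

text \<open>The sum of the images over all n, written as an integral over the counting measure of
  the natural numbers so that \<open>nn_integral_kernel\<close> applies to it.\<close>

definition corr :: "(nat \<Rightarrow> (nat \<Rightarrow> 'a) measure) \<Rightarrow> 'a set measure" where
  "corr M = measure_of finite_configs (sets finite_config_space)
     (\<lambda>A. \<integral>\<^sup>+n. emeasure (distr (offdiag_part M n) finite_config_space (\<lambda>x. x ` {..<n})) A \<partial>count_space UNIV)"

lemma sets_corr: "sets (corr M) = sets finite_config_space"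
  unfolding corr_def space_finite_config_space[symmetric]
  using sets.space_closed[of finite_config_space] by (simp add: sets.sigma_sets_eq)

lemma measurable_offdiag_part_image:
  "symmetric_radon_sequence M \<Longrightarrow> (\<lambda>x. x ` {..<n}) \<in> measurable (offdiag_part M n) finite_config_space"
  using measurable_offdiag_image by (simp add: measurable_cong_sets[OF sets_offdiag_part refl])

lemma nn_integral_corr:
  assumes M: "symmetric_radon_sequence M" and G: "G \<in> borel_measurable finite_config_space"
  shows "(\<integral>\<^sup>+\<xi>. G \<xi> \<partial>corr M) = (\<Sum>n. ennreal (1 / fact n) * (\<integral>\<^sup>+x. G (x ` {..<n}) * indicator (offdiag n) x \<partial>M n))"
proof -
  let ?\<kappa> = "\<lambda>n. distr (offdiag_part M n) finite_config_space (\<lambda>x. x ` {..<n})"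
  have e: "emeasure (corr M) A = (\<integral>\<^sup>+n. emeasure (?\<kappa> n) A \<partial>count_space UNIV)" if A: "A \<in> sets finite_config_space" for A
  proof (rule emeasure_measure_of[OF corr_def])
    show "sets finite_config_space \<subseteq> Pow finite_configs"
      using sets.space_closed[of finite_config_space] by (simp add: space_finite_config_space)
    show "A \<in> sets (corr M)" using A by (simp add: sets_corr)
    show "positive (sets (corr M)) (\<lambda>A. \<integral>\<^sup>+n. emeasure (?\<kappa> n) A \<partial>count_space UNIV)" by (simp add: positive_def)
    show "countably_additive (sets (corr M)) (\<lambda>A. \<integral>\<^sup>+n. emeasure (?\<kappa> n) A \<partial>count_space UNIV)"
    proof (rule countably_additiveI)
      fix A :: "nat \<Rightarrow> 'a set set" assume A: "range A \<subseteq> sets (corr M)" "disjoint_family A"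
      have "(\<Sum>i. \<integral>\<^sup>+n. emeasure (?\<kappa> n) (A i) \<partial>count_space UNIV) = (\<integral>\<^sup>+n. (\<Sum>i. emeasure (?\<kappa> n) (A i)) \<partial>count_space UNIV)"
        by (rule nn_integral_suminf[symmetric]) simp
      also have "\<dots> = (\<integral>\<^sup>+n. emeasure (?\<kappa> n) (\<Union>i. A i) \<partial>count_space UNIV)"
        by (intro nn_integral_cong suminf_emeasure) (use A sets_corr in auto)
      finally show "(\<Sum>i. \<integral>\<^sup>+n. emeasure (?\<kappa> n) (A i) \<partial>count_space UNIV) = (\<integral>\<^sup>+n. emeasure (?\<kappa> n) (\<Union>i. A i) \<partial>count_space UNIV)" .
    qed
  qed
  have "(\<integral>\<^sup>+\<xi>. G \<xi> \<partial>corr M) = (\<integral>\<^sup>+n. (\<integral>\<^sup>+\<xi>. G \<xi> \<partial>?\<kappa> n) \<partial>count_space UNIV)"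
    by (rule nn_integral_kernel) (use e G sets_corr in \<open>auto simp: measurable_cong_sets[OF sets_corr refl]\<close>)
  also have "\<dots> = (\<Sum>n. ennreal (1 / fact n) * (\<integral>\<^sup>+x. G (x ` {..<n}) * indicator (offdiag n) x \<partial>M n))"
    unfolding nn_integral_count_space_nat
  proof (rule suminf_cong)
    fix n
    have "(\<integral>\<^sup>+\<xi>. G \<xi> \<partial>?\<kappa> n) = (\<integral>\<^sup>+x. G (x ` {..<n}) \<partial>offdiag_part M n)"
      by (rule nn_integral_distr[OF measurable_offdiag_part_image[OF M]]) (use G in simp)
    also have "\<dots> = ennreal (1 / fact n) * (\<integral>\<^sup>+x. G (x ` {..<n}) * indicator (offdiag n) x \<partial>M n)"
      by (rule nn_integral_offdiag_part[OF M measurable_compose[OF measurable_offdiag_image G]])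
    finally show "(\<integral>\<^sup>+\<xi>. G \<xi> \<partial>?\<kappa> n) = ennreal (1 / fact n) * (\<integral>\<^sup>+x. G (x ` {..<n}) * indicator (offdiag n) x \<partial>M n)" .
  qed
  finally show ?thesis .
qed

text \<open>Finite subsets are sorted by their cardinality n. Those of size n contribute 1 / n!
  times an integral over the off-diagonal part of the n-th power, whose mean is the n-th moment
  measure.\<close>

lemma nn_integral_subconfigurations:
  assumes \<mu>: "simple_point_process (\<mu> :: 'a measure measure)" and M: "moment_sequence \<mu> M"
    and G: "G \<in> borel_measurable finite_config_space"
  shows "(\<integral>\<^sup>+\<eta>\<in>simple_measures. (\<integral>\<^sup>+\<xi>. G \<xi> \<partial>count_space {\<xi>. \<xi> \<subseteq> atoms \<eta> \<and> finite \<xi>}) \<partial>\<mu>) = (\<integral>\<^sup>+\<xi>. G \<xi> \<partial>corr M)"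
proof -
  have R: "random_measure \<mu>" using \<mu> by (simp add: simple_point_process_def)
  have S: "symmetric_radon_sequence M" using M by (simp add: moment_sequence_def)
  let ?g = "\<lambda>n x. G (x ` {..<n}) * indicator (offdiag n) x"
  note gm = measurable_offdiag_lift[OF G]
  have "(\<integral>\<^sup>+\<xi>. G \<xi> \<partial>count_space {\<xi>. \<xi> \<subseteq> atoms \<eta> \<and> finite \<xi>}) * indicator simple_measures \<eta>
      = (\<Sum>n. ennreal (1 / fact n) * (\<integral>\<^sup>+x. ?g n x \<partial>tpow n \<eta>))" if eta: "\<eta> \<in> simple_measures" for \<eta>
  proof -
    obtain \<gamma> where g: "\<gamma> \<in> configurations" "\<eta> = config_measure \<gamma>" using eta by (auto simp: simple_measures_def)
    show ?thesis
      using eta unfolding g(2) atoms_config nn_integral_tpow_config[OF g(1) gm]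
      by (simp add: nn_integral_finite_subsets[OF configuration_countable(1)[OF g(1)]])
  qed
  then have "AE \<eta> in \<mu>. (\<integral>\<^sup>+\<xi>. G \<xi> \<partial>count_space {\<xi>. \<xi> \<subseteq> atoms \<eta> \<and> finite \<xi>}) * indicator simple_measures \<eta>
      = (\<Sum>n. ennreal (1 / fact n) * (\<integral>\<^sup>+x. ?g n x \<partial>tpow n \<eta>))"
    using simple_point_process_AE[OF \<mu>] by (auto elim!: AE_mp)
  then have "(\<integral>\<^sup>+\<eta>\<in>simple_measures. (\<integral>\<^sup>+\<xi>. G \<xi> \<partial>count_space {\<xi>. \<xi> \<subseteq> atoms \<eta> \<and> finite \<xi>}) \<partial>\<mu>) =
     (\<integral>\<^sup>+\<eta>. (\<Sum>n. ennreal (1 / fact n) * (\<integral>\<^sup>+x. ?g n x \<partial>tpow n \<eta>)) \<partial>\<mu>)"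
    by (rule nn_integral_cong_AE)
  also have "\<dots> = (\<Sum>n. \<integral>\<^sup>+\<eta>. ennreal (1 / fact n) * (\<integral>\<^sup>+x. ?g n x \<partial>tpow n \<eta>) \<partial>\<mu>)"
    by (intro nn_integral_suminf borel_measurable_times_ennreal measurable_nn_integral_tpow[OF R gm]) simp
  also have "\<dots> = (\<Sum>n. ennreal (1 / fact n) * (\<integral>\<^sup>+x. ?g n x \<partial>M n))"
    by (intro suminf_cong)
      (simp only: nn_integral_cmult[OF measurable_nn_integral_tpow[OF R gm]] nn_integral_moment[OF R M gm])
  also have "\<dots> = (\<integral>\<^sup>+\<xi>. G \<xi> \<partial>corr M)" by (rule nn_integral_corr[OF S G, symmetric])
  finally show ?thesis .
qed

lemma correlation_measure_iff:
  assumes \<mu>: "simple_point_process (\<mu> :: 'a measure measure)" and M: "moment_sequence \<mu> M"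
  shows "correlation_measure \<mu> \<rho> \<longleftrightarrow> \<rho> = corr M"
proof
  show "correlation_measure \<mu> \<rho>" if "\<rho> = corr M"
    unfolding correlation_measure_def that using sets_corr nn_integral_subconfigurations[OF \<mu> M] by blast
  assume \<rho>: "correlation_measure \<mu> \<rho>"
  have s: "sets \<rho> = sets finite_config_space" using \<rho> by (simp add: correlation_measure_def)
  show "\<rho> = corr M"
  proof (rule measure_eqI)
    show "sets \<rho> = sets (corr M)" using s sets_corr by simp
    fix A assume "A \<in> sets \<rho>"
    then have A: "A \<in> sets finite_config_space" using s by simp
    then have iA: "(indicator A :: 'a set \<Rightarrow> ennreal) \<in> borel_measurable finite_config_space" by simp
    from \<rho> have "(\<integral>\<^sup>+\<eta>\<in>simple_measures. (\<integral>\<^sup>+\<xi>. indicator A \<xi> \<partial>count_space {\<xi>. \<xi> \<subseteq> atoms \<eta> \<and> finite \<xi>}) \<partial>\<mu>) = (\<integral>\<^sup>+\<xi>. indicator A \<xi> \<partial>\<rho>)"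
      unfolding correlation_measure_def by (elim conjE) (rule bspec[OF _ iA])
    then have "(\<integral>\<^sup>+\<xi>. indicator A \<xi> \<partial>\<rho>) = (\<integral>\<^sup>+\<xi>. indicator A \<xi> \<partial>corr M)"
      unfolding nn_integral_subconfigurations[OF \<mu> M iA] by (rule sym)
    then show "emeasure \<rho> A = emeasure (corr M) A" using A s sets_corr by simp
  qed
qed

lemma emeasure_corr_card:
  assumes M: "symmetric_radon_sequence M" and A: "A \<in> sets finite_config_space" and c: "\<forall>\<xi>\<in>A. card \<xi> = n"
  shows "emeasure (corr M) A = emeasure (offdiag_part M n) {x \<in> offdiag n. x ` {..<n} \<in> A}"
proof -
  let ?S = "\<lambda>k. {x \<in> offdiag k. x ` {..<k} \<in> A}"
  have S: "?S k \<in> sets (offdiag_borel k)" for k by (rule offdiag_preimage_sets[OF A])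
  then have S': "?S k \<in> sets (M k)" for k using symmetric_radon_sequenceD(2)[OF M] by (simp add: sets_offdiag_borel)
  have ind: "indicator A (x ` {..<k}) * indicator (offdiag k) x = (indicator (?S k) x :: ennreal)" for k x
    by (auto split: split_indicator)
  have "emeasure (corr M) A = (\<integral>\<^sup>+\<xi>. indicator A \<xi> \<partial>corr M)" using A sets_corr by simp
  also have "\<dots> = (\<Sum>k. ennreal (1 / fact k) * (\<integral>\<^sup>+x. indicator A (x ` {..<k}) * indicator (offdiag k) x \<partial>M k))"
    by (rule nn_integral_corr[OF M]) (use A in simp)
  also have "\<dots> = (\<Sum>k. ennreal (1 / fact k) * emeasure (M k) (?S k))"
    unfolding ind using S' by simp
  also have "\<dots> = (\<Sum>k\<in>{n}. ennreal (1 / fact k) * emeasure (M k) (?S k))"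
  proof (rule suminf_finite)
    fix k assume "k \<notin> {n}"
    then have "?S k = {}" using c card_offdiag_image by fastforce
    then show "ennreal (1 / fact k) * emeasure (M k) (?S k) = 0" by (simp only: emeasure_empty mult_zero_right)
  qed simp
  finally show ?thesis using emeasure_offdiag_part[OF M S[of n]] by simp
qed

text \<open>For a Borel set D of tuples, let g x be the number of permutations that carry x into D.
  Under a symmetric measure g has integral n! times the mass of D, and g x depends only on the set
  of entries of x, so the superlevel sets of g can be tested on n-point sets.\<close>

lemma symmetric_offdiag_determined:
  assumes P: "sets P = sets (offdiag_borel n :: (nat \<Rightarrow> 'a) measure)" "symmetric_measure n P"
    and Q: "sets Q = sets (offdiag_borel n)" "symmetric_measure n Q"
    and eq: "\<And>A. A \<in> sets finite_config_space \<Longrightarrow> \<forall>\<xi>\<in>A. card \<xi> = n \<Longrightarrow>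
      emeasure P {x \<in> offdiag n. x ` {..<n} \<in> A} = emeasure Q {x \<in> offdiag n. x ` {..<n} \<in> A}"
  shows "P = Q"
proof (rule measure_eqI)
  show "sets P = sets Q" using P Q by simp
  fix D assume "D \<in> sets P"
  then have D: "D \<in> sets (offdiag_borel n)" using P by simp
  let ?S = "{\<sigma>. \<sigma> permutes {..<n}}"
  have fS: "finite ?S" by (simp add: finite_permutations)
  have cS: "card ?S = fact n" by (simp add: card_permutations)
  have pm: "(\<lambda>x. x \<circ> \<sigma>) \<in> measurable (offdiag_borel n) (offdiag_borel n :: (nat \<Rightarrow> 'a) measure)" if s: "\<sigma> permutes {..<n}" for \<sigma>
  proof (rule measurableI)
    show "x \<circ> \<sigma> \<in> space (offdiag_borel n)" if "x \<in> space (offdiag_borel n)" for x :: "nat \<Rightarrow> 'a"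
      using that offdiag_permute(1)[OF _ s] by (simp add: space_offdiag_borel)
    fix B :: "(nat \<Rightarrow> 'a) set" assume B: "B \<in> sets (offdiag_borel n)"
    have sn: "\<sigma> j < n" if "j < n" for j using permutes_in_image[OF s, of j] that by simp
    have eqp: "x \<circ> \<sigma> = pull n \<sigma> x" if "x \<in> offdiag n" for x :: "nat \<Rightarrow> 'a"
      using that s by (auto simp: pull_def offdiag_iff extensional_def permutes_not_in fun_eq_iff)
    have "(\<lambda>x. x \<circ> \<sigma>) -` B \<inter> space (offdiag_borel n) = (pull n \<sigma> -` B \<inter> space (pow_borel n)) \<inter> offdiag n"
      using eqp by (auto simp: space_offdiag_borel space_PiM offdiag_def cube_def)
    also have "\<dots> \<in> sets (offdiag_borel n)"
    proof -
      have "pull n \<sigma> -` B \<inter> space (pow_borel n) \<in> sets (pow_borel n)"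
        by (rule measurable_sets[OF measurable_pull[of n \<sigma> n, OF sn]]) (use B in \<open>simp_all add: sets_offdiag_borel\<close>)
      from sets.Int[OF this offdiag_sets] show ?thesis unfolding sets_offdiag_borel by blast
    qed
    finally show "(\<lambda>x. x \<circ> \<sigma>) -` B \<inter> space (offdiag_borel n) \<in> sets (offdiag_borel n)" .
  qed
  define g where "g x = card {\<sigma>. \<sigma> permutes {..<n} \<and> x \<circ> \<sigma> \<in> D}" for x
  have g_le: "g x \<le> fact n" for x unfolding g_def cS[symmetric] by (intro card_mono fS) auto
  have g_sum: "of_nat (g x) = (\<Sum>\<sigma>\<in>?S. indicator D (x \<circ> \<sigma>) :: ennreal)" for x
  proof -
    have "(of_nat (g x) :: ennreal) = (\<Sum>\<sigma>\<in>{\<sigma>\<in>?S. x \<circ> \<sigma> \<in> D}. 1)" by (simp add: g_def)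
    also have "\<dots> = (\<Sum>\<sigma>\<in>?S. if x \<circ> \<sigma> \<in> D then 1 else 0)" by (rule sum.inter_filter[OF fS])
    also have "\<dots> = (\<Sum>\<sigma>\<in>?S. indicator D (x \<circ> \<sigma>))" by (rule sum.cong) (auto simp: indicator_def)
    finally show ?thesis .
  qed
  \<comment> \<open>The layer-cake form of g, whose values lie in {0..n!}.\<close>
  have g_sum': "of_nat (g x) = (\<Sum>k\<in>{1..fact n}. indicator {x. k \<le> g x} x :: ennreal)" for x
  proof -
    have "(\<Sum>k\<in>{1..fact n}. indicator {x. k \<le> g x} x :: ennreal) = of_nat (card ({1..fact n} \<inter> {k. k \<le> g x}))"
      by (simp add: indicator_def sum.If_cases)
    also have "{1..fact n} \<inter> {k. k \<le> g x} = {1..g x}" using g_le[of x] by auto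
    finally show ?thesis by simp
  qed
  have g_perm: "g y = g x" if xy: "x \<in> offdiag n" "y \<in> offdiag n" "x ` {..<n} = y ` {..<n}" for x y
  proof -
    obtain \<tau> where t: "\<tau> permutes {..<n}" "y = x \<circ> \<tau>" by (rule offdiag_same_image[OF xy])
    have "bij_betw (\<lambda>\<sigma>. \<tau> \<circ> \<sigma>) {\<sigma>. \<sigma> permutes {..<n} \<and> y \<circ> \<sigma> \<in> D} {\<sigma>. \<sigma> permutes {..<n} \<and> x \<circ> \<sigma> \<in> D}"
    proof (rule bij_betw_byWitness[where f'="\<lambda>\<sigma>. inv \<tau> \<circ> \<sigma>"])
      have c: "inv \<tau> \<circ> \<tau> = id" "\<tau> \<circ> inv \<tau> = id" using permutes_inv_o[OF t(1)] by auto
      show "\<forall>\<sigma>\<in>{\<sigma>. \<sigma> permutes {..<n} \<and> y \<circ> \<sigma> \<in> D}. inv \<tau> \<circ> (\<tau> \<circ> \<sigma>) = \<sigma>"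
        "\<forall>\<sigma>\<in>{\<sigma>. \<sigma> permutes {..<n} \<and> x \<circ> \<sigma> \<in> D}. \<tau> \<circ> (inv \<tau> \<circ> \<sigma>) = \<sigma>"
        using c by (simp_all add: comp_assoc[symmetric])
      show "(\<lambda>\<sigma>. \<tau> \<circ> \<sigma>) ` {\<sigma>. \<sigma> permutes {..<n} \<and> y \<circ> \<sigma> \<in> D} \<subseteq> {\<sigma>. \<sigma> permutes {..<n} \<and> x \<circ> \<sigma> \<in> D}"
        using permutes_compose[OF _ t(1)] by (auto simp: t(2) comp_assoc)
      show "(\<lambda>\<sigma>. inv \<tau> \<circ> \<sigma>) ` {\<sigma>. \<sigma> permutes {..<n} \<and> x \<circ> \<sigma> \<in> D} \<subseteq> {\<sigma>. \<sigma> permutes {..<n} \<and> y \<circ> \<sigma> \<in> D}"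
      proof
        fix p assume "p \<in> (\<lambda>\<sigma>. inv \<tau> \<circ> \<sigma>) ` {\<sigma>. \<sigma> permutes {..<n} \<and> x \<circ> \<sigma> \<in> D}"
        then obtain \<sigma> where s: "p = inv \<tau> \<circ> \<sigma>" "\<sigma> permutes {..<n}" "x \<circ> \<sigma> \<in> D" by blast
        have "y \<circ> p = x \<circ> (\<tau> \<circ> inv \<tau>) \<circ> \<sigma>" unfolding t(2) s(1) by (simp only: comp_assoc)
        then have "y \<circ> p = x \<circ> \<sigma>" using c(2) by simp
        then show "p \<in> {\<sigma>. \<sigma> permutes {..<n} \<and> y \<circ> \<sigma> \<in> D}"
          using s permutes_compose[OF s(2) permutes_inv[OF t(1)]] by simp
      qed
    qed
    then show ?thesis unfolding g_def by (rule bij_betw_same_card)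
  qed
  have [measurable]: "(\<lambda>x. indicator D (x \<circ> \<sigma>) :: ennreal) \<in> borel_measurable (offdiag_borel n)" if "\<sigma> permutes {..<n}" for \<sigma>
    using measurable_compose[OF pm[OF that], of "indicator D" borel] D by simp
  have gm: "(\<lambda>x. of_nat (g x) :: ennreal) \<in> borel_measurable (offdiag_borel n)"
    unfolding g_sum by (rule borel_measurable_sum) simp
  have Sk: "{x \<in> offdiag n. k \<le> g x} \<in> sets (offdiag_borel n)" for k
  proof -
    have "{x \<in> space (offdiag_borel n). of_nat k \<le> (of_nat (g x) :: ennreal)} \<in> sets (offdiag_borel n)"
      using gm by measurable
    then show ?thesis by (simp add: space_offdiag_borel)
  qed
  \<comment> \<open>The superlevel sets of g, transported to n-point sets; by \<open>g_perm\<close>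
    their preimages are no larger than the sets started from.\<close>
  define A where "A k = (\<lambda>x. x ` {..<n}) ` {x \<in> offdiag n. k \<le> g x}" for k
  have Apre: "{x \<in> offdiag n. x ` {..<n} \<in> A k} = {x \<in> offdiag n. k \<le> g x}" for k
  proof (intro equalityI subsetI)
    fix x assume "x \<in> {x \<in> offdiag n. x ` {..<n} \<in> A k}"
    then obtain y where x: "x \<in> offdiag n" and y: "y \<in> offdiag n" "k \<le> g y" "x ` {..<n} = y ` {..<n}"
      unfolding A_def by blast
    have "g x = g y" by (rule g_perm[OF y(1) x y(3)[symmetric]])
    then show "x \<in> {x \<in> offdiag n. k \<le> g x}" using x y(2) by simp
  qed (auto simp: A_def)
  have Acard: "card \<xi> = n" if "\<xi> \<in> A k" for \<xi> k
    using that card_offdiag_image by (auto simp: A_def)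
  have As: "A k \<in> sets finite_config_space" for k
    unfolding sets_finite_config_space
  proof (intro CollectI conjI allI)
    show "A k \<subseteq> finite_configs" by (auto simp: A_def finite_configs_def)
    fix m
    show "{x \<in> offdiag m. x ` {..<m} \<in> A k} \<in> sets (offdiag_borel m)"
    proof (cases "m = n")
      case True then show ?thesis using Apre Sk by simp
    next
      case False
      then have "{x \<in> offdiag m. x ` {..<m} \<in> A k} = {}" using Acard card_offdiag_image by fastforce
      then show ?thesis by (simp only: sets.empty_sets)
    qed
  qed
  have main: "fact n * emeasure N D = (\<Sum>k\<in>{1..fact n}. emeasure N {x \<in> offdiag n. k \<le> g x})"
    if N: "sets N = sets (offdiag_borel n)" "symmetric_measure n N" for N
  proof -
    have mN: "borel_measurable N = (borel_measurable (offdiag_borel n) :: ((nat \<Rightarrow> 'a) \<Rightarrow> ennreal) set)"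
      by (rule measurable_cong_sets[OF N(1) refl])
    have spN: "space N = offdiag n" using sets_eq_imp_space_eq[OF N(1)] by (simp add: space_offdiag_borel)
    have "(\<integral>\<^sup>+x. indicator D (x \<circ> \<sigma>) \<partial>N) = emeasure N D" if s: "\<sigma> permutes {..<n}" for \<sigma>
    proof -
      have m: "(\<lambda>x. x \<circ> \<sigma>) \<in> measurable N N" using pm[OF s] by (simp add: measurable_cong_sets[OF N(1) N(1)])
      have "(\<integral>\<^sup>+x. indicator D (x \<circ> \<sigma>) \<partial>N) = (\<integral>\<^sup>+x. indicator D x \<partial>distr N N (\<lambda>x. x \<circ> \<sigma>))"
        by (rule nn_integral_distr[OF m, symmetric]) (use D N(1) in simp)
      also have "distr N N (\<lambda>x. x \<circ> \<sigma>) = N" using N(2) s by (simp add: symmetric_measure_def)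
      also have "(\<integral>\<^sup>+x. indicator D x \<partial>N) = emeasure N D" using D N(1) by simp
      finally show ?thesis .
    qed
    then have "(\<Sum>\<sigma>\<in>?S. emeasure N D) = (\<Sum>\<sigma>\<in>?S. \<integral>\<^sup>+x. indicator D (x \<circ> \<sigma>) \<partial>N)" by simp
    also have "\<dots> = (\<integral>\<^sup>+x. of_nat (g x) \<partial>N)"
      unfolding g_sum by (subst nn_integral_sum) (auto simp: mN)
    also have "\<dots> = (\<integral>\<^sup>+x. (\<Sum>k\<in>{1..fact n}. indicator {x \<in> offdiag n. k \<le> g x} x) \<partial>N)"
      unfolding g_sum' by (intro nn_integral_cong sum.cong) (auto simp: spN indicator_def)
    also have "\<dots> = (\<Sum>k\<in>{1..fact n}. emeasure N {x \<in> offdiag n. k \<le> g x})"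
      using Sk N(1) by (subst nn_integral_sum) auto
    finally show ?thesis by (simp add: cS)
  qed
  have "fact n * emeasure P D = fact n * emeasure Q D"
    unfolding main[OF P] main[OF Q] using eq[OF As] Acard by (simp add: Apre)
  then show "emeasure P D = emeasure Q D" by (metis ennreal_inverse_fact)
qed

lemma symmetric_offdiag_part:
  assumes M: "symmetric_radon_sequence M" shows "symmetric_measure n (offdiag_part M n)"
  unfolding symmetric_measure_def
proof (intro allI impI)
  fix \<sigma> assume s: "\<sigma> permutes {..<n}"
  let ?N = "offdiag_part M n"
  note D = symmetric_radon_sequenceD[OF M]
  have sn: "\<sigma> j < n" if "j < n" for j using permutes_in_image[OF s, of j] that by simp
  have ext: "x \<in> extensional {..<n}" if "x \<in> space (M n)" for x using that D(3) by (auto simp: PiE_def)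
  have eqp: "x \<circ> \<sigma> = pull n \<sigma> x" if "x \<in> extensional {..<n}" for x :: "nat \<Rightarrow> 'a"
    using that s by (auto simp: pull_def extensional_def permutes_not_in fun_eq_iff)
  have mM: "(\<lambda>x. x \<circ> \<sigma>) \<in> measurable (M n) (M n)"
  proof (rule measurable_eqI)
    show "x \<circ> \<sigma> = pull n \<sigma> x" if "x \<in> space (M n)" for x by (rule eqp[OF ext[OF that]])
    show "pull n \<sigma> \<in> measurable (M n) (M n)"
      using measurable_pull[of n \<sigma> n, OF sn] by (simp add: measurable_cong_sets[OF D(2) D(2)])
  qed
  have inv: "x \<circ> \<sigma> \<in> offdiag n \<Longrightarrow> x \<in> offdiag n" if "x \<in> space (M n)" for x
  proof -
    assume a: "x \<circ> \<sigma> \<in> offdiag n"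
    have "x = (x \<circ> \<sigma>) \<circ> inv \<sigma>" using permutes_inv_o[OF s] by (simp add: comp_assoc)
    then show "x \<in> offdiag n" using offdiag_permute(1)[OF a permutes_inv[OF s]] by simp
  qed
  have pre: "(\<lambda>x. x \<circ> \<sigma>) -` A \<inter> offdiag n = (\<lambda>x. x \<circ> \<sigma>) -` A \<inter> space (M n)" if "A \<subseteq> offdiag n" for A
    using that inv D(3) by (auto simp: offdiag_def cube_def)
  have pres: "(\<lambda>x. x \<circ> \<sigma>) -` A \<inter> offdiag n \<in> sets (offdiag_borel n)" if "A \<in> sets (offdiag_borel n)" for A :: "(nat \<Rightarrow> 'a) set"
  proof -
    have A: "A \<in> sets (M n)" "A \<subseteq> offdiag n" using that by (simp_all add: sets_offdiag_borel D(2))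
    have "(\<lambda>x. x \<circ> \<sigma>) -` A \<inter> offdiag n \<in> sets (pow_borel n)"
      unfolding pre[OF A(2)] using measurable_sets[OF mM A(1)] D(2) by simp
    then show ?thesis unfolding sets_offdiag_borel by blast
  qed
  have mN: "(\<lambda>x. x \<circ> \<sigma>) \<in> measurable ?N ?N"
  proof (rule measurableI)
    show "x \<circ> \<sigma> \<in> space ?N" if "x \<in> space ?N" for x using that offdiag_permute(1)[OF _ s] by (simp add: space_offdiag_part[OF M])
    show "(\<lambda>x. x \<circ> \<sigma>) -` A \<inter> space ?N \<in> sets ?N" if "A \<in> sets ?N" for A
      using that pres by (simp add: space_offdiag_part[OF M] sets_offdiag_part[OF M])
  qed
  show "distr ?N ?N (\<lambda>x. x \<circ> \<sigma>) = ?N"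
  proof (rule measure_eqI)
    fix A assume "A \<in> sets (distr ?N ?N (\<lambda>x. x \<circ> \<sigma>))"
    then have A: "A \<in> sets (offdiag_borel n)" by (simp add: sets_offdiag_part[OF M])
    then have A': "A \<in> sets (M n)" "A \<subseteq> offdiag n" by (simp_all add: sets_offdiag_borel D(2))
    have "emeasure (distr ?N ?N (\<lambda>x. x \<circ> \<sigma>)) A = emeasure ?N ((\<lambda>x. x \<circ> \<sigma>) -` A \<inter> offdiag n)"
      using A mN by (simp add: emeasure_distr sets_offdiag_part[OF M] space_offdiag_part[OF M])
    also have "\<dots> = ennreal (1 / fact n) * emeasure (M n) ((\<lambda>x. x \<circ> \<sigma>) -` A \<inter> space (M n))"
      using emeasure_offdiag_part[OF M pres[OF A]] pre[OF A'(2)] by simp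
    also have "emeasure (M n) ((\<lambda>x. x \<circ> \<sigma>) -` A \<inter> space (M n)) = emeasure (distr (M n) (M n) (\<lambda>x. x \<circ> \<sigma>)) A"
      by (rule emeasure_distr[OF mM A'(1), symmetric])
    also have "distr (M n) (M n) (\<lambda>x. x \<circ> \<sigma>) = M n" by (rule D(4)[OF s])
    finally show "emeasure (distr ?N ?N (\<lambda>x. x \<circ> \<sigma>)) A = emeasure ?N A"
      unfolding emeasure_offdiag_part[OF M A] .
  qed simp
qed

lemma lifted_restriction_iff:
  assumes M: "symmetric_radon_sequence M"
  shows "lifted_restriction n (corr M) P \<longleftrightarrow> P = offdiag_part M n"
proof
  show "lifted_restriction n (corr M) P" if "P = offdiag_part M n"
    unfolding lifted_restriction_def that
    using sets_offdiag_part[OF M] symmetric_offdiag_part[OF M] emeasure_corr_card[OF M] by blast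
  assume "lifted_restriction n (corr M) P"
  then have P: "sets P = sets (offdiag_borel n)" "symmetric_measure n P"
    and e: "\<forall>A\<in>sets finite_config_space. (\<forall>\<xi>\<in>A. card \<xi> = n) \<longrightarrow>
      emeasure (corr M) A = emeasure P {x \<in> offdiag n. x ` {..<n} \<in> A}"
    unfolding lifted_restriction_def by blast+
  show "P = offdiag_part M n"
  proof (rule symmetric_offdiag_determined[OF P sets_offdiag_part[OF M] symmetric_offdiag_part[OF M]])
    fix A :: "'a set set" assume A: "A \<in> sets finite_config_space" "\<forall>\<xi>\<in>A. card \<xi> = n"
    show "emeasure P {x \<in> offdiag n. x ` {..<n} \<in> A} = emeasure (offdiag_part M n) {x \<in> offdiag n. x ` {..<n} \<in> A}"
      using bspec[OF e A(1)] A(2) emeasure_corr_card[OF M A] by simp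
  qed
qed

theorem correlation_measure_of_simple:
  assumes \<mu>: "simple_point_process (\<mu> :: 'a measure measure)" and M: "moment_sequence \<mu> M"
  shows "(\<exists>!\<rho>. correlation_measure \<mu> \<rho>) \<and>
           (\<forall>\<rho>. correlation_measure \<mu> \<rho> \<longrightarrow>
              (\<forall>n\<ge>1. (\<exists>!\<rho>n. lifted_restriction n \<rho> \<rho>n) \<and>
                 (\<forall>\<rho>n. lifted_restriction n \<rho> \<rho>n \<longrightarrow>
                    (\<forall>\<Delta>\<in>sets (offdiag_borel n).
                       emeasure \<rho>n \<Delta> = ennreal (1 / fact n) * emeasure (M n) \<Delta>))))"
proof -
  have S: "symmetric_radon_sequence M" using M by (simp add: moment_sequence_def)
  show ?thesis
    unfolding correlation_measure_iff[OF \<mu> M]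
    using lifted_restriction_iff[OF S] emeasure_offdiag_part[OF S] by simp
qed

end

section \<open>Positive definiteness\<close>

lemma topspace_Psi: "topspace Psi_top = Sigma UNIV (\<lambda>n. PiE {..<n} (\<lambda>_. UNIV))"
  by (simp add: Psi_top_def topspace_pow_top comp_def)

lemma measurable_Psi_inject:
  "Pair n \<in> measurable (pow_borel n) (borel_of (Psi_top :: (nat \<times> (nat \<Rightarrow> 'a::second_countable_topology)) topology))"
proof -
  have "continuous_map (pow_top n) Psi_top (Pair n :: (nat \<Rightarrow> 'a) \<Rightarrow> _)"
    unfolding Psi_top_def by (rule continuous_map_component_injection) simp
  from continuous_map_measurable_borel_of[OF this] show ?thesis
    by (simp add: measurable_cong_sets[OF sets_borel_of_pow_top refl])
qed

text \<open>Borel sets of a single level are Borel in the disjoint union, by induction over the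
  generated sigma-algebra, and there are only countably many levels.\<close>

lemma sets_PsiI:
  fixes A :: "(nat \<times> (nat \<Rightarrow> 'a::second_countable_topology)) set"
  assumes "A \<subseteq> topspace Psi_top" "\<And>n. {x. (n, x) \<in> A} \<in> sets (pow_borel n)"
  shows "A \<in> sets (borel_of Psi_top)"
proof -
  let ?B = "borel_of (Psi_top :: (nat \<times> (nat \<Rightarrow> 'a)) topology)"
  have level: "{n} \<times> S \<in> sets ?B" if S: "S \<in> sets (pow_borel n)" for n and S :: "(nat \<Rightarrow> 'a) set"
  proof -
    have top: "openin Psi_top ({n} \<times> U)" if U: "openin (pow_top n) U" for U :: "(nat \<Rightarrow> 'a) set"
      unfolding Psi_top_def openin_sum_topology
    proof (intro conjI ballI)
      show "{n} \<times> U \<subseteq> Sigma UNIV (topspace \<circ> pow_top)" using openin_subset[OF U] by auto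
      fix i
      have "{x. (i, x) \<in> {n} \<times> U} = (if i = n then U else {})" by auto
      then show "openin (pow_top i) {x. (i, x) \<in> {n} \<times> U}" using U by simp
    qed
    have "S \<in> sigma_sets (topspace (pow_top n)) {U. openin (pow_top n) U}"
      using S by (simp add: sets_borel_of_pow_top[symmetric] sets_borel_of)
    then show ?thesis
    proof induct
      case (Basic a) then show ?case using openin_sets_borel_of[OF top] by simp
    next
      case (Compl a)
      have "{n} \<times> (topspace (pow_top n) - a) = {n} \<times> topspace (pow_top n) - {n} \<times> a" by auto
      then show ?case using Compl(2) openin_sets_borel_of[OF top[OF openin_topspace]] by simp
    next
      case (Union a)
      have "{n} \<times> (\<Union>i. a i) = (\<Union>i. {n} \<times> a i)" by auto
      then show ?case using Union by simp
    qed simp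
  qed
  have "A = (\<Union>n. {n} \<times> {x. (n, x) \<in> A})" by auto
  also have "\<dots> \<in> sets ?B" using level assms(2) by (intro sets.countable_UN) auto
  finally show ?thesis .
qed

lemma measurable_Psi:
  assumes "\<And>n. (\<lambda>x. f (n, x)) \<in> measurable (pow_borel n) N"
  shows "f \<in> measurable (borel_of (Psi_top :: (nat \<times> (nat \<Rightarrow> 'a::second_countable_topology)) topology)) N"
proof (rule measurableI)
  let ?B = "borel_of (Psi_top :: (nat \<times> (nat \<Rightarrow> 'a)) topology)"
  show "f p \<in> space N" if "p \<in> space ?B" for p
  proof -
    obtain n x where p: "p = (n, x)" by (cases p)
    then have "x \<in> space (pow_borel n)" using that by (simp add: topspace_Psi space_PiM)
    then show ?thesis using measurable_space[OF assms[of n]] p by simp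
  qed
  show "f -` A \<inter> space ?B \<in> sets ?B" if A: "A \<in> sets N" for A
  proof (rule sets_PsiI)
    fix n
    have "{x. (n, x) \<in> f -` A \<inter> space ?B} = (\<lambda>x. f (n, x)) -` A \<inter> space (pow_borel n)"
      by (auto simp: topspace_Psi space_PiM)
    then show "{x. (n, x) \<in> f -` A \<inter> space ?B} \<in> sets (pow_borel n)"
      using measurable_sets[OF assms A] by simp
  qed simp
qed

lemma measurable_Psi_section:
  assumes "f \<in> measurable (borel_of (Psi_top :: (nat \<times> (nat \<Rightarrow> 'a::second_countable_topology)) topology)) N"
  shows "(\<lambda>x. f (n, x)) \<in> measurable (pow_borel n) N"
  using measurable_compose[OF measurable_Psi_inject assms] .

text \<open>Sides are listed so that tensor products become concatenations and the symmetry of the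
  measures becomes invariance under rearranging the list.\<close>

definition lbox :: "'a set list \<Rightarrow> (nat \<Rightarrow> 'a) set" where
  "lbox As = PiE {..<length As} (\<lambda>i. As ! i)"

lemma lbox_sets: "(\<And>A. A \<in> set As \<Longrightarrow> A \<in> sets borel) \<Longrightarrow> lbox As \<in> sets (pow_borel (length As))"
  unfolding lbox_def by (rule sets_PiM_I_finite) auto

abbreviation pull_left :: "nat \<Rightarrow> (nat \<Rightarrow> 'a) \<Rightarrow> nat \<Rightarrow> 'a" where
  "pull_left m \<equiv> pull m (\<lambda>j. j)"

abbreviation pull_right :: "nat \<Rightarrow> nat \<Rightarrow> (nat \<Rightarrow> 'a) \<Rightarrow> nat \<Rightarrow> 'a" where
  "pull_right m l \<equiv> pull l (\<lambda>j. m + j)"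

lemma Psi_tensor_pull:
  "Psi_tensor F G (k, x) = (\<Sum>m\<le>k. F (m, pull_left m x) * G (k - m, pull_right m (k - m) x))"
  by (simp add: Psi_tensor_def pull_def)

lemma lbox_append:
  assumes x: "x \<in> PiE {..<length As + length Bs} (\<lambda>_. UNIV)"
  shows "x \<in> lbox (As @ Bs) \<longleftrightarrow> pull_left (length As) x \<in> lbox As \<and> pull_right (length As) (length Bs) x \<in> lbox Bs"
proof -
  have "x \<in> lbox (As @ Bs) \<longleftrightarrow> (\<forall>i<length As + length Bs. x i \<in> (As @ Bs) ! i)"
    using x by (simp add: lbox_def PiE_iff Ball_def)
  also have "\<dots> \<longleftrightarrow> (\<forall>i<length As. x i \<in> As ! i) \<and> (\<forall>i<length Bs. x (length As + i) \<in> Bs ! i)"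
  proof (intro iffI conjI allI impI)
    assume a: "\<forall>i<length As + length Bs. x i \<in> (As @ Bs) ! i"
    show "x i \<in> As ! i" if "i < length As" for i using spec[OF a, of i] that by (simp add: nth_append)
    show "x (length As + i) \<in> Bs ! i" if "i < length Bs" for i using spec[OF a, of "length As + i"] that by simp
  next
    fix i assume a: "(\<forall>i<length As. x i \<in> As ! i) \<and> (\<forall>i<length Bs. x (length As + i) \<in> Bs ! i)" "i < length As + length Bs"
    show "x i \<in> (As @ Bs) ! i"
    proof (cases "i < length As")
      case False
      then have "i - length As < length Bs" "length As + (i - length As) = i" using a(2) by auto
      then have "x i \<in> Bs ! (i - length As)" using a(1) by metis
      then show ?thesis using False by (simp add: nth_append)
    qed (use a in \<open>simp add: nth_append\<close>)
  qed
  also have "\<dots> \<longleftrightarrow> pull_left (length As) x \<in> lbox As \<and> pull_right (length As) (length Bs) x \<in> lbox Bs"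
    by (simp add: lbox_def PiE_iff pull_def Ball_def)
  finally show ?thesis .
qed

context loc_compact
begin

lemma sets_Psi_measure: "sets (Psi_measure M) = sets (borel_of (Psi_top :: (nat \<times> (nat \<Rightarrow> 'a)) topology))"
  unfolding Psi_measure_def by (rule sets.sets_measure_of_eq[of "borel_of Psi_top", unfolded space_borel_of])

lemma nn_integral_Psi:
  fixes M :: "nat \<Rightarrow> (nat \<Rightarrow> 'a) measure"
  assumes M: "symmetric_radon_sequence M" and f: "f \<in> borel_measurable (borel_of Psi_top)"
  shows "(\<integral>\<^sup>+p. f p \<partial>Psi_measure M) = (\<Sum>n. \<integral>\<^sup>+x. f (n, x) \<partial>M n)"
proof -
  note D = symmetric_radon_sequenceD[OF M]
  let ?B = "borel_of (Psi_top :: (nat \<times> (nat \<Rightarrow> 'a)) topology)"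
  let ?\<kappa> = "\<lambda>n. distr (M n) ?B (Pair n)"
  have pm: "Pair n \<in> measurable (M n) ?B" for n
    using measurable_Psi_inject[of n] by (simp add: measurable_cong_sets[OF D(2) refl])
  have \<kappa>: "emeasure (?\<kappa> n) A = emeasure (M n) {x. (n, x) \<in> A}" if A: "A \<in> sets ?B" for A n
  proof -
    have "Pair n -` A \<inter> space (M n) = {x. (n, x) \<in> A}"
      using sets.sets_into_space[OF A] by (auto simp: topspace_Psi D(3))
    then show ?thesis by (simp add: emeasure_distr[OF pm A])
  qed
  have e: "emeasure (Psi_measure M) A = (\<integral>\<^sup>+n. emeasure (?\<kappa> n) A \<partial>count_space UNIV)" if A: "A \<in> sets ?B" for A
  proof -
    have "emeasure (Psi_measure M) A = (\<Sum>n. emeasure (M n) {x. (n, x) \<in> A})"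
    proof (rule emeasure_measure_of[OF Psi_measure_def])
      show "sets ?B \<subseteq> Pow (topspace Psi_top)" using sets.space_closed[of ?B] by simp
      show "A \<in> sets (Psi_measure M)" using A by (simp add: sets_Psi_measure)
      show "positive (sets (Psi_measure M)) (\<lambda>A. \<Sum>n. emeasure (M n) {x. (n, x) \<in> A})" by (simp add: positive_def)
      show "countably_additive (sets (Psi_measure M)) (\<lambda>A. \<Sum>n. emeasure (M n) {x. (n, x) \<in> A})"
      proof (rule countably_additiveI)
        fix A :: "nat \<Rightarrow> (nat \<times> (nat \<Rightarrow> 'a)) set" assume A: "range A \<subseteq> sets (Psi_measure M)" "disjoint_family A" "(\<Union>i. A i) \<in> sets (Psi_measure M)"
        then have As: "A i \<in> sets ?B" for i by (auto simp: sets_Psi_measure)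
        have "(\<Sum>i. \<Sum>n. emeasure (M n) {x. (n, x) \<in> A i}) = (\<Sum>i. \<integral>\<^sup>+n. emeasure (?\<kappa> n) (A i) \<partial>count_space UNIV)"
          by (simp add: nn_integral_count_space_nat \<kappa>[OF As])
        also have "\<dots> = (\<integral>\<^sup>+n. (\<Sum>i. emeasure (?\<kappa> n) (A i)) \<partial>count_space UNIV)"
          by (rule nn_integral_suminf[symmetric]) simp
        also have "\<dots> = (\<integral>\<^sup>+n. emeasure (?\<kappa> n) (\<Union>i. A i) \<partial>count_space UNIV)"
          by (intro nn_integral_cong suminf_emeasure) (use A As in auto)
        also have "\<dots> = (\<Sum>n. emeasure (M n) {x. (n, x) \<in> (\<Union>i. A i)})"
        proof -
          have "(\<Union>i. A i) \<in> sets ?B" using As by auto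
          then show ?thesis by (simp only: nn_integral_count_space_nat \<kappa>)
        qed
        finally show "(\<Sum>i. \<Sum>n. emeasure (M n) {x. (n, x) \<in> A i}) = (\<Sum>n. emeasure (M n) {x. (n, x) \<in> (\<Union>i. A i)})" .
      qed
    qed
    then show ?thesis by (simp add: nn_integral_count_space_nat \<kappa>[OF A])
  qed
  have "(\<integral>\<^sup>+p. f p \<partial>Psi_measure M) = (\<integral>\<^sup>+n. (\<integral>\<^sup>+p. f p \<partial>?\<kappa> n) \<partial>count_space UNIV)"
    by (rule nn_integral_kernel) (use e f sets_Psi_measure in \<open>auto simp: measurable_cong_sets[OF sets_Psi_measure refl]\<close>)
  also have "\<dots> = (\<Sum>n. \<integral>\<^sup>+x. f (n, x) \<partial>M n)"
    unfolding nn_integral_count_space_nat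
    by (intro suminf_cong nn_integral_distr[OF pm]) (use f in simp)
  finally show ?thesis .
qed

lemma integral_Psi:
  fixes M :: "nat \<Rightarrow> (nat \<Rightarrow> 'a) measure" and H :: "nat \<times> (nat \<Rightarrow> 'a) \<Rightarrow> real"
  assumes M: "symmetric_radon_sequence M" and H: "H \<in> borel_measurable (borel_of Psi_top)"
    and H0: "\<And>n x. n > K \<Longrightarrow> x \<in> PiE {..<n} (\<lambda>_. UNIV) \<Longrightarrow> H (n, x) = 0"
    and Hi: "\<And>n. n \<le> K \<Longrightarrow> integrable (M n) (\<lambda>x. H (n, x))"
  shows "(\<integral>p. H p \<partial>Psi_measure M) = (\<Sum>n\<le>K. \<integral>x. H (n, x) \<partial>M n)"
proof -
  note D = symmetric_radon_sequenceD[OF M]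
  have fin: "(\<integral>\<^sup>+p. ennreal (g (H p)) \<partial>Psi_measure M) = (\<Sum>n\<le>K. \<integral>\<^sup>+x. ennreal (g (H (n, x))) \<partial>M n)"
    if g: "g \<in> borel_measurable borel" "g 0 = 0" for g :: "real \<Rightarrow> real"
  proof -
    have "(\<integral>\<^sup>+p. ennreal (g (H p)) \<partial>Psi_measure M) = (\<Sum>n. \<integral>\<^sup>+x. ennreal (g (H (n, x))) \<partial>M n)"
      by (rule nn_integral_Psi[OF M]) (use measurable_compose[OF H g(1)] in measurable)
    also have "\<dots> = (\<Sum>n\<le>K. \<integral>\<^sup>+x. ennreal (g (H (n, x))) \<partial>M n)"
    proof (rule suminf_finite)
      fix n assume "n \<notin> {..K}"
      then have "(\<integral>\<^sup>+x. ennreal (g (H (n, x))) \<partial>M n) = (\<integral>\<^sup>+x. 0 \<partial>M n)"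
        by (intro nn_integral_cong) (simp add: H0 D(3) g(2))
      then show "(\<integral>\<^sup>+x. ennreal (g (H (n, x))) \<partial>M n) = 0" by simp
    qed simp
    finally show ?thesis .
  qed
  have Hm: "H \<in> borel_measurable (Psi_measure M)" using H by (simp add: measurable_cong_sets[OF sets_Psi_measure refl])
  have le: "(\<integral>\<^sup>+x. ennreal (g (H (n, x))) \<partial>M n) < \<infinity>" if n: "n \<le> K" and g: "\<And>t. g t \<le> \<bar>t\<bar>" for n g
  proof -
    have "(\<integral>\<^sup>+x. ennreal (g (H (n, x))) \<partial>M n) \<le> (\<integral>\<^sup>+x. ennreal (norm (H (n, x))) \<partial>M n)"
      by (intro nn_integral_mono ennreal_leI) (simp add: g)
    also have "\<dots> < \<infinity>" using Hi[OF n] by (simp add: integrable_iff_bounded)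
    finally show ?thesis .
  qed
  have "(\<integral>\<^sup>+p. ennreal (norm (H p)) \<partial>Psi_measure M) < \<infinity>"
    using fin[of abs] le[of _ abs] by simp
  then have "integrable (Psi_measure M) H" using Hm by (simp add: integrable_iff_bounded)
  then have "(\<integral>p. H p \<partial>Psi_measure M) =
      enn2real (\<Sum>n\<le>K. \<integral>\<^sup>+x. ennreal (H (n, x)) \<partial>M n) - enn2real (\<Sum>n\<le>K. \<integral>\<^sup>+x. ennreal (- H (n, x)) \<partial>M n)"
    using fin[of "\<lambda>t. t"] fin[of uminus] by (simp add: real_lebesgue_integral_def)
  also have "\<dots> = (\<Sum>n\<le>K. enn2real (\<integral>\<^sup>+x. ennreal (H (n, x)) \<partial>M n)) - (\<Sum>n\<le>K. enn2real (\<integral>\<^sup>+x. ennreal (- H (n, x)) \<partial>M n))"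
  proof -
    have "(\<integral>\<^sup>+x. ennreal (H (n, x)) \<partial>M n) < \<top>" "(\<integral>\<^sup>+x. ennreal (- H (n, x)) \<partial>M n) < \<top>" if "n \<le> K" for n
      using le[OF that, of "\<lambda>t. t"] le[OF that, of uminus] by simp_all
    then show ?thesis by (subst (1 2) enn2real_sum) auto
  qed
  also have "\<dots> = (\<Sum>n\<le>K. \<integral>x. H (n, x) \<partial>M n)"
    by (simp add: sum_subtractf[symmetric] real_lebesgue_integral_def[OF Hi])
  finally show ?thesis .
qed

text \<open>The test function is a combination of indicators of boxes, each in the degree given by
  its number of sides. Its tensor square combines the indicators of concatenated boxes, so the
  integral is the quadratic form of the moment matrix indexed by lists of sets.\<close>

theorem positive_definite_boxes:
  fixes M :: "nat \<Rightarrow> (nat \<Rightarrow> 'a) measure"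
  assumes M: "symmetric_radon_sequence M" and pd: "positive_definite M" and T: "finite T"
    and A: "\<And>t B. t \<in> T \<Longrightarrow> B \<in> set (A t) \<Longrightarrow> B \<in> relcompact_borel"
  shows "0 \<le> (\<Sum>s\<in>T. \<Sum>t\<in>T. c s * c t * measure (M (length (A s) + length (A t))) (lbox (A s @ A t)))"
proof -
  note D = symmetric_radon_sequenceD[OF M]
  let ?n = "\<lambda>t. length (A t)"
  define F :: "nat \<times> (nat \<Rightarrow> 'a) \<Rightarrow> real" where
    "F = (\<lambda>(n, x). \<Sum>t\<in>T. c t * (if n = ?n t then indicator (lbox (A t)) x else 0))"
  have Ab: "B \<in> sets borel" if "t \<in> T" "B \<in> set (A t)" for t B using A[OF that] by (rule relcompact_borel_sets)
  have Fm: "F \<in> borel_measurable (borel_of Psi_top)"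
  proof (rule measurable_Psi)
    fix n
    have "(\<lambda>x. if n = ?n t then indicator (lbox (A t)) x else (0::real)) \<in> borel_measurable (pow_borel n)" if "t \<in> T" for t
      using lbox_sets[of "A t"] Ab[OF that] by (cases "n = ?n t") auto
    then show "(\<lambda>x. F (n, x)) \<in> borel_measurable (pow_borel n)"
      unfolding F_def by simp
  qed
  have Fb: "\<bar>F p\<bar> \<le> (\<Sum>t\<in>T. \<bar>c t\<bar>)" for p
    unfolding F_def case_prod_beta
    by (rule order_trans[OF sum_abs]) (intro sum_mono, auto simp: abs_mult split: split_indicator)
  \<comment> \<open>A crude common bound for the lengths; the tensor square then lives in degrees up
    to 2 N.\<close>
  define N where "N = (\<Sum>t\<in>T. ?n t)"
  have nN: "?n t \<le> N" if "t \<in> T" for t unfolding N_def using member_le_sum[of t T ?n] that T by auto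
  define \<Lambda> where "\<Lambda> = (\<Union>B\<in>(\<Union>t\<in>T. set (A t)). B)"
  have L: "\<Lambda> \<in> relcompact_borel"
    unfolding \<Lambda>_def by (rule relcompact_borel_finite_UN) (use T A in auto)
  have F0: "F (n, x) = 0" if "(n, x) \<in> topspace Psi_top - (SIGMA n:{..N}. cube n \<Lambda>)" for n x
    unfolding F_def prod.case
  proof (rule sum.neutral, intro ballI)
    fix t assume t: "t \<in> T"
    have "lbox (A t) \<subseteq> cube (?n t) \<Lambda>"
      unfolding lbox_def cube_def
    proof (rule PiE_mono)
      fix i assume "i \<in> {..<length (A t)}"
      then have "A t ! i \<in> set (A t)" by simp
      then show "A t ! i \<subseteq> \<Lambda>" unfolding \<Lambda>_def using t by blast
    qed
    then show "c t * (if n = ?n t then indicator (lbox (A t)) x else 0) = 0"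
      using that nN[OF t] by (auto simp: indicator_def)
  qed
  have pos: "0 \<le> (\<integral>p. Psi_tensor F F p \<partial>Psi_measure M)"
  proof (rule pd[unfolded positive_definite_def, rule_format, OF Fm], intro conjI exI ballI bexI)
    show "\<bar>F p\<bar> \<le> (\<Sum>t\<in>T. \<bar>c t\<bar>)" for p by (rule Fb)
    show "F p = 0" if "p \<in> topspace Psi_top - (SIGMA n:{..N}. cube n \<Lambda>)" for p
      using F0[of "fst p" "snd p"] that by simp
  qed (rule L)
  have tensor: "Psi_tensor F F (k, x) =
      (\<Sum>s\<in>T. \<Sum>t\<in>T. c s * c t * (if k = ?n s + ?n t then indicator (lbox (A s @ A t)) x else 0))"
    if x: "x \<in> PiE {..<k} (\<lambda>_. UNIV)" for k x
  proof -
    let ?I = "\<lambda>t m x. (if m = ?n t then indicator (lbox (A t)) x else 0 :: real)"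
    have "Psi_tensor F F (k, x) = (\<Sum>m\<le>k. (\<Sum>s\<in>T. c s * ?I s m (pull_left m x)) * (\<Sum>t\<in>T. c t * ?I t (k - m) (pull_right m (k - m) x)))"
      unfolding Psi_tensor_pull F_def by simp
    also have "\<dots> = (\<Sum>m\<le>k. \<Sum>s\<in>T. \<Sum>t\<in>T. c s * c t * (?I s m (pull_left m x) * ?I t (k - m) (pull_right m (k - m) x)))"
      by (simp add: sum_product mult_ac)
    also have "\<dots> = (\<Sum>s\<in>T. \<Sum>t\<in>T. \<Sum>m\<le>k. c s * c t * (?I s m (pull_left m x) * ?I t (k - m) (pull_right m (k - m) x)))"
      by (subst sum.swap, intro sum.cong[OF refl], subst sum.swap) simp
    also have "\<dots> = (\<Sum>s\<in>T. \<Sum>t\<in>T. c s * c t * (if k = ?n s + ?n t then indicator (lbox (A s @ A t)) x else 0))"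
    proof (intro sum.cong[OF refl])
      fix s t
      have "(\<Sum>m\<le>k. c s * c t * (?I s m (pull_left m x) * ?I t (k - m) (pull_right m (k - m) x)))
        = (\<Sum>m\<le>k. if m = ?n s then c s * c t * (indicator (lbox (A s)) (pull_left (?n s) x) * ?I t (k - ?n s) (pull_right (?n s) (k - ?n s) x)) else 0)"
        by (rule sum.cong) auto
      also have "\<dots> = (if ?n s \<le> k then c s * c t * (indicator (lbox (A s)) (pull_left (?n s) x) * ?I t (k - ?n s) (pull_right (?n s) (k - ?n s) x)) else 0)"
        by simp
      also have "\<dots> = c s * c t * (if k = ?n s + ?n t then indicator (lbox (A s @ A t)) x else 0)"
      proof (cases "k = ?n s + ?n t")
        case True
        then show ?thesis using lbox_append[of x "A s" "A t"] x by (simp add: indicator_def)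
      next
        case False
        then show ?thesis by auto
      qed
      finally show "(\<Sum>m\<le>k. c s * c t * (?I s m (pull_left m x) * ?I t (k - m) (pull_right m (k - m) x)))
        = c s * c t * (if k = ?n s + ?n t then indicator (lbox (A s @ A t)) x else 0)" .
    qed
    finally show ?thesis .
  qed
  have bs: "lbox (A s @ A t) \<in> sets (M (?n s + ?n t))" if "s \<in> T" "t \<in> T" for s t
    using lbox_sets[of "A s @ A t"] Ab that D(2) by auto
  have bf: "emeasure (M (?n s + ?n t)) (lbox (A s @ A t)) < \<infinity>" if "s \<in> T" "t \<in> T" for s t
  proof -
    have "(A s @ A t) ! l \<in> relcompact_borel" if l: "l < length (A s @ A t)" for l
      using nth_mem[OF l] A \<open>s \<in> T\<close> \<open>t \<in> T\<close> by auto
    then show ?thesis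
      unfolding lbox_def using radon_pow_finite[OF D(1), of "length (A s @ A t)" "\<lambda>i. (A s @ A t) ! i"] by simp
  qed
  have ind: "integrable (M k) (\<lambda>x. if k = ?n s + ?n t then indicator (lbox (A s @ A t)) x else 0 :: real)"
    "(\<integral>x. (if k = ?n s + ?n t then indicator (lbox (A s @ A t)) x else 0 :: real) \<partial>M k)
      = (if k = ?n s + ?n t then measure (M k) (lbox (A s @ A t)) else 0)" if "s \<in> T" "t \<in> T" for s t k
    using bs[OF that] bf[OF that] by (cases "k = ?n s + ?n t"; simp)+
  let ?h = "\<lambda>k x. \<Sum>s\<in>T. \<Sum>t\<in>T. c s * c t * (if k = ?n s + ?n t then indicator (lbox (A s @ A t)) x else 0 :: real)"
  have spc: "Psi_tensor F F (k, x) = ?h k x" if "x \<in> space (M k)" for k x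
    using that tensor D(3) by simp
  have hi: "integrable (M k) (?h k)" for k by (intro Bochner_Integration.integrable_sum integrable_mult_right ind)
  have Tm: "Psi_tensor F F \<in> borel_measurable (borel_of Psi_top)"
  proof (rule measurable_Psi, rule measurable_eqI)
    show "Psi_tensor F F (n, x) = ?h n x" if "x \<in> space (pow_borel n)" for n x
      using that tensor by (simp add: space_PiM)
    show "?h n \<in> borel_measurable (pow_borel n)" for n
      using borel_measurable_integrable[OF hi[of n]] by (simp add: measurable_cong_sets[OF D(2) refl])
  qed
  have "(\<integral>p. Psi_tensor F F p \<partial>Psi_measure M) = (\<Sum>k\<le>2 * N. \<integral>x. Psi_tensor F F (k, x) \<partial>M k)"
  proof (rule integral_Psi[OF M Tm])
    fix k x assume k: "2 * N < k" and x: "x \<in> PiE {..<k} (\<lambda>_. (UNIV :: 'a set))"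
    have "k \<noteq> ?n s + ?n t" if "s \<in> T" "t \<in> T" for s t using nN[OF that(1)] nN[OF that(2)] k by linarith
    then show "Psi_tensor F F (k, x) = 0" unfolding tensor[OF x] by (intro sum.neutral ballI) auto
  next
    show "integrable (M k) (\<lambda>x. Psi_tensor F F (k, x))" for k
      using hi[of k] by (subst Bochner_Integration.integrable_cong[OF refl spc]) auto
  qed
  also have "\<dots> = (\<Sum>k\<le>2 * N. \<Sum>s\<in>T. \<Sum>t\<in>T. c s * c t * (if k = ?n s + ?n t then measure (M k) (lbox (A s @ A t)) else 0))"
  proof (rule sum.cong[OF refl])
    fix k
    have "(\<integral>x. Psi_tensor F F (k, x) \<partial>M k) = (\<integral>x. ?h k x \<partial>M k)"
      by (rule Bochner_Integration.integral_cong[OF refl spc])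
    also have "\<dots> = (\<Sum>s\<in>T. \<Sum>t\<in>T. c s * c t * (if k = ?n s + ?n t then measure (M k) (lbox (A s @ A t)) else 0))"
      by (simp add: Bochner_Integration.integral_sum Bochner_Integration.integrable_sum ind cong: sum.cong)
    finally show "(\<integral>x. Psi_tensor F F (k, x) \<partial>M k) =
       (\<Sum>s\<in>T. \<Sum>t\<in>T. c s * c t * (if k = ?n s + ?n t then measure (M k) (lbox (A s @ A t)) else 0))" .
  qed
  also have "\<dots> = (\<Sum>s\<in>T. \<Sum>t\<in>T. \<Sum>k\<le>2 * N. c s * c t * (if k = ?n s + ?n t then measure (M k) (lbox (A s @ A t)) else 0))"
    by (subst sum.swap, intro sum.cong[OF refl], subst sum.swap) simp
  also have "\<dots> = (\<Sum>s\<in>T. \<Sum>t\<in>T. c s * c t * measure (M (?n s + ?n t)) (lbox (A s @ A t)))"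
  proof (intro sum.cong[OF refl])
    fix s t assume "s \<in> T" "t \<in> T"
    then have "?n s + ?n t \<le> 2 * N" using nN[of s] nN[of t] by linarith
    moreover have "(\<Sum>k\<le>2 * N. c s * c t * (if k = ?n s + ?n t then measure (M k) (lbox (A s @ A t)) else 0))
      = (\<Sum>k\<le>2 * N. if k = ?n s + ?n t then c s * c t * measure (M k) (lbox (A s @ A t)) else 0)"
      by (rule sum.cong) auto
    ultimately show "(\<Sum>k\<le>2 * N. c s * c t * (if k = ?n s + ?n t then measure (M k) (lbox (A s @ A t)) else 0))
      = c s * c t * measure (M (?n s + ?n t)) (lbox (A s @ A t))" by simp
  qed
  finally show ?thesis using pos by simp
qed

section \<open>Positive definiteness of the moments of a random measure\<close>

definition join :: "nat \<Rightarrow> nat \<Rightarrow> (nat \<Rightarrow> 'a) \<times> (nat \<Rightarrow> 'a) \<Rightarrow> nat \<Rightarrow> 'a" where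
  "join m l = (\<lambda>(x, y). \<lambda>j\<in>{..<m + l}. if j < m then x j else y (j - m))"

lemma pull_join:
  assumes "x \<in> PiE {..<m} (\<lambda>_. UNIV)" "y \<in> PiE {..<l} (\<lambda>_. UNIV)"
  shows "pull_left m (join m l (x, y)) = x" "pull_right m l (join m l (x, y)) = y"
  by (rule PiE_ext[OF pull_in_PiE assms(1)], simp add: pull_def join_def)
    (rule PiE_ext[OF pull_in_PiE assms(2)], simp add: pull_def join_def)

lemma measurable_join: "join m l \<in> measurable (pow_borel m \<Otimes>\<^sub>M pow_borel l) (pow_borel (m + l))"
  unfolding join_def case_prod_beta
proof (rule measurable_restrict)
  fix j assume "j \<in> {..<m + l}"
  then show "(\<lambda>p. if j < m then fst p j else snd p (j - m)) \<in> borel_measurable (pow_borel m \<Otimes>\<^sub>M pow_borel l)"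
    using measurable_compose[OF measurable_fst measurable_pow_component[of j m]]
      measurable_compose[OF measurable_snd measurable_pow_component[of "j - m" l]]
    by (cases "j < m") auto
qed

lemma tpow_join:
  assumes \<eta>: "radon \<eta>"
  shows "tpow (m + l) \<eta> = distr (tpow m \<eta> \<Otimes>\<^sub>M tpow l \<eta>) (pow_borel (m + l)) (join m l)"
proof -
  interpret product_sigma_finite "\<lambda>_::nat. \<eta>" by (rule radon_product_sigma_finite[OF \<eta>])
  interpret L: sigma_finite_measure "tpow l \<eta>" by (rule tpow_sigma_finite[OF \<eta>])
  note s = sets_tpow[OF \<eta>]
  have jm: "join m l \<in> measurable (tpow m \<eta> \<Otimes>\<^sub>M tpow l \<eta>) (pow_borel (m + l))"
    using measurable_join[of m l] by (simp add: measurable_cong_sets[OF sets_pair_measure_cong[OF s s] refl])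
  have "distr (tpow m \<eta> \<Otimes>\<^sub>M tpow l \<eta>) (pow_borel (m + l)) (join m l) = PiM {..<m + l} (\<lambda>_. \<eta>)"
  proof (rule PiM_eqI)
    show "sets (distr (tpow m \<eta> \<Otimes>\<^sub>M tpow l \<eta>) (pow_borel (m + l)) (join m l)) = sets (PiM {..<m + l} (\<lambda>_. \<eta>))"
      using s[of "m + l"] by (simp add: tpow_def)
    fix A assume "\<And>i. i \<in> {..<m + l} \<Longrightarrow> A i \<in> sets \<eta>"
    then have A: "A i \<in> sets borel" if "i < m + l" for i using that radon_euclideanD(1)[OF \<eta>] by auto
    let ?B = "PiE {..<m} A" and ?C = "PiE {..<l} (\<lambda>j. A (m + j))"
    have BC: "?B \<in> sets (tpow m \<eta>)" "?C \<in> sets (tpow l \<eta>)"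
      unfolding s by (rule sets_PiM_I_finite; use A in auto)+
    have "join m l -` PiE {..<m + l} A \<inter> space (tpow m \<eta> \<Otimes>\<^sub>M tpow l \<eta>) = ?B \<times> ?C"
    proof (intro equalityI subsetI)
      fix p assume p: "p \<in> join m l -` PiE {..<m + l} A \<inter> space (tpow m \<eta> \<Otimes>\<^sub>M tpow l \<eta>)"
      then have e: "fst p \<in> extensional {..<m}" "snd p \<in> extensional {..<l}"
        by (auto simp: space_pair_measure space_tpow[OF \<eta>] PiE_def)
      have j: "join m l p i \<in> A i" if "i < m + l" for i using p that by (auto simp: PiE_def Pi_def)
      have "fst p i \<in> A i" if "i < m" for i using j[of i] that by (simp add: join_def case_prod_beta)
      moreover have "snd p i \<in> A (m + i)" if "i < l" for i using j[of "m + i"] that by (simp add: join_def case_prod_beta)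
      ultimately show "p \<in> ?B \<times> ?C" using e by (cases p) (simp add: PiE_def Pi_def)
    next
      fix p assume p: "p \<in> ?B \<times> ?C"
      have "fst p i \<in> A i" if "i < m" for i using p that by (auto simp: PiE_def Pi_def)
      moreover have "snd p (i - m) \<in> A i" if "\<not> i < m" "i < m + l" for i
      proof -
        have "i - m < l" "m + (i - m) = i" using that by auto
        moreover have "snd p j \<in> A (m + j)" if "j < l" for j using p that by (auto simp: PiE_def Pi_def)
        ultimately show ?thesis by metis
      qed
      ultimately have "join m l p \<in> PiE {..<m + l} A" by (simp add: join_def case_prod_beta PiE_def Pi_def)
      moreover have "p \<in> space (tpow m \<eta> \<Otimes>\<^sub>M tpow l \<eta>)"
        using p by (auto simp: space_pair_measure space_tpow[OF \<eta>] PiE_def)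
      ultimately show "p \<in> join m l -` PiE {..<m + l} A \<inter> space (tpow m \<eta> \<Otimes>\<^sub>M tpow l \<eta>)" by simp
    qed
    then have "emeasure (distr (tpow m \<eta> \<Otimes>\<^sub>M tpow l \<eta>) (pow_borel (m + l)) (join m l)) (PiE {..<m + l} A)
       = emeasure (tpow m \<eta> \<Otimes>\<^sub>M tpow l \<eta>) (?B \<times> ?C)"
      using A by (subst emeasure_distr[OF jm]) (auto intro!: sets_PiM_I_finite)
    also have "\<dots> = emeasure (tpow m \<eta>) ?B * emeasure (tpow l \<eta>) ?C" by (rule L.emeasure_pair_measure_Times[OF BC])
    also have "\<dots> = (\<Prod>i<m. emeasure \<eta> (A i)) * (\<Prod>j<l. emeasure \<eta> (A (m + j)))"
      using A by (simp add: tpow_box[OF \<eta>])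
    also have "\<dots> = (\<Prod>i<m + l. emeasure \<eta> (A i))"
      by (induct l) (simp_all add: mult.assoc[symmetric])
    finally show "emeasure (distr (tpow m \<eta> \<Otimes>\<^sub>M tpow l \<eta>) (pow_borel (m + l)) (join m l)) (PiE {..<m + l} A)
       = (\<Prod>i\<in>{..<m + l}. emeasure \<eta> (A i))" .
  qed simp
  then show ?thesis by (simp add: tpow_def)
qed

lemma integrable_tpow_bounded:
  assumes \<eta>: "radon \<eta>" and f: "f \<in> borel_measurable (pow_borel n)"
    and b: "\<And>x. x \<in> PiE {..<n} (\<lambda>_. UNIV) \<Longrightarrow> \<bar>f x\<bar> \<le> B" and L: "\<Lambda> \<in> relcompact_borel"
    and z: "\<And>x. x \<in> PiE {..<n} (\<lambda>_. UNIV) \<Longrightarrow> x \<notin> cube n \<Lambda> \<Longrightarrow> f x = (0::real)"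
  shows "integrable (tpow n \<eta>) f"
proof (rule integrableI_bounded_set[of "cube n \<Lambda>" _ _ B])
  show "cube n \<Lambda> \<in> sets (tpow n \<eta>)" using cube_sets[OF relcompact_borel_sets[OF L]] sets_tpow[OF \<eta>] by simp
  show "f \<in> borel_measurable (tpow n \<eta>)" using f by (simp add: measurable_cong_sets[OF sets_tpow[OF \<eta>] refl])
  show "emeasure (tpow n \<eta>) (cube n \<Lambda>) < \<infinity>"
    unfolding cube_def using radon_euclideanD(4)[OF \<eta> L] relcompact_borel_sets[OF L]
    by (simp add: tpow_box[OF \<eta>] power_less_top_ennreal)
qed (use b z in \<open>auto intro!: AE_I2 simp: space_tpow[OF \<eta>]\<close>)

text \<open>Fubini's theorem, after the (m + l)-th power has been identified with the product of the
  two powers; boundedness and support in a cube of finite mass give integrability.\<close>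

lemma integral_tpow_tensor:
  assumes \<eta>: "radon \<eta>" and L: "\<Lambda> \<in> relcompact_borel"
    and f: "f \<in> borel_measurable (pow_borel m)" "\<And>x. x \<in> PiE {..<m} (\<lambda>_. UNIV) \<Longrightarrow> \<bar>f x\<bar> \<le> B"
      "\<And>x. x \<in> PiE {..<m} (\<lambda>_. UNIV) \<Longrightarrow> x \<notin> cube m \<Lambda> \<Longrightarrow> f x = (0::real)"
    and g: "g \<in> borel_measurable (pow_borel l)" "\<And>x. x \<in> PiE {..<l} (\<lambda>_. UNIV) \<Longrightarrow> \<bar>g x\<bar> \<le> B"
      "\<And>x. x \<in> PiE {..<l} (\<lambda>_. UNIV) \<Longrightarrow> x \<notin> cube l \<Lambda> \<Longrightarrow> g x = (0::real)"
  shows "(\<integral>x. f (pull_left m x) * g (pull_right m l x) \<partial>tpow (m + l) \<eta>) = (\<integral>x. f x \<partial>tpow m \<eta>) * (\<integral>x. g x \<partial>tpow l \<eta>)"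
proof -
  note s = sets_tpow[OF \<eta>] and sp = space_tpow[OF \<eta>]
  interpret A: sigma_finite_measure "tpow m \<eta>" by (rule tpow_sigma_finite[OF \<eta>])
  interpret B: sigma_finite_measure "tpow l \<eta>" by (rule tpow_sigma_finite[OF \<eta>])
  interpret pair_sigma_finite "tpow m \<eta>" "tpow l \<eta>" ..
  have jm: "join m l \<in> measurable (tpow m \<eta> \<Otimes>\<^sub>M tpow l \<eta>) (pow_borel (m + l))"
    using measurable_join[of m l] by (simp add: measurable_cong_sets[OF sets_pair_measure_cong[OF s s] refl])
  have fm: "f \<in> borel_measurable (tpow m \<eta>)" and gm: "g \<in> borel_measurable (tpow l \<eta>)"
    using f(1) g(1) by (simp_all add: measurable_cong_sets[OF s refl])
  have fi: "integrable (tpow m \<eta>) f" by (rule integrable_tpow_bounded[OF \<eta> f(1,2) L f(3)])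
  have gi: "integrable (tpow l \<eta>) g" by (rule integrable_tpow_bounded[OF \<eta> g(1,2) L g(3)])
  have hm: "(\<lambda>x. f (pull_left m x) * g (pull_right m l x)) \<in> borel_measurable (pow_borel (m + l))"
    using measurable_compose[OF measurable_pull[of m "\<lambda>j. j" "m + l"] f(1)]
      measurable_compose[OF measurable_pull[of l "\<lambda>j. m + j" "m + l"] g(1)] by auto
  have "(\<integral>x. f (pull_left m x) * g (pull_right m l x) \<partial>tpow (m + l) \<eta>)
     = (\<integral>p. f (pull_left m (join m l p)) * g (pull_right m l (join m l p)) \<partial>(tpow m \<eta> \<Otimes>\<^sub>M tpow l \<eta>))"
    unfolding tpow_join[OF \<eta>] by (rule integral_distr[OF jm hm])
  also have "\<dots> = (\<integral>p. f (fst p) * g (snd p) \<partial>(tpow m \<eta> \<Otimes>\<^sub>M tpow l \<eta>))"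
    by (rule Bochner_Integration.integral_cong[OF refl]) (auto simp: space_pair_measure sp pull_join)
  also have "\<dots> = (\<integral>x. f x \<partial>tpow m \<eta>) * (\<integral>y. g y \<partial>tpow l \<eta>)"
  proof -
    have i: "integrable (tpow m \<eta> \<Otimes>\<^sub>M tpow l \<eta>) (\<lambda>p. f (fst p) * g (snd p))"
    proof (rule Fubini_integrable)
      show "(\<lambda>p. f (fst p) * g (snd p)) \<in> borel_measurable (tpow m \<eta> \<Otimes>\<^sub>M tpow l \<eta>)" using fm gm by measurable
      show "integrable (tpow m \<eta>) (\<lambda>x. \<integral>y. norm (f (fst (x, y)) * g (snd (x, y))) \<partial>tpow l \<eta>)"
        using fi by (simp add: abs_mult)
      show "AE x in tpow m \<eta>. integrable (tpow l \<eta>) (\<lambda>y. f (fst (x, y)) * g (snd (x, y)))"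
        using gi by simp
    qed
    show ?thesis using integral_fst'[OF i] by simp
  qed
  finally show ?thesis .
qed

text \<open>Positive and negative parts are treated separately, as the mean formula is available for
  nonnegative functions. The function h is bounded and lives on a cube of finite mass, so no
  difference of infinities can occur.\<close>

lemma integral_moment:
  fixes \<mu> :: "'a measure measure" and h :: "(nat \<Rightarrow> 'a) \<Rightarrow> real"
  assumes \<mu>: "random_measure \<mu>" and M: "moment_sequence \<mu> M" and h: "h \<in> borel_measurable (pow_borel n)"
    and b: "\<And>x. x \<in> PiE {..<n} (\<lambda>_. UNIV) \<Longrightarrow> \<bar>h x\<bar> \<le> B" and L: "\<Lambda> \<in> relcompact_borel"
    and z: "\<And>x. x \<in> PiE {..<n} (\<lambda>_. UNIV) \<Longrightarrow> x \<notin> cube n \<Lambda> \<Longrightarrow> h x = 0"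
  shows "integrable (M n) h" "integrable \<mu> (\<lambda>\<eta>. \<integral>x. h x \<partial>tpow n \<eta>)" "(\<integral>x. h x \<partial>M n) = (\<integral>\<eta>. (\<integral>x. h x \<partial>tpow n \<eta>) \<partial>\<mu>)"
proof -
  have S: "symmetric_radon_sequence M" using M by (simp add: moment_sequence_def)
  note D = symmetric_radon_sequenceD[OF S] and R = random_measureD[OF \<mu>]
  show hi: "integrable (M n) h"
  proof (rule integrableI_bounded_set[of "cube n \<Lambda>" _ _ B])
    show "cube n \<Lambda> \<in> sets (M n)" using cube_sets[OF relcompact_borel_sets[OF L]] D(2) by simp
    show "h \<in> borel_measurable (M n)" using h by (simp add: measurable_cong_sets[OF D(2) refl])
    show "emeasure (M n) (cube n \<Lambda>) < \<infinity>"
      unfolding cube_def by (rule radon_pow_finite[OF D(1)]) (rule L)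
  qed (use b z in \<open>auto intro!: AE_I2 simp: D(3)\<close>)
  have part: "integrable \<mu> (\<lambda>\<eta>. enn2real (\<integral>\<^sup>+x. ennreal (g x) \<partial>tpow n \<eta>)) \<and>
      (\<integral>\<eta>. enn2real (\<integral>\<^sup>+x. ennreal (g x) \<partial>tpow n \<eta>) \<partial>\<mu>) = enn2real (\<integral>\<^sup>+x. ennreal (g x) \<partial>M n)"
    if g: "g \<in> borel_measurable (pow_borel n)" and gb: "\<And>x. g x \<le> \<bar>h x\<bar>" for g :: "(nat \<Rightarrow> 'a) \<Rightarrow> real"
  proof -
    let ?u = "\<lambda>\<eta>. \<integral>\<^sup>+x. ennreal (g x) \<partial>tpow n \<eta>"
    have gm: "(\<lambda>x. ennreal (g x)) \<in> borel_measurable (pow_borel n)" using g by simp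
    have um: "?u \<in> borel_measurable \<mu>" by (rule measurable_nn_integral_tpow[OF \<mu> gm])
    have fin: "?u \<eta> < \<infinity>" if e: "\<eta> \<in> space \<mu>" for \<eta>
    proof -
      have "?u \<eta> \<le> (\<integral>\<^sup>+x. ennreal (norm (h x)) \<partial>tpow n \<eta>)"
        by (intro nn_integral_mono ennreal_leI) (simp add: gb)
      also have "\<dots> < \<infinity>"
        using integrable_tpow_bounded[OF R(3)[OF e] h b L z] by (simp add: integrable_iff_bounded)
      finally show ?thesis .
    qed
    have tot: "(\<integral>\<^sup>+\<eta>. ?u \<eta> \<partial>\<mu>) = (\<integral>\<^sup>+x. ennreal (g x) \<partial>M n)" by (rule nn_integral_moment[OF \<mu> M gm, symmetric])
    have "(\<integral>\<^sup>+x. ennreal (g x) \<partial>M n) \<le> (\<integral>\<^sup>+x. ennreal (norm (h x)) \<partial>M n)"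
      by (intro nn_integral_mono ennreal_leI) (simp add: gb)
    also have "\<dots> < \<infinity>" using hi by (simp add: integrable_iff_bounded)
    finally have tf: "(\<integral>\<^sup>+x. ennreal (g x) \<partial>M n) < \<infinity>" .
    have eq: "(\<integral>\<^sup>+\<eta>. ennreal (enn2real (?u \<eta>)) \<partial>\<mu>) = (\<integral>\<^sup>+x. ennreal (g x) \<partial>M n)"
      unfolding tot[symmetric] by (rule nn_integral_cong) (use fin in \<open>simp add: ennreal_enn2real\<close>)
    have em: "(\<lambda>\<eta>. enn2real (?u \<eta>)) \<in> borel_measurable \<mu>" using um by (rule borel_measurable_enn2real)
    show ?thesis
    proof
      show "integrable \<mu> (\<lambda>\<eta>. enn2real (?u \<eta>))"
        using em eq tf by (intro integrableI_nonneg) auto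
      show "(\<integral>\<eta>. enn2real (?u \<eta>) \<partial>\<mu>) = enn2real (\<integral>\<^sup>+x. ennreal (g x) \<partial>M n)"
        using em eq by (subst integral_eq_nn_integral) auto
    qed
  qed
  have p1: "integrable \<mu> (\<lambda>\<eta>. enn2real (\<integral>\<^sup>+x. ennreal (h x) \<partial>tpow n \<eta>))"
      "(\<integral>\<eta>. enn2real (\<integral>\<^sup>+x. ennreal (h x) \<partial>tpow n \<eta>) \<partial>\<mu>) = enn2real (\<integral>\<^sup>+x. ennreal (h x) \<partial>M n)"
    using part[of h] h by auto
  have p2: "integrable \<mu> (\<lambda>\<eta>. enn2real (\<integral>\<^sup>+x. ennreal (- h x) \<partial>tpow n \<eta>))"
      "(\<integral>\<eta>. enn2real (\<integral>\<^sup>+x. ennreal (- h x) \<partial>tpow n \<eta>) \<partial>\<mu>) = enn2real (\<integral>\<^sup>+x. ennreal (- h x) \<partial>M n)"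
    using part[of "\<lambda>x. - h x"] h by auto
  have split: "(\<integral>x. h x \<partial>tpow n \<eta>) = enn2real (\<integral>\<^sup>+x. ennreal (h x) \<partial>tpow n \<eta>) - enn2real (\<integral>\<^sup>+x. ennreal (- h x) \<partial>tpow n \<eta>)"
    if "\<eta> \<in> space \<mu>" for \<eta>
    by (rule real_lebesgue_integral_def[OF integrable_tpow_bounded[OF R(3)[OF that] h b L z]])
  show "integrable \<mu> (\<lambda>\<eta>. \<integral>x. h x \<partial>tpow n \<eta>)"
    using Bochner_Integration.integrable_diff[OF p1(1) p2(1)]
    by (subst Bochner_Integration.integrable_cong[OF refl split]) auto
  have "(\<integral>\<eta>. (\<integral>x. h x \<partial>tpow n \<eta>) \<partial>\<mu>) = (\<integral>\<eta>. enn2real (\<integral>\<^sup>+x. ennreal (h x) \<partial>tpow n \<eta>) - enn2real (\<integral>\<^sup>+x. ennreal (- h x) \<partial>tpow n \<eta>) \<partial>\<mu>)"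
    by (rule Bochner_Integration.integral_cong[OF refl split])
  also have "\<dots> = enn2real (\<integral>\<^sup>+x. ennreal (h x) \<partial>M n) - enn2real (\<integral>\<^sup>+x. ennreal (- h x) \<partial>M n)"
    by (simp only: Bochner_Integration.integral_diff[OF p1(1) p2(1)] p1(2) p2(2))
  also have "\<dots> = (\<integral>x. h x \<partial>M n)" by (rule real_lebesgue_integral_def[OF hi, symmetric])
  finally show "(\<integral>x. h x \<partial>M n) = (\<integral>\<eta>. (\<integral>x. h x \<partial>tpow n \<eta>) \<partial>\<mu>)" by simp
qed

text \<open>Let a_n be the integral of the degree n component of F against the n-th power of \<eta>.
  The integral of the tensor square is the mean of the square of the sum of all a_n.\<close>

theorem moment_imp_positive_definite:
  fixes \<mu> :: "'a measure measure"
  assumes \<mu>: "random_measure \<mu>" and M: "moment_sequence \<mu> M"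
  shows "positive_definite M"
  unfolding positive_definite_def
proof (intro ballI impI, elim conjE exE bexE)
  fix F :: "nat \<times> (nat \<Rightarrow> 'a) \<Rightarrow> real" and B :: real and N :: nat and \<Lambda> :: "'a set"
  assume F: "F \<in> borel_measurable (borel_of Psi_top)" and b: "\<forall>p\<in>topspace Psi_top. \<bar>F p\<bar> \<le> B"
    and L: "\<Lambda> \<in> relcompact_borel" and z: "\<forall>p\<in>topspace Psi_top - (SIGMA n:{..N}. cube n \<Lambda>). F p = 0"
  have S: "symmetric_radon_sequence M" using M by (simp add: moment_sequence_def)
  note D = symmetric_radon_sequenceD[OF S] and R = random_measureD[OF \<mu>]
  let ?X = "\<lambda>n. PiE {..<n} (\<lambda>_. UNIV) :: (nat \<Rightarrow> 'a) set"
  have fm: "(\<lambda>x. F (n, x)) \<in> borel_measurable (pow_borel n)" for n by (rule measurable_Psi_section[OF F])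
  have fb: "\<bar>F (n, x)\<bar> \<le> B" if "x \<in> ?X n" for n x using b that by (simp add: topspace_Psi)
  have f0: "F (n, x) = 0" if "x \<in> ?X n" "x \<notin> cube n \<Lambda> \<or> N < n" for n x
  proof (rule bspec[OF z], rule DiffI)
    show "(n, x) \<in> topspace Psi_top" unfolding topspace_Psi using that(1) by blast
    show "(n, x) \<notin> (SIGMA n:{..N}. cube n \<Lambda>)"
      using that(2) unfolding mem_Sigma_iff atMost_iff by (meson not_le)
  qed
  let ?t = "\<lambda>m l x. F (m, pull_left m x) * F (l, pull_right m l x)"
  have tm: "?t m l \<in> borel_measurable (pow_borel (m + l))" for m l
    using measurable_compose[OF measurable_pull[of m "\<lambda>j. j" "m + l"] fm[of m]]
      measurable_compose[OF measurable_pull[of l "\<lambda>j. m + j" "m + l"] fm[of l]] by auto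
  have tb: "\<bar>?t m l x\<bar> \<le> B * B" for m l x
  proof -
    have "\<bar>F (m, pull_left m x)\<bar> \<le> B" "\<bar>F (l, pull_right m l x)\<bar> \<le> B"
      by (rule fb[OF pull_in_PiE])+
    then show ?thesis unfolding abs_mult
      by (rule mult_mono) (use \<open>\<bar>F (m, pull_left m x)\<bar> \<le> B\<close> abs_ge_zero order_trans in blast)+
  qed
  have t0: "?t m l x = 0" if x: "x \<in> ?X (m + l)" "x \<notin> cube (m + l) \<Lambda>" for m l x
  proof (rule ccontr)
    assume "?t m l x \<noteq> 0"
    then have "F (m, pull_left m x) \<noteq> 0" "F (l, pull_right m l x) \<noteq> 0" by auto
    then have c: "pull_left m x \<in> cube m \<Lambda>" "pull_right m l x \<in> cube l \<Lambda>"
      using f0[OF pull_in_PiE] by blast+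
    have "x i \<in> \<Lambda>" if "i < m + l" for i
    proof (cases "i < m")
      case True
      have "pull_left m x i \<in> \<Lambda>" using c(1) True by (auto simp: cube_def PiE_def Pi_def)
      then show ?thesis using True by (simp add: pull_def)
    next
      case False
      then have "i - m < l" "m + (i - m) = i" using that by auto
      moreover from this have "pull_right m l x (i - m) \<in> \<Lambda>" using c(2) by (auto simp: cube_def PiE_def Pi_def)
      ultimately show ?thesis by (simp add: pull_def)
    qed
    then have "x \<in> cube (m + l) \<Lambda>" using x(1) by (simp add: cube_def PiE_def Pi_def)
    then show False using x(2) by simp
  qed
  have IM: "integrable (M (m + l)) (?t m l)" "integrable \<mu> (\<lambda>\<eta>. \<integral>x. ?t m l x \<partial>tpow (m + l) \<eta>)"
    "(\<integral>x. ?t m l x \<partial>M (m + l)) = (\<integral>\<eta>. (\<integral>x. ?t m l x \<partial>tpow (m + l) \<eta>) \<partial>\<mu>)" for m l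
    by (rule integral_moment[OF \<mu> M tm tb L t0]; assumption)+
  let ?a = "\<lambda>n \<eta>. \<integral>x. F (n, x) \<partial>tpow n \<eta>"
  have tt: "(\<integral>x. ?t m l x \<partial>tpow (m + l) \<eta>) = ?a m \<eta> * ?a l \<eta>" if "\<eta> \<in> space \<mu>" for m l \<eta>
    by (rule integral_tpow_tensor[OF R(3)[OF that] L fm fb _ fm fb]) (use f0 in blast)+
  have ti: "integrable \<mu> (\<lambda>\<eta>. ?a m \<eta> * ?a l \<eta>)" for m l
    using IM(2)[of m l] by (subst (asm) Bochner_Integration.integrable_cong[OF refl tt]) auto
  have tM: "(\<integral>x. ?t m l x \<partial>M (m + l)) = (\<integral>\<eta>. ?a m \<eta> * ?a l \<eta> \<partial>\<mu>)" for m l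
    unfolding IM(3) by (rule Bochner_Integration.integral_cong[OF refl tt])
  have tens: "Psi_tensor F F (k, x) = (\<Sum>m\<le>k. ?t m (k - m) x)" for k x by (rule Psi_tensor_pull)
  have tm': "?t m (k - m) \<in> borel_measurable (pow_borel k)" "integrable (M k) (?t m (k - m))" if "m \<le> k" for m k
    using tm[of m "k - m"] IM(1)[of m "k - m"] that by simp_all
  have "(\<integral>p. Psi_tensor F F p \<partial>Psi_measure M) = (\<Sum>k\<le>2 * N. \<integral>x. Psi_tensor F F (k, x) \<partial>M k)"
  proof (rule integral_Psi[OF S])
    show "Psi_tensor F F \<in> borel_measurable (borel_of Psi_top)"
      by (rule measurable_Psi) (simp only: tens, intro borel_measurable_sum tm', simp)
    show "integrable (M k) (\<lambda>x. Psi_tensor F F (k, x))" for k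
      unfolding tens by (intro Bochner_Integration.integrable_sum tm') simp
    fix k x assume k: "2 * N < k" "x \<in> ?X k"
    have "?t m (k - m) x = 0" if "m \<le> k" for m
    proof (cases "N < m")
      case False
      then have "N < k - m" using k(1) by simp
      then show ?thesis using f0[OF pull_in_PiE, of "k - m"] by simp
    qed (use f0[OF pull_in_PiE, of m] in simp)
    then show "Psi_tensor F F (k, x) = 0" unfolding tens by (intro sum.neutral ballI) simp
  qed
  also have "\<dots> = (\<Sum>k\<le>2 * N. \<Sum>m\<le>k. \<integral>\<eta>. ?a m \<eta> * ?a (k - m) \<eta> \<partial>\<mu>)"
  proof (rule sum.cong[OF refl])
    fix k
    have "(\<integral>x. Psi_tensor F F (k, x) \<partial>M k) = (\<Sum>m\<le>k. \<integral>x. ?t m (k - m) x \<partial>M k)"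
      unfolding tens by (rule Bochner_Integration.integral_sum) (simp add: tm')
    also have "\<dots> = (\<Sum>m\<le>k. \<integral>\<eta>. ?a m \<eta> * ?a (k - m) \<eta> \<partial>\<mu>)"
    proof (rule sum.cong[OF refl])
      fix m assume "m \<in> {..k}"
      then show "(\<integral>x. ?t m (k - m) x \<partial>M k) = (\<integral>\<eta>. ?a m \<eta> * ?a (k - m) \<eta> \<partial>\<mu>)" using tM[of m "k - m"] by simp
    qed
    finally show "(\<integral>x. Psi_tensor F F (k, x) \<partial>M k) = (\<Sum>m\<le>k. \<integral>\<eta>. ?a m \<eta> * ?a (k - m) \<eta> \<partial>\<mu>)" .
  qed
  also have "\<dots> = (\<Sum>p\<in>(SIGMA k:{..2 * N}. {..k}). \<integral>\<eta>. ?a (snd p) \<eta> * ?a (fst p - snd p) \<eta> \<partial>\<mu>)"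
    by (simp add: sum.Sigma case_prod_beta)
  also have "\<dots> = (\<Sum>p\<in>{..N} \<times> {..N}. \<integral>\<eta>. ?a (fst p) \<eta> * ?a (snd p) \<eta> \<partial>\<mu>)"
  proof -
    have a0: "?a n \<eta> = 0" if "N < n" "\<eta> \<in> space \<mu>" for n \<eta>
    proof -
      have "?a n \<eta> = (\<integral>x. 0 \<partial>tpow n \<eta>)"
        by (rule Bochner_Integration.integral_cong[OF refl]) (use f0 that in \<open>simp add: space_tpow[OF R(3)]\<close>)
      then show ?thesis by simp
    qed
    have z0: "(\<integral>\<eta>. ?a m \<eta> * ?a l \<eta> \<partial>\<mu>) = 0" if "N < m \<or> N < l" for m l
    proof -
      have "(\<integral>\<eta>. ?a m \<eta> * ?a l \<eta> \<partial>\<mu>) = (\<integral>\<eta>. 0 \<partial>\<mu>)"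
        by (rule Bochner_Integration.integral_cong[OF refl]) (use a0 that in auto)
      then show ?thesis by simp
    qed
    \<comment> \<open>The square of degrees embeds into the triangle m \<le> k \<le> 2 N by (m, l)
      \<mapsto> (m + l, m); the remaining pairs of the triangle involve a degree above N and
      contribute 0.\<close>
    have "(\<Sum>p\<in>{..N} \<times> {..N}. \<integral>\<eta>. ?a (fst p) \<eta> * ?a (snd p) \<eta> \<partial>\<mu>)
      = (\<Sum>p\<in>(\<lambda>(m, l). (m + l, m)) ` ({..N} \<times> {..N}). \<integral>\<eta>. ?a (snd p) \<eta> * ?a (fst p - snd p) \<eta> \<partial>\<mu>)"
      by (subst sum.reindex) (auto simp: inj_on_def case_prod_beta)
    also have "\<dots> = (\<Sum>p\<in>(SIGMA k:{..2 * N}. {..k}). \<integral>\<eta>. ?a (snd p) \<eta> * ?a (fst p - snd p) \<eta> \<partial>\<mu>)"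
    proof (rule sum.mono_neutral_left)
      show "\<forall>p\<in>(SIGMA k:{..2 * N}. {..k}) - (\<lambda>(m, l). (m + l, m)) ` ({..N} \<times> {..N}).
         (\<integral>\<eta>. ?a (snd p) \<eta> * ?a (fst p - snd p) \<eta> \<partial>\<mu>) = 0"
      proof
        fix p assume p: "p \<in> (SIGMA k:{..2 * N}. {..k}) - (\<lambda>(m, l). (m + l, m)) ` ({..N} \<times> {..N})"
        obtain k m where km: "p = (k, m)" by (cases p)
        have "m \<le> k" using p km by simp
        then have "p = (\<lambda>(m, l). (m + l, m)) (m, k - m)" by (simp add: km)
        then have "(m, k - m) \<notin> {..N} \<times> {..N}" using p by blast
        then have "N < m \<or> N < k - m" by auto
        then show "(\<integral>\<eta>. ?a (snd p) \<eta> * ?a (fst p - snd p) \<eta> \<partial>\<mu>) = 0" using z0 by (simp add: km)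
      qed
    qed auto
    finally show ?thesis by simp
  qed
  also have "\<dots> = (\<Sum>m\<le>N. \<Sum>l\<le>N. \<integral>\<eta>. ?a m \<eta> * ?a l \<eta> \<partial>\<mu>)"
    by (simp add: sum.cartesian_product case_prod_beta)
  also have "\<dots> = (\<integral>\<eta>. (\<Sum>m\<le>N. \<Sum>l\<le>N. ?a m \<eta> * ?a l \<eta>) \<partial>\<mu>)"
    by (simp add: Bochner_Integration.integral_sum Bochner_Integration.integrable_sum ti)
  also have "\<dots> = (\<integral>\<eta>. (\<Sum>m\<le>N. ?a m \<eta>) * (\<Sum>m\<le>N. ?a m \<eta>) \<partial>\<mu>)"
    by (simp add: sum_product)
  also have "0 \<le> \<dots>" by (rule integral_nonneg_AE) simp
  finally show "0 \<le> (\<integral>p. Psi_tensor F F p \<partial>Psi_measure M)" .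
qed

end

section \<open>Repeated coordinates under (S), and the factorial moments of a count\<close>

lemma mset_eq_obtains_permutation:
  assumes "mset xs = mset ys"
  obtains p where "p permutes {..<length xs}" "\<And>i. i < length xs \<Longrightarrow> xs ! i = ys ! p i"
proof -
  have l: "length xs = length ys" using mset_eq_length[OF assms] .
  obtain p where p: "p permutes {..<length ys}" "permute_list p ys = xs"
    using mset_eq_permutation[OF assms] by blast
  show ?thesis
    by (rule that[of p]) (use p l permute_list_nth[OF p(1)] in auto)
qed

lemma comp_permutes_eq_pull:
  assumes "x \<in> extensional {..<n}" "\<sigma> permutes {..<n}"
  shows "x \<circ> \<sigma> = pull n \<sigma> x"
proof
  fix j
  show "(x \<circ> \<sigma>) j = pull n \<sigma> x j"
    using assms by (cases "j < n") (simp_all add: pull_def extensional_def permutes_not_in)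
qed

lemma count_mset_map_upt: "count (mset (map s [0..<N])) l = card {j. j < N \<and> s j = l}"
proof (induct N)
  case (Suc N)
  have "{j. j < Suc N \<and> s j = l} = {j. j < N \<and> s j = l} \<union> (if s N = l then {N} else {})"
    by (auto simp: less_Suc_eq)
  then show ?case using Suc by (auto simp: card_insert_if)
qed simp

lemma count_mset_block_index: "count (mset (block_index n i)) l = (if l < n then i l else 0)"
  unfolding block_index_def by (induct n) (auto simp: less_Suc_eq)

context loc_compact
begin

lemma measurable_permute:
  assumes M: "symmetric_radon_sequence (M :: nat \<Rightarrow> (nat \<Rightarrow> 'a) measure)" and s: "\<sigma> permutes {..<n}"
  shows "(\<lambda>x. x \<circ> \<sigma>) \<in> measurable (M n) (M n)"
proof (rule measurable_eqI)
  note D = symmetric_radon_sequenceD[OF M]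
  show "x \<circ> \<sigma> = pull n \<sigma> x" if "x \<in> space (M n)" for x
    by (rule comp_permutes_eq_pull[OF _ s]) (use that D(3) in \<open>auto simp: PiE_def\<close>)
  have "\<sigma> j < n" if "j < n" for j using permutes_in_image[OF s, of j] that by simp
  then show "pull n \<sigma> \<in> measurable (M n) (M n)"
    using measurable_pull[of n \<sigma> n] by (simp add: measurable_cong_sets[OF D(2) D(2)])
qed

lemma emeasure_permute_image:
  assumes M: "symmetric_radon_sequence (M :: nat \<Rightarrow> (nat \<Rightarrow> 'a) measure)" and s: "\<sigma> permutes {..<n}" and E: "E \<in> sets (pow_borel n)"
  shows "emeasure (M n) ((\<lambda>x. x \<circ> \<sigma>) ` E) = emeasure (M n) E"
proof -
  note D = symmetric_radon_sequenceD[OF M]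
  note t = permutes_inv[OF s]
  have Es: "E \<subseteq> PiE {..<n} (\<lambda>_. UNIV)" using sets.sets_into_space[OF E] by (simp add: space_PiM)
  have c: "x \<circ> \<sigma> \<circ> inv \<sigma> = x" "x \<circ> inv \<sigma> \<circ> \<sigma> = x" for x :: "nat \<Rightarrow> 'a"
    using permutes_inv_o[OF s] by (simp_all add: comp_assoc)
  have "(\<lambda>x. x \<circ> \<sigma>) ` E = (\<lambda>x. x \<circ> inv \<sigma>) -` E \<inter> space (M n)"
  proof (intro equalityI subsetI)
    fix y assume "y \<in> (\<lambda>x. x \<circ> \<sigma>) ` E"
    then obtain x where x: "x \<in> E" "y = x \<circ> \<sigma>" by blast
    have "y \<in> extensional {..<n}"
      using x Es s by (auto simp: extensional_def PiE_def permutes_not_in)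
    then have "y \<in> space (M n)" unfolding D(3) PiE_def by simp
    moreover have "y \<circ> inv \<sigma> = x" unfolding x(2) by (rule c)
    ultimately show "y \<in> (\<lambda>x. x \<circ> inv \<sigma>) -` E \<inter> space (M n)" using x(1) by simp
  next
    fix y assume "y \<in> (\<lambda>x. x \<circ> inv \<sigma>) -` E \<inter> space (M n)"
    then have "y \<circ> inv \<sigma> \<in> E" by simp
    moreover have "y = (\<lambda>x. x \<circ> \<sigma>) (y \<circ> inv \<sigma>)" by (simp only: c)
    ultimately show "y \<in> (\<lambda>x. x \<circ> \<sigma>) ` E" by blast
  qed
  also have "emeasure (M n) \<dots> = emeasure (distr (M n) (M n) (\<lambda>x. x \<circ> inv \<sigma>)) E"
    by (rule emeasure_distr[OF measurable_permute[OF M t], symmetric]) (use E D(2) in simp)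
  also have "\<dots> = emeasure (M n) E" by (simp only: D(4)[OF t])
  finally show ?thesis .
qed

text \<open>(S) speaks of consecutive blocks. A general surjection s takes each value as often as
  the block map whose block sizes are the sizes of the fibres of s; so the two differ by a
  permutation of the coordinates, under which \<open>M N\<close> is invariant.\<close>

lemma emeasure_pull_offdiag:
  assumes M: "symmetric_radon_sequence (M :: nat \<Rightarrow> (nat \<Rightarrow> 'a) measure)" and S: "simplicity_identity M"
    and s: "s ` {..<N} = {..<n}" and D: "\<Delta> \<in> sets (offdiag_borel n)"
  shows "emeasure (M N) (pull N s ` \<Delta>) = emeasure (M n) \<Delta>"
proof (cases "n = 0")
  case True
  then have N: "N = 0" using s by (cases N) auto
  have "\<Delta> \<subseteq> offdiag 0" using D True by (simp add: sets_offdiag_borel)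
  then have "pull 0 s x = x" if "x \<in> \<Delta>" for x using that by (auto simp: pull_def offdiag_iff)
  then have "pull 0 s ` \<Delta> = \<Delta>" by simp
  then show ?thesis using True N by simp
next
  case False
  define i where "i l = card {j. j < N \<and> s j = l}" for l
  have i1: "1 \<le> i l" if "l < n" for l
  proof -
    obtain j where "j < N" "s j = l" using s \<open>l < n\<close> by (metis imageE lessThan_iff)
    then have "{j. j < N \<and> s j = l} \<noteq> {}" by blast
    then show ?thesis by (simp add: i_def Suc_le_eq card_gt_0_iff)
  qed
  have sn: "s j < n" if "j < N" for j using s that by blast
  have "mset (block_index n i) = mset (map s [0..<N])"
  proof (rule multiset_eqI)
    fix l
    have "i l = 0" if "\<not> l < n"
    proof -
      have "{j. j < N \<and> s j = l} = {}" using sn that by blast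
      then show ?thesis by (simp only: i_def card.empty)
    qed
    then show "count (mset (block_index n i)) l = count (mset (map s [0..<N])) l"
      unfolding count_mset_block_index count_mset_map_upt by (auto simp: i_def)
  qed
  moreover from this have len: "length (block_index n i) = N" using mset_eq_length by fastforce
  ultimately obtain p where p: "p permutes {..<N}" "\<And>j. j < N \<Longrightarrow> block_index n i ! j = map s [0..<N] ! p j"
    using mset_eq_obtains_permutation by metis
  have pn: "p j < N" if "j < N" for j using permutes_in_image[OF p(1), of j] that by simp
  have ps: "block_index n i ! j = s (p j)" if "j < N" for j using p(2)[OF that] pn[OF that] by simp
  have si: "(\<Sum>l<n. i l) = N" using len length_block_index[of n i] by simp
  have dp: "diag_point n i x = pull N s x \<circ> p" for x :: "nat \<Rightarrow> 'a"
  proof -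
    have "pull N s x \<circ> p = pull N p (pull N s x)"
      by (rule comp_permutes_eq_pull[OF _ p(1)]) (simp add: pull_def)
    also have "\<dots> = diag_point n i x"
      unfolding diag_point_eq_pull si by (rule ext) (simp add: pull_def pn ps)
    finally show ?thesis by simp
  qed
  have D': "\<Delta> \<in> sets (pow_borel n)" "\<Delta> \<subseteq> offdiag n" using D by (simp_all add: sets_offdiag_borel)
  have "diag_point n i ` \<Delta> = (\<lambda>x. pull N s x \<circ> p) ` \<Delta>" by (rule image_cong[OF refl dp])
  then have "diag_point n i ` \<Delta> = (\<lambda>y. y \<circ> p) ` pull N s ` \<Delta>" by (simp only: image_image)
  then have "diag_mass M n i \<Delta> = emeasure (M N) (pull N s ` \<Delta>)"
    unfolding diag_mass_def si by (simp only: emeasure_permute_image[OF M p(1) pull_image_sets[OF s D'(1)]])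
  moreover have "diag_mass M n i \<Delta> = diag_mass M n (\<lambda>_. 1) \<Delta>"
    using S[unfolded simplicity_identity_def, rule_format, of n i \<Delta>] False i1 D by simp
  moreover have "diag_mass M n (\<lambda>_. 1) \<Delta> = emeasure (M n) \<Delta>"
  proof -
    have b: "block_index n (\<lambda>_. 1) = [0..<n]"
      unfolding block_index_def by (induct n) simp_all
    have "diag_point n (\<lambda>_. 1) x = x" if "x \<in> \<Delta>" for x
    proof -
      have "x \<in> extensional {..<n}" using that D'(2) by (auto simp: offdiag_iff)
      then show ?thesis
        unfolding diag_point_eq_pull b by (intro ext) (simp add: pull_def restrict_def extensional_def)
    qed
    then have "diag_point n (\<lambda>_. 1) ` \<Delta> = \<Delta>" by (simp only: image_cong[OF refl] image_ident)
    then show ?thesis by (simp add: diag_mass_def)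
  qed
  ultimately show ?thesis by simp
qed

text \<open>The set B is cut according to which coordinates coincide. Each stratum arises from an
  off-diagonal set of k-tuples by repeating coordinates, and so does its image under the pull; by
  \<open>emeasure_pull_offdiag\<close> both have the mass of that off-diagonal set.\<close>

theorem emeasure_pull:
  assumes M: "symmetric_radon_sequence (M :: nat \<Rightarrow> (nat \<Rightarrow> 'a) measure)" and S: "simplicity_identity M"
    and d: "d ` {..<N} = {..<n}" and B: "B \<in> sets (pow_borel n)"
  shows "emeasure (M N) (pull N d ` B) = emeasure (M n) B"
proof -
  note D = symmetric_radon_sequenceD[OF M]
  \<comment> \<open>The coincidence pattern of x, recorded as a set of pairs of indices.\<close>
  let ?K = "\<lambda>x. {(i, j). i < n \<and> j < n \<and> x i = (x j :: 'a)}"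
  let ?R = "Pow ({..<n} \<times> {..<n})"
  define Br where "Br r = {x \<in> B. ?K x = r}" for r
  have BX: "B \<subseteq> PiE {..<n} (\<lambda>_. UNIV)" using sets.sets_into_space[OF B] by (simp add: space_PiM)
  have dn: "d j < n" if "j < N" for j using d that by blast
  have stratum: "Br r \<in> sets (pow_borel n) \<and> emeasure (M N) (pull N d ` Br r) = emeasure (M n) (Br r)" for r
  proof (cases "Br r = {}")
    case True then show ?thesis by simp
  next
    case False
    \<comment> \<open>Any point of the stratum shows the pattern; numbering its distinct entries
      yields the index map s.\<close>
    then obtain x0 where x0: "x0 \<in> B" "?K x0 = r" by (auto simp: Br_def)
    define k where "k = card (x0 ` {..<n})"
    obtain e where e: "bij_betw e (x0 ` {..<n}) {..<k}"
      using ex_bij_betw_finite_nat[of "x0 ` {..<n}"] by (auto simp: k_def atLeast0LessThan)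
    define s where "s i = e (x0 i)" for i
    have s: "s ` {..<n} = {..<k}" using e by (auto simp: s_def bij_betw_def image_image)
    have sk: "s i < k" if "i < n" for i using s that by blast
    have s_eq: "s i = s j \<longleftrightarrow> (i, j) \<in> r" if "i < n" "j < n" for i j
      using e that x0(2) by (auto simp: s_def bij_betw_def inj_on_def)
    define \<Delta> where "\<Delta> = {y \<in> offdiag k. pull n s y \<in> B}"
    have \<Delta>: "\<Delta> \<in> sets (offdiag_borel k)"
    proof -
      have "\<Delta> = (pull n s -` B \<inter> space (pow_borel k)) \<inter> offdiag k"
        by (auto simp: \<Delta>_def space_PiM offdiag_def cube_def)
      moreover have "pull n s -` B \<inter> space (pow_borel k) \<in> sets (pow_borel k)"
        by (rule measurable_sets[OF measurable_pull B]) (rule sk)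
      ultimately show ?thesis using offdiag_sets[of k, where 'a='a] by (simp add: sets_offdiag_borel)
    qed
    have Br: "Br r = pull n s ` \<Delta>"
    proof (intro equalityI subsetI)
      fix x assume "x \<in> Br r"
      then have x: "x \<in> B" "?K x = r" by (auto simp: Br_def)
      have xx: "x i = x j \<longleftrightarrow> s i = s j" if "i < n" "j < n" for i j using s_eq[OF that] x(2) that by blast
      have "\<forall>l. \<exists>i. l < k \<longrightarrow> i < n \<and> s i = l" using s by (metis imageE lessThan_iff)
      then obtain q where q: "\<And>l. l < k \<Longrightarrow> q l < n" "\<And>l. l < k \<Longrightarrow> s (q l) = l" by metis
      let ?y = "pull k q x"
      have "?y \<in> offdiag k"
        unfolding offdiag_iff
      proof
        show "inj_on ?y {..<k}"
        proof (rule inj_onI)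
          fix a b assume ab: "a \<in> {..<k}" "b \<in> {..<k}" "?y a = ?y b"
          then have "x (q a) = x (q b)" by (simp add: pull_def)
          then have "s (q a) = s (q b)" using xx q(1) ab by simp
          then show "a = b" using q(2) ab by simp
        qed
      qed (simp add: pull_def)
      moreover have "pull n s ?y = x"
      proof (rule PiE_ext[OF pull_in_PiE])
        show "x \<in> PiE {..<n} (\<lambda>_. UNIV)" using x(1) BX by blast
        fix i assume "i \<in> {..<n}"
        then have i: "i < n" by simp
        have "x (q (s i)) = x i" using xx[OF q(1)[OF sk[OF i]] i] q(2)[OF sk[OF i]] by simp
        then show "pull n s ?y i = x i" using i sk[OF i] by (simp add: pull_def)
      qed
      ultimately show "x \<in> pull n s ` \<Delta>" using x(1) unfolding \<Delta>_def by (intro image_eqI[of _ _ ?y]) simp_all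
    next
      fix x assume "x \<in> pull n s ` \<Delta>"
      then obtain y where y: "y \<in> offdiag k" "pull n s y \<in> B" "x = pull n s y" by (auto simp: \<Delta>_def)
      have "x i = x j \<longleftrightarrow> (i, j) \<in> r" if "i < n" "j < n" for i j
        using y(1) sk that s_eq[OF that] by (auto simp: y(3) pull_def offdiag_iff inj_on_def)
      moreover have "r \<subseteq> {..<n} \<times> {..<n}" using x0(2) by auto
      ultimately have "?K x = r" by blast
      then show "x \<in> Br r" using y by (simp add: Br_def)
    qed
    have \<Delta>': "\<Delta> \<in> sets (pow_borel k)" using \<Delta> by (simp add: sets_offdiag_borel)
    have sd: "(\<lambda>j. s (d j)) ` {..<N} = {..<k}" using s d by (metis image_image)
    have "pull N d ` Br r = pull N (\<lambda>j. s (d j)) ` \<Delta>"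
    proof -
      have "pull N d (pull n s y) = pull N (\<lambda>j. s (d j)) y" for y :: "nat \<Rightarrow> 'a"
        by (rule ext) (simp add: pull_def dn)
      then show ?thesis unfolding Br by (simp only: image_image)
    qed
    then have "emeasure (M N) (pull N d ` Br r) = emeasure (M k) \<Delta>"
      using emeasure_pull_offdiag[OF M S sd \<Delta>] by simp
    also have "\<dots> = emeasure (M n) (Br r)"
      unfolding Br by (rule emeasure_pull_offdiag[OF M S s \<Delta>, symmetric])
    finally show ?thesis using pull_image_sets[OF s \<Delta>'] Br by simp
  qed
  have U: "B = (\<Union>r\<in>?R. Br r)"
  proof (intro equalityI subsetI)
    fix x assume "x \<in> B"
    then have "x \<in> Br (?K x)" by (simp add: Br_def)
    moreover have "?K x \<in> ?R" by auto
    ultimately show "x \<in> (\<Union>r\<in>?R. Br r)" by (rule UN_I[rotated])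
  next
    fix x assume "x \<in> (\<Union>r\<in>?R. Br r)"
    then show "x \<in> B" unfolding Br_def by blast
  qed
  have disj: "disjoint_family_on Br ?R" unfolding disjoint_family_on_def Br_def by blast
  have disj': "disjoint_family_on (\<lambda>r. pull N d ` Br r) ?R"
    unfolding disjoint_family_on_def
  proof (intro ballI impI)
    fix r r' :: "(nat \<times> nat) set" assume "r \<noteq> r'"
    then have e: "Br r \<inter> Br r' = {}" by (auto simp: Br_def)
    have "pull N d ` Br r \<inter> pull N d ` Br r' = pull N d ` (Br r \<inter> Br r')"
      by (rule inj_on_image_Int[OF pull_inj[OF d], symmetric]) (use BX in \<open>auto simp: Br_def\<close>)
    then show "pull N d ` Br r \<inter> pull N d ` Br r' = {}" using e by simp
  qed
  have "emeasure (M n) B = (\<Sum>r\<in>?R. emeasure (M n) (Br r))"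
    by (subst U, rule sum_emeasure[symmetric]) (use stratum D(2) disj in auto)
  also have "\<dots> = (\<Sum>r\<in>?R. emeasure (M N) (pull N d ` Br r))" using stratum by simp
  also have "\<dots> = emeasure (M N) (\<Union>r\<in>?R. pull N d ` Br r)"
    by (rule sum_emeasure) (use stratum D(2) disj' pull_image_sets[OF d] in auto)
  also have "(\<Union>r\<in>?R. pull N d ` Br r) = pull N d ` B" by (simp only: image_UN[symmetric] U[symmetric])
  finally show ?thesis by simp
qed

text \<open>The counterpart of \<open>falling_poly n * monom 1 k\<close> for tuples: n distinct
  entries followed by k unrestricted ones.\<close>

definition dist_cube :: "nat \<Rightarrow> nat \<Rightarrow> 'a set \<Rightarrow> (nat \<Rightarrow> 'a) set" where
  "dist_cube n k A = {x \<in> cube (n + k) A. inj_on x {..<n}}"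

lemma dist_cube_sets:
  assumes A: "A \<in> sets borel" shows "dist_cube n k A \<in> sets (pow_borel (n + k))"
proof -
  have "pull_left n -` offdiag n \<inter> space (pow_borel (n + k)) \<in> sets (pow_borel (n + k) :: (nat \<Rightarrow> 'a) measure)"
    by (rule measurable_sets[OF measurable_pull[of n "\<lambda>j. j" "n + k"] offdiag_sets]) simp
  from sets.Int[OF this cube_sets[OF A]]
  have "pull_left n -` offdiag n \<inter> space (pow_borel (n + k)) \<inter> cube (n + k) A \<in> sets (pow_borel (n + k))" .
  also have "pull_left n -` offdiag n \<inter> space (pow_borel (n + k)) \<inter> cube (n + k) A = dist_cube n k A"
  proof -
    have "pull_left n x \<in> offdiag n \<longleftrightarrow> inj_on x {..<n}" for x :: "nat \<Rightarrow> 'a"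
      by (simp add: offdiag_iff pull_def inj_on_def)
    moreover have "cube (n + k) A \<subseteq> space (pow_borel (n + k))" unfolding cube_def space_PiM by (rule PiE_mono) simp
    ultimately show ?thesis unfolding dist_cube_def by blast
  qed
  finally show ?thesis .
qed

lemma dist_cube_finite:
  assumes M: "symmetric_radon_sequence (M :: nat \<Rightarrow> (nat \<Rightarrow> 'a) measure)" and A: "A \<in> relcompact_borel"
  shows "emeasure (M (n + k)) (dist_cube n k A) < \<infinity>"
proof -
  note D = symmetric_radon_sequenceD[OF M]
  have "emeasure (M (n + k)) (dist_cube n k A) \<le> emeasure (M (n + k)) (cube (n + k) A)"
    by (rule emeasure_mono) (use cube_sets[OF relcompact_borel_sets[OF A]] D(2) in \<open>auto simp: dist_cube_def\<close>)
  also have "\<dots> < \<infinity>" unfolding cube_def by (rule radon_pow_finite[OF D(1)]) (rule A)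
  finally show ?thesis .
qed

text \<open>The entry at position n either differs from the n distinct entries before it or equals
  exactly one of them, and inserting such a repetition preserves the mass by
  \<open>emeasure_pull\<close>.\<close>

lemma dist_cube_recursion:
  assumes M: "symmetric_radon_sequence (M :: nat \<Rightarrow> (nat \<Rightarrow> 'a) measure)" and S: "simplicity_identity M"
    and A: "A \<in> relcompact_borel"
  shows "measure (M (n + Suc k)) (dist_cube n (Suc k) A) =
    measure (M (Suc n + k)) (dist_cube (Suc n) k A) + of_nat n * measure (M (n + k)) (dist_cube n k A)"
proof -
  note D = symmetric_radon_sequenceD[OF M] and Ab = relcompact_borel_sets[OF A]
  let ?N = "n + Suc k"
  \<comment> \<open>The index map \<open>d i\<close> inserts a copy of entry i at position n and
    shifts the later entries.\<close>
  define d where "d i j = (if j < n then j else if j = n then i else j - 1)" for i j :: nat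
  let ?E = "\<lambda>i. pull ?N (d i) ` dist_cube n k A"
  have ds: "d i ` {..<?N} = {..<n + k}" if "i < n" for i
  proof (intro equalityI subsetI)
    fix l assume l: "l \<in> {..<n + k}"
    show "l \<in> d i ` {..<?N}"
      by (rule image_eqI[of _ _ "if l < n then l else Suc l"]) (use l in \<open>auto simp: d_def\<close>)
  qed (use that in \<open>auto simp: d_def split: if_splits\<close>)
  have Es: "?E i \<in> sets (pow_borel ?N)" if "i < n" for i
    by (rule pull_image_sets[OF ds[OF that] dist_cube_sets[OF Ab]])
  have cube_iff: "x \<in> cube m A \<longleftrightarrow> x \<in> extensional {..<m} \<and> (\<forall>j<m. x j \<in> A)" for m and x :: "nat \<Rightarrow> 'a"
    by (auto simp: cube_def PiE_def Pi_def)
  have E: "?E i = {x \<in> dist_cube n (Suc k) A. x n = x i}" if i: "i < n" for i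
  proof (intro equalityI subsetI)
    fix x assume "x \<in> ?E i"
    then obtain y where y: "y \<in> dist_cube n k A" "x = pull ?N (d i) y" by blast
    have dl: "d i j < n + k" if "j < ?N" for j using ds[OF i] that by blast
    have yA: "y j \<in> A" if "j < n + k" for j using y(1) that by (simp add: dist_cube_def cube_iff)
    have "x \<in> cube ?N A" unfolding cube_iff y(2) using dl yA by (simp add: pull_def)
    moreover have "x j = y j" if "j < n" for j using that by (simp add: y(2) pull_def d_def)
    moreover from this have "inj_on x {..<n}" using y(1) by (simp add: dist_cube_def inj_on_def)
    moreover have "x n = x i" using i by (simp add: y(2) pull_def d_def)
    ultimately show "x \<in> {x \<in> dist_cube n (Suc k) A. x n = x i}" by (simp add: dist_cube_def)
  next
    fix x assume "x \<in> {x \<in> dist_cube n (Suc k) A. x n = x i}"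
    then have x: "x \<in> extensional {..<?N}" "\<And>j. j < ?N \<Longrightarrow> x j \<in> A" "inj_on x {..<n}" "x n = x i"
      by (simp_all add: dist_cube_def cube_iff)
    let ?y = "pull (n + k) (\<lambda>j. if j < n then j else Suc j) x"
    have "?y \<in> dist_cube n k A"
      unfolding dist_cube_def cube_iff using x(2,3) by (simp add: pull_def inj_on_def)
    moreover have "x = pull ?N (d i) ?y"
    proof
      fix j
      show "x j = pull ?N (d i) ?y j"
      proof (cases "j < ?N")
        case True
        have "j < n \<or> j = n \<or> n < j" by linarith
        then show ?thesis using True x(4) i by (auto simp: pull_def d_def)
      next
        case False
        then show ?thesis using x(1) by (simp add: pull_def extensional_def)
      qed
    qed
    ultimately show "x \<in> ?E i" by blast
  qed
  have split: "dist_cube n (Suc k) A = dist_cube (Suc n) k A \<union> (\<Union>i\<in>{..<n}. ?E i)"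
  proof (intro equalityI subsetI)
    fix x assume x: "x \<in> dist_cube n (Suc k) A"
    show "x \<in> dist_cube (Suc n) k A \<union> (\<Union>i\<in>{..<n}. ?E i)"
    proof (cases "\<exists>i<n. x n = x i")
      case True then show ?thesis using E x by blast
    next
      case False
      then have "inj_on x {..<Suc n}" using x unfolding dist_cube_def lessThan_Suc by auto
      then show ?thesis using x by (simp add: dist_cube_def)
    qed
  next
    fix x assume "x \<in> dist_cube (Suc n) k A \<union> (\<Union>i\<in>{..<n}. ?E i)"
    then show "x \<in> dist_cube n (Suc k) A"
    proof
      assume "x \<in> dist_cube (Suc n) k A"
      then show ?thesis by (auto simp: dist_cube_def lessThan_Suc)
    next
      assume "x \<in> (\<Union>i\<in>{..<n}. ?E i)"
      then show ?thesis using E by blast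
    qed
  qed
  have dj: "dist_cube (Suc n) k A \<inter> (\<Union>i\<in>{..<n}. ?E i) = {}"
  proof (rule ccontr)
    assume "dist_cube (Suc n) k A \<inter> (\<Union>i\<in>{..<n}. ?E i) \<noteq> {}"
    then obtain x i where x: "x \<in> dist_cube (Suc n) k A" "i < n" "x \<in> ?E i" by blast
    then have "x n = x i" using E by blast
    moreover have "inj_on x {..<Suc n}" using x(1) by (simp add: dist_cube_def)
    ultimately have "n = i" using x(2) by (simp add: inj_on_def)
    then show False using x(2) by simp
  qed
  have dj': "disjoint_family_on ?E {..<n}"
    unfolding disjoint_family_on_def
  proof (intro ballI impI)
    fix i j assume ij: "i \<in> {..<n}" "j \<in> {..<n}" "i \<noteq> j"
    show "?E i \<inter> ?E j = {}"
    proof (rule ccontr)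
      assume "?E i \<inter> ?E j \<noteq> {}"
      then obtain x where "x \<in> dist_cube n (Suc k) A" "x n = x i" "x n = x j" using E ij by blast
      then show False using ij by (auto simp: dist_cube_def inj_on_def)
    qed
  qed
  have m1: "emeasure (M ?N) (?E i) = emeasure (M (n + k)) (dist_cube n k A)" if "i < n" for i
    by (rule emeasure_pull[OF M S ds[OF that] dist_cube_sets[OF Ab]])
  have "emeasure (M ?N) (dist_cube n (Suc k) A) =
      emeasure (M ?N) (dist_cube (Suc n) k A) + emeasure (M ?N) (\<Union>i\<in>{..<n}. ?E i)"
    unfolding split
    by (rule plus_emeasure[symmetric]) (use dist_cube_sets[OF Ab, of "Suc n" k] Es D(2) dj in auto)
  also have "emeasure (M ?N) (\<Union>i\<in>{..<n}. ?E i) = (\<Sum>i<n. emeasure (M ?N) (?E i))"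
    by (rule sum_emeasure[symmetric]) (use Es D(2) dj' in auto)
  also have "\<dots> = of_nat n * emeasure (M (n + k)) (dist_cube n k A)" using m1 by simp
  finally have e: "emeasure (M ?N) (dist_cube n (Suc k) A) =
      emeasure (M ?N) (dist_cube (Suc n) k A) + of_nat n * emeasure (M (n + k)) (dist_cube n k A)" .
  have f: "emeasure (M (n + k)) (dist_cube n k A) = ennreal (measure (M (n + k)) (dist_cube n k A))" for n k
    using dist_cube_finite[OF M A, of n k] by (intro emeasure_eq_ennreal_measure) simp
  have "ennreal (measure (M ?N) (dist_cube n (Suc k) A)) =
     ennreal (measure (M ?N) (dist_cube (Suc n) k A) + of_nat n * measure (M (n + k)) (dist_cube n k A))"
    using e f[of n "Suc k"] f[of "Suc n" k] f[of n k]
    by (simp add: ennreal_plus ennreal_mult ennreal_of_nat_eq_real_of_nat)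
  then show ?thesis by (subst (asm) ennreal_inj) simp_all
qed

text \<open>The induction carries a factor X^k along, since the recursion trades an unrestricted
  entry for a distinct one.\<close>

lemma falling_poly_moment:
  fixes T :: "real poly \<Rightarrow> real"
  assumes M: "symmetric_radon_sequence (M :: nat \<Rightarrow> (nat \<Rightarrow> 'a) measure)" and S: "simplicity_identity M"
    and A: "A \<in> relcompact_borel"
    and T_add: "\<And>u v. T (u + v) = T u + T v" and T_smult: "\<And>c u. T (smult c u) = c * T u"
    and T_monom: "\<And>k. T (monom 1 k) = measure (M k) (cube k A)"
  shows "T (falling_poly n) = measure (M n) (cube n A \<inter> offdiag n)"
proof -
  have "T (falling_poly n * monom 1 k) = measure (M (n + k)) (dist_cube n k A)" for k
  proof (induct n arbitrary: k)
    case 0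
    then show ?case by (simp add: falling_poly_def T_monom dist_cube_def)
  next
    case (Suc n)
    have "falling_poly n * monom 1 (Suc k) = ([:0, 1:] * falling_poly n) * monom 1 k"
      by (simp add: monom_Suc mult_ac)
    also have "\<dots> = falling_poly (Suc n) * monom 1 k + smult (of_nat n) (falling_poly n * monom 1 k)"
      unfolding falling_poly_Suc by (simp add: distrib_right)
    finally have "T (falling_poly n * monom 1 (Suc k)) = T (falling_poly (Suc n) * monom 1 k) + of_nat n * T (falling_poly n * monom 1 k)"
      by (simp only: T_add T_smult)
    then show ?case using Suc[of "Suc k"] Suc[of k] dist_cube_recursion[OF M S A, of n k] by simp
  qed
  from this[of 0] have "T (falling_poly n) = measure (M n) (dist_cube n 0 A)" by (simp add: monom_0 one_pCons[symmetric])
  also have "dist_cube n 0 A = cube n A \<inter> offdiag n"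
    by (auto simp: dist_cube_def offdiag_iff cube_def PiE_def)
  finally show ?thesis .
qed

end

section \<open>Counts with prescribed moments\<close>

lemma Poly_Mapping_eq_sum_single: "p = (\<Sum>\<alpha>\<in>Poly_Mapping.keys p. Poly_Mapping.single \<alpha> (Poly_Mapping.lookup p \<alpha>))"
proof (rule poly_mapping_eqI)
  fix \<beta>
  have "(\<Sum>\<alpha>\<in>Poly_Mapping.keys p. Poly_Mapping.lookup (Poly_Mapping.single \<alpha> (Poly_Mapping.lookup p \<alpha>)) \<beta>)
      = (\<Sum>\<alpha>\<in>Poly_Mapping.keys p. if \<alpha> = \<beta> then Poly_Mapping.lookup p \<beta> else 0)"
    by (rule sum.cong) (auto simp: lookup_single when_def)
  also have "\<dots> = Poly_Mapping.lookup p \<beta>" by (simp add: in_keys_iff)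
  finally show "Poly_Mapping.lookup p \<beta> = Poly_Mapping.lookup (\<Sum>\<alpha>\<in>Poly_Mapping.keys p. Poly_Mapping.single \<alpha> (Poly_Mapping.lookup p \<alpha>)) \<beta>"
    by (simp only: lookup_sum)
qed

text \<open>Polynomials in countably many commuting variables: a monomial is the multiset of its
  variables, so products of monomials are sums of multisets.\<close>

type_synonym moment_poly = "nat multiset \<Rightarrow>\<^sub>0 real"

definition lin_ext :: "(nat multiset \<Rightarrow> real) \<Rightarrow> moment_poly \<Rightarrow> real" where
  "lin_ext m p = (\<Sum>\<alpha>\<in>Poly_Mapping.keys p. Poly_Mapping.lookup p \<alpha> * m \<alpha>)"

lemma lin_ext_superset:
  assumes "finite S" "Poly_Mapping.keys p \<subseteq> S"
  shows "lin_ext m p = (\<Sum>\<alpha>\<in>S. Poly_Mapping.lookup p \<alpha> * m \<alpha>)"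
  unfolding lin_ext_def by (rule sum.mono_neutral_left) (use assms in \<open>auto simp: in_keys_iff\<close>)

lemma lin_ext_add: "lin_ext m (p + q) = lin_ext m p + lin_ext m q"
proof -
  let ?S = "Poly_Mapping.keys p \<union> Poly_Mapping.keys q"
  have S: "finite ?S" by simp
  have "lin_ext m (p + q) = (\<Sum>\<alpha>\<in>?S. Poly_Mapping.lookup (p + q) \<alpha> * m \<alpha>)"
    by (rule lin_ext_superset[OF S]) (rule keys_add)
  also have "\<dots> = (\<Sum>\<alpha>\<in>?S. Poly_Mapping.lookup p \<alpha> * m \<alpha>) + (\<Sum>\<alpha>\<in>?S. Poly_Mapping.lookup q \<alpha> * m \<alpha>)"
    by (simp add: lookup_add distrib_right sum.distrib)
  also have "\<dots> = lin_ext m p + lin_ext m q" by (simp add: lin_ext_superset[OF S])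
  finally show ?thesis .
qed

lemma lin_ext_single: "lin_ext m (Poly_Mapping.single \<alpha> c) = c * m \<alpha>"
  by (subst lin_ext_superset[of "{\<alpha>}"]) (auto split: if_splits)

lemma lin_ext_sum: "lin_ext m (sum f A) = (\<Sum>x\<in>A. lin_ext m (f x))"
proof (cases "finite A")
  case True
  have "lin_ext m 0 = 0" by (simp add: lin_ext_def)
  with True show ?thesis by (induct A rule: finite_induct) (simp_all add: lin_ext_add)
qed (simp add: lin_ext_def)

lemma lin_ext_scale: "lin_ext m (Poly_Mapping.single 0 c * p) = c * lin_ext m p"
proof -
  have "lin_ext m (Poly_Mapping.single 0 c * p)
     = lin_ext m (Poly_Mapping.single 0 c * (\<Sum>\<alpha>\<in>Poly_Mapping.keys p. Poly_Mapping.single \<alpha> (Poly_Mapping.lookup p \<alpha>)))"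
    by (simp only: Poly_Mapping_eq_sum_single[symmetric])
  also have "\<dots> = (\<Sum>\<alpha>\<in>Poly_Mapping.keys p. c * Poly_Mapping.lookup p \<alpha> * m \<alpha>)"
    by (simp add: sum_distrib_left mult_single lin_ext_sum lin_ext_single)
  also have "\<dots> = c * lin_ext m p" by (simp add: lin_ext_def sum_distrib_left mult.assoc)
  finally show ?thesis .
qed

lemma lin_ext_square:
  "lin_ext m (p * p) = (\<Sum>\<alpha>\<in>Poly_Mapping.keys p. \<Sum>\<beta>\<in>Poly_Mapping.keys p.
     Poly_Mapping.lookup p \<alpha> * Poly_Mapping.lookup p \<beta> * m (\<alpha> + \<beta>))"
proof -
  let ?s = "\<Sum>\<alpha>\<in>Poly_Mapping.keys p. Poly_Mapping.single \<alpha> (Poly_Mapping.lookup p \<alpha>)"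
  have "lin_ext m (p * p) = lin_ext m (?s * ?s)" by (simp only: Poly_Mapping_eq_sum_single[symmetric])
  also have "\<dots> = (\<Sum>\<alpha>\<in>Poly_Mapping.keys p. \<Sum>\<beta>\<in>Poly_Mapping.keys p.
     Poly_Mapping.lookup p \<alpha> * Poly_Mapping.lookup p \<beta> * m (\<alpha> + \<beta>))"
    by (simp add: sum_product mult_single lin_ext_sum lin_ext_single)
  finally show ?thesis .
qed

definition subst_var :: "nat \<Rightarrow> real poly \<Rightarrow> moment_poly" where
  "subst_var i u = (\<Sum>k\<le>degree u. Poly_Mapping.single (replicate_mset k i) (coeff u k))"

lemma subst_var_ge:
  assumes "degree u \<le> K"
  shows "subst_var i u = (\<Sum>k\<le>K. Poly_Mapping.single (replicate_mset k i) (coeff u k))"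
  unfolding subst_var_def by (rule sum.mono_neutral_left) (use assms in \<open>auto simp: coeff_eq_0 not_le\<close>)

lemma subst_var_add: "subst_var i (u + v) = subst_var i u + subst_var i v"
proof -
  let ?K = "max (degree u) (degree v)"
  have "degree (u + v) \<le> ?K" by (rule degree_add_le) auto
  then show ?thesis
    by (simp add: subst_var_ge[of _ ?K] single_add sum.distrib)
qed

lemma subst_var_const: "subst_var i [:c:] = Poly_Mapping.single 0 c"
  by (simp add: subst_var_def)

lemma subst_var_smult: "subst_var i (smult c u) = Poly_Mapping.single 0 c * subst_var i u"
proof -
  have "degree (smult c u) \<le> degree u" by (rule degree_smult_le)
  then show ?thesis
    by (subst subst_var_ge) (simp_all add: subst_var_def sum_distrib_left mult_single)
qed

lemma subst_var_shift: "subst_var i (pCons 0 u) = Poly_Mapping.single {#i#} 1 * subst_var i u"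
proof -
  have "degree (pCons 0 u) \<le> Suc (degree u)" by (rule degree_pCons_le)
  then have "subst_var i (pCons 0 u) = (\<Sum>k\<le>Suc (degree u). Poly_Mapping.single (replicate_mset k i) (coeff (pCons 0 u) k))"
    by (rule subst_var_ge)
  also have "\<dots> = (\<Sum>k\<le>degree u. Poly_Mapping.single (replicate_mset (Suc k) i) (coeff u k))"
    by (subst sum.atMost_Suc_shift) simp
  finally show ?thesis by (simp add: subst_var_def sum_distrib_left mult_single)
qed

text \<open>Reduced to multiplication by constants and by the variable, through the recursion over
  coefficients.\<close>

lemma subst_var_mult: "subst_var i (u * v) = subst_var i u * subst_var i v"
proof (induct u)
  case 0
  have "subst_var i 0 = 0" by (simp add: subst_var_def)
  then show ?case by simp
next
  case (pCons a u)
  have "pCons a u = [:a:] + pCons 0 u" by simp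
  then have "subst_var i (pCons a u) = Poly_Mapping.single 0 a + Poly_Mapping.single {#i#} 1 * subst_var i u"
    by (simp only: subst_var_add subst_var_const subst_var_shift)
  moreover have "pCons a u * v = smult a v + pCons 0 (u * v)" by simp
  then have "subst_var i (pCons a u * v) = Poly_Mapping.single 0 a * subst_var i v + Poly_Mapping.single {#i#} 1 * subst_var i (u * v)"
    by (simp only: subst_var_add subst_var_smult subst_var_shift)
  ultimately show ?case by (simp add: pCons distrib_right mult.assoc)
qed

lemma subst_var_monom: "subst_var i (monom 1 k) = Poly_Mapping.single (replicate_mset k i) 1"
proof -
  have "degree (monom (1::real) k) \<le> k" by (rule degree_monom_le)
  then have "subst_var i (monom 1 k) = (\<Sum>j\<le>k. Poly_Mapping.single (replicate_mset j i) (coeff (monom 1 k) j))"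
    by (rule subst_var_ge)
  also have "\<dots> = (\<Sum>j\<le>k. if j = k then Poly_Mapping.single (replicate_mset k i) 1 else 0)"
    by (rule sum.cong) auto
  finally show ?thesis by simp
qed

lemma prod_list_single:
  "prod_list (map (\<lambda>i. Poly_Mapping.single {#i#} (1::real)) is) = Poly_Mapping.single (mset is) 1"
  by (induct "is") (simp_all add: mult_single)

context loc_compact
begin

text \<open>Inverting the factorial moments \<open>n! l\<^sub>n\<close> gives weights \<open>s\<^sub>k\<close> with \<open>\<bar>s\<^sub>k\<bar> \<le> \<Sum>\<^sub>n (n choose k) l\<^sub>n\<close>, and
  \<open>\<Sum>\<^sub>k 256\<^sup>k (n choose k) = 257\<^sup>n\<close>.\<close>

definition nice :: "(nat \<Rightarrow> (nat \<Rightarrow> 'a) measure) \<Rightarrow> 'a set \<Rightarrow> bool" where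
  "nice M A \<longleftrightarrow> A \<in> relcompact_borel \<and>
     summable (\<lambda>n. 257 ^ n * (measure (M n) (cube n A \<inter> offdiag n) / fact n))"

text \<open>Symmetry of the measures; it lets a moment be assigned to a monomial, which knows its
  variables but not their order.\<close>

lemma lbox_permute:
  assumes M: "symmetric_radon_sequence (M :: nat \<Rightarrow> (nat \<Rightarrow> 'a) measure)"
    and e: "mset As = mset Bs" and A: "\<And>A. A \<in> set As \<Longrightarrow> A \<in> sets borel"
  shows "measure (M (length As)) (lbox As) = measure (M (length Bs)) (lbox Bs)"
proof -
  have l: "length As = length Bs" by (rule mset_eq_length[OF e])
  obtain p where p: "p permutes {..<length As}" "\<And>i. i < length As \<Longrightarrow> As ! i = Bs ! p i"
    using mset_eq_obtains_permutation[OF e] by metis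
  have pim: "p ` {..<length As} = {..<length As}" by (rule permutes_image[OF p(1)])
  have "(\<lambda>x. x \<circ> p) ` lbox Bs = lbox As"
  proof (intro equalityI subsetI)
    fix y assume "y \<in> (\<lambda>x. x \<circ> p) ` lbox Bs"
    then obtain x where x: "x \<in> lbox Bs" "y = x \<circ> p" by blast
    have "x (p i) \<in> As ! i" if "i < length As" for i
    proof -
      have "p i < length Bs" using pim that l by auto
      then show ?thesis using x(1) p(2)[OF that] by (simp add: lbox_def PiE_iff)
    qed
    moreover have "x (p i) = undefined" if "\<not> i < length As" for i
      using x(1) that l permutes_not_in[OF p(1), of i] by (simp add: lbox_def PiE_iff extensional_def)
    ultimately show "y \<in> lbox As" by (simp add: x(2) lbox_def PiE_iff extensional_def)
  next
    fix y assume y: "y \<in> lbox As"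
    have c: "y \<circ> inv p \<circ> p = y" using permutes_inv_o[OF p(1)] by (simp add: comp_assoc)
    have "y (inv p i) \<in> Bs ! i" if "i < length Bs" for i
    proof -
      have q: "inv p i < length As" using permutes_in_image[OF permutes_inv[OF p(1)], of i] that l by simp
      have "p (inv p i) = i" using permutes_inverses(1)[OF p(1)] by simp
      moreover have "y (inv p i) \<in> As ! inv p i" using y q by (simp add: lbox_def PiE_iff)
      ultimately show ?thesis using p(2)[OF q] by simp
    qed
    moreover have "y (inv p i) = undefined" if "\<not> i < length Bs" for i
      using y that l permutes_not_in[OF permutes_inv[OF p(1)], of i] by (simp add: lbox_def PiE_iff extensional_def)
    ultimately have "y \<circ> inv p \<in> lbox Bs" by (simp add: lbox_def PiE_iff extensional_def)
    then have "(y \<circ> inv p) \<circ> p \<in> (\<lambda>x. x \<circ> p) ` lbox Bs" by (rule imageI)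
    then show "y \<in> (\<lambda>x. x \<circ> p) ` lbox Bs" by (simp only: c)
  qed
  moreover have "lbox Bs \<in> sets (pow_borel (length As))"
    unfolding l by (rule lbox_sets) (use A e in \<open>metis set_mset_mset\<close>)
  ultimately have "emeasure (M (length As)) (lbox As) = emeasure (M (length As)) (lbox Bs)"
    using emeasure_permute_image[OF M p(1)] by metis
  then show ?thesis by (simp add: measure_def l)
qed

text \<open>The functional sends a monomial to the mass of the box with the corresponding sides.
  Nonnegativity on squares is positive definiteness on boxes, the weights of a single variable come
  from its factorial moments, and \<open>nice\<close> is the decay that the inversion of these
  moments requires.\<close>

theorem counting_process_exists:
  fixes A :: "nat \<Rightarrow> 'a set" and M :: "nat \<Rightarrow> (nat \<Rightarrow> 'a) measure"
  assumes M: "symmetric_radon_sequence M" and S: "simplicity_identity M" and pd: "positive_definite M"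
    and A: "\<And>i. nice M (A i)"
  obtains P where "prob_space P" "sets P = sets (PiM UNIV (\<lambda>_. count_space (UNIV :: nat set)))"
    "\<And>is. integrable P (\<lambda>\<omega>. prod_list (map (\<lambda>i. real (\<omega> i)) is))"
    "\<And>is. (\<integral>\<omega>. prod_list (map (\<lambda>i. real (\<omega> i)) is) \<partial>P) = measure (M (length is)) (lbox (map A is))"
proof -
  have Ar: "A i \<in> relcompact_borel" for i using A by (simp add: nice_def)
  have Ab: "B \<in> sets borel" if "B \<in> set (map A is)" for B "is" using that Ar relcompact_borel_sets by auto
  \<comment> \<open>Sorting merely picks one order of the sides; every other order gives the same
    mass.\<close>
  define m where "m \<alpha> = measure (M (size \<alpha>)) (lbox (map A (sorted_list_of_multiset \<alpha>)))" for \<alpha>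
  have m: "m (mset is) = measure (M (length is)) (lbox (map A is))" for "is"
    using lbox_permute[OF M, of "map A (sorted_list_of_multiset (mset is))" "map A is"] Ab
    by (simp add: m_def)
  let ?L = "lin_ext m"
  let ?T = "\<lambda>i u. ?L (subst_var i u)"
  define l where "l i n = measure (M n) (cube n (A i) \<inter> offdiag n) / fact n" for i n
  have marg: "\<exists>s. summable (\<lambda>k. 256 ^ k * \<bar>s k\<bar>) \<and> (\<forall>u. ?T i u = suminf (\<lambda>k. poly u (of_nat k) * s k))" for i
  proof -
    have T_add: "?T i (u + v) = ?T i u + ?T i v" for u v by (simp add: subst_var_add lin_ext_add)
    have T_smult: "?T i (smult c u) = c * ?T i u" for c u by (simp add: subst_var_smult lin_ext_scale)
    have T_monom: "?T i (monom 1 k) = measure (M k) (cube k (A i))" for k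
    proof -
      have "lbox (map A (replicate k i)) = cube k (A i)"
        unfolding lbox_def cube_def length_map length_replicate by (rule PiE_cong) simp
      then show ?thesis using m[of "replicate k i"] by (simp add: subst_var_monom lin_ext_single)
    qed
    have fall: "?T i (falling_poly n) = fact n * l i n" for n
      using falling_poly_moment[OF M S Ar T_add T_smult T_monom, of n] by (simp add: l_def)
    have "0 \<le> l i n" for n by (simp add: l_def)
    then have "summable (\<lambda>n. 257 ^ n * \<bar>l i n\<bar>)"
      using A[of i] by (simp add: nice_def l_def)
    from marginal_of_factorial_moments[of "?T i" "l i", OF T_add T_smult fall this] show ?thesis by metis
  qed
  then obtain s where s: "\<And>i. summable (\<lambda>k. 256 ^ k * \<bar>s i k\<bar>)" "\<And>i u. ?T i u = suminf (\<lambda>k. poly u (of_nat k) * s i k)"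
    by metis
  interpret moment_functional ?L subst_var s
  proof
    show "0 \<le> ?L (p * p)" for p
    proof -
      let ?A = "\<lambda>\<alpha>. map A (sorted_list_of_multiset \<alpha>)"
      have "m (\<alpha> + \<beta>) = measure (M (length (?A \<alpha>) + length (?A \<beta>))) (lbox (?A \<alpha> @ ?A \<beta>))" for \<alpha> \<beta>
        using m[of "sorted_list_of_multiset \<alpha> @ sorted_list_of_multiset \<beta>"] by simp
      then show ?thesis
        unfolding lin_ext_square
        using positive_definite_boxes[OF M pd finite_keys, of p ?A "Poly_Mapping.lookup p"] Ar by auto
    qed
    show "?L 1 = 1"
    proof -
      have "?L 1 = m {#}" using lin_ext_single[of m 0 1] by simp
      also have "\<dots> = measure (M 0) (lbox [])" using m[of "[]"] by simp
      also have "lbox [] = {\<lambda>_. undefined :: 'a}" by (simp add: lbox_def)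
      also have "measure (M 0) {\<lambda>_. undefined} = 1"
        using symmetric_radon_sequenceD(5)[OF M] by (simp add: measure_def)
      finally show ?thesis .
    qed
    show "subst_var i [:c:] = subst_var 0 [:c:]" for i c by (simp add: subst_var_const)
    show "?L (subst_var 0 [:c:] * a) = c * ?L a" for c a by (simp add: subst_var_const lin_ext_scale)
    show "subst_var i 1 = 1" for i using subst_var_const[of i 1] by (simp add: one_pCons)
  qed (use s in \<open>simp_all add: lin_ext_add subst_var_add subst_var_mult\<close>)
  have X: "subst_var i [:0, 1:] = Poly_Mapping.single {#i#} 1" for i
    using subst_var_monom[of i 1] by (simp add: monom_Suc monom_0)
  obtain P where P: "prob_space P" "sets P = sets (PiM UNIV (\<lambda>_. count_space (UNIV :: nat set)))"
    "\<And>is. integrable P (\<lambda>\<omega>. prod_list (map (\<lambda>i. real (\<omega> i)) is))"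
    "\<And>is. (\<integral>\<omega>. prod_list (map (\<lambda>i. real (\<omega> i)) is) \<partial>P) = ?L (prod_list (map (\<lambda>i. subst_var i [:0, 1:]) is))"
    using representing_measure by metis
  have "?L (prod_list (map (\<lambda>i. subst_var i [:0, 1:]) is)) = measure (M (length is)) (lbox (map A is))" for "is"
    unfolding X prod_list_single lin_ext_single m by simp
  with P show ?thesis by (intro that[of P]) simp_all
qed

end

section \<open>Construction of the random measure\<close>

text \<open>\<open>\<kappa>\<close> and \<open>co\<close> give the index of the \<open>n\<close>-th compact inner approximation of \<open>A i\<close> and of its complement
  in \<open>A i\<close>; \<open>l\<close> enumerates the pieces of the locally finite partition of the space.\<close>

locale counting_semiring = loc_compact dummy for dummy :: "'a::polish_space itself" +
  fixes A :: "nat \<Rightarrow> 'a set" and \<kappa> co :: "nat \<Rightarrow> nat \<Rightarrow> nat" and l :: "nat \<Rightarrow> nat"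
  assumes A_Int: "\<exists>k. A k = A i \<inter> A j" and A_Diff: "\<exists>k. A k = A i - A j"
    and A_relcompact: "A i \<in> relcompact_borel"
    and inner_compact: "compact (A (\<kappa> i n))" and inner_subset: "A (\<kappa> i n) \<subseteq> A i"
    and inner_compl: "A (co i n) = A i - A (\<kappa> i n)"
    and A_sigma: "sigma_sets UNIV (range A) = sets (borel :: 'a measure)"
    and cover_disjoint: "disjoint_family (\<lambda>j. A (l j))" and cover: "(\<Union>j. A (l j)) = UNIV"
    and cover_compact: "compact K \<Longrightarrow> \<exists>r. K \<subseteq> (\<Union>j<r. A (l j))"
begin

text \<open>Countably many conditions under which the counts come from a measure: finite additivity,
  and inner regularity in an integral form. A natural number that can be made arbitrarily small is
  0, so the inner approximation is asked to lose nothing at some stage.\<close>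

definition good :: "(nat \<Rightarrow> nat) \<Rightarrow> bool" where
  "good \<omega> \<longleftrightarrow> (\<forall>r p q. A r = A p \<union> A q \<and> A p \<inter> A q = {} \<longrightarrow> \<omega> r = \<omega> p + \<omega> q) \<and>
     (\<forall>i. \<exists>n. \<omega> (co i n) = 0)"

text \<open>Several indices may name the same set; for good \<omega> the choice among them does not
  matter, by \<open>good_eq\<close>.\<close>

definition weight :: "(nat \<Rightarrow> nat) \<Rightarrow> 'a set \<Rightarrow> nat" where
  "weight \<omega> X = \<omega> (SOME i. A i = X)"

lemma A_borel: "A i \<in> sets borel"
  using A_relcompact by (rule relcompact_borel_sets)

lemma range_Int: "X \<in> range A \<Longrightarrow> Y \<in> range A \<Longrightarrow> X \<inter> Y \<in> range A"
proof -
  assume "X \<in> range A" "Y \<in> range A"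
  then obtain i j where "X = A i" "Y = A j" by blast
  then show ?thesis using A_Int[of i j] by (metis rangeI)
qed

lemma range_Diff: "X \<in> range A \<Longrightarrow> Y \<in> range A \<Longrightarrow> X - Y \<in> range A"
proof -
  assume "X \<in> range A" "Y \<in> range A"
  then obtain i j where "X = A i" "Y = A j" by blast
  then show ?thesis using A_Diff[of i j] by (metis rangeI)
qed

lemma range_empty: "{} \<in> range A"
  using range_Diff[of "A 0" "A 0"] by simp

context
  fixes \<omega> assumes g: "good \<omega>"
begin

lemma good_add: "A r = A p \<union> A q \<Longrightarrow> A p \<inter> A q = {} \<Longrightarrow> \<omega> r = \<omega> p + \<omega> q"
  using g unfolding good_def by blast

lemma good_empty: "A i = {} \<Longrightarrow> \<omega> i = 0"
  using good_add[of i i i] by simp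

lemma good_eq: "A i = A j \<Longrightarrow> \<omega> i = \<omega> j"
proof -
  assume e: "A i = A j"
  obtain k where k: "A k = {}" using range_empty by auto
  then show ?thesis using good_add[of i j k] good_empty[OF k] e by simp
qed

lemma weight_A: "weight \<omega> (A i) = \<omega> i"
  unfolding weight_def by (rule good_eq, rule someI) (rule refl)

lemma weight_split:
  assumes "X \<in> range A" "Y \<in> range A" shows "weight \<omega> X = weight \<omega> (X \<inter> Y) + weight \<omega> (X - Y)"
proof -
  obtain r p q where rpq: "X = A r" "X \<inter> Y = A p" "X - Y = A q"
    using assms range_Int[OF assms] range_Diff[OF assms] by blast
  have "\<omega> r = \<omega> p + \<omega> q" by (rule good_add) (use rpq in blast)+
  then show ?thesis unfolding rpq(2,3) by (simp add: rpq(1) weight_A)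
qed

lemma weight_mono:
  assumes "X \<in> range A" "Y \<in> range A" "X \<subseteq> Y" shows "weight \<omega> X \<le> weight \<omega> Y"
proof -
  have "Y \<inter> X = X" using assms(3) by blast
  then show ?thesis using weight_split[OF assms(2,1)] by simp
qed

lemma inner_regular_weight:
  assumes "X \<in> range A"
  obtains K where "K \<in> range A" "compact K" "K \<subseteq> X" "weight \<omega> (X - K) = 0"
proof -
  obtain i where i: "X = A i" using assms by blast
  obtain n where "\<omega> (co i n) = 0" using g unfolding good_def by blast
  then have "weight \<omega> (X - A (\<kappa> i n)) = 0" using weight_A[of "co i n"] by (simp add: i inner_compl)
  then show ?thesis using that[of "A (\<kappa> i n)"] inner_compact inner_subset i by blast
qed

text \<open>Inner approximations that lose no count keep this property under finite intersections.
  If no weight vanished, these decreasing compact intersections would all be nonempty, and a common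
  point would lie in every R m.\<close>

lemma weight_vanishes:
  assumes R: "\<And>m. R m \<in> range A" and dec: "decseq R" and emp: "(\<Inter>m. R m) = {}"
  shows "\<exists>m::nat. weight \<omega> (R m) = 0"
proof (rule ccontr)
  assume n: "\<not> ?thesis"
  have "\<forall>m. \<exists>K. K \<in> range A \<and> compact K \<and> K \<subseteq> R m \<and> weight \<omega> (R m - K) = 0"
    using inner_regular_weight[OF R] by metis
  then obtain K where K: "\<And>m. K m \<in> range A" "\<And>m. compact (K m)" "\<And>m. K m \<subseteq> R m" "\<And>m. weight \<omega> (R m - K m) = 0"
    by metis
  define L where "L m = (\<Inter>i\<le>m. K i)" for m
  have LS: "L (Suc m) = L m \<inter> K (Suc m)" for m by (simp add: L_def atMost_Suc Int_commute)
  have L: "L m \<in> range A \<and> compact (L m) \<and> L m \<subseteq> R m \<and> weight \<omega> (R m - L m) = 0" for m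
  proof (induct m)
    case 0 then show ?case using K[of 0] by (simp add: L_def)
  next
    case (Suc m)
    let ?X = "R (Suc m) - L (Suc m)" and ?Y = "R (Suc m) - K (Suc m)"
    have L1: "L (Suc m) \<in> range A" unfolding LS using Suc K by (intro range_Int) auto
    have X: "?X \<in> range A" and Y: "?Y \<in> range A" using R K L1 by (auto intro!: range_Diff)
    have "R (Suc m) \<subseteq> R m" using dec by (simp add: decseq_Suc_iff)
    then have sub: "?X \<inter> ?Y \<subseteq> ?Y" "?X - ?Y \<subseteq> R m - L m" unfolding LS by blast+
    have "weight \<omega> (?X \<inter> ?Y) \<le> weight \<omega> ?Y" by (rule weight_mono[OF range_Int[OF X Y] Y sub(1)])
    moreover have "weight \<omega> (?X - ?Y) \<le> weight \<omega> (R m - L m)"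
      by (rule weight_mono[OF range_Diff[OF X Y] range_Diff[OF R] sub(2)]) (use Suc in blast)
    ultimately have "weight \<omega> ?X = 0" using weight_split[OF X Y] K(4)[of "Suc m"] Suc by simp
    moreover have "compact (L (Suc m))" unfolding LS using Suc K(2) by (intro compact_Int) auto
    moreover have "L (Suc m) \<subseteq> R (Suc m)" unfolding LS using K(3) by blast
    ultimately show ?case using L1 by blast
  qed
  have ne: "L m \<noteq> {}" for m
  proof
    assume "L m = {}"
    then have "weight \<omega> (R m) = 0" using L[of m] by simp
    then show False using n by blast
  qed
  have "(\<Inter>m. L m) \<noteq> {}"
  proof -
    have "L 0 \<inter> (\<Inter>m. L m) \<noteq> {}"
    proof (rule compact_imp_fip_image)
      show "closed (L m)" for m using L[of m] by (blast intro: compact_imp_closed)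
      show "L 0 \<inter> \<Inter> (L ` I) \<noteq> {}" if I: "finite I" for I
      proof -
        have mono: "L n \<subseteq> L m" if "m \<le> n" for m n unfolding L_def using that by force
        have "L (Max (insert 0 I)) \<subseteq> L i" if "i \<in> insert 0 I" for i
          by (rule mono) (use that I in \<open>simp add: Max_ge\<close>)
        then have "L (Max (insert 0 I)) \<subseteq> L 0 \<inter> \<Inter> (L ` I)" by blast
        then show ?thesis using ne by blast
      qed
    qed (use L[of 0] in simp)
    then show ?thesis by blast
  qed
  moreover have "L m \<subseteq> R m" for m using L[of m] by (elim conjE)
  then have "(\<Inter>m. L m) \<subseteq> (\<Inter>m. R m)" by (rule INF_mono')
  ultimately show False unfolding emp by simp
qed

text \<open>The remainders of the disjoint union decrease to the empty set, so one of them has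
  weight 0; from there on all terms vanish and the series is a finite sum.\<close>

lemma weight_countably_additive: "countably_additive (range A) (\<lambda>X. of_nat (weight \<omega> X) :: ennreal)"
proof (rule countably_additiveI)
  fix B :: "nat \<Rightarrow> 'a set" assume B: "range B \<subseteq> range A" "disjoint_family B" "(\<Union>i. B i) \<in> range A"
  let ?U = "\<Union>i. B i"
  define R where "R m = ?U - (\<Union>i<m. B i)" for m
  have Br: "B i \<in> range A" for i using B(1) by blast
  have RS: "R (Suc m) = R m - B m" for m unfolding R_def lessThan_Suc by blast
  have R: "R m \<in> range A" for m
  proof (induct m)
    case 0 then show ?case using B(3) by (simp add: R_def)
  next
    case (Suc m) then show ?case unfolding RS by (rule range_Diff[OF _ Br])
  qed
  have sum: "weight \<omega> ?U = (\<Sum>i<m. weight \<omega> (B i)) + weight \<omega> (R m)" for m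
  proof (induct m)
    case 0 then show ?case by (simp add: R_def)
  next
    case (Suc m)
    have "B m \<subseteq> R m"
    proof
      fix x assume x: "x \<in> B m"
      have "x \<notin> B i" if "i < m" for i
        using disjoint_family_onD[OF B(2), of i m] x that by auto
      then show "x \<in> R m" using x unfolding R_def by blast
    qed
    then have "R m \<inter> B m = B m" by blast
    then have "weight \<omega> (R m) = weight \<omega> (B m) + weight \<omega> (R (Suc m))"
      using weight_split[OF R Br, of m m] unfolding RS by simp
    then show ?case using Suc by simp
  qed
  have "decseq R" unfolding decseq_Suc_iff RS by blast
  moreover have "(\<Inter>m. R m) = {}"
  proof (rule ccontr)
    assume "(\<Inter>m. R m) \<noteq> {}"
    then obtain x where x: "\<And>m. x \<in> R m" by blast
    then obtain i where "x \<in> B i" unfolding R_def by blast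
    then have "x \<notin> R (Suc i)" unfolding RS by blast
    then show False using x by blast
  qed
  ultimately obtain m where m: "weight \<omega> (R m) = 0" using weight_vanishes[of R] R by blast
  have z: "weight \<omega> (B i) = 0" if "m \<le> i" for i
  proof -
    have "(\<Sum>k<Suc i. weight \<omega> (B k)) \<le> weight \<omega> ?U" using sum[of "Suc i"] by simp
    moreover have "weight \<omega> ?U = (\<Sum>k<m. weight \<omega> (B k))" using sum[of m] m by simp
    moreover have "(\<Sum>k<m. weight \<omega> (B k)) \<le> (\<Sum>k<i. weight \<omega> (B k))"
      by (rule sum_mono2) (use that in auto)
    ultimately show ?thesis by simp
  qed
  have "(suminf (\<lambda>i. of_nat (weight \<omega> (B i))) :: ennreal) = (\<Sum>i<m. of_nat (weight \<omega> (B i)))"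
    by (rule suminf_finite) (use z in auto)
  also have "\<dots> = of_nat (weight \<omega> ?U)" using sum[of m] m by simp
  finally show "(suminf (\<lambda>i. of_nat (weight \<omega> (B i))) :: ennreal) = of_nat (weight \<omega> (\<Union>i. B i))" .
qed

text \<open>Caratheodory's extension; it is finite on compact sets because each of them is covered
  by finitely many pieces, and each piece has a finite count.\<close>

lemma counting_measure_exists:
  "\<exists>\<eta>. radon \<eta> \<and> (\<forall>i. emeasure \<eta> (A i) = of_nat (\<omega> i))"
proof -
  have sr: "semiring_of_sets UNIV (range A)"
  proof
    show "\<exists>C\<subseteq>range A. finite C \<and> disjoint C \<and> X - Y = \<Union>C" if "X \<in> range A" "Y \<in> range A" for X Y
      by (rule exI[of _ "{X - Y}"]) (use range_Diff[OF that] in \<open>auto simp: disjoint_def\<close>)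
  qed (use range_empty range_Int in auto)
  have e0: "weight \<omega> {} = 0"
  proof -
    obtain k where k: "A k = {}" using range_empty by auto
    then show ?thesis using weight_A[of k] good_empty[OF k] by simp
  qed
  have "positive (range A) (\<lambda>X. of_nat (weight \<omega> X) :: ennreal)" by (simp add: positive_def e0)
  from semiring_of_sets.caratheodory[OF sr this weight_countably_additive]
  obtain \<mu>' :: "'a set \<Rightarrow> ennreal" where mu: "\<forall>s\<in>range A. \<mu>' s = of_nat (weight \<omega> s)"
    "measure_space UNIV (sigma_sets UNIV (range A)) \<mu>'" by blast
  define \<eta> where "\<eta> = measure_of UNIV (sets borel) \<mu>'"
  have ms: "measure_space UNIV (sets (borel :: 'a measure)) \<mu>'" using mu(2) unfolding A_sigma .
  have s: "sets \<eta> = sets borel" unfolding \<eta>_def using sets.sets_measure_of_eq[of "borel :: 'a measure"] by simp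
  have em: "emeasure \<eta> B = \<mu>' B" if "B \<in> sets borel" for B
    by (rule emeasure_measure_of[OF \<eta>_def]) (use ms that s in \<open>auto simp: measure_space_def\<close>)
  have eA: "emeasure \<eta> (A i) = of_nat (\<omega> i)" for i using em[OF A_borel] mu(1) weight_A by simp
  have "radon \<eta>"
  proof (rule radon_euclideanI[OF s])
    fix K :: "'a set" assume "compact K"
    then obtain r where r: "K \<subseteq> (\<Union>j<r. A (l j))" using cover_compact by blast
    have "emeasure \<eta> K \<le> emeasure \<eta> (\<Union>j<r. A (l j))"
      by (rule emeasure_mono[OF r]) (use s A_borel in auto)
    also have "\<dots> \<le> (\<Sum>j<r. emeasure \<eta> (A (l j)))"
      by (rule emeasure_subadditive_finite) (use s A_borel in auto)
    also have "\<dots> < \<infinity>" by (simp add: eA of_nat_less_top)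
    finally show "emeasure \<eta> K < \<infinity>" .
  qed
  then show ?thesis using eA by blast
qed

end

text \<open>The null measure is the default outside the good event: every value stays a Radon
  measure, and the map stays measurable.\<close>

definition realize :: "(nat \<Rightarrow> nat) \<Rightarrow> 'a measure" where
  "realize \<omega> = (if good \<omega> then SOME \<eta>. radon \<eta> \<and> (\<forall>i. emeasure \<eta> (A i) = of_nat (\<omega> i)) else null_measure borel)"

lemma radon_null: "radon (null_measure borel)"
  by (rule radon_euclideanI) simp_all

lemma radon_realize: "radon (realize \<omega>)"
  unfolding realize_def using someI_ex[OF counting_measure_exists[of \<omega>]] radon_null by auto

lemma realize_A: "good \<omega> \<Longrightarrow> emeasure (realize \<omega>) (A i) = of_nat (\<omega> i)"
  unfolding realize_def using someI_ex[OF counting_measure_exists[of \<omega>]] by simp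

lemma realize_bad: "\<not> good \<omega> \<Longrightarrow> emeasure (realize \<omega>) B = 0"
  by (simp add: realize_def)

lemma Int_stable_range: "Int_stable (range A)"
  by (rule Int_stableI) (rule range_Int)

context
  fixes P :: "(nat \<Rightarrow> nat) measure"
  assumes P: "prob_space P" "sets P = sets (PiM UNIV (\<lambda>_. count_space (UNIV :: nat set)))"
begin

lemma measurable_coordinate: "(\<lambda>\<omega>. \<omega> i) \<in> measurable P (count_space UNIV)"
  unfolding measurable_cong_sets[OF P(2) refl] by (rule measurable_component_singleton) simp

lemma space_P_UNIV: "space P = UNIV"
  using sets_eq_imp_space_eq[OF P(2)] by (simp add: space_PiM)

lemma good_sets: "{\<omega>. good \<omega>} \<in> sets P"
proof -
  note [measurable] = measurable_coordinate
  have "{\<omega> \<in> space P. (\<forall>r p q. A r = A p \<union> A q \<and> A p \<inter> A q = {} \<longrightarrow> \<omega> r = \<omega> p + \<omega> q) \<and>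
     (\<forall>i. \<exists>n. \<omega> (co i n) = 0)} \<in> sets P"
    by measurable
  then show ?thesis by (simp add: good_def space_P_UNIV)
qed

text \<open>The coordinates give the masses of the semiring. Dynkin's argument extends this inside
  each A i, whose mass is finite, and the pieces of the partition are summed.\<close>

lemma measurable_realize:
  assumes B: "B \<in> sets borel"
  shows "(\<lambda>\<omega>. emeasure (realize \<omega>) B) \<in> borel_measurable P"
proof -
  note R = radon_euclideanD[OF radon_realize]
  have mA: "(\<lambda>\<omega>. emeasure (realize \<omega>) (A i)) \<in> borel_measurable P" for i
  proof (rule measurable_eqI)
    show "emeasure (realize \<omega>) (A i) = indicator {\<omega>. good \<omega>} \<omega> * of_nat (\<omega> i)" for \<omega>
      using realize_A[of \<omega> i] realize_bad[of \<omega> "A i"] by (cases "good \<omega>") auto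
    have "(\<lambda>\<omega>. of_nat (\<omega> i) :: ennreal) \<in> borel_measurable P"
      by (rule measurable_compose[OF measurable_coordinate]) simp
    then show "(\<lambda>\<omega>. indicator {\<omega>. good \<omega>} \<omega> * of_nat (\<omega> i) :: ennreal) \<in> borel_measurable P"
      using good_sets by measurable
  qed
  have 1: "(\<lambda>\<omega>. emeasure (realize \<omega>) (B \<inter> A i)) \<in> borel_measurable P" for i
  proof (rule measurable_emeasure_Dynkin[where G="range A" and \<Omega>=UNIV])
    show "emeasure (realize \<omega>) (A i) < \<infinity>" for \<omega> using R(4)[OF A_relcompact] .
    show "(\<lambda>\<omega>. emeasure (realize \<omega>) (X \<inter> A i)) \<in> borel_measurable P" if X: "X \<in> range A" for X
    proof -
      have "X \<inter> A i \<in> range A" using X by (rule range_Int) simp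
      then obtain k where "X \<inter> A i = A k" by blast
      then show ?thesis using mA by simp
    qed
    show "B \<in> sigma_sets UNIV (range A)" unfolding A_sigma by (rule B)
  qed (use Int_stable_range R(1) A_sigma mA in auto)
  show ?thesis
  proof (rule measurable_eqI)
    show "emeasure (realize \<omega>) B = suminf (\<lambda>j. emeasure (realize \<omega>) (B \<inter> A (l j)))" for \<omega>
    proof -
      have "suminf (\<lambda>j. emeasure (realize \<omega>) (B \<inter> A (l j))) = emeasure (realize \<omega>) (\<Union>j. B \<inter> A (l j))"
      proof (rule suminf_emeasure)
        show "range (\<lambda>j. B \<inter> A (l j)) \<subseteq> sets (realize \<omega>)" using B A_borel R(1) by auto
        show "disjoint_family (\<lambda>j. B \<inter> A (l j))"
          using cover_disjoint unfolding disjoint_family_on_def by blast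
      qed
      also have "(\<Union>j. B \<inter> A (l j)) = B" using cover by (simp flip: Int_UN_distrib)
      finally show ?thesis by simp
    qed
    show "(\<lambda>\<omega>. suminf (\<lambda>j. emeasure (realize \<omega>) (B \<inter> A (l j)))) \<in> borel_measurable P"
      by (rule borel_measurable_suminf_order) (rule 1)
  qed
qed

text \<open>The law of \<open>realize\<close> under P. Its box moments are prescribed for sides in
  the semiring, and \<open>emeasure_eq_tpow_mean\<close> extends them to all relatively compact
  Borel sides.\<close>

theorem random_measure_of_counts:
  fixes M :: "nat \<Rightarrow> (nat \<Rightarrow> 'a) measure"
  assumes M: "symmetric_radon_sequence M"
    and ae: "AE \<omega> in P. good \<omega>"
    and int: "\<And>is. integrable P (\<lambda>\<omega>. prod_list (map (\<lambda>i. real (\<omega> i)) is))"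
    and mom: "\<And>is. (\<integral>\<omega>. prod_list (map (\<lambda>i. real (\<omega> i)) is) \<partial>P) = measure (M (length is)) (lbox (map A is))"
  shows "\<exists>\<mu>. random_measure \<mu> \<and> finite_moments \<mu> \<and> moment_sequence \<mu> M"
proof -
  note R = radon_euclideanD[OF radon_realize] and D = symmetric_radon_sequenceD[OF M]
  interpret prob_space P by (rule P(1))
  let ?\<mu> = "distr P (borel_of vague_topology) realize"
  have rm: "realize \<in> measurable P (borel_of vague_topology)"
    by (rule measurable_vague) (rule radon_realize, rule measurable_realize)
  have rand: "random_measure ?\<mu>"
    unfolding random_measure_def by (simp add: prob_space_distr[OF rm])
  have mean: "emeasure (M n) B = (\<integral>\<^sup>+\<omega>. emeasure (tpow n (realize \<omega>)) B \<partial>P)" if B: "B \<in> sets (pow_borel n)" for n B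
  proof (rule emeasure_eq_tpow_mean[OF radon_realize measurable_realize Int_stable_range A_sigma _ _ D(2) _ _ B])
    show "range (\<lambda>j. A (l j)) \<subseteq> range A" by blast
    show "(\<Union>j. A (l j)) = UNIV" by (rule cover)
    fix X assume X: "\<And>k. k < n \<Longrightarrow> X k \<in> range A"
    then show "emeasure (M n) (PiE {..<n} X) \<noteq> \<infinity>"
      using radon_pow_finite[OF D(1), of n X] A_relcompact by (force simp: less_top)
    have "\<forall>k. \<exists>i. k < n \<longrightarrow> X k = A i" using X by blast
    then obtain i where i: "\<And>k. k < n \<Longrightarrow> X k = A (i k)" by metis
    let ?is = "map i [0..<n]"
    have box: "PiE {..<n} X = lbox (map A ?is)"
      unfolding lbox_def by (simp, rule PiE_cong) (simp add: i)
    have pl: "prod_list (map (\<lambda>i. real (\<omega> i)) ?is) = (\<Prod>k<n. real (\<omega> (i k)))" for \<omega>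
      by (simp add: comp_def prod.distinct_set_conv_list[symmetric] atLeast0LessThan)
    have "emeasure (M n) (PiE {..<n} X) = ennreal (measure (M n) (PiE {..<n} X))"
      using \<open>emeasure (M n) (PiE {..<n} X) \<noteq> \<infinity>\<close> by (intro emeasure_eq_ennreal_measure) simp
    also have "\<dots> = ennreal (\<integral>\<omega>. prod_list (map (\<lambda>i. real (\<omega> i)) ?is) \<partial>P)"
      unfolding mom box by simp
    also have "\<dots> = (\<integral>\<^sup>+\<omega>. ennreal (prod_list (map (\<lambda>i. real (\<omega> i)) ?is)) \<partial>P)"
      by (rule nn_integral_eq_integral[OF int, symmetric]) (simp only: pl, simp add: prod_nonneg)
    also have "\<dots> = (\<integral>\<^sup>+\<omega>. (\<Prod>k<n. emeasure (realize \<omega>) (X k)) \<partial>P)"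
    proof (rule nn_integral_cong_AE, rule AE_mp[OF ae], intro AE_I2 impI)
      fix \<omega> assume "good \<omega>"
      then have "(\<Prod>k<n. emeasure (realize \<omega>) (X k)) = (\<Prod>k<n. ennreal (real (\<omega> (i k))))"
        by (intro prod.cong refl) (simp add: i realize_A ennreal_of_nat_eq_real_of_nat)
      also have "\<dots> = ennreal (\<Prod>k<n. real (\<omega> (i k)))" by (rule prod_ennreal) simp
      finally show "ennreal (prod_list (map (\<lambda>i. real (\<omega> i)) ?is)) = (\<Prod>k<n. emeasure (realize \<omega>) (X k))"
        by (simp only: pl)
    qed
    finally show "emeasure (M n) (PiE {..<n} X) = (\<integral>\<^sup>+\<omega>. (\<Prod>k<n. emeasure (realize \<omega>) (X k)) \<partial>P)" .
  qed
  have boxes: "emeasure (M n) (PiE {..<n} X) = (\<integral>\<^sup>+\<eta>. (\<Prod>k<n. emeasure \<eta> (X k)) \<partial>?\<mu>)"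
    if X: "\<And>k. k < n \<Longrightarrow> X k \<in> relcompact_borel" for n X
  proof -
    have Xb: "X k \<in> sets borel" if "k < n" for k using X[OF that] by (rule relcompact_borel_sets)
    have "emeasure (M n) (PiE {..<n} X) = (\<integral>\<^sup>+\<omega>. emeasure (tpow n (realize \<omega>)) (PiE {..<n} X) \<partial>P)"
      by (rule mean, rule sets_PiM_I_finite) (use Xb in auto)
    also have "\<dots> = (\<integral>\<^sup>+\<omega>. (\<Prod>k<n. emeasure (realize \<omega>) (X k)) \<partial>P)"
      by (rule nn_integral_cong) (rule tpow_box[OF radon_realize Xb])
    also have "\<dots> = (\<integral>\<^sup>+\<eta>. (\<Prod>k<n. emeasure \<eta> (X k)) \<partial>?\<mu>)"
      by (rule nn_integral_distr[OF rm, symmetric])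
        (auto intro!: borel_measurable_prod_ennreal measurable_vague_emeasure Xb)
    finally show ?thesis .
  qed
  have "finite_moments ?\<mu>"
    unfolding finite_moments_def
  proof (intro allI impI ballI)
    fix n and X :: "'a set" assume "X \<in> relcompact_borel"
    then show "(\<integral>\<^sup>+\<eta>. emeasure \<eta> X ^ n \<partial>?\<mu>) < \<infinity>"
      using boxes[of n "\<lambda>_. X"] radon_pow_finite[OF D(1), of n "\<lambda>_. X"] by simp
  qed
  moreover have "moment_sequence ?\<mu> M"
    unfolding moment_sequence_def using M boxes by blast
  ultimately show ?thesis using rand by blast
qed

end

end

text \<open>The terms are countable and closed under Boolean operations and under the operation
  \<open>Inner n j t\<close>, a compact subset of the intersection of \<open>t\<close> with the \<open>j\<close>-th piece.\<close>

datatype set_term = Gen nat | Neg set_term | Join set_term set_term | Inner nat nat set_term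

instance set_term :: countable by countable_datatype

primrec eval_term :: "(nat \<Rightarrow> 'a set) \<Rightarrow> (nat \<Rightarrow> nat \<Rightarrow> 'a set \<Rightarrow> 'a set) \<Rightarrow> set_term \<Rightarrow> 'a set" where
  "eval_term b h (Gen n) = b n"
| "eval_term b h (Neg t) = - eval_term b h t"
| "eval_term b h (Join s t) = eval_term b h s \<union> eval_term b h t"
| "eval_term b h (Inner n j t) = h n j (eval_term b h t)"

lemma lbox_singleton: "lbox [X] = PiE {..<1} (\<lambda>_. X)"
proof -
  have "{..<length [X]} = {..<1}" by simp
  then show ?thesis unfolding lbox_def by (simp only:, intro PiE_cong) simp
qed

lemma lbox_pair: "lbox [X, Y] = {x \<in> PiE {..<2} (\<lambda>_. UNIV). x 0 \<in> X \<and> x 1 \<in> Y}"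
proof (rule set_eqI)
  fix x :: "nat \<Rightarrow> 'a"
  have "(\<forall>i<2::nat. x i \<in> [X, Y] ! i) \<longleftrightarrow> x 0 \<in> X \<and> x 1 \<in> Y"
    by (auto simp: numeral_2_eq_2 All_less_Suc)
  then show "x \<in> lbox [X, Y] \<longleftrightarrow> x \<in> {x \<in> PiE {..<2} (\<lambda>_. UNIV). x 0 \<in> X \<and> x 1 \<in> Y}"
    by (simp add: lbox_def PiE_iff Ball_def numeral_2_eq_2[symmetric] del: One_nat_def) blast
qed

section \<open>Pieces of slow growth, and the existence of the random measure\<close>

context loc_compact
begin

context
  fixes M :: "nat \<Rightarrow> (nat \<Rightarrow> 'a) measure"
  assumes M: "symmetric_radon_sequence M"
begin

lemma cube_offdiag_fmeasurable:
  assumes "A \<in> relcompact_borel" shows "cube n A \<inter> offdiag n \<in> fmeasurable (M n)"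
proof (rule fmeasurable_Int_fmeasurable)
  note D = symmetric_radon_sequenceD[OF M]
  show "cube n A \<in> fmeasurable (M n)"
  proof (rule fmeasurableI)
    show "cube n A \<in> sets (M n)"
      unfolding cube_def D(2) by (rule sets_PiM_I_finite) (use assms relcompact_borel_sets in auto)
    show "emeasure (M n) (cube n A) < \<infinity>" unfolding cube_def by (rule radon_pow_finite[OF D(1) assms])
  qed
  show "offdiag n \<in> sets (M n)" unfolding D(2) by (rule offdiag_sets)
qed

lemma nice_subset:
  assumes A: "nice M A" and B: "B \<in> sets borel" "B \<subseteq> A"
  shows "nice M B"
proof -
  have Ar: "A \<in> relcompact_borel" using A by (simp add: nice_def)
  have Br: "B \<in> relcompact_borel" by (rule relcompact_borel_subset[OF Ar B])
  have "measure (M n) (cube n B \<inter> offdiag n) \<le> measure (M n) (cube n A \<inter> offdiag n)" for n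
  proof (rule measure_mono_fmeasurable[OF _ fmeasurableD cube_offdiag_fmeasurable[OF Ar]])
    show "cube n B \<inter> offdiag n \<subseteq> cube n A \<inter> offdiag n"
      unfolding cube_def using PiE_mono[of "{..<n}" "\<lambda>_. B" "\<lambda>_. A"] B(2) by blast
  qed (rule cube_offdiag_fmeasurable[OF Br])
  then have "measure (M n) (cube n B \<inter> offdiag n) / fact n \<le> measure (M n) (cube n A \<inter> offdiag n) / fact n" for n
    by (rule divide_right_mono) simp
  then have "257 ^ n * (measure (M n) (cube n B \<inter> offdiag n) / fact n)
      \<le> 257 ^ n * (measure (M n) (cube n A \<inter> offdiag n) / fact n)" for n
    by (rule mult_left_mono) simp
  then have "norm (257 ^ n * (measure (M n) (cube n B \<inter> offdiag n) / fact n))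
      \<le> 257 ^ n * (measure (M n) (cube n A \<inter> offdiag n) / fact n)" for n
    unfolding real_norm_def abs_mult abs_divide by simp
  then have "summable (\<lambda>n. 257 ^ n * (measure (M n) (cube n B \<inter> offdiag n) / fact n))"
    by (rule summable_comparison_test'[where N=0, OF conjunct2[OF A[unfolded nice_def]]])
  then show ?thesis using Br by (simp add: nice_def)
qed

text \<open>A tuple of two or more entries equal to x is not off-diagonal, so at most the terms with
  n < 2 of the series are nonzero.\<close>

lemma nice_singleton: "nice M {x}"
proof -
  have "cube n {x} \<inter> offdiag n = {}" if "n \<notin> {..<2}" for n
  proof -
    have False if y: "y \<in> cube n {x}" "inj_on y {..<n}" for y
    proof -
      have "0 < n" "1 < n" using \<open>n \<notin> {..<2}\<close> by auto
      then have "y 0 = x" "y 1 = x" using y(1) unfolding cube_def by (auto simp: PiE_iff)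
      then show False using inj_onD[OF y(2), of 0 1] \<open>0 < n\<close> \<open>1 < n\<close> by simp
    qed
    then show ?thesis unfolding offdiag_def by blast
  qed
  then have "summable (\<lambda>n. 257 ^ n * (measure (M n) (cube n {x} \<inter> offdiag n) / fact n))"
    by (intro summable_finite[of "{..<2}"]) auto
  moreover have "{x} \<in> relcompact_borel" by (simp add: relcompact_borel_def)
  ultimately show ?thesis by (simp add: nice_def)
qed

text \<open>Since 514 = 2 * 257, the series is dominated by a geometric series with ratio 1 /
  2.\<close>

lemma nice_if_small_growth:
  assumes A: "A \<in> relcompact_borel" and c: "0 \<le> c" "c < 1 / 514"
    and b: "\<And>n. 1 \<le> n \<Longrightarrow> emeasure (M n) (cube n A \<inter> offdiag n) \<le> ennreal (c ^ n * fact n)"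
  shows "nice M A"
proof -
  have "norm (257 ^ n * (measure (M n) (cube n A \<inter> offdiag n) / fact n)) \<le> (1 / 2) ^ n" if "1 \<le> n" for n
  proof -
    have "measure (M n) (cube n A \<inter> offdiag n) \<le> c ^ n * fact n"
      unfolding measure_def using enn2real_mono[OF b[OF that]] c(1) by simp
    then have "measure (M n) (cube n A \<inter> offdiag n) / fact n \<le> c ^ n" by (simp add: pos_divide_le_eq)
    then have "257 ^ n * (measure (M n) (cube n A \<inter> offdiag n) / fact n) \<le> 257 ^ n * c ^ n"
      by (rule mult_left_mono) simp
    also have "\<dots> = (257 * c) ^ n" by (simp add: power_mult_distrib)
    also have "\<dots> \<le> (1 / 2) ^ n" using c by (intro power_mono) auto
    finally show ?thesis by simp
  qed
  moreover have "summable (\<lambda>n. (1 / 2 :: real) ^ n)" by (rule summable_geometric) simp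
  ultimately have "summable (\<lambda>n. 257 ^ n * (measure (M n) (cube n A \<inter> offdiag n) / fact n))"
    by (rule summable_comparison_test'[where N=1, rotated])
  then show ?thesis using A by (simp add: nice_def)
qed

text \<open>Balls around x shrink to {x}; without x they shrink to the empty set, so (C2) eventually
  brings the constant below 1 / 514.\<close>

lemma punctured_nice_nbhd:
  assumes g: "offdiag_growth_bound M"
  shows "\<exists>U. open U \<and> x \<in> U \<and> nice M (U - {x})"
proof -
  obtain C where C: "\<And>\<Lambda>. \<Lambda> \<in> relcompact_borel \<Longrightarrow> C \<Lambda> \<ge> 0"
    "\<And>\<Lambda> n. \<Lambda> \<in> relcompact_borel \<Longrightarrow> 1 \<le> n \<Longrightarrow> emeasure (M n) (cube n \<Lambda> \<inter> offdiag n) \<le> ennreal (C \<Lambda> ^ n * fact n)"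
    "\<And>\<Lambda>. range \<Lambda> \<subseteq> relcompact_borel \<and> decseq \<Lambda> \<and> (\<Inter>k. \<Lambda> k) = {} \<Longrightarrow> (\<lambda>k. C (\<Lambda> k)) \<longlonglongrightarrow> 0"
    using g unfolding offdiag_growth_bound_def by blast
  obtain V where V: "open V" "x \<in> V" "V \<in> relcompact_borel" using relcompact_nbhd by blast
  let ?U = "\<lambda>k. V \<inter> ball x (1 / Suc k)" and ?\<Lambda> = "\<lambda>k. V \<inter> ball x (1 / Suc k) - {x}"
  have o: "open (?U k)" for k using V(1) by (intro open_Int) auto
  have r: "?\<Lambda> k \<in> relcompact_borel" for k
    by (rule relcompact_borel_subset[OF V(3)]) (use o in \<open>auto intro!: sets.Diff\<close>)
  have d: "decseq ?\<Lambda>"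
  proof (rule decseq_SucI)
    fix k
    have "ball x (1 / Suc (Suc k)) \<subseteq> ball x (1 / Suc k)" by (rule subset_ball) (simp add: field_simps)
    then show "?\<Lambda> (Suc k) \<subseteq> ?\<Lambda> k" by blast
  qed
  have e: "(\<Inter>k. ?\<Lambda> k) = {}"
  proof (rule ccontr)
    assume "(\<Inter>k. ?\<Lambda> k) \<noteq> {}"
    then obtain y where y: "\<And>k. y \<in> ?\<Lambda> k" by blast
    then have "0 < dist x y" by auto
    then obtain k where "1 / Suc k < dist x y" by (rule nat_approx_posE)
    then show False using y[of k] by simp
  qed
  have "(\<lambda>k. C (?\<Lambda> k)) \<longlonglongrightarrow> 0" by (rule C(3)) (use r d e in blast)
  then have "\<forall>\<^sub>F k in sequentially. C (?\<Lambda> k) < 1 / 514" by (rule order_tendstoD) simp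
  then obtain k where "C (?\<Lambda> k) < 1 / 514" by (auto simp: eventually_sequentially)
  then have "nice M (?U k - {x})" by (rule nice_if_small_growth[OF r C(1)[OF r] _ C(2)[OF r]])
  moreover have "x \<in> ?U k" using V(2) by simp
  ultimately show ?thesis using o by blast
qed

text \<open>A countable open cover is made disjoint and each of its pieces is split at the centre:
  even indices hold the centre if the piece contains it, odd ones hold the rest. A compact set lies
  in the first m sets of the cover for some m, hence in the first 2 m pieces.\<close>

lemma nice_pieces:
  assumes g: "offdiag_growth_bound M"
  obtains \<Lambda> :: "nat \<Rightarrow> 'a set" where "\<And>j. nice M (\<Lambda> j)" "disjoint_family \<Lambda>" "(\<Union>j. \<Lambda> j) = UNIV"
    "\<And>K. compact K \<Longrightarrow> \<exists>r. K \<subseteq> (\<Union>j<r. \<Lambda> j)"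
proof -
  obtain c :: "nat \<Rightarrow> 'a" and U where U: "\<And>i. open (U i)" "\<And>i. nice M (U i - {c i})" "(\<Union>i. U i) = UNIV"
    using countable_open_cover[of "\<lambda>x U. nice M (U - {x})"] punctured_nice_nbhd[OF g] by metis
  let ?D = "disjointed U"
  have Db: "?D i \<in> sets borel" for i
    unfolding disjointed_def using U(1) by (intro sets.Diff sets.finite_UN) auto
  define \<Lambda> where "\<Lambda> n = (if even n then ?D (n div 2) \<inter> {c (n div 2)} else ?D (n div 2) - {c (n div 2)})" for n
  have pair: "\<Lambda> (2 * i) \<union> \<Lambda> (2 * i + 1) = ?D i" for i by (auto simp: \<Lambda>_def)
  have sub: "\<Lambda> n \<subseteq> ?D (n div 2)" for n by (auto simp: \<Lambda>_def)
  show thesis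
  proof
    show "nice M (\<Lambda> n)" for n
    proof (cases "even n")
      case True
      then show ?thesis using nice_subset[OF nice_singleton[of "c (n div 2)"], of "\<Lambda> n"] Db by (auto simp: \<Lambda>_def)
    next
      case False
      then show ?thesis
        using nice_subset[OF U(2)[of "n div 2"], of "\<Lambda> n"] Db disjointed_subset[of U "n div 2"] by (auto simp: \<Lambda>_def)
    qed
    show "disjoint_family \<Lambda>"
      unfolding disjoint_family_on_def
    proof (intro ballI impI)
      fix m n :: nat assume "m \<noteq> n"
      show "\<Lambda> m \<inter> \<Lambda> n = {}"
      proof (cases "m div 2 = n div 2")
        case True
        then have "even m \<noteq> even n" using \<open>m \<noteq> n\<close> by presburger
        then show ?thesis using True by (auto simp: \<Lambda>_def)
      next
        case False
        then have "?D (m div 2) \<inter> ?D (n div 2) = {}"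
          using disjoint_family_onD[OF disjoint_family_disjointed[of U]] by simp
        then show ?thesis using sub[of m] sub[of n] by blast
      qed
    qed
    have "?D i \<subseteq> (\<Union>j. \<Lambda> j)" for i unfolding pair[symmetric] by blast
    then have "(\<Union>i. ?D i) \<subseteq> (\<Union>j. \<Lambda> j)" by (rule UN_least)
    then show "(\<Union>j. \<Lambda> j) = UNIV" unfolding UN_disjointed_eq U(3) by (rule top.extremum_uniqueI)
    show "\<exists>r. K \<subseteq> (\<Union>j<r. \<Lambda> j)" if K: "compact K" for K
    proof -
      have "K \<subseteq> (\<Union>i\<in>UNIV. U i)" using U(3) by simp
      from compactE_image[OF K U(1) this] obtain I where I: "finite I" "K \<subseteq> (\<Union>i\<in>I. U i)"
        by metis
      obtain m where m: "I \<subseteq> {..<m}" using finite_nat_bounded[OF I(1)] by blast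
      note I(2)
      also have "(\<Union>i\<in>I. U i) \<subseteq> (\<Union>i\<in>{0..<m}. U i)" by (rule UN_mono) (use m in auto)
      also have "\<dots> = (\<Union>i\<in>{0..<m}. ?D i)" by (rule finite_UN_disjointed_eq[symmetric])
      also have "\<dots> \<subseteq> (\<Union>j<2 * m. \<Lambda> j)"
      proof
        fix x assume "x \<in> (\<Union>i\<in>{0..<m}. ?D i)"
        then obtain i where "i < m" "x \<in> \<Lambda> (2 * i) \<union> \<Lambda> (2 * i + 1)" unfolding pair by auto
        moreover from this have "2 * i < 2 * m" "2 * i + 1 < 2 * m" by auto
        ultimately show "x \<in> (\<Union>j<2 * m. \<Lambda> j)" by blast
      qed
      finally show ?thesis by blast
    qed
  qed
qed

text \<open>The first moment measure, moved from one-entry tuples to the space itself, is a Radon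
  measure, and inner regularity applies to it.\<close>

lemma inner_approximation:
  assumes B: "B \<in> relcompact_borel" and e: "0 < e"
  shows "\<exists>K. compact K \<and> K \<subseteq> B \<and> measure (M 1) (lbox [B - K]) \<le> e"
proof -
  note D = symmetric_radon_sequenceD[OF M]
  define \<nu> where "\<nu> = distr (M 1) borel (\<lambda>x. x 0)"
  have m: "(\<lambda>x. x 0) \<in> measurable (M 1) borel"
    unfolding measurable_cong_sets[OF D(2) refl] by (rule measurable_component_singleton) simp
  have nu: "emeasure \<nu> X = emeasure (M 1) (lbox [X])" if "X \<in> sets borel" for X
  proof -
    have "(\<lambda>x. x 0) -` X \<inter> space (M 1) = lbox [X]"
      unfolding D(3) lbox_singleton by (auto simp: PiE_iff)
    then show ?thesis unfolding \<nu>_def emeasure_distr[OF m that] by (rule arg_cong)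
  qed
  have r: "radon \<nu>"
  proof (rule radon_euclideanI)
    show "sets \<nu> = sets borel" by (simp add: \<nu>_def)
    fix K :: "'a set" assume "compact K"
    then have "K \<in> relcompact_borel" "K \<in> sets borel" by (auto simp: relcompact_borel_iff compact_imp_closed)
    then show "emeasure \<nu> K < \<infinity>"
      using radon_pow_finite[OF D(1)[of 1], of "\<lambda>_. K"] by (simp add: nu lbox_singleton)
  qed
  have Bb: "B \<in> sets borel" using B by (rule relcompact_borel_sets)
  have fin: "emeasure \<nu> B \<noteq> \<top>" using radon_euclideanD(4)[OF r B] by simp
  have "emeasure \<nu> B = (SUP K\<in>{K. compact K \<and> K \<subseteq> B}. emeasure \<nu> K)"
    using r Bb radon_euclideanD(1)[OF r] unfolding radon_measure_def by (simp add: compactin_euclidean_iff)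
  then have "\<exists>K\<in>{K. compact K \<and> K \<subseteq> B}. emeasure \<nu> B < emeasure \<nu> K + ennreal e"
    by (intro SUP_approx_ennreal) (use e fin in auto)
  then obtain K where K: "compact K" "K \<subseteq> B" "emeasure \<nu> B < emeasure \<nu> K + ennreal e" by blast
  have Kb: "K \<in> sets borel" using K(1) by (simp add: compact_imp_closed)
  have "emeasure (M 1) (lbox [B - K]) = emeasure \<nu> (B - K)" using Bb Kb by (simp add: nu sets.Diff)
  also have "\<dots> = emeasure \<nu> B - emeasure \<nu> K"
    by (rule emeasure_Diff) (use radon_euclideanD(1)[OF r] radon_euclideanD(3)[OF r K(1)] K(2) Bb Kb in auto)
  also have "\<dots> \<le> ennreal e" using K(3) fin by (auto simp: ennreal_minus_le_iff less_imp_le)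
  finally have "measure (M 1) (lbox [B - K]) \<le> e"
    unfolding measure_def using e by (intro enn2real_leI) auto
  then show ?thesis using K by blast
qed

text \<open>Additivity of second moments in one side, with the other side fixed. Read as an identity
  of expectations, it makes the additivity defect of two counts orthogonal to every count.\<close>

lemma measure_lbox_pair_Un:
  assumes A: "A \<in> relcompact_borel" "B \<in> relcompact_borel" "C \<in> relcompact_borel" and d: "A \<inter> B = {}"
  shows "measure (M 2) (lbox [A \<union> B, C]) = measure (M 2) (lbox [A, C]) + measure (M 2) (lbox [B, C])"
proof -
  note D = symmetric_radon_sequenceD[OF M]
  have f: "lbox [X, Y] \<in> fmeasurable (M 2)" if "X \<in> relcompact_borel" "Y \<in> relcompact_borel" for X Y
  proof (rule fmeasurableI)
    show "lbox [X, Y] \<in> sets (M 2)"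
      using lbox_sets[of "[X, Y]"] that relcompact_borel_sets unfolding D(2) by (auto simp: numeral_2_eq_2)
    show "emeasure (M 2) (lbox [X, Y]) < \<infinity>"
      using radon_pow_finite[OF D(1)[of 2], of "\<lambda>i. [X, Y] ! i"] that
      by (simp add: lbox_def numeral_2_eq_2 nth_Cons split: nat.split)
  qed
  have "lbox [A \<union> B, C] = lbox [A, C] \<union> lbox [B, C]" unfolding lbox_pair by blast
  moreover have "lbox [A, C] \<inter> lbox [B, C] = {}" unfolding lbox_pair using d by blast
  ultimately show ?thesis using measure_Un3[OF f[OF A(1,3)] f[OF A(2,3)]] by simp
qed

theorem random_measure_exists:
  assumes S: "simplicity_identity M" and pd: "positive_definite M" and g: "offdiag_growth_bound M"
  shows "\<exists>\<mu>. random_measure \<mu> \<and> finite_moments \<mu> \<and> moment_sequence \<mu> M"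
proof -
  obtain \<Lambda> :: "nat \<Rightarrow> 'a set" where \<Lambda>: "\<And>j. nice M (\<Lambda> j)" "disjoint_family \<Lambda>" "(\<Union>j. \<Lambda> j) = UNIV"
    "\<And>K. compact K \<Longrightarrow> \<exists>r. K \<subseteq> (\<Union>j<r. \<Lambda> j)" using nice_pieces[OF g] by blast
  have \<Lambda>r: "\<Lambda> j \<in> relcompact_borel" for j using \<Lambda>(1) by (simp add: nice_def)
  obtain \<B> :: "'a set set" where B: "countable \<B>" "topological_basis \<B>" using ex_countable_basis by blast
  have "\<B> \<noteq> {}" using topological_basisE[OF B(2) open_UNIV UNIV_I] by blast
  have "\<exists>b :: nat \<Rightarrow> 'a set. range b = \<B>" by (rule exI, rule range_from_nat_into[OF \<open>\<B> \<noteq> {}\<close> B(1)])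
  then obtain b :: "nat \<Rightarrow> 'a set" where b: "range b = \<B>" ..
  define ok where "ok n X K \<longleftrightarrow> compact K \<and> K \<subseteq> X \<and> measure (M 1) (lbox [X - K]) \<le> 1 / Suc n" for n :: nat and X K
  define h where "h n j X = (SOME K. ok n (X \<inter> \<Lambda> j) K)" for n j X
  let ?e = "eval_term b h"
  have hok: "ok n (X \<inter> \<Lambda> j) (h n j X)" if X: "X \<in> sets borel" for n j X
  proof -
    have "X \<inter> \<Lambda> j \<in> relcompact_borel"
      by (rule relcompact_borel_subset[OF \<Lambda>r]) (use X \<Lambda>r[THEN relcompact_borel_sets] in auto)
    then have "\<exists>K. ok n (X \<inter> \<Lambda> j) K" unfolding ok_def by (rule inner_approximation) simp
    then show ?thesis unfolding h_def by (rule someI_ex)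
  qed
  have eb: "?e t \<in> sets borel" for t
  proof (induct t)
    case (Gen n)
    have "open (b n)" using topological_basis_open[OF B(2)] b by blast
    then show ?case by simp
  next
    case (Neg t) then show ?case by (simp add: borel_comp)
  next
    case (Inner n j t)
    then show ?case using hok[of "?e t" n j] by (simp add: ok_def compact_imp_closed)
  qed auto
  \<comment> \<open>An index names a term together with the piece of the partition to which the term
    is restricted.\<close>
  define idx where "idx j t = to_nat (j :: nat, t :: set_term)" for j t
  define A where "A i = (case from_nat i of (j, t) \<Rightarrow> ?e t \<inter> \<Lambda> j)" for i
  define \<kappa> where "\<kappa> i n = (case from_nat i of (j, t) \<Rightarrow> idx j (Inner n j t))" for i n
  \<comment> \<open>The term stands for \<open>t\<close> without its inner approximation.\<close>
  define co where "co i n = (case from_nat i of (j, t) \<Rightarrow> idx j (Neg (Join (Neg t) (Inner n j t))))" for i n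
  \<comment> \<open>A term for the whole space; its negation serves as a term for the empty
    set.\<close>
  let ?one = "Join (Gen 0) (Neg (Gen 0))"
  define l where "l j = idx j ?one" for j
  have Ai: "A (idx j t) = ?e t \<inter> \<Lambda> j" for j t by (simp add: A_def idx_def)
  have \<kappa>i: "\<kappa> (idx j t) n = idx j (Inner n j t)" and coi: "co (idx j t) n = idx j (Neg (Join (Neg t) (Inner n j t)))" for j t n
    by (simp_all add: \<kappa>_def co_def idx_def)
  have ex: "\<exists>j t. i = idx j t \<or> A i = A (idx j t) \<and> \<kappa> i = \<kappa> (idx j t) \<and> co i = co (idx j t)" for i
  proof -
    obtain j t where "(from_nat i :: nat \<times> set_term) = (j, t)" by (cases "from_nat i :: nat \<times> set_term") blast
    then have "A i = A (idx j t) \<and> \<kappa> i = \<kappa> (idx j t) \<and> co i = co (idx j t)"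
      by (auto simp: A_def \<kappa>_def co_def idx_def fun_eq_iff)
    then show ?thesis by blast
  qed
  then have ex: "\<exists>j t. A i = A (idx j t) \<and> \<kappa> i = \<kappa> (idx j t) \<and> co i = co (idx j t)" for i by metis
  have Al: "A (l j) = \<Lambda> j" for j by (simp add: l_def Ai)
  have inner: "?e (Inner n j t) \<inter> \<Lambda> j = ?e (Inner n j t)" for n j t using hok[OF eb[of t], of n j] by (auto simp: ok_def)
  have disj: "\<Lambda> i \<inter> \<Lambda> j = {}" if "i \<noteq> j" for i j using disjoint_family_onD[OF \<Lambda>(2)] that by simp
  have compl: "A (co i n) = A i - A (\<kappa> i n)" and cl: "compact (A (\<kappa> i n))" and sub: "A (\<kappa> i n) \<subseteq> A i"
    and small: "measure (M 1) (lbox [A (co i n)]) \<le> 1 / Suc n" for i n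
  proof -
    obtain j t where jt: "A i = A (idx j t)" "\<kappa> i = \<kappa> (idx j t)" "co i = co (idx j t)" using ex[of i] by blast
    have k: "A (\<kappa> i n) = h n j (?e t)" using inner[of n j t] by (simp add: jt \<kappa>i Ai)
    show c: "A (co i n) = A i - A (\<kappa> i n)" unfolding jt by (auto simp: \<kappa>i coi Ai)
    show "compact (A (\<kappa> i n))" "A (\<kappa> i n) \<subseteq> A i"
      unfolding k jt(1) Ai using hok[OF eb[of t], of n j] by (auto simp: ok_def)
    show "measure (M 1) (lbox [A (co i n)]) \<le> 1 / Suc n"
      unfolding c unfolding k jt(1) Ai using hok[OF eb[of t], of n j] unfolding ok_def by blast
  qed
  have Ab: "A i \<in> sets borel" for i using eb \<Lambda>r[THEN relcompact_borel_sets] by (auto simp: A_def split: prod.split)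
  have An: "nice M (A i)" for i
  proof -
    obtain j t where jt: "A i = A (idx j t)" using ex[of i] by blast
    show ?thesis by (rule nice_subset[OF \<Lambda>(1)[of j] Ab]) (simp add: jt Ai)
  qed
  have Ar: "A i \<in> relcompact_borel" for i using An by (simp add: nice_def)
  interpret cs: counting_semiring dummy A \<kappa> co l
  proof
    fix i k
    obtain j s where js: "A i = A (idx j s)" using ex[of i] by blast
    obtain m t where mt: "A k = A (idx m t)" using ex[of k] by blast
    show "\<exists>r. A r = A i \<inter> A k"
    proof (cases "j = m")
      case True
      then have "A (idx j (Neg (Join (Neg s) (Neg t)))) = A i \<inter> A k" unfolding js mt by (auto simp: Ai)
      then show ?thesis by blast
    next
      case False
      then have "A (idx j (Neg ?one)) = A i \<inter> A k" unfolding js mt using disj[of j m] by (auto simp: Ai)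
      then show ?thesis by blast
    qed
    show "\<exists>r. A r = A i - A k"
    proof (cases "j = m")
      case True
      then have "A (idx j (Neg (Join (Neg s) t))) = A i - A k" unfolding js mt by (auto simp: Ai)
      then show ?thesis by blast
    next
      case False
      then have "A i = A i - A k" unfolding js mt using disj[of j m] by (auto simp: Ai)
      then show ?thesis by blast
    qed
  next
    show "sigma_sets UNIV (range A) = sets (borel :: 'a measure)"
    proof
      show "sigma_sets UNIV (range A) \<subseteq> sets (borel :: 'a measure)"
        using sets.sigma_sets_subset[of "range A" "borel :: 'a measure"] Ab by auto
      have "b n \<in> sigma_sets UNIV (range A)" for n
      proof -
        have "b n = (\<Union>j. A (idx j (Gen n)))" using \<Lambda>(3) by (auto simp: Ai)
        also have "\<dots> \<in> sigma_sets UNIV (range A)" by (rule sigma_sets.Union) (rule sigma_sets.Basic, simp)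
        finally show ?thesis .
      qed
      then have "sigma_sets UNIV \<B> \<subseteq> sigma_sets UNIV (range A)" unfolding b[symmetric] by (intro sigma_sets_mono) auto
      moreover have "sets (borel :: 'a measure) = sigma_sets UNIV \<B>"
        unfolding borel_eq_countable_basis[OF B] by simp
      ultimately show "sets (borel :: 'a measure) \<subseteq> sigma_sets UNIV (range A)" by simp
    qed
    show "compact K \<Longrightarrow> \<exists>r. K \<subseteq> (\<Union>j<r. A (l j))" for K using \<Lambda>(4) by (simp add: Al)
  qed (use Ar cl sub compl \<Lambda>(2,3) in \<open>simp_all add: Al\<close>)
  obtain P where P: "prob_space P" "sets P = sets (PiM UNIV (\<lambda>_. count_space (UNIV :: nat set)))"
    and int: "\<And>is. integrable P (\<lambda>\<omega>. prod_list (map (\<lambda>i. real (\<omega> i)) is))"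
    and mom: "\<And>is. (\<integral>\<omega>. prod_list (map (\<lambda>i. real (\<omega> i)) is) \<partial>P) = measure (M (length is)) (lbox (map A is))"
    by (rule counting_process_exists[OF M S pd An]) (rule that)
  interpret prob_space P by (rule P(1))
  have spP: "space P = UNIV" by (rule cs.space_P_UNIV[OF P])
  note [measurable] = cs.measurable_coordinate[OF P]
  have i1: "integrable P (\<lambda>\<omega>. real (\<omega> p))" for p using int[of "[p]"] by simp
  have i2: "integrable P (\<lambda>\<omega>. real (\<omega> p) * real (\<omega> q))" for p q using int[of "[p, q]"] by simp
  have e1: "(\<integral>\<omega>. real (\<omega> p) \<partial>P) = measure (M 1) (lbox [A p])" for p using mom[of "[p]"] by simp
  have e2: "(\<integral>\<omega>. real (\<omega> p) * real (\<omega> q) \<partial>P) = measure (M 2) (lbox [A p, A q])" for p q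
    using mom[of "[p, q]"] by (simp add: numeral_2_eq_2)
  \<comment> \<open>The defect of additivity is orthogonal to every count, hence to itself.\<close>
  have add: "AE \<omega> in P. \<omega> r = \<omega> p + \<omega> q" if "A r = A p \<union> A q" "A p \<inter> A q = {}" for r p q
  proof -
    let ?f = "\<lambda>\<omega>. real (\<omega> r) - real (\<omega> p) - real (\<omega> q)"
    have fint: "integrable P (\<lambda>\<omega>. ?f \<omega> * real (\<omega> s))" for s
      using i2 by (simp add: left_diff_distrib)
    have z: "(\<integral>\<omega>. ?f \<omega> * real (\<omega> s) \<partial>P) = 0" for s
      using measure_lbox_pair_Un[OF Ar[of p] Ar[of q] Ar[of s]] that i2 by (simp add: left_diff_distrib e2)
    have "integrable P (\<lambda>\<omega>. ?f \<omega> * ?f \<omega>)" unfolding right_diff_distrib[of "?f _"] using fint by simp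
    moreover have "(\<integral>\<omega>. ?f \<omega> * ?f \<omega> \<partial>P) = 0"
      unfolding right_diff_distrib[of "?f _"] using fint by (simp add: z)
    ultimately have "AE \<omega> in P. ?f \<omega> * ?f \<omega> = 0" by (subst (asm) integral_nonneg_eq_0_iff_AE) auto
    then show ?thesis by (rule AE_mp) (auto intro!: AE_I2)
  qed
  \<comment> \<open>A natural number valued count is nonzero with probability at most its mean,
    which is at most 1 / (n + 1) for the n-th complement; so all of them are nonzero with
    probability 0 only.\<close>
  have van: "AE \<omega> in P. \<exists>n. \<omega> (co i n) = 0" for i
  proof (rule AE_I')
    let ?S = "{\<omega> \<in> space P. \<forall>n. \<omega> (co i n) \<noteq> 0}"
    have Ss: "?S \<in> sets P" by measurable
    have "emeasure P ?S \<le> ennreal (1 / Suc n)" for n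
    proof -
      have "emeasure P ?S = (\<integral>\<^sup>+\<omega>. indicator ?S \<omega> \<partial>P)" using Ss by simp
      also have "\<dots> \<le> (\<integral>\<^sup>+\<omega>. ennreal (real (\<omega> (co i n))) \<partial>P)"
      proof (rule nn_integral_mono)
        fix \<omega>
        have "ennreal 1 \<le> ennreal (real (\<omega> (co i n)))" if "\<omega> \<in> ?S"
          by (rule ennreal_leI) (use that in \<open>auto simp: Suc_le_eq\<close>)
        then show "indicator ?S \<omega> \<le> ennreal (real (\<omega> (co i n)))" by (cases "\<omega> \<in> ?S") auto
      qed
      also have "\<dots> = ennreal (measure (M 1) (lbox [A (co i n)]))"
        unfolding e1[symmetric] by (rule nn_integral_eq_integral[OF i1]) simp
      also have "\<dots> \<le> ennreal (1 / Suc n)" by (rule ennreal_leI[OF small])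
      finally show ?thesis .
    qed
    moreover have "(\<lambda>n. ennreal (1 / Suc n)) \<longlonglongrightarrow> ennreal 0"
      by (rule tendsto_ennrealI) (rule LIMSEQ_inverse_real_of_nat[unfolded inverse_eq_divide])
    ultimately have "emeasure P ?S \<le> ennreal 0" by (intro LIMSEQ_le_const) auto
    then show "?S \<in> null_sets P" using Ss by (auto simp: null_sets_def)
  qed auto
  have "AE \<omega> in P. \<forall>r p q. A r = A p \<union> A q \<and> A p \<inter> A q = {} \<longrightarrow> \<omega> r = \<omega> p + \<omega> q"
    unfolding AE_all_countable
  proof (intro allI)
    show "AE \<omega> in P. A r = A p \<union> A q \<and> A p \<inter> A q = {} \<longrightarrow> \<omega> r = \<omega> p + \<omega> q" for r p q
    proof (cases "A r = A p \<union> A q \<and> A p \<inter> A q = {}")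
      case True
      then have "AE \<omega> in P. \<omega> r = \<omega> p + \<omega> q" by (intro add) (elim conjE; assumption)+
      then show ?thesis by (rule AE_mp) (rule AE_I2, simp)
    next
      case False
      then show ?thesis by (intro AE_I2 impI) (rule notE)
    qed
  qed
  moreover have "AE \<omega> in P. \<forall>i. \<exists>n. \<omega> (co i n) = 0" unfolding AE_all_countable using van by blast
  ultimately have "AE \<omega> in P. cs.good \<omega>" unfolding cs.good_def by (rule AE_conjI)
  from cs.random_measure_of_counts[OF P M this int mom] show ?thesis .
qed

end

end

theorem corollary20:
  assumes "locally_compact_space (euclidean :: 'a::polish_space topology)"
  shows
    "(\<forall>(\<mu> :: 'a measure measure) M.
        random_measure \<mu> \<and> finite_moments \<mu> \<and> moment_sequence \<mu> M \<and>
        growth_bound M \<and> offdiag_growth_bound M \<longrightarrow>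
        (simple_point_process \<mu> \<longleftrightarrow> simplicity_identity M) \<and>
        (simple_point_process \<mu> \<longrightarrow>
           (\<exists>!\<rho>. correlation_measure \<mu> \<rho>) \<and>
           (\<forall>\<rho>. correlation_measure \<mu> \<rho> \<longrightarrow>
              (\<forall>n\<ge>1. (\<exists>!\<rho>n. lifted_restriction n \<rho> \<rho>n) \<and>
                 (\<forall>\<rho>n. lifted_restriction n \<rho> \<rho>n \<longrightarrow>
                    (\<forall>\<Delta>\<in>sets (offdiag_borel n).
                       emeasure \<rho>n \<Delta> = ennreal (1 / fact n) * emeasure (M n) \<Delta>))))))
     \<and>
     (\<forall>M :: nat \<Rightarrow> (nat \<Rightarrow> 'a) measure.
        symmetric_radon_sequence M \<and> growth_bound M \<and> offdiag_growth_bound M \<longrightarrow>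
        ((\<exists>\<mu>. simple_point_process \<mu> \<and> finite_moments \<mu> \<and> moment_sequence \<mu> M) \<longleftrightarrow>
           positive_definite M \<and> simplicity_identity M))"
proof -
  interpret loc_compact "TYPE('a)" by standard (rule assms)
  show ?thesis
  proof (rule conjI; intro allI impI; elim conjE)
    fix \<mu> :: "'a measure measure" and M
    assume a: "random_measure \<mu>" "moment_sequence \<mu> M"
    have "simple_point_process \<mu> \<longleftrightarrow> simplicity_identity M"
      using simplicity_identity_imp_simple[OF a] simple_imp_simplicity_identity[OF _ a(2)] by blast
    then show "(simple_point_process \<mu> \<longleftrightarrow> simplicity_identity M) \<and>
        (simple_point_process \<mu> \<longrightarrow>
           (\<exists>!\<rho>. correlation_measure \<mu> \<rho>) \<and>
           (\<forall>\<rho>. correlation_measure \<mu> \<rho> \<longrightarrow>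
              (\<forall>n\<ge>1. (\<exists>!\<rho>n. lifted_restriction n \<rho> \<rho>n) \<and>
                 (\<forall>\<rho>n. lifted_restriction n \<rho> \<rho>n \<longrightarrow>
                    (\<forall>\<Delta>\<in>sets (offdiag_borel n).
                       emeasure \<rho>n \<Delta> = ennreal (1 / fact n) * emeasure (M n) \<Delta>)))))"
      using correlation_measure_of_simple[OF _ a(2)] by iprover
  next
    fix M :: "nat \<Rightarrow> (nat \<Rightarrow> 'a) measure"
    assume M: "symmetric_radon_sequence M" and g: "offdiag_growth_bound M"
    show "(\<exists>\<mu>. simple_point_process \<mu> \<and> finite_moments \<mu> \<and> moment_sequence \<mu> M) \<longleftrightarrow>
           positive_definite M \<and> simplicity_identity M"
    proof
      assume "\<exists>\<mu>. simple_point_process \<mu> \<and> finite_moments \<mu> \<and> moment_sequence \<mu> M"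
      then obtain \<mu> where m: "simple_point_process \<mu>" "moment_sequence \<mu> M" by blast
      then have "random_measure \<mu>" by (simp add: simple_point_process_def)
      then show "positive_definite M \<and> simplicity_identity M"
        using moment_imp_positive_definite[OF _ m(2)] simple_imp_simplicity_identity[OF m] by blast
    next
      assume r: "positive_definite M \<and> simplicity_identity M"
      \<comment> \<open>The constructed process has the prescribed moments; (S) is used a second
        time to see that it is simple.\<close>
      then obtain \<mu> where "random_measure \<mu>" "finite_moments \<mu>" "moment_sequence \<mu> M"
        using random_measure_exists[OF M _ _ g] by blast
      then show "\<exists>\<mu>. simple_point_process \<mu> \<and> finite_moments \<mu> \<and> moment_sequence \<mu> M"
        using simplicity_identity_imp_simple[of \<mu> M] r by blast
    qed
  qed
qed

end
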